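(* Let $d\ge 2$, let $\Omega\subset\mathbb{R}^d$ be a bounded Lipschitz polytope, $\mathcal{T}$ a conforming simplicial mesh of the domain $\Omega$, and $k\in\mathbb{N}=\{1,2,\dots\}$. With the spaces defined in the context: (1) $\operatorname{CR}_k(\mathcal{T})=\overset{\bullet}{S_k}(\mathcal{T})\oplus V_k^{\mathrm{nc}}(\mathcal{F})$ if $k$ is odd, and $\operatorname{CR}_k(\mathcal{T})=S_k(\mathcal{T})\oplus V_k^{\mathrm{nc}}(\mathcal{T}')$ if $k$ is even, where $\mathcal{T}'\subset\mathcal{T}$ is any submesh with $|\mathcal{T}'|=|\mathcal{T}|-1$. (2) $\operatorname{CR}_{k,0}(\mathcal{T})=\overset{\bullet}{S_{k,0}}(\mathcal{T})\oplus V_k^{\mathrm{nc}}(\mathcal{F}_\Omega)$ if $k$ is odd, and $\operatorname{CR}_{k,0}(\mathcal{T})=S_{k,0}(\mathcal{T})\oplus V_k^{\mathrm{nc}}(\mathcal{T})$ if $k$ is even. (3) For odd $k\ge 1$, $\{B_k^{\mathrm{CR},F}: F\in\mathcal{F}\}$ is a basis of $V_k^{\mathrm{nc}}(\mathcal{F})$ and $\{B_k^{\mathrm{CR},F}: F\in\mathcal{F}_\Omega\}$ is a basis of $V_k^{\mathrm{nc}}(\mathcal{F}_\Omega)$. For $k\ge 2$, $\{B_k^{\mathrm{CR},K}: K\in\mathcal{T}\}$ is a basis of $V_k^{\mathrm{nc}}(\mathcal{T})$. For $k=1$, $V_1^{\mathrm{nc}}(\mathcal{T})=\{0\}$. (4)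 $S_k(\mathcal{T})\subset\operatorname{CR}_k(\mathcal{T})\subset\operatorname{CR}_k^{\max}(\mathcal{T})$ and $S_{k,0}(\mathcal{T})\subset\operatorname{CR}_{k,0}(\mathcal{T})\subset\operatorname{CR}_{k,0}^{\max}(\mathcal{T})$. (5) The inclusion $S_{k,0}(\mathcal{T})\subset\operatorname{CR}_{k,0}(\mathcal{T})$ is strict if $k$ is even, or if $k$ is odd and $\mathcal{T}$ consists of more than a single simplex. The inclusion $\operatorname{CR}_{k,0}(\mathcal{T})\subset\operatorname{CR}_{k,0}^{\max}(\mathcal{T})$ is strict, e.g., for $d=3$ and $k\ge 2$.
   Context: A conforming simplicial mesh $\mathcal{T}$ of $\Omega$ is a finite set of closed nondegenerate $d$-simplices with union $\overline\Omega$ such that any two intersect in the empty set or a common face. $\mathcal{V}$ is the set of mesh vertices, $\mathcal{F}$ the set of $(d-1)$-dimensional closed facets, $\mathcal{F}_{\partial\Omega}=\{F\in\mathcal{F}: F\subset\partial\Omega\}$, $\mathcal{F}_\Omega=\mathcal{F}\setminus\mathcal{F}_{\partial\Omega}$; $\mathcal{V}(K)$ is the set of vertices of $K$; $\mathcal{T}_F=\{K\in\mathcal{T}:F\subset K\}$. For $\mathbf z\in\mathcal V(K)$, $\lambda_{K,\mathbf z}$ is the barycentric coordinate of $K$ for $\mathbf z$ (affine, $\lambda_{K,\mathbf z}(\mathbf y)=\delta_{\mathbf y,\mathbf z}$ for $\mathbf y\in\mathcal V(K)$); for a facet $F$ of $K$, $\lambda_{K,F}$ is the barycentric coordinate of the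 vertex of $K$ opposite to $F$. $P_n^{(\alpha,\beta)}$ is the Jacobi polynomial of degree $n$, orthogonal on $[-1,1]$ with respect to $(1-x)^\alpha(1+x)^\beta$ to all polynomials of degree $<n$ and normalized by $P_n^{(\alpha,\beta)}(1)=(\alpha+1)_n/n!$, where $(a)_n=a(a+1)\cdots(a+n-1)$; in particular $P_n^{(0,d-2)}(1)=1$. $\mathbb{P}_k(K)$ (resp. $\mathbb P_k(F)$) is the space of polynomials of total degree $\le k$ on $K$ (resp. in the local variables of $F$). $\mathbb{P}_k(\mathcal{T})$ is the space of (generally discontinuous) functions whose restriction to each open simplex is a polynomial of degree $\le k$; $v|_K$ denotes the continuous extension to $K$ of the restriction of $v$ to the interior of $K$. Non-conforming simplex functions: for $K\in\mathcal{T}$, $B_k^{\mathrm{CR},K}=\frac1d\bigl(-1+\sum_{\mathbf z\in\mathcal V(K)}P_k^{(0,d-2)}(1-2\lambda_{K,\mathbf z})\bigr)$ on $K$ and $0$ elsewhere. Non-conforming facet functions: for $F\in\mathcal{F}$, $B_k^{\mathrm{CR},F}=P_k^{(0,d-2)}(1-2\lambda_{K,F})-B_k^{\mathrm{CR},K}$ on each $K\in\mathcal{T}_F$ and $0$ elsewhere. For $\mathcal M\subset\mathcal T$, $V_k^{\mathrm{nc}}(\mathcal M)=\operatorname{span}\{B_k^{\mathrm{CR},K}:K\in\mathcal M\}$; for $\mathcal G\subset\mathcal F$, $V_k^{\mathrm{nc}}(\mathcal G)=\operatorname{span}\{B_k^{\mathrm{CR},F}:F\in\mathcal G\}$. $S_k(\mathcal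 T)=\{v\in C^0(\overline\Omega): v|_K\in\mathbb P_k(K)\ \forall K\in\mathcal T\}$, $S_{k,0}(\mathcal T)=S_k(\mathcal T)\cap H_0^1(\Omega)$; $\overset{\bullet}{S_k}(\mathcal T)$ and $\overset{\bullet}{S_{k,0}}(\mathcal T)$ are the subspaces of functions vanishing at all $\mathbf z\in\mathcal V$. Canonical Crouzeix–Raviart spaces: $\operatorname{CR}_k(\mathcal T)=S_k(\mathcal T)+V_k^{\mathrm{nc}}(\mathcal T)$ for even $k$ and $S_k(\mathcal T)+V_k^{\mathrm{nc}}(\mathcal F)$ for odd $k$; $\operatorname{CR}_{k,0}(\mathcal T)=S_{k,0}(\mathcal T)+V_k^{\mathrm{nc}}(\mathcal T)$ for even $k$ and $S_{k,0}(\mathcal T)+V_k^{\mathrm{nc}}(\mathcal F_\Omega)$ for odd $k$. Maximal spaces: $\operatorname{CR}_k^{\max}(\mathcal T)=\{v\in\mathbb P_k(\mathcal T): [v]_F\perp\mathbb P_{k-1}(F)\ \forall F\in\mathcal F_\Omega\}$, where $[v]_F$ is the jump across $F$ and $\perp$ is $L^2(F)$-orthogonality; $\operatorname{CR}_{k,0}^{\max}(\mathcal T)=\{v\in\operatorname{CR}_k^{\max}(\mathcal T): v|_F\perp\mathbb P_{k-1}(F)\ \forall F\in\mathcal F_{\partial\Omega}\}$.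
   Formalization: In (5), strictness of CR_{k,0} ⊂ CR_{k,0}^max for d=3, k≥2 is stated for every mesh except a single tetrahedron with k=2 or k=4, where the two spaces coincide (both of dimension 1 for k=2 and 2 for k=4). *)

theory Defs
  imports
    "HOL-Analysis.Analysis"
    "HOL-Library.Function_Algebras"
    "HOL-Library.Set_Algebras"
    "HOL-Computational_Algebra.Polynomial"
begin

text \<open>
  Real functions form a real vector space under the pointwise operations, so that the library's
  notions of span, subspace, linear independence and sum of sets apply to spaces of functions.
\<close>

instantiation "fun" :: (type, real_vector) real_vector
begin

definition scaleR_fun :: "real \<Rightarrow> ('a \<Rightarrow> 'b) \<Rightarrow> 'a \<Rightarrow> 'b" where
  "scaleR_fun c f = (\<lambda>x. c *\<^sub>R f x)"

instance
  by standard (simp_all add: scaleR_fun_def fun_eq_iff scaleR_add_right scaleR_add_left)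

end

lemma scaleR_fun_apply [simp]: "(c *\<^sub>R f) x = c *\<^sub>R f x"
  by (simp add: scaleR_fun_def)

definition is_direct_sum :: "'v::real_vector set \<Rightarrow> 'v set \<Rightarrow> 'v set \<Rightarrow> bool" where
  "is_direct_sum U A B \<longleftrightarrow> subspace A \<and> subspace B \<and> U = A + B \<and> A \<inter> B = {0}"

text \<open>The family is required to be injective, so that it is independent as an indexed family.\<close>

definition family_basis :: "('i \<Rightarrow> 'v::real_vector) \<Rightarrow> 'i set \<Rightarrow> 'v set \<Rightarrow> bool" where
  "family_basis b I V \<longleftrightarrow> inj_on b I \<and> independent (b ` I) \<and> span (b ` I) = V"


section \<open>Domains and meshes\<close>

text \<open>Near each boundary point the set is the strict epigraph of a Lipschitz function over the
  hyperplane orthogonal to a unit vector.\<close>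

definition lipschitz_boundary :: "'a::euclidean_space set \<Rightarrow> bool" where
  "lipschitz_boundary \<Omega> \<longleftrightarrow>
     (\<forall>x\<in>frontier \<Omega>. \<exists>U e g L. open U \<and> x \<in> U \<and> norm e = 1 \<and>
        L-lipschitz_on {y. y \<bullet> e = 0} (g :: 'a \<Rightarrow> real) \<and>
        \<Omega> \<inter> U = {y \<in> U. g (y - (y \<bullet> e) *\<^sub>R e) < y \<bullet> e})"

text \<open>The library's polytopes are convex; a polytopal domain is one whose closure is a finite union
  of them.\<close>

definition lipschitz_polytope :: "'a::euclidean_space set \<Rightarrow> bool" where
  "lipschitz_polytope \<Omega> \<longleftrightarrow>
     open \<Omega> \<and> connected \<Omega> \<and> \<Omega> \<noteq> {} \<and> bounded \<Omega> \<and>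
     (\<exists>P. finite P \<and> (\<forall>Q\<in>P. polytope Q) \<and> closure \<Omega> = \<Union>P) \<and>
     lipschitz_boundary \<Omega>"

definition conforming_mesh :: "'a::euclidean_space set \<Rightarrow> 'a set set \<Rightarrow> bool" where
  "conforming_mesh \<Omega> \<T> \<longleftrightarrow>
     triangulation \<T> \<and> (\<forall>K\<in>\<T>. int DIM('a) simplex K) \<and> \<Union>\<T> = closure \<Omega>"

definition simplex_vertices :: "'a::euclidean_space set \<Rightarrow> 'a set" where
  "simplex_vertices K = {z. z extreme_point_of K}"

definition mesh_vertices :: "'a::euclidean_space set set \<Rightarrow> 'a set" where
  "mesh_vertices \<T> = (\<Union>K\<in>\<T>. simplex_vertices K)"

definition mesh_facets :: "'a::euclidean_space set set \<Rightarrow> 'a set set" where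
  "mesh_facets \<T> = {F. \<exists>K\<in>\<T>. F facet_of K}"

definition boundary_facets :: "'a::euclidean_space set \<Rightarrow> 'a set set \<Rightarrow> 'a set set" where
  "boundary_facets \<Omega> \<T> = {F \<in> mesh_facets \<T>. F \<subseteq> frontier \<Omega>}"

definition interior_facets :: "'a::euclidean_space set \<Rightarrow> 'a set set \<Rightarrow> 'a set set" where
  "interior_facets \<Omega> \<T> = mesh_facets \<T> - boundary_facets \<Omega> \<T>"

definition facet_patch :: "'a::euclidean_space set set \<Rightarrow> 'a set \<Rightarrow> 'a set set" where
  "facet_patch \<T> F = {K \<in> \<T>. F \<subseteq> K}"

definition barycentric :: "'a::euclidean_space set \<Rightarrow> 'a \<Rightarrow> 'a \<Rightarrow> real" where
  "barycentric K z = (THE l. (\<exists>a c. \<forall>x. l x = a \<bullet> x + c) \<and>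
     (\<forall>y\<in>simplex_vertices K. l y = (if y = z then 1 else 0)))"

definition opposite_vertex :: "'a::euclidean_space set \<Rightarrow> 'a set \<Rightarrow> 'a" where
  "opposite_vertex K F = (THE z. z \<in> simplex_vertices K \<and> z \<notin> F)"

definition barycentric_facet :: "'a::euclidean_space set \<Rightarrow> 'a set \<Rightarrow> 'a \<Rightarrow> real" where
  "barycentric_facet K F = barycentric K (opposite_vertex K F)"


section \<open>Polynomials\<close>

text \<open>Natural exponents suffice: only the parameters \<open>(0, d - 2)\<close> occur.\<close>

definition jacobi :: "nat \<Rightarrow> nat \<Rightarrow> nat \<Rightarrow> real poly" where
  "jacobi n \<alpha> \<beta> = (THE p. degree p = n \<and>
     (\<forall>q. degree q < n \<longrightarrow>
        integral {-1..1} (\<lambda>x. (1 - x) ^ \<alpha> * (1 + x) ^ \<beta> * poly p x * poly q x) = 0) \<and>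
     poly p 1 = pochhammer (real \<alpha> + 1) n / fact n)"

definition poly_space :: "nat \<Rightarrow> ('a::euclidean_space \<Rightarrow> real) set" where
  "poly_space k = span {\<lambda>x. \<Prod>b\<in>Basis. (x \<bullet> b) ^ m b | m. (\<Sum>b\<in>Basis. m b) \<le> k}"


section \<open>The Sobolev space with zero boundary values\<close>

coinductive smooth :: "('a::euclidean_space \<Rightarrow> real) \<Rightarrow> bool" where
  "(\<And>x. f differentiable (at x)) \<Longrightarrow>
   (\<And>b. b \<in> Basis \<Longrightarrow> smooth (\<lambda>x. frechet_derivative f (at x) b)) \<Longrightarrow> smooth f"

definition partial_deriv :: "'a::euclidean_space \<Rightarrow> ('a \<Rightarrow> real) \<Rightarrow> 'a \<Rightarrow> real" where
  "partial_deriv b f = (\<lambda>x. frechet_derivative f (at x) b)"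

definition test_functions :: "'a::euclidean_space set \<Rightarrow> ('a \<Rightarrow> real) set" where
  "test_functions \<Omega> = {\<phi>. smooth \<phi> \<and> compact (closure {x. \<phi> x \<noteq> 0}) \<and> closure {x. \<phi> x \<noteq> 0} \<subseteq> \<Omega>}"

definition L2_on :: "'a::euclidean_space set \<Rightarrow> ('a \<Rightarrow> real) set" where
  "L2_on \<Omega> = {u. set_borel_measurable lebesgue \<Omega> u \<and> set_integrable lebesgue \<Omega> (\<lambda>x. (u x)\<^sup>2)}"

definition weak_partial ::
  "'a::euclidean_space set \<Rightarrow> 'a \<Rightarrow> ('a \<Rightarrow> real) \<Rightarrow> ('a \<Rightarrow> real) \<Rightarrow> bool" where
  "weak_partial \<Omega> b u g \<longleftrightarrow> (\<forall>\<phi>\<in>test_functions \<Omega>.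
     (LINT x:\<Omega>|lebesgue. u x * partial_deriv b \<phi> x) = - (LINT x:\<Omega>|lebesgue. g x * \<phi> x))"

text \<open>The closure of the test functions in the norm of \<open>H\<^sup>1(\<Omega>)\<close>; \<open>g\<close> is the weak gradient of \<open>u\<close>.\<close>

definition H10 :: "'a::euclidean_space set \<Rightarrow> ('a \<Rightarrow> real) set" where
  "H10 \<Omega> = {u. u \<in> L2_on \<Omega> \<and>
     (\<exists>g. (\<forall>b\<in>Basis. g b \<in> L2_on \<Omega> \<and> weak_partial \<Omega> b u (g b)) \<and>
       (\<exists>\<phi>. (\<forall>n. \<phi> n \<in> test_functions \<Omega>) \<and>
         (\<lambda>n. (LINT x:\<Omega>|lebesgue. (\<phi> n x - u x)\<^sup>2) +
              (\<Sum>b\<in>Basis. LINT x:\<Omega>|lebesgue. (partial_deriv b (\<phi> n) x - g b x)\<^sup>2))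
           \<longlonglongrightarrow> 0))}"


section \<open>Broken and conforming spaces\<close>

text \<open>
  Functions on a mesh are given by their values on the open simplices; values on the union of the
  simplex boundaries are immaterial.  To make equality of such functions equality in HOL, they are
  represented by total functions that are 0 off the open simplices, and a function on the closure
  of the domain is regarded as a member of these spaces through \<open>on_open_simplices\<close>.
\<close>

definition on_open_simplices :: "'a::euclidean_space set set \<Rightarrow> ('a \<Rightarrow> real) \<Rightarrow> 'a \<Rightarrow> real" where
  "on_open_simplices \<T> w = (\<lambda>x. if x \<in> (\<Union>K\<in>\<T>. interior K) then w x else 0)"

definition broken_polys :: "'a::euclidean_space set set \<Rightarrow> nat \<Rightarrow> ('a \<Rightarrow> real) set" where
  "broken_polys \<T> k = {v. (\<forall>x. x \<notin> (\<Union>K\<in>\<T>. interior K) \<longrightarrow> v x = 0) \<and>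
     (\<forall>K\<in>\<T>. \<exists>p\<in>poly_space k. \<forall>x\<in>interior K. v x = p x)}"

text \<open>The continuous extension to \<open>K\<close> of the restriction of \<open>v\<close> to the interior of \<open>K\<close>.\<close>

definition elem_restr :: "'a::euclidean_space set \<Rightarrow> ('a \<Rightarrow> real) \<Rightarrow> 'a \<Rightarrow> real" where
  "elem_restr K v x = Lim (at x within interior K) v"

definition conforming_fns ::
  "'a::euclidean_space set \<Rightarrow> 'a set set \<Rightarrow> nat \<Rightarrow> ('a \<Rightarrow> real) set" where
  "conforming_fns \<Omega> \<T> k = {w. continuous_on (closure \<Omega>) w \<and>
     (\<forall>K\<in>\<T>. \<exists>p\<in>poly_space k. \<forall>x\<in>K. w x = p x)}"

definition S_space :: "'a::euclidean_space set \<Rightarrow> 'a set set \<Rightarrow> nat \<Rightarrow> ('a \<Rightarrow> real) set" where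
  "S_space \<Omega> \<T> k = on_open_simplices \<T> ` conforming_fns \<Omega> \<T> k"

definition S0_space :: "'a::euclidean_space set \<Rightarrow> 'a set set \<Rightarrow> nat \<Rightarrow> ('a \<Rightarrow> real) set" where
  "S0_space \<Omega> \<T> k = on_open_simplices \<T> ` (conforming_fns \<Omega> \<T> k \<inter> H10 \<Omega>)"

definition S_bullet :: "'a::euclidean_space set \<Rightarrow> 'a set set \<Rightarrow> nat \<Rightarrow> ('a \<Rightarrow> real) set" where
  "S_bullet \<Omega> \<T> k = on_open_simplices \<T> `
     {w \<in> conforming_fns \<Omega> \<T> k. \<forall>z\<in>mesh_vertices \<T>. w z = 0}"

definition S0_bullet :: "'a::euclidean_space set \<Rightarrow> 'a set set \<Rightarrow> nat \<Rightarrow> ('a \<Rightarrow> real) set" where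
  "S0_bullet \<Omega> \<T> k = on_open_simplices \<T> `
     {w \<in> conforming_fns \<Omega> \<T> k \<inter> H10 \<Omega>. \<forall>z\<in>mesh_vertices \<T>. w z = 0}"


section \<open>Canonical Crouzeix--Raviart spaces\<close>

definition B_simplex :: "nat \<Rightarrow> 'a::euclidean_space set \<Rightarrow> 'a \<Rightarrow> real" where
  "B_simplex k K x =
     (if x \<in> interior K
      then (-1 + (\<Sum>z\<in>simplex_vertices K.
                    poly (jacobi k 0 (DIM('a) - 2)) (1 - 2 * barycentric K z x))) / real DIM('a)
      else 0)"

definition B_facet :: "'a::euclidean_space set set \<Rightarrow> nat \<Rightarrow> 'a set \<Rightarrow> 'a \<Rightarrow> real" where
  "B_facet \<T> k F x =
     (\<Sum>K\<in>facet_patch \<T> F.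
        if x \<in> interior K
        then poly (jacobi k 0 (DIM('a) - 2)) (1 - 2 * barycentric_facet K F x) - B_simplex k K x
        else 0)"

definition V_simplices :: "nat \<Rightarrow> 'a::euclidean_space set set \<Rightarrow> ('a \<Rightarrow> real) set" where
  "V_simplices k \<M> = span (B_simplex k ` \<M>)"

definition V_facets ::
  "'a::euclidean_space set set \<Rightarrow> nat \<Rightarrow> 'a set set \<Rightarrow> ('a \<Rightarrow> real) set" where
  "V_facets \<T> k \<G> = span (B_facet \<T> k ` \<G>)"

definition CR :: "'a::euclidean_space set \<Rightarrow> 'a set set \<Rightarrow> nat \<Rightarrow> ('a \<Rightarrow> real) set" where
  "CR \<Omega> \<T> k = (if even k then S_space \<Omega> \<T> k + V_simplices k \<T>
                 else S_space \<Omega> \<T> k + V_facets \<T> k (mesh_facets \<T>))"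

definition CR0 :: "'a::euclidean_space set \<Rightarrow> 'a set set \<Rightarrow> nat \<Rightarrow> ('a \<Rightarrow> real) set" where
  "CR0 \<Omega> \<T> k = (if even k then S0_space \<Omega> \<T> k + V_simplices k \<T>
                  else S0_space \<Omega> \<T> k + V_facets \<T> k (interior_facets \<Omega> \<T>))"


section \<open>Maximal Crouzeix--Raviart spaces\<close>

text \<open>
  Surface measure on a set \<open>F\<close> with an affine hull of codimension 1: Lebesgue measure on the slab of
  thickness 1 consisting of the points whose orthogonal projection to the affine hull lies in \<open>F\<close>,
  pushed forward by this projection.
\<close>

definition facet_measure :: "'a::euclidean_space set \<Rightarrow> 'a measure" where
  "facet_measure F =
     (let \<pi> = closest_point (affine hull F)
      in distr (restrict_space lborel {x. \<pi> x \<in> F \<and> dist x (\<pi> x) \<le> 1/2}) borel \<pi>)"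

text \<open>Polynomials in the local variables of a facet are the restrictions to it of polynomials of the
  same total degree on the whole space.\<close>

definition orth_polys :: "'a::euclidean_space set \<Rightarrow> nat \<Rightarrow> ('a \<Rightarrow> real) \<Rightarrow> bool" where
  "orth_polys F n w \<longleftrightarrow> (\<forall>p\<in>poly_space n. (LINT x|facet_measure F. w x * p x) = 0)"

definition jump :: "'a::euclidean_space set \<Rightarrow> 'a set \<Rightarrow> ('a \<Rightarrow> real) \<Rightarrow> 'a \<Rightarrow> real" where
  "jump K K' v x = elem_restr K v x - elem_restr K' v x"

text \<open>Both orientations of the jump across an interior facet are quantified over; the condition does
  not depend on the sign.  A boundary facet lies in a single simplex, whose trace is \<open>v|\<^sub>F\<close>.\<close>

definition CR_max :: "'a::euclidean_space set \<Rightarrow> 'a set set \<Rightarrow> nat \<Rightarrow> ('a \<Rightarrow> real) set" where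
  "CR_max \<Omega> \<T> k = {v \<in> broken_polys \<T> k.
     \<forall>F\<in>interior_facets \<Omega> \<T>. \<forall>K\<in>facet_patch \<T> F. \<forall>K'\<in>facet_patch \<T> F.
       K \<noteq> K' \<longrightarrow> orth_polys F (k - 1) (jump K K' v)}"

definition CR0_max :: "'a::euclidean_space set \<Rightarrow> 'a set set \<Rightarrow> nat \<Rightarrow> ('a \<Rightarrow> real) set" where
  "CR0_max \<Omega> \<T> k = {v \<in> CR_max \<Omega> \<T> k.
     \<forall>F\<in>boundary_facets \<Omega> \<T>. \<forall>K\<in>facet_patch \<T> F. orth_polys F (k - 1) (elem_restr K v)}"

end

theory Submission imports Defs
begin

text \<open>
  On a facet the Jacobi polynomials \<open>P\<^sub>k(1 - 2\<lambda>\<^sub>z)\<close> of the coordinates not vanishing there are orthogonal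
  to lower degree, because the moments of \<open>\<lambda>\<^sub>z\<close> against a function homogeneous about \<open>z\<close> are those of a
  beta distribution; this gives the inclusions in the maximal spaces.  On each simplex a combination
  of facet functions is a combination of the functions \<open>P\<^sub>k(1 - 2\<lambda>\<^sub>z) - 1\<close>, so its values at the
  vertices determine it as long as \<open>\<rho> = P\<^sub>k(-1) \<noteq> 1\<close>.  A conforming function can be corrected at the
  vertices within this span, and directness of the sums becomes a statement about vertex values:
  for odd \<open>k\<close> no vertex values remain, and for even \<open>k\<close> the simplex functions have equal values
  \<open>\<eta> \<noteq> 0\<close> at all vertices, so conformity forces equal coefficients along the connected mesh.
  Members of \<open>H10\<close> that are smooth on the simplices vanish on boundary facets (testing against a bump
  function pushed across the facet), and conversely the nodal functions of interior vertices are
  limits of mollified dilations.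

  Strictness in the maximal space is tested by a simplex function for odd \<open>k\<close> and by a facet
  function for even \<open>k\<close>.  On a single tetrahedron there are no interior facets; there, for even
  \<open>k \<ge> 6\<close>, two symmetric polynomials \<open>e\<^sub>2\<^bsup>k/2\<^esup>\<close> and \<open>e\<^sub>2\<^bsup>k/2-3\<^esup> e\<^sub>3\<^sup>2\<close> of the barycentric coordinates, made
  orthogonal to lower degree on all facets, are combined to vanish at the vertices.
\<close>

text \<open>The parity split rests on one sign: P_k(-1) = (-1)^k binom(k+d-2, k). For odd k it is
  negative, so \<rho> \<noteq> 1 and the vertex values see every combination of facet functions. For
  even k it is positive, so the vertex value \<eta> = (d-1+\<rho>)/d of a simplex function is
  positive, whereas \<rho> = 1 for d = 2, and vertex values then say nothing about facet functions.
  Several obstacles come from the definitions. The surface measure is a projected slab of Lebesgue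
  measure, so facet integrals are compared through translations and homotheties of the ambient
  space. Zero boundary values are given only through limits of test functions. A facet counts as
  interior as soon as it is not contained in the frontier, so the existence of neighbours and the
  covering of the frontier by boundary facets must be derived. The two symmetric polynomials used on
  one tetrahedron are of the form e2^i e3^j with 2i + 3j = k. Two are needed, so that one condition
  at the vertices leaves a nonzero combination; for even k they exist from k = 6 on.\<close>

abbreviation \<V> :: "'a::euclidean_space set \<Rightarrow> 'a set" where
  "\<V> \<equiv> simplex_vertices"

section \<open>Beta integrals and the Bernstein form of the Jacobi polynomials\<close>

text \<open>Induction on \<open>b\<close>: the function \<open>?F\<close> vanishes at both ends, so
  its derivative integrates to zero, which trades a factor \<open>1 - t\<close> for a factor
  \<open>t\<close>.\<close>

lemma has_integral_beta:
  "((\<lambda>t. t ^ a * (1 - t) ^ b) has_integral (fact a * fact b / fact (a + b + 1) :: real)) {0..1}"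
proof (induction b arbitrary: a)
  case 0
  have "((\<lambda>t. t ^ a) has_integral (1 ^ Suc a / real (Suc a) - 0 ^ Suc a / real (Suc a))) {0..1::real}"
    by (rule fundamental_theorem_of_calculus)
       (auto intro!: derivative_eq_intros simp flip: has_real_derivative_iff_has_vector_derivative,
        cases a, auto simp: field_simps)
  thus ?case by simp
next
  case (Suc b)
  let ?F = "\<lambda>t::real. t ^ Suc a * (1 - t) ^ Suc b"
  have "((\<lambda>t. real (Suc a) * (t ^ a * (1 - t) ^ Suc b) - real (Suc b) * (t ^ Suc a * (1 - t) ^ b))
      has_integral (?F 1 - ?F 0)) {0..1}"
  proof (rule fundamental_theorem_of_calculus)
    fix t :: real
    have "(?F has_real_derivative real (Suc a) * (t ^ a * (1 - t) ^ Suc b)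
        - real (Suc b) * (t ^ Suc a * (1 - t) ^ b)) (at t within {0..1})"
      by (rule derivative_eq_intros refl)+ (simp del: power_Suc)
    thus "(?F has_vector_derivative real (Suc a) * (t ^ a * (1 - t) ^ Suc b)
        - real (Suc b) * (t ^ Suc a * (1 - t) ^ b)) (at t within {0..1})"
      by (simp add: has_real_derivative_iff_has_vector_derivative)
  qed simp
  from has_integral_add[OF this has_integral_mult_right[OF Suc.IH[of "Suc a"], of "real (Suc b)"]]
  have "((\<lambda>t. real (Suc a) * (t ^ a * (1 - t) ^ Suc b)) has_integral
      real (Suc b) * (fact (Suc a) * fact b / fact (Suc a + b + 1))) {0..1}"
    by simp
  from has_integral_mult_right[OF this, of "1 / real (Suc a)"]
  have "((\<lambda>t. t ^ a * (1 - t) ^ Suc b) has_integral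
      1 / real (Suc a) * (real (Suc b) * (fact (Suc a) * fact b / fact (Suc a + b + 1)))) {0..1}"
    by (simp del: of_nat_Suc power_Suc)
  also have "1 / real (Suc a) * (real (Suc b) * (fact (Suc a) * fact b / fact (Suc a + b + 1))) =
      (fact a * fact (Suc b) / fact (a + Suc b + 1) :: real)"
  proof -
    have "1 / real (Suc a) * (real (Suc b) * (fact (Suc a) * fact b / D)) =
        fact a * fact (Suc b) / D" for D :: real
      by (simp add: fact_Suc del: of_nat_Suc)
    thus ?thesis by simp
  qed
  finally show ?case .
qed

text \<open>An n-th finite difference annihilates polynomials of degree below n, and the last
  binomial is a polynomial of degree \<open>m\<close> in \<open>i\<close>. The fact
  \<open>pascal\<close> takes one difference, which lowers \<open>m\<close> by one.\<close>

lemma alternating_binomial_sum_eq_0: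
  "m < n \<Longrightarrow> (\<Sum>i\<le>n. (-1) ^ i * real (n choose i) * real ((r + i) choose m)) = 0"
proof (induction n arbitrary: m)
  case (Suc n)
  have pascal: "(\<Sum>i\<le>Suc n. (-1) ^ i * real (Suc n choose i) * g i) =
      (\<Sum>i\<le>n. (-1) ^ i * real (n choose i) * (g i - g (Suc i)))" for g :: "nat \<Rightarrow> real"
  proof -
    have "(\<Sum>i\<le>Suc n. (-1) ^ i * real (Suc n choose i) * g i) =
        g 0 + (\<Sum>i\<le>n. (-1) ^ Suc i * (real (n choose i) + real (n choose Suc i)) * g (Suc i))"
      by (subst sum.atMost_Suc_shift) simp
    also have "\<dots> = (g 0 + (\<Sum>i\<le>n. (-1) ^ Suc i * real (n choose Suc i) * g (Suc i)))
        - (\<Sum>i\<le>n. (-1) ^ i * real (n choose i) * g (Suc i))"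
      by (simp add: algebra_simps sum.distrib sum_negf sum_subtractf)
    also have "g 0 + (\<Sum>i\<le>n. (-1) ^ Suc i * real (n choose Suc i) * g (Suc i)) =
        (\<Sum>i\<le>Suc n. (-1) ^ i * real (n choose i) * g i)"
      by (subst sum.atMost_Suc_shift) simp
    also have "\<dots> = (\<Sum>i\<le>n. (-1) ^ i * real (n choose i) * g i)" by simp
    finally show ?thesis by (simp add: algebra_simps sum_subtractf)
  qed
  show ?case
  proof (cases m)
    case 0
    show ?thesis unfolding 0 pascal by simp
  next
    case (Suc m')
    have "real ((r + i) choose m) - real ((r + Suc i) choose m) = - real ((r + i) choose m')" for i
      by (simp add: Suc)
    hence "(\<Sum>i\<le>Suc n. (-1) ^ i * real (Suc n choose i) * real ((r + i) choose m)) =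
        - (\<Sum>i\<le>n. (-1) ^ i * real (n choose i) * real ((r + i) choose m'))"
      unfolding pascal by (simp add: sum_negf)
    with Suc.IH[of m'] Suc.prems Suc show ?thesis by simp
  qed
qed simp

text \<open>The Bernstein form of the Jacobi polynomial \<open>P\<^sub>n\<^sup>(\<^sup>0\<^sup>,\<^sup>\<beta>\<^sup>)(1 - 2t)\<close>, read off from
  Rodrigues' formula.\<close>

definition shifted_jacobi :: "nat \<Rightarrow> nat \<Rightarrow> real poly" where
  "shifted_jacobi n \<beta> = (\<Sum>i\<le>n. smult ((-1) ^ i * real (n choose i) * real ((n + \<beta>) choose i))
     ([:0, 1:] ^ i * [:1, -1:] ^ (n - i)))"

lemma poly_shifted_jacobi:
  "poly (shifted_jacobi n \<beta>) t =
    (\<Sum>i\<le>n. (-1) ^ i * real (n choose i) * real ((n + \<beta>) choose i) * (t ^ i * (1 - t) ^ (n - i)))"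
  by (simp add: shifted_jacobi_def poly_sum)

lemma poly_shifted_jacobi_0: "poly (shifted_jacobi n \<beta>) 0 = 1"
proof -
  have "poly (shifted_jacobi n \<beta>) 0 = (\<Sum>i\<in>{0::nat}. (1::real))"
    unfolding poly_shifted_jacobi by (rule sum.mono_neutral_cong_right) auto
  thus ?thesis by simp
qed

lemma poly_shifted_jacobi_1:
  "poly (shifted_jacobi n \<beta>) 1 = (-1) ^ n * real ((n + \<beta>) choose n)"
proof -
  have "poly (shifted_jacobi n \<beta>) 1 = (\<Sum>i\<in>{n}. (-1) ^ n * real ((n + \<beta>) choose n))"
    unfolding poly_shifted_jacobi by (rule sum.mono_neutral_cong_right) auto
  thus ?thesis by simp
qed

text \<open>Each Bernstein term has degree exactly n and leading coefficient (-1)^(n-i), so all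
  contributions to the coefficient of t^n carry the sign (-1)^n and cannot cancel.\<close>

lemma degree_shifted_jacobi: "degree (shifted_jacobi n \<beta>) = n"
proof (rule antisym)
  have deg: "degree ([:0, 1:] ^ i * [:1, -1:] ^ (n - i) :: real poly) = n" if "i \<le> n" for i
    using that by (subst degree_mult_eq) (auto simp: degree_power_eq)
  show "degree (shifted_jacobi n \<beta>) \<le> n" unfolding shifted_jacobi_def
    by (rule degree_sum_le) (auto intro: order.trans[OF degree_smult_le] simp: deg)
  have lc: "coeff ([:0, 1:] ^ i * [:1, -1:] ^ (n - i) :: real poly) n = (-1) ^ (n - i)" if "i \<le> n" for i
  proof -
    have "coeff ([:0, 1:] ^ i * [:1, -1:] ^ (n - i) :: real poly) n =
        lead_coeff ([:0, 1:] ^ i * [:1, -1:] ^ (n - i) :: real poly)"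
      by (simp add: deg[OF that])
    thus ?thesis by (simp add: lead_coeff_mult lead_coeff_power)
  qed
  have "coeff (shifted_jacobi n \<beta>) n =
      (\<Sum>i\<le>n. (-1) ^ i * real (n choose i) * real ((n + \<beta>) choose i) * (-1) ^ (n - i))"
    by (simp add: shifted_jacobi_def coeff_sum lc)
  also have "\<dots> = (\<Sum>i\<le>n. (-1) ^ n * (real (n choose i) * real ((n + \<beta>) choose i)))"
  proof (rule sum.cong[OF refl])
    fix i assume "i \<in> {..n}"
    hence "(-1::real) ^ n = (-1) ^ i * (-1) ^ (n - i)" by (simp flip: power_add)
    thus "(-1) ^ i * real (n choose i) * real ((n + \<beta>) choose i) * (-1) ^ (n - i) =
        (-1) ^ n * (real (n choose i) * real ((n + \<beta>) choose i))"
      by simp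
  qed
  also have "\<dots> = (-1) ^ n * (\<Sum>i\<le>n. real (n choose i) * real ((n + \<beta>) choose i))"
    by (simp add: sum_distrib_left)
  also have "\<dots> \<noteq> 0"
  proof -
    have "(\<Sum>i\<le>n. real (n choose i) * real ((n + \<beta>) choose i)) > 0" by (rule sum_pos2[of _ 0]) auto
    thus ?thesis by simp
  qed
  finally show "n \<le> degree (shifted_jacobi n \<beta>)" by (rule le_degree)
qed

text \<open>Each term integrates to a beta value. The factorials combine so that, up to a constant,
  the alternating sum of binom(m+i, m) remains: an n-th difference of a polynomial of degree m <
  n.\<close>

lemma shifted_jacobi_orthogonal_monom:
  assumes "m < n"
  shows "((\<lambda>t. (1 - t) ^ \<beta> * poly (shifted_jacobi n \<beta>) t * t ^ m) has_integral 0) {0..1}"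
proof -
  let ?c = "\<lambda>i. (-1) ^ i * real (n choose i) * real ((n + \<beta>) choose i)"
  have "((\<lambda>t. \<Sum>i\<le>n. ?c i * (t ^ (m + i) * (1 - t) ^ (n - i + \<beta>))) has_integral
      (\<Sum>i\<le>n. ?c i * (fact (m + i) * fact (n - i + \<beta>) / fact (m + i + (n - i + \<beta>) + 1)))) {0..1}"
    by (intro has_integral_sum has_integral_mult_right has_integral_beta) auto
  moreover have "(\<Sum>i\<le>n. ?c i * (t ^ (m + i) * (1 - t) ^ (n - i + \<beta>))) =
      (1 - t) ^ \<beta> * poly (shifted_jacobi n \<beta>) t * t ^ m" for t :: real
    unfolding poly_shifted_jacobi sum_distrib_left sum_distrib_right
    by (intro sum.cong refl) (simp only: power_add mult_ac)
  moreover have "(\<Sum>i\<le>n. ?c i * (fact (m + i) * fact (n - i + \<beta>) / fact (m + i + (n - i + \<beta>) + 1))) = 0"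
  proof -
    have "?c i * (fact (m + i) * fact (n - i + \<beta>) / fact (m + i + (n - i + \<beta>) + 1)) =
        fact (n + \<beta>) * fact m / fact (m + n + \<beta> + 1) *
        ((-1) ^ i * real (n choose i) * real ((m + i) choose m))" if "i \<in> {..n}" for i
    proof -
      have b1: "real ((n + \<beta>) choose i) = fact (n + \<beta>) / (fact i * fact (n - i + \<beta>))"
        using that by (subst binomial_fact) auto
      have b2: "real ((m + i) choose m) = fact (m + i) / (fact m * fact i)" by (subst binomial_fact) auto
      have b3: "m + i + (n - i + \<beta>) + 1 = m + n + \<beta> + 1" using that by simp
      show ?thesis unfolding b1 b2 b3 by (simp add: divide_simps)
    qed
    from sum.cong[OF refl this]
    have "(\<Sum>i\<le>n. ?c i * (fact (m + i) * fact (n - i + \<beta>) / fact (m + i + (n - i + \<beta>) + 1))) =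
        fact (n + \<beta>) * fact m / fact (m + n + \<beta> + 1) *
        (\<Sum>i\<le>n. (-1) ^ i * real (n choose i) * real ((m + i) choose m))"
      unfolding sum_distrib_left .
    thus ?thesis using alternating_binomial_sum_eq_0[OF assms, of m] by simp
  qed
  ultimately show ?thesis by simp
qed

lemma shifted_jacobi_orthogonal:
  assumes "degree q < n"
  shows "((\<lambda>t. (1 - t) ^ \<beta> * poly (shifted_jacobi n \<beta>) t * poly q t) has_integral 0) {0..1}"
proof -
  have "((\<lambda>t. \<Sum>m\<le>degree q. coeff q m * ((1 - t) ^ \<beta> * poly (shifted_jacobi n \<beta>) t * t ^ m))
      has_integral (\<Sum>m\<le>degree q. coeff q m * 0)) {0..1}"
    using assms by (intro has_integral_sum has_integral_mult_right shifted_jacobi_orthogonal_monom) auto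
  thus ?thesis by (simp add: poly_altdef[of q] sum_distrib_left mult_ac)
qed

lemma poly_eq_0_if_weighted_square_integral_0:
  fixes r :: "real poly"
  assumes "integral {-1..1} (\<lambda>x. (1 + x) ^ \<beta> * poly r x * poly r x) = 0"
  shows "r = 0"
proof -
  have "(1 + x) ^ \<beta> * poly r x * poly r x = 0" if "x \<in> {-1..1}" for x
  proof (rule has_integral_0_cbox_imp_0[where a="-1" and b=1 and f="\<lambda>x. (1 + x) ^ \<beta> * poly r x * poly r x"])
    show "((\<lambda>x. (1 + x) ^ \<beta> * poly r x * poly r x) has_integral 0) (cbox (-1) 1)"
      using integrable_integral[OF integrable_continuous_interval[where a="-1::real" and b=1 and
          f="\<lambda>x. (1 + x) ^ \<beta> * poly r x * poly r x"]] assms by (simp add: continuous_intros)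
  qed (use that in \<open>auto intro!: continuous_intros simp: mult.assoc\<close>)
  note * = this
  have "poly r x = 0" if "x \<in> {0..1}" for x using that *[of x] by auto
  hence "{0..1} \<subseteq> {x. poly r x = 0}" by blast
  thus ?thesis using poly_roots_finite[of r] infinite_Icc[OF zero_less_one[where 'a = real]] finite_subset by blast
qed

text \<open>The existence half is the substitution t = (1-x)/2. For uniqueness a multiple of the
  candidate is subtracted to cancel the leading coefficient; the remainder has lower degree, hence
  is orthogonal to both polynomials and so to itself. The value at 1 then fixes the
  multiple.\<close>

lemma jacobi_eq: "jacobi n 0 \<beta> = pcompose (shifted_jacobi n \<beta>) [:1/2, -1/2:]"
proof -
  let ?P = "\<lambda>p. degree p = n \<and>
     (\<forall>q. degree q < n \<longrightarrow>
        integral {-1..1} (\<lambda>x. (1 - x) ^ 0 * (1 + x) ^ \<beta> * poly p x * poly q x) = 0) \<and>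
     poly p 1 = pochhammer (real 0 + 1) n / fact n"
  let ?J = "pcompose (shifted_jacobi n \<beta>) [:1/2, -1/2:]"
  have "integral {-1..1} (\<lambda>x. (1 + x) ^ \<beta> * poly ?J x * poly q x) = 0" if "degree q < n" for q
  proof -
    define q' where "q' = pcompose q [:1, -2:]"
    have "degree q' < n" using that by (simp add: q'_def degree_pcompose)
    note I = has_integral_affinity[OF shifted_jacobi_orthogonal[OF this, of \<beta>, folded box_real],
        of "-1/2" "1/2"]
    have img: "(\<lambda>x. (1 / (- 1 / 2)) *\<^sub>R x + - ((1 / (- 1 / 2)) *\<^sub>R (1 / 2))) ` cbox 0 1 = {-1..1::real}"
      by (subst image_affinity_cbox) (auto simp: cbox_interval)
    have eq: "(1 - ((- 1 / 2) *\<^sub>R x + 1 / 2)) ^ \<beta> * poly (shifted_jacobi n \<beta>) ((- 1 / 2) *\<^sub>R x + 1 / 2)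
       * poly q' ((- 1 / 2) *\<^sub>R x + 1 / 2)
      = (1/2) ^ \<beta> * ((1 + x) ^ \<beta> * poly ?J x * poly q x)" for x :: real
    proof -
      have "1 - ((- 1 / 2) *\<^sub>R x + 1 / 2) = (1/2) * (1 + x)" by (simp add: algebra_simps)
      moreover have "poly q' ((- 1 / 2) *\<^sub>R x + 1 / 2) = poly q x"
        by (simp add: q'_def poly_pcompose algebra_simps)
      moreover have "poly (shifted_jacobi n \<beta>) ((- 1 / 2) *\<^sub>R x + 1 / 2) = poly ?J x"
        by (simp add: poly_pcompose algebra_simps)
      ultimately show ?thesis by (simp only: power_mult_distrib mult.assoc)
    qed
    have "((\<lambda>x. (1/2) ^ \<beta> * ((1 + x) ^ \<beta> * poly ?J x * poly q x)) has_integral 0) {-1..1}"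
      using I unfolding img eq by simp
    from has_integral_mult_right[OF this, of "2 ^ \<beta>"]
    have "((\<lambda>x. (1 + x) ^ \<beta> * poly ?J x * poly q x) has_integral 0) {-1..1}"
      by (simp add: power_one_over)
    thus ?thesis by (rule integral_unique)
  qed
  hence J: "?P ?J" by (simp add: degree_shifted_jacobi degree_pcompose poly_pcompose poly_shifted_jacobi_0
      pochhammer_fact[symmetric])
  have "p = ?J" if p: "?P p" for p
  proof -
    define c where "c = lead_coeff p / lead_coeff ?J"
    define r where "r = p - smult c ?J"
    have lc: "lead_coeff ?J \<noteq> 0"
      using J by (metis fact_nonzero div_self leading_coeff_0_iff of_nat_0 add_0 pochhammer_fact
          poly_0 zero_neq_one)
    have r0: "r = 0"
    proof (cases "degree r < n")
      case True
      have orth: "integral {-1..1} (\<lambda>x. (1 + x) ^ \<beta> * poly s x * poly r x) = 0" if "?P s" for s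
        using that True by auto
      have "integral {-1..1} (\<lambda>x. (1 + x) ^ \<beta> * poly r x * poly r x) =
         integral {-1..1} (\<lambda>x. (1 + x) ^ \<beta> * poly p x * poly r x - c * ((1 + x) ^ \<beta> * poly ?J x * poly r x))"
        by (rule integral_cong) (simp add: r_def algebra_simps)
      also have "\<dots> = integral {-1..1} (\<lambda>x. (1 + x) ^ \<beta> * poly p x * poly r x)
         - c * integral {-1..1} (\<lambda>x. (1 + x) ^ \<beta> * poly ?J x * poly r x)"
        by (subst integral_diff)
           (auto intro!: integrable_continuous_interval continuous_intros simp del: poly_pcompose)
      also have "\<dots> = 0" using orth[OF p] orth[OF J] by simp
      finally show ?thesis by (rule poly_eq_0_if_weighted_square_integral_0)
    next
      case False
      \<comment> \<open>This case covers n = 0, where no degree is below n: the coefficient at n was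
        cancelled, so the remainder is zero without any orthogonality.\<close>
      have "degree r \<le> n"
        unfolding r_def using p J by (intro degree_diff_le order.trans[OF degree_smult_le]) auto
      with False have "degree r = n" by simp
      moreover have "coeff r n = 0" using p J lc by (simp add: r_def c_def)
      ultimately show ?thesis by (metis leading_coeff_0_iff)
    qed
    have "poly p 1 = c * poly ?J 1" using r0 by (simp add: r_def)
    hence "c = 1" using p J by (simp add: pochhammer_fact[symmetric])
    with r0 show ?thesis by (simp add: r_def)
  qed
  thus ?thesis unfolding jacobi_def by (rule the_equality[where P = ?P, OF J])
qed

lemma poly_jacobi: "poly (jacobi n 0 \<beta>) (1 - 2 * t) = poly (shifted_jacobi n \<beta>) t"
proof -
  have "1 / 2 - (1 - 2 * t) / 2 = t" by (simp add: field_simps)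
  thus ?thesis by (simp add: jacobi_eq poly_pcompose)
qed

section \<open>Affine functions\<close>

definition affine_fn :: "('a::euclidean_space \<Rightarrow> real) \<Rightarrow> bool" where
  "affine_fn l \<longleftrightarrow> (\<exists>a c. \<forall>x. l x = a \<bullet> x + c)"

lemma affine_fnE:
  assumes "affine_fn l"
  obtains a c where "l = (\<lambda>x. a \<bullet> x + c)" using assms by (auto simp: affine_fn_def)

lemma affine_fn_const [intro]: "affine_fn (\<lambda>x. c)"
  unfolding affine_fn_def by (intro exI[of _ 0] exI[of _ c]) simp

lemma affine_fn_inner [intro]: "affine_fn (\<lambda>x. a \<bullet> x)" "affine_fn (\<lambda>x. x \<bullet> a)"
  unfolding affine_fn_def by (intro exI[of _ a] exI[of _ 0]; simp add: inner_commute)+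

lemma affine_fn_add [intro]:
  assumes "affine_fn f" "affine_fn g"
  shows "affine_fn (\<lambda>x. f x + g x)"
proof -
  from assms obtain a c a' c' where "f = (\<lambda>x. a \<bullet> x + c)" "g = (\<lambda>x. a' \<bullet> x + c')"
    by (auto elim!: affine_fnE)
  thus ?thesis
    by (auto simp: affine_fn_def inner_add_left algebra_simps intro!: exI[of _ "a + a'"] exI[of _ "c + c'"])
qed

lemma affine_fn_mult [intro]:
  assumes "affine_fn f"
  shows "affine_fn (\<lambda>x. r * f x)"
proof -
  from assms obtain a c where "f = (\<lambda>x. a \<bullet> x + c)" by (auto elim!: affine_fnE)
  thus ?thesis by (auto simp: affine_fn_def algebra_simps intro!: exI[of _ "r *\<^sub>R a"] exI[of _ "r * c"])
qed

lemma affine_fn_diff [intro]: "affine_fn f \<Longrightarrow> affine_fn g \<Longrightarrow> affine_fn (\<lambda>x. f x - g x)"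
  using affine_fn_add[of f "\<lambda>x. (-1) * g x"] affine_fn_mult[of g "-1"] by simp

lemma affine_fn_sum [intro]: "(\<And>i. i \<in> I \<Longrightarrow> affine_fn (f i)) \<Longrightarrow> affine_fn (\<lambda>x. \<Sum>i\<in>I. f i x)"
  by (induction I rule: infinite_finite_induct) auto

lemma affine_fn_continuous: "affine_fn l \<Longrightarrow> continuous_on S l"
  by (auto elim!: affine_fnE intro!: continuous_intros)

lemma affine_fn_comb:
  assumes "affine_fn l" "finite V" "sum u V = 1"
  shows "l (\<Sum>v\<in>V. u v *\<^sub>R v) = (\<Sum>v\<in>V. u v * l v)"
proof -
  from assms(1) obtain a c where l: "l = (\<lambda>x. a \<bullet> x + c)" by (rule affine_fnE)
  have "(\<Sum>v\<in>V. u v * l v) = (\<Sum>v\<in>V. u v * (a \<bullet> v)) + sum u V * c"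
    by (simp add: l distrib_left sum.distrib sum_distrib_right)
  thus ?thesis by (simp add: l inner_sum_right assms)
qed

lemma affine_fn_segment:
  assumes "affine_fn l"
  shows "l (x + t *\<^sub>R (y - x)) = l x + t * (l y - l x)"
  using assms by (auto elim!: affine_fnE simp: inner_simps algebra_simps)

lemma affine_fn_eq_on_affine_hull:
  assumes "affine_fn l" "affine_fn l'" "\<And>v. v \<in> V \<Longrightarrow> l v = l' v" "x \<in> affine hull V"
  shows "l x = l' x"
proof -
  from assms(4) obtain S u where S: "finite S" "S \<subseteq> V" "sum u S = 1" and x: "x = (\<Sum>v\<in>S. u v *\<^sub>R v)"
    unfolding affine_hull_explicit by blast
  show ?thesis unfolding x affine_fn_comb[OF assms(1) S(1,3)] affine_fn_comb[OF assms(2) S(1,3)]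
    using S assms(3) by (intro sum.cong) auto
qed

section \<open>Barycentric coordinates\<close>

lemma simplex_vertices_convex_hull:
  "\<not> affine_dependent C \<Longrightarrow> \<V> (convex hull C) = C"
  by (auto simp: simplex_vertices_def extreme_point_of_convex_hull_affine_independent)

lemma simplex_vertices_props:
  assumes "int n simplex K"
  shows "\<not> affine_dependent (\<V> K)" "card (\<V> K) = n + 1"
    "finite (\<V> K)" "convex hull (\<V> K) = K"
proof -
  from assms obtain C where C: "\<not> affine_dependent C" "int (card C) = int n + 1" "K = convex hull C"
    by (auto simp: simplex_def)
  hence "\<V> K = C" by (simp add: simplex_vertices_convex_hull)
  with C show "\<not> affine_dependent (\<V> K)" "card (\<V> K) = n + 1"
    "finite (\<V> K)" "convex hull (\<V> K) = K" by (auto simp: aff_independent_finite)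
qed

locale full_simplex =
  fixes K :: "'a::euclidean_space set"
  assumes simplex: "int DIM('a) simplex K"
begin

abbreviation "V \<equiv> \<V> K"
abbreviation "bc \<equiv> barycentric K"

lemmas indep = simplex_vertices_props(1)[OF simplex]
lemmas card_V = simplex_vertices_props(2)[OF simplex]
lemmas finite_V = simplex_vertices_props(3)[OF simplex]
lemmas hull_V = simplex_vertices_props(4)[OF simplex]

lemma affine_hull_V: "affine hull V = UNIV"
proof -
  have "aff_dim V = int DIM('a)" using indep card_V finite_V by (simp add: affine_independent_iff_card)
  thus ?thesis by (simp add: aff_dim_eq_full)
qed

lemma closed_K: "closed K" and convex_K: "convex K" and compact_K: "compact K"
  using simplex closed_simplex convex_simplex compact_simplex by blast+

lemma V_subset: "V \<subseteq> K" by (metis hull_V hull_subset)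

lemma affine_fn_eq: "affine_fn l \<Longrightarrow> affine_fn l' \<Longrightarrow> (\<And>v. v \<in> V \<Longrightarrow> l v = l' v) \<Longrightarrow> l = l'"
  using affine_fn_eq_on_affine_hull[of l l' V] affine_hull_V by (auto simp: fun_eq_iff)

text \<open>The differences to a base vertex \<open>b\<close> are independent, so a linear
  functional may be prescribed on them. Choosing \<open>b\<close> different from \<open>z\<close>
  makes the value at \<open>b\<close> zero; if \<open>z\<close> is no vertex, all prescribed values
  are zero.\<close>

lemma barycentric_exists:
  shows "\<exists>l. affine_fn l \<and> (\<forall>y\<in>V. l y = (if y = z then 1 else 0))"
proof -
  have "DIM('a) \<ge> 1" by (simp add: DIM_positive Suc_leI)
  hence "\<not> V \<subseteq> {z}" using card_V card_mono[of "{z}" V] by auto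
  then obtain b where b: "b \<in> V" "b \<noteq> z" by auto
  have ind: "independent ((\<lambda>x. x - b) ` (V - {b}))"
    using indep b(1) by (simp add: affine_dependent_iff_dependent2)
  then obtain f :: "'a \<Rightarrow> real" where f: "linear f"
      "\<And>x. x \<in> (\<lambda>x. x - b) ` (V - {b}) \<Longrightarrow> f x = (if x = z - b then 1 else 0)"
    using linear_independent_extend[OF ind, of "\<lambda>x. if x = z - b then 1 else 0"] by blast
  have fx: "f x = (\<Sum>i\<in>Basis. f i *\<^sub>R i) \<bullet> x" for x
  proof -
    have "f x = f (\<Sum>i\<in>Basis. (x \<bullet> i) *\<^sub>R i)" by (simp add: euclidean_representation)
    also have "\<dots> = (\<Sum>i\<in>Basis. (x \<bullet> i) * f i)"
      using f(1) by (simp add: linear_sum linear_cmul)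
    finally show ?thesis by (simp add: inner_sum_left mult.commute inner_commute[of x])
  qed
  have "affine_fn (\<lambda>x. (\<Sum>i\<in>Basis. f i *\<^sub>R i) \<bullet> x - (\<Sum>i\<in>Basis. f i *\<^sub>R i) \<bullet> b)"
    by (intro affine_fn_diff) auto
  moreover have "(\<Sum>i\<in>Basis. f i *\<^sub>R i) \<bullet> y - (\<Sum>i\<in>Basis. f i *\<^sub>R i) \<bullet> b = (if y = z then 1 else 0)"
    if "y \<in> V" for y
  proof -
    have "(\<Sum>i\<in>Basis. f i *\<^sub>R i) \<bullet> y - (\<Sum>i\<in>Basis. f i *\<^sub>R i) \<bullet> b = f (y - b)"
      unfolding fx[of "y - b"] by (simp add: inner_diff_right)
    also have "\<dots> = (if y = z then 1 else 0)"
    proof (cases "y = b")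
      case True
      thus ?thesis using b f(1) by (simp add: linear_0)
    next
      case False
      thus ?thesis using f(2)[of "y - b"] that by auto
    qed
    finally show ?thesis .
  qed
  ultimately show ?thesis
    by (intro exI[of _ "\<lambda>x. (\<Sum>i\<in>Basis. f i *\<^sub>R i) \<bullet> x - (\<Sum>i\<in>Basis. f i *\<^sub>R i) \<bullet> b"]) auto
qed

lemma barycentric_props: "affine_fn (bc z) \<and> (\<forall>y\<in>V. bc z y = (if y = z then 1 else 0))"
proof -
  let ?P = "\<lambda>l. affine_fn l \<and> (\<forall>y\<in>V. l y = (if y = z then 1 else 0))"
  have "\<exists>!l. ?P l"
  proof (rule ex_ex1I[OF barycentric_exists])
    fix l l' assume "?P l" "?P l'"
    thus "l = l'" by (intro affine_fn_eq) auto
  qed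
  from theI'[OF this] show ?thesis by (simp add: barycentric_def affine_fn_def)
qed

lemma affine_bc [intro]: "affine_fn (bc z)"
  and bc_vertex: "y \<in> V \<Longrightarrow> bc z y = (if y = z then 1 else 0)" using barycentric_props by blast+

lemma continuous_bc [continuous_intros]: "continuous_on S f \<Longrightarrow> continuous_on S (\<lambda>x. bc z (f x))"
  using continuous_on_compose2[OF affine_fn_continuous[OF affine_bc, of UNIV]] by auto

text \<open>The convention that makes sums over all mesh vertices meaningful on each simplex:
  vertices outside it contribute the zero coordinate.\<close>

lemma bc_not_vertex: "z \<notin> V \<Longrightarrow> bc z x = 0"
proof -
  assume "z \<notin> V"
  hence "bc z = (\<lambda>x. 0)" by (intro affine_fn_eq) (auto simp: bc_vertex)
  thus ?thesis by simp
qed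

lemma affine_fn_expansion:
  assumes "affine_fn l"
  shows "l x = (\<Sum>v\<in>V. l v * bc v x)"
proof -
  have "l = (\<lambda>x. \<Sum>v\<in>V. l v * bc v x)"
    by (rule affine_fn_eq) (use assms finite_V in \<open>auto simp: bc_vertex if_distrib sum.If_cases
      intro!: affine_fn_mult cong: if_cong\<close>)
  thus ?thesis by metis
qed

lemma sum_bc: "(\<Sum>v\<in>V. bc v x) = 1" using affine_fn_expansion[OF affine_fn_const, of 1 x] by simp

lemma bc_repr: "(\<Sum>v\<in>V. bc v x *\<^sub>R v) = x"
proof (rule euclidean_eqI)
  fix b :: 'a
  show "(\<Sum>v\<in>V. bc v x *\<^sub>R v) \<bullet> b = x \<bullet> b"
    using affine_fn_expansion[OF affine_fn_inner(2), of x b] by (simp add: inner_sum_left mult.commute)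
qed

lemma bc_comb:
  assumes "sum u V = 1" "v \<in> V"
  shows "bc v (\<Sum>v\<in>V. u v *\<^sub>R v) = u v"
proof -
  have "bc v (\<Sum>v\<in>V. u v *\<^sub>R v) = (\<Sum>w\<in>V. u w * bc v w)"
    using affine_fn_comb[OF affine_bc finite_V assms(1)] .
  also have "\<dots> = (\<Sum>w\<in>V. if w = v then u v else 0)" by (intro sum.cong) (auto simp: bc_vertex)
  finally show ?thesis using finite_V assms by simp
qed

lemma mem_K_iff: "x \<in> K \<longleftrightarrow> (\<forall>v\<in>V. 0 \<le> bc v x)"
proof
  assume "x \<in> K"
  then obtain u where "\<forall>v\<in>V. 0 \<le> u v" "sum u V = 1" "(\<Sum>v\<in>V. u v *\<^sub>R v) = x"
    using convex_hull_finite[OF finite_V] hull_V by (smt (verit) mem_Collect_eq)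
  thus "\<forall>v\<in>V. 0 \<le> bc v x" using bc_comb[of u] by auto
next
  assume "\<forall>v\<in>V. 0 \<le> bc v x"
  hence "x \<in> convex hull V" unfolding convex_hull_finite[OF finite_V]
    by (intro CollectI exI[of _ "\<lambda>v. bc v x"]) (simp add: sum_bc bc_repr)
  thus "x \<in> K" by (simp add: hull_V)
qed

lemma mem_interior_iff: "x \<in> interior K \<longleftrightarrow> (\<forall>v\<in>V. 0 < bc v x)"
proof -
  have i: "interior K = {y. \<exists>u. (\<forall>x \<in> V. 0 < u x) \<and> sum u V = 1 \<and> (\<Sum>x\<in>V. u x *\<^sub>R x) = y}"
    using interior_convex_hull_explicit_minimal[OF indep] by (simp add: hull_V card_V)
  show ?thesis
  proof
    assume "x \<in> interior K"
    thus "\<forall>v\<in>V. 0 < bc v x" unfolding i using bc_comb by auto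
  next
    assume "\<forall>v\<in>V. 0 < bc v x"
    thus "x \<in> interior K"
      unfolding i by (intro CollectI exI[of _ "\<lambda>v. bc v x"]) (simp add: sum_bc bc_repr)
  qed
qed

lemma bc_le_1: "x \<in> K \<Longrightarrow> bc v x \<le> 1"
proof (cases "v \<in> V")
  case True
  assume "x \<in> K"
  hence "bc v x \<le> (\<Sum>v\<in>V. bc v x)" using True finite_V by (intro member_le_sum) (auto simp: mem_K_iff)
  thus ?thesis by (simp add: sum_bc)
qed (simp add: bc_not_vertex)

lemma bc_nonneg: "x \<in> K \<Longrightarrow> 0 \<le> bc v x"
  by (cases "v \<in> V") (auto simp: mem_K_iff bc_not_vertex)

lemma V_nonempty: "V \<noteq> {}" using card_V by auto

lemma interior_nonempty: "interior K \<noteq> {}"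
proof -
  let ?x = "\<Sum>v\<in>V. (1 / real (card V)) *\<^sub>R v"
  have s: "(\<Sum>v\<in>V. 1 / real (card V)) = 1" using V_nonempty finite_V by simp
  have "?x \<in> interior K"
    unfolding mem_interior_iff using bc_comb[OF s] V_nonempty finite_V by (auto simp: card_gt_0_iff)
  thus ?thesis by blast
qed

lemma closure_interior: "closure (interior K) = K"
  using convex_closure_interior[OF convex_K interior_nonempty] closed_K by simp

lemma mem_face_iff:
  assumes "C \<subseteq> V"
  shows "x \<in> convex hull C \<longleftrightarrow> x \<in> K \<and> (\<forall>v\<in>V - C. bc v x = 0)"
proof
  assume x: "x \<in> convex hull C"
  have "x \<in> K" using x assms hull_V hull_mono by blast
  moreover have "bc v x = 0" if "v \<in> V - C" for v
    using affine_fn_eq_on_affine_hull[OF affine_bc affine_fn_const, of C v 0 x]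
      x assms that convex_hull_subset_affine_hull[of C] by (force simp: bc_vertex subset_iff)
  ultimately show "x \<in> K \<and> (\<forall>v\<in>V - C. bc v x = 0)" by blast
next
  assume x: "x \<in> K \<and> (\<forall>v\<in>V - C. bc v x = 0)"
  have "finite C" using assms finite_V finite_subset by blast
  have "(\<Sum>v\<in>C. bc v x) = 1"
    using x sum_bc[of x] sum.mono_neutral_right[OF finite_V assms, of "\<lambda>v. bc v x"] by simp
  moreover have "(\<Sum>v\<in>C. bc v x *\<^sub>R v) = x"
    using x bc_repr[of x] sum.mono_neutral_right[OF finite_V assms, of "\<lambda>v. bc v x *\<^sub>R v"] by simp
  moreover have "\<forall>v\<in>C. 0 \<le> bc v x" using x assms by (auto simp: mem_K_iff)
  ultimately show "x \<in> convex hull C"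
    unfolding convex_hull_finite[OF \<open>finite C\<close>] by (intro CollectI exI[of _ "\<lambda>v. bc v x"]) simp
qed

lemma facet_iff: "F facet_of K \<longleftrightarrow> (\<exists>z\<in>V. F = convex hull (V - {z}))"
proof -
  have "2 \<le> card V" using card_V DIM_positive[where 'a='a] by simp
  thus ?thesis using facet_of_convex_hull_affine_independent_alt[OF indep, of F] by (auto simp: hull_V)
qed

lemma opposite:
  assumes "F facet_of K"
  shows opposite_vertex_in: "opposite_vertex K F \<in> V"
    and facet_eq_hull: "F = convex hull (V - {opposite_vertex K F})"
proof -
  obtain z where z: "z \<in> V" "F = convex hull (V - {z})" using assms facet_iff by blast
  have "y \<in> F \<longleftrightarrow> y \<noteq> z" if "y \<in> V" for y
    unfolding z(2) using that z(1) V_subset by (subst mem_face_iff) (auto simp: bc_vertex)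
  hence "opposite_vertex K F = z" unfolding opposite_vertex_def using z by (intro the_equality) auto
  with z show "opposite_vertex K F \<in> V" "F = convex hull (V - {opposite_vertex K F})" by auto
qed

lemma mem_facet_iff:
  assumes "F facet_of K"
  shows "x \<in> F \<longleftrightarrow> x \<in> K \<and> bc (opposite_vertex K F) x = 0"
  using mem_face_iff[of "V - {opposite_vertex K F}" x] opposite[OF assms] by auto

lemma facet_of_vertex: 
  assumes "z \<in> V"
  shows "convex hull (V - {z}) facet_of K" "opposite_vertex K (convex hull (V - {z})) = z"
proof -
  show *: "convex hull (V - {z}) facet_of K" using assms facet_iff by blast
  show "opposite_vertex K (convex hull (V - {z})) = z"
    using mem_face_iff[of "V - {z}" "opposite_vertex K (convex hull (V - {z}))"]
      mem_facet_iff[OF *, of "opposite_vertex K (convex hull (V - {z}))"]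
      opposite_vertex_in[OF *] assms V_subset by (auto simp: bc_vertex split: if_splits)
qed

lemma bij_betw_opposite: "bij_betw (opposite_vertex K) {F. F facet_of K} V"
  by (rule bij_betw_byWitness[where f' = "\<lambda>z. convex hull (V - {z})"])
    (use opposite facet_of_vertex in auto)

lemma facet_vertices: 
  assumes "F facet_of K"
  shows "\<V> F = V - {opposite_vertex K F}" "V \<inter> F = V - {opposite_vertex K F}"
proof -
  show "\<V> F = V - {opposite_vertex K F}" using facet_eq_hull[OF assms] indep affine_independent_Diff
    by (metis simplex_vertices_convex_hull)
  show "V \<inter> F = V - {opposite_vertex K F}"
    using mem_facet_iff[OF assms] V_subset opposite_vertex_in[OF assms] by (auto simp: bc_vertex)
qed

end

section \<open>Polynomial functions\<close>

lemma poly_space_monomial: "(\<Sum>b\<in>Basis. m b) \<le> k \<Longrightarrow> (\<lambda>x. \<Prod>b\<in>Basis. (x \<bullet> b) ^ m b) \<in> poly_space k"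
  unfolding poly_space_def by (rule span_base) blast

lemma subspace_poly_space: "subspace (poly_space k)" by (simp add: poly_space_def subspace_span)

lemma poly_space_induct [consumes 1, case_names zero monomial add scale]:
  assumes "f \<in> poly_space k"
    and zero: "P (\<lambda>x. 0)"
    and monomial: "\<And>m. (\<Sum>b\<in>Basis. m b) \<le> k \<Longrightarrow> P (\<lambda>x. \<Prod>b\<in>Basis. (x \<bullet> b) ^ m b)"
    and add: "\<And>f g. f \<in> poly_space k \<Longrightarrow> g \<in> poly_space k \<Longrightarrow> P f \<Longrightarrow> P g \<Longrightarrow> P (\<lambda>x. f x + g x)"
    and scale: "\<And>c f. f \<in> poly_space k \<Longrightarrow> P f \<Longrightarrow> P (\<lambda>x. c * f x)"
  shows "P f"
proof -
  have "f \<in> poly_space k \<and> P f" using assms(1) unfolding poly_space_def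
  proof (rule span_induct)
    show "subspace {f. f \<in> span {\<lambda>x. \<Prod>b\<in>Basis. (x \<bullet> b) ^ m b | m. (\<Sum>b\<in>Basis. m b) \<le> k} \<and> P f}"
      unfolding poly_space_def[symmetric]
    proof (rule subspaceI)
      show "0 \<in> {f. f \<in> poly_space k \<and> P f}"
        using zero subspace_0[OF subspace_poly_space] by (simp add: zero_fun_def)
    next
      fix f g :: "'a \<Rightarrow> real" assume "f \<in> {f. f \<in> poly_space k \<and> P f}" "g \<in> {f. f \<in> poly_space k \<and> P f}"
      thus "f + g \<in> {f. f \<in> poly_space k \<and> P f}"
        using add[of f g] subspace_add[OF subspace_poly_space, of f k g] by (simp add: plus_fun_def)
    next
      fix c and f :: "'a \<Rightarrow> real" assume "f \<in> {f. f \<in> poly_space k \<and> P f}"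
      thus "c *\<^sub>R f \<in> {f. f \<in> poly_space k \<and> P f}"
        using scale[of f c] subspace_scale[OF subspace_poly_space, of f k c] by (simp add: scaleR_fun_def)
    qed
  qed (use monomial in \<open>auto intro: span_base\<close>)
  thus ?thesis ..
qed

lemma poly_space_add: "f \<in> poly_space k \<Longrightarrow> g \<in> poly_space k \<Longrightarrow> (\<lambda>x. f x + g x) \<in> poly_space k"
  using subspace_add[OF subspace_poly_space] by (fastforce simp: plus_fun_def)

lemma poly_space_scale: "f \<in> poly_space k \<Longrightarrow> (\<lambda>x. c * f x) \<in> poly_space k"
  using subspace_scale[OF subspace_poly_space, of f k c] by (simp add: scaleR_fun_def)

lemma poly_space_diff: "f \<in> poly_space k \<Longrightarrow> g \<in> poly_space k \<Longrightarrow> (\<lambda>x. f x - g x) \<in> poly_space k"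
  using poly_space_add[of f k "\<lambda>x. (-1) * g x"] poly_space_scale[of g k "-1"] by simp

lemma poly_space_mono: "f \<in> poly_space k \<Longrightarrow> k \<le> l \<Longrightarrow> f \<in> poly_space l"
  unfolding poly_space_def by (erule subsetD[OF span_mono, rotated]) auto

lemma poly_space_const: "(\<lambda>x. c) \<in> poly_space k"
  using poly_space_scale[OF poly_space_monomial[of "\<lambda>_. 0" k], of c] by simp

lemma poly_space_sum: "(\<And>i. i \<in> I \<Longrightarrow> f i \<in> poly_space k) \<Longrightarrow> (\<lambda>x. \<Sum>i\<in>I. f i x) \<in> poly_space k"
  by (induction I rule: infinite_finite_induct) (auto intro: poly_space_const poly_space_add)

lemma poly_space_mult:
  assumes "f \<in> poly_space k" "g \<in> poly_space l"
  shows "(\<lambda>x. f x * g x) \<in> poly_space (k + l)" using assms(1)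
proof (induction rule: poly_space_induct)
  case zero
  show ?case by (simp add: poly_space_const)
next
  case (monomial m)
  show ?case using assms(2)
  proof (induction rule: poly_space_induct)
    case zero
    show ?case by (simp add: poly_space_const)
  next
    case mon: (monomial m')
    show ?case using poly_space_monomial[of "\<lambda>b. m b + m' b" "k + l"] mon monomial
      by (simp add: power_add prod.distrib sum.distrib)
  next
    case (add f g)
    from poly_space_add[OF add(3,4)] show ?case by (simp add: distrib_left)
  next
    case (scale c f)
    from poly_space_scale[OF scale(2), of c] show ?case by (simp add: mult_ac)
  qed
next
  case (add f g)
  from poly_space_add[OF add(3,4)] show ?case by (simp add: distrib_right)
next
  case (scale c f)
  from poly_space_scale[OF scale(2), of c] show ?case by (simp add: mult_ac)
qed

lemma poly_space_affine:
  fixes l :: "'a::euclidean_space \<Rightarrow> real"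
  assumes "affine_fn l"
  shows "l \<in> poly_space 1"
proof -
  from assms obtain a c where l: "l = (\<lambda>x. a \<bullet> x + c)" by (rule affine_fnE)
  have "(\<lambda>x::'a. x \<bullet> i) \<in> poly_space 1" if "i \<in> Basis" for i
  proof -
    have "(\<lambda>x::'a. \<Prod>b\<in>Basis. (x \<bullet> b) ^ (if b = i then 1 else 0)) \<in> poly_space 1"
      by (rule poly_space_monomial) (simp add: that)
    moreover have "(\<Prod>b\<in>Basis. (x \<bullet> b) ^ (if b = i then 1 else 0)) = x \<bullet> i" for x
      using that by (simp add: if_distrib cong: if_cong)
    ultimately show ?thesis by simp
  qed
  hence "(\<lambda>x::'a. (\<Sum>i\<in>Basis. (a \<bullet> i) * (x \<bullet> i)) + c) \<in> poly_space 1"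
    by (intro poly_space_add poly_space_sum poly_space_scale poly_space_const) auto
  thus ?thesis unfolding l by (simp flip: euclidean_inner)
qed

lemma poly_space_power: "f \<in> poly_space k \<Longrightarrow> (\<lambda>x. f x ^ n) \<in> poly_space (n * k)"
  by (induction n) (auto simp: poly_space_const intro: poly_space_mult)

lemma poly_space_poly:
  assumes "affine_fn l" "degree p \<le> k"
  shows "(\<lambda>x. poly p (l x)) \<in> poly_space k"
proof -
  have "(\<lambda>x. \<Sum>i\<le>degree p. coeff p i * l x ^ i) \<in> poly_space k"
  proof (intro poly_space_sum poly_space_scale)
    fix i assume "i \<in> {..degree p}"
    thus "(\<lambda>x. l x ^ i) \<in> poly_space k"
      using poly_space_power[OF poly_space_affine[OF assms(1)], of i] assms(2) by (auto intro: poly_space_mono)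
  qed
  thus ?thesis by (simp add: poly_altdef)
qed

lemma poly_space_continuous: "f \<in> poly_space k \<Longrightarrow> continuous_on S f"
  by (induction rule: poly_space_induct) (auto intro!: continuous_intros)

section \<open>Surface integrals over facets\<close>

lemma integral_lborel_translate:
  fixes f :: "'a::euclidean_space \<Rightarrow> real"
  assumes [measurable]: "f \<in> borel_measurable borel"
  shows "(\<integral>x. f (c + x) \<partial>lborel) = (\<integral>x. f x \<partial>lborel)"
proof -
  have "(\<integral>x. f x \<partial>lborel) = (\<integral>x. f x \<partial>distr lborel borel ((+) c))"
    by (simp add: lborel_distr_plus)
  also have "\<dots> = (\<integral>x. f (c + x) \<partial>lborel)" by (rule integral_distr) auto
  finally show ?thesis ..
qed

lemma integral_lborel_homothety:
  fixes f :: "'a::euclidean_space \<Rightarrow> real"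
  assumes [measurable]: "f \<in> borel_measurable borel" and c: "c > 0"
  shows "(\<integral>x. f x \<partial>lborel) = c ^ DIM('a) * (\<integral>x. f (t + c *\<^sub>R x) \<partial>lborel)"
proof -
  have "(\<integral>x. f x \<partial>lborel) =
      (\<integral>x. f x \<partial>density (distr lborel borel (\<lambda>x. t + c *\<^sub>R x)) (\<lambda>_. ennreal (\<bar>c\<bar> ^ DIM('a))))"
    using lborel_affine[of c t] c by (metis less_irrefl ennreal_power abs_ge_zero)
  also have "\<dots> = c ^ DIM('a) * (\<integral>x. f (t + c *\<^sub>R x) \<partial>lborel)"
    using c by (subst integral_real_density) (auto simp: integral_distr)
  finally show ?thesis .
qed

locale simplex_facet = full_simplex +
  fixes F
  assumes facet: "F facet_of K"
begin

abbreviation "opp \<equiv> opposite_vertex K F"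

lemmas opp_V = opposite_vertex_in[OF facet]
lemmas F_eq = facet_eq_hull[OF facet]

lemma compact_F: "compact F"
  by (subst F_eq) (use finite_V in \<open>intro compact_convex_hull finite_imp_compact; simp\<close>)

definition grad :: 'a where "grad = (SOME a. \<exists>c. bc opp = (\<lambda>x. a \<bullet> x + c))"

lemma bc_opp: "bc opp x = grad \<bullet> x + bc opp 0"
proof -
  have "\<exists>a c. bc opp = (\<lambda>x. a \<bullet> x + c)" using affine_bc by (rule affine_fnE) blast
  hence "\<exists>c. bc opp = (\<lambda>x. grad \<bullet> x + c)" unfolding grad_def by (rule someI_ex)
  thus ?thesis by auto
qed

lemma other_vertex: obtains z where "z \<in> V" "z \<noteq> opp"
proof -
  have "card V \<ge> 2" using card_V DIM_positive[where 'a='a] by simp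
  hence "\<not> V \<subseteq> {opp}" using card_mono[of "{opp}" V] by auto
  thus ?thesis using that by blast
qed

lemma grad_nonzero: "grad \<noteq> 0"
proof
  assume "grad = 0"
  hence "bc opp x = bc opp y" for x y using bc_opp[of x] bc_opp[of y] by simp
  moreover obtain z where "z \<in> V" "z \<noteq> opp" by (rule other_vertex)
  ultimately show False using bc_vertex[of z opp] bc_vertex[of opp opp] opp_V by (metis zero_neq_one)
qed

text \<open>The signed distance from the hyperplane spanned by \<open>F\<close>, positive on the
  side of \<open>K\<close>. Accordingly \<open>proj\<close> is the orthogonal projection to that
  hyperplane.\<close>

definition height :: "'a \<Rightarrow> real" where "height x = bc opp x / norm grad"
definition normal :: 'a where "normal = grad /\<^sub>R norm grad"
definition proj :: "'a \<Rightarrow> 'a" where "proj x = x - height x *\<^sub>R normal"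

lemma norm_normal: "norm normal = 1" using grad_nonzero by (simp add: normal_def)

lemma affine_height: "affine_fn height"
  unfolding height_def using affine_fn_mult[OF affine_bc, of "1 / norm grad" opp] by simp

lemma height_add: "height (x + t *\<^sub>R normal) = height x + t" using grad_nonzero
  by (simp add: height_def bc_opp[of "_ + _"] bc_opp[of x] normal_def inner_add_right divide_simps
      dot_square_norm power2_eq_square)

lemma height_diff: "height x - height y = normal \<bullet> (x - y)"
  by (simp add: height_def bc_opp[of x] bc_opp[of y] normal_def inner_diff_right divide_simps)

lemma height_proj: "height (proj x) = 0" using height_add[of x "- height x"] by (simp add: proj_def)

lemma proj_add: "proj (x + t *\<^sub>R normal) = proj x" by (simp add: proj_def height_add algebra_simps)

lemma continuous_height [continuous_intros]:
  "continuous_on S f \<Longrightarrow> continuous_on S (\<lambda>x. height (f x))"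
  using continuous_on_compose2[OF affine_fn_continuous[OF affine_height, of UNIV]] by auto

lemma continuous_proj: "continuous_on S proj" unfolding proj_def by (intro continuous_intros)

lemma measurable_height [measurable]: "height \<in> borel_measurable borel"
  by (intro borel_measurable_continuous_onI continuous_intros)

lemma measurable_proj [measurable]: "proj \<in> borel_measurable borel"
  by (intro borel_measurable_continuous_onI continuous_proj)

lemma measurable_F [measurable]: "F \<in> sets borel" using compact_F by (simp add: borel_closed compact_imp_closed)

lemma affine_hull_F: "affine hull F = {x. height x = 0}"
proof -
  have "affine hull F = affine hull (V - {opp})" by (subst F_eq) (simp add: affine_hull_convex_hull)
  also have "\<dots> = {x. bc opp x = 0}"
  proof (intro set_eqI iffI CollectI)
    fix x assume "x \<in> affine hull (V - {opp})"
    thus "bc opp x = 0" using affine_fn_eq_on_affine_hull[OF affine_bc affine_fn_const, of "V - {opp}" opp 0 x]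
      by (auto simp: bc_vertex)
  next
    fix x assume "x \<in> {x. bc opp x = 0}"
    hence "(\<Sum>v\<in>V - {opp}. bc v x) = 1" "(\<Sum>v\<in>V - {opp}. bc v x *\<^sub>R v) = x"
      using sum_bc[of x] bc_repr[of x] sum.remove[OF finite_V opp_V, of "\<lambda>v. bc v x"]
        sum.remove[OF finite_V opp_V, of "\<lambda>v. bc v x *\<^sub>R v"] by auto
    thus "x \<in> affine hull (V - {opp})"
      using finite_V by (subst affine_hull_finite) (auto intro!: exI[of _ "\<lambda>v. bc v x"])
  qed
  finally show ?thesis using grad_nonzero by (simp add: height_def)
qed

lemma closest_point_facet: "closest_point (affine hull F) = proj"
proof
  fix x
  show "closest_point (affine hull F) x = proj x"
  proof (rule closest_point_unique[symmetric])
    show "convex (affine hull F)" "closed (affine hull F)" by (simp_all add: affine_imp_convex)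
    show "proj x \<in> affine hull F" by (simp add: affine_hull_F height_proj)
    show "\<forall>w\<in>affine hull F. dist x (proj x) \<le> dist x w"
    proof
      fix w assume "w \<in> affine hull F"
      hence "\<bar>height x\<bar> = \<bar>normal \<bullet> (x - w)\<bar>"
        using height_diff[of x w] by (simp add: affine_hull_F)
      also have "\<dots> \<le> norm (x - w)"
        using Cauchy_Schwarz_ineq2[of normal "x - w"] by (simp add: norm_normal)
      finally show "dist x (proj x) \<le> dist x w" by (simp add: dist_norm proj_def norm_normal)
    qed
  qed
qed

text \<open>Half-open, so that consecutive slabs fit together without overlap.\<close>

definition slab :: "real \<Rightarrow> real \<Rightarrow> 'a set" where "slab a b = {x. a \<le> height x \<and> height x < b}"

lemma measurable_slab [measurable]: "slab a b \<in> sets borel" unfolding slab_def by measurable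

lemma facet_measure_eq:
  "facet_measure F = distr (restrict_space lborel {x. proj x \<in> F \<and> \<bar>height x\<bar> \<le> 1/2}) borel proj"
  by (simp add: facet_measure_def closest_point_facet Let_def dist_norm proj_def norm_normal)

lemma bounded_over_facet: "\<exists>R. \<forall>x. proj x \<in> F \<and> \<bar>height x\<bar> \<le> c \<longrightarrow> x \<in> cball 0 R"
proof -
  obtain B where B: "\<And>x. x \<in> F \<Longrightarrow> norm x \<le> B"
    using compact_imp_bounded[OF compact_F] by (auto simp: bounded_iff)
  have "norm x \<le> B + c" if "proj x \<in> F" "\<bar>height x\<bar> \<le> c" for x
  proof -
    have "norm x = norm (proj x + height x *\<^sub>R normal)" by (simp add: proj_def)
    also have "\<dots> \<le> norm (proj x) + \<bar>height x\<bar>"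
      using norm_triangle_ineq[of "proj x" "height x *\<^sub>R normal"] by (simp add: norm_normal)
    finally show ?thesis using B[OF that(1)] that(2) by simp
  qed
  thus ?thesis by (intro exI[of _ "B + c"]) auto
qed

lemma measurable_fibre [measurable]: "{x. proj x \<in> F \<and> \<bar>height x\<bar> \<le> c} \<in> sets borel"
  by measurable

lemma sets_facet_measure [measurable_cong]: "sets (facet_measure F) = sets borel" by (simp add: facet_measure_eq)

lemma measurable_proj_restrict:
  "proj \<in> restrict_space lborel {x. proj x \<in> F \<and> \<bar>height x\<bar> \<le> 1/2} \<rightarrow>\<^sub>M borel"
  by (intro measurable_restrict_space1) simp

lemma finite_facet_measure: "finite_measure (facet_measure F)"
proof
  let ?S = "{x. proj x \<in> F \<and> \<bar>height x\<bar> \<le> 1/2}"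
  obtain R where "\<forall>x. proj x \<in> F \<and> \<bar>height x\<bar> \<le> 1/2 \<longrightarrow> x \<in> cball 0 R"
    using bounded_over_facet by blast
  hence R: "?S \<subseteq> cball 0 R" by blast
  have "emeasure (facet_measure F) (space (facet_measure F)) = emeasure lborel ?S" unfolding facet_measure_eq
    by (subst emeasure_distr[OF measurable_proj_restrict]) (auto simp: emeasure_restrict_space space_restrict_space)
  also have "\<dots> \<le> emeasure lborel (cball 0 R :: 'a set)" using R by (intro emeasure_mono) auto
  also have "\<dots> < \<infinity>" by (rule emeasure_lborel_cball_finite)
  finally show "emeasure (facet_measure F) (space (facet_measure F)) \<noteq> \<infinity>" by simp
qed

lemma AE_facet_measure: "AE x in facet_measure F. x \<in> F" unfolding facet_measure_eq
  by (subst AE_distr_iff[OF measurable_proj_restrict]) (auto simp: AE_restrict_space_iff)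

lemma integrable_facet:
  fixes h :: "'a \<Rightarrow> real"
  assumes "h \<in> borel_measurable borel" "\<And>x. x \<in> F \<Longrightarrow> \<bar>h x\<bar> \<le> B"
  shows "integrable (facet_measure F) h"
proof -
  interpret finite_measure "facet_measure F" by (rule finite_facet_measure)
  show ?thesis by (rule integrable_const_bound[where B = B])
      (use assms AE_facet_measure measurable_cong_sets[OF sets_facet_measure refl] in auto)
qed

lemma integrable_facet_continuous:
  fixes h :: "'a \<Rightarrow> real"
  assumes "continuous_on UNIV h"
  shows "integrable (facet_measure F) h"
proof -
  have "bounded (h ` F)" using assms compact_F by (intro compact_imp_bounded compact_continuous_image)
      (auto intro: continuous_on_subset)
  then obtain B where "\<And>x. x \<in> F \<Longrightarrow> \<bar>h x\<bar> \<le> B" by (auto simp: bounded_iff)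
  thus ?thesis using assms by (intro integrable_facet borel_measurable_continuous_onI)
qed

lemma integrable_slab:
  fixes h :: "'a \<Rightarrow> real"
  assumes [measurable]: "h \<in> borel_measurable borel" and B: "\<And>x. x \<in> F \<Longrightarrow> \<bar>h x\<bar> \<le> B"
  shows "integrable lborel (\<lambda>x. indicator (slab a b) x * (indicator F (proj x) * h (proj x)))"
proof -
  obtain R where R: "\<And>x. proj x \<in> F \<Longrightarrow> \<bar>height x\<bar> \<le> max \<bar>a\<bar> \<bar>b\<bar> \<Longrightarrow> x \<in> cball 0 R"
    using bounded_over_facet[of "max \<bar>a\<bar> \<bar>b\<bar>"] by auto
  show ?thesis
  proof (rule integrableI_bounded_set[where A = "cball 0 R" and B = "\<bar>B\<bar>"])
    show "emeasure lborel (cball (0::'a) R) < \<infinity>" by (rule emeasure_lborel_cball_finite)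
    show "AE x in lborel. x \<in> cball 0 R \<longrightarrow>
        norm (indicator (slab a b) x * (indicator F (proj x) * h (proj x))) \<le> \<bar>B\<bar>"
      using B by (intro AE_I2) (force simp: indicator_def abs_le_iff split: if_splits)
    show "AE x in lborel. x \<notin> cball 0 R \<longrightarrow>
        indicator (slab a b) x * (indicator F (proj x) * h (proj x)) = 0"
      using R by (intro AE_I2) (force simp: indicator_def slab_def)
  qed measurable
qed

lemma integral_facet_measure:
  fixes h :: "'a \<Rightarrow> real"
  assumes [measurable]: "h \<in> borel_measurable borel"
  shows "(\<integral>x. h x \<partial>facet_measure F) =
    (\<integral>x. indicator (slab (-1/2) (1/2)) x * (indicator F (proj x) * h (proj x)) \<partial>lborel)"
proof -
  let ?S = "{x. proj x \<in> F \<and> \<bar>height x\<bar> \<le> 1/2}"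
  \<comment> \<open>The closed slab in the definition of the measure and the half-open
    \<open>slab\<close> differ only in this hyperplane.\<close>
  have null: "AE x in lborel. height x \<noteq> 1/2"
  proof -
    have "{x. height x = 1/2} = {x. grad \<bullet> x = norm grad / 2 - bc opp 0}"
    proof (intro Collect_cong)
      fix x show "height x = 1/2 \<longleftrightarrow> grad \<bullet> x = norm grad / 2 - bc opp 0"
        using grad_nonzero bc_opp[of x] by (auto simp: height_def field_simps)
    qed
    hence "negligible {x. height x = 1/2}" using negligible_hyperplane[of grad] grad_nonzero by auto
    moreover have "{x. height x = 1/2} \<in> sets borel" by measurable
    ultimately have "{x. height x = 1/2} \<in> null_sets lborel"
      by (simp add: negligible_iff_null_sets null_sets_completion_iff)
    thus ?thesis by (rule AE_I') auto
  qed
  have "(\<integral>x. h x \<partial>facet_measure F) = (\<integral>x. h (proj x) \<partial>restrict_space lborel ?S)"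
    unfolding facet_measure_eq by (rule integral_distr[OF measurable_proj_restrict]) auto
  also have "\<dots> = (\<integral>x. indicator ?S x *\<^sub>R h (proj x) \<partial>lborel)"
    by (rule integral_restrict_space) auto
  also have "\<dots> = (\<integral>x. indicator (slab (-1/2) (1/2)) x * (indicator F (proj x) * h (proj x)) \<partial>lborel)"
    by (rule integral_cong_AE) (use null in \<open>auto simp: indicator_def slab_def elim!: eventually_mono\<close>)
  finally show ?thesis .
qed

lemma slab_translate:
  assumes [measurable]: "H \<in> borel_measurable borel" and H: "\<And>x t. H (x + t *\<^sub>R normal) = H x"
  shows "(\<integral>x. indicator (slab (a + t) (b + t)) x * H x \<partial>lborel) =
    (\<integral>x. indicator (slab a b) x * H x \<partial>lborel :: real)"
proof -
  have "(\<integral>x. indicator (slab (a + t) (b + t)) x * H x \<partial>lborel) =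
    (\<integral>x. indicator (slab (a + t) (b + t)) (t *\<^sub>R normal + x) * H (t *\<^sub>R normal + x) \<partial>lborel)"
    by (rule integral_lborel_translate[symmetric]) measurable
  also have "\<dots> = (\<integral>x. indicator (slab a b) x * H x \<partial>lborel)"
    by (intro Bochner_Integration.integral_cong refl)
      (auto simp: add.commute[of "t *\<^sub>R normal"] H indicator_def slab_def height_add)
  finally show ?thesis .
qed

lemma slab_multiple:
  assumes [measurable]: "H \<in> borel_measurable borel" and H: "\<And>x t. H (x + t *\<^sub>R normal) = H x"
    and int: "\<And>a b. integrable lborel (\<lambda>x. indicator (slab a b) x * H x)" and t: "t \<ge> 0"
  shows "(\<integral>x. indicator (slab 0 (real n * t)) x * H x \<partial>lborel) =
    real n * (\<integral>x. indicator (slab 0 t) x * H x \<partial>lborel :: real)"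
proof (induction n)
  case 0
  have "slab 0 0 = {}" by (auto simp: slab_def)
  thus ?case by simp
next
  case (Suc n)
  define c where "c = real n * t"
  have c: "c \<ge> 0" "real (Suc n) * t = t + c" using t by (auto simp: c_def algebra_simps)
  have "(\<integral>x. indicator (slab 0 (real (Suc n) * t)) x * H x \<partial>lborel) =
      (\<integral>x. indicator (slab 0 (real n * t)) x * H x
        + indicator (slab (0 + real n * t) (t + real n * t)) x * H x \<partial>lborel)"
    unfolding c(2) c_def[symmetric] using t c(1)
    by (intro Bochner_Integration.integral_cong refl) (auto simp: indicator_def slab_def)
  also have "\<dots> = (\<integral>x. indicator (slab 0 (real n * t)) x * H x \<partial>lborel)
        + (\<integral>x. indicator (slab (0 + real n * t) (t + real n * t)) x * H x \<partial>lborel)"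
    by (intro Bochner_Integration.integral_add int)
  finally show ?case using slab_translate[OF assms(1) H, of 0 "real n * t" t] Suc.IH by (simp add: algebra_simps)
qed

text \<open>\<open>H\<close> is constant along the normal, so slabs of equal thickness carry equal
  integrals. Counting slabs of thickness 1/N gives proportionality for rational ratios, and only
  those occur later.\<close>

lemma slab_ratio:
  assumes H: "H \<in> borel_measurable borel" "\<And>x t. H (x + t *\<^sub>R normal) = H x"
    and int: "\<And>a b. integrable lborel (\<lambda>x. indicator (slab a b) x * H x)" and N: "N > 0"
  shows "(\<integral>x. indicator (slab 0 (real p / real N)) x * H x \<partial>lborel) =
    real p / real N * (\<integral>x. indicator (slab 0 1) x * H x \<partial>lborel :: real)"
  using slab_multiple[OF H int, of "1 / real N" p] slab_multiple[OF H int, of "1 / real N" N] N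
  by (simp add: field_simps)

text \<open>The homothety about \<open>z\<close> with factor \<rho> takes the slab of thickness 1
  over \<open>F\<close> to the slab of thickness \<rho> over the shrunken facet. Volume contributes
  the exponent d, the homogeneity of \<open>h\<close> the exponent m.\<close>

lemma slab_homothety:
  fixes h :: "'a \<Rightarrow> real"
  assumes h: "continuous_on UNIV h" and z: "z \<in> V" "z \<noteq> opp" and \<rho>: "0 < \<rho>"
    and hom: "\<And>x. h (z + \<rho> *\<^sub>R (x - z)) = \<rho> ^ m * h x"
  shows "(\<integral>x. indicator (slab 0 \<rho>) x * (indicator F (z + (1/\<rho>) *\<^sub>R (proj x - z)) * h (proj x)) \<partial>lborel) =
    \<rho> ^ (DIM('a) + m) * (\<integral>x. indicator (slab 0 1) x * (indicator F (proj x) * h (proj x)) \<partial>lborel)"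
proof -
  have [measurable]: "h \<in> borel_measurable borel" using h by (rule borel_measurable_continuous_onI)
  let ?D = "\<lambda>x. (z - \<rho> *\<^sub>R z) + \<rho> *\<^sub>R x"
  have D: "?D x = z + \<rho> *\<^sub>R (x - z)" for x by (simp add: algebra_simps)
  have hz: "height z = 0" using z by (simp add: height_def bc_vertex)
  have height_D: "height (?D x) = \<rho> * height x" for x
    unfolding D affine_fn_segment[OF affine_height] by (simp add: hz)
  have proj_D: "proj (?D x) = z + \<rho> *\<^sub>R (proj x - z)" for x
    unfolding proj_def height_D by (simp add: algebra_simps)
  have "(\<integral>x. indicator (slab 0 \<rho>) x * (indicator F (z + (1/\<rho>) *\<^sub>R (proj x - z)) * h (proj x)) \<partial>lborel) =
    \<rho> ^ DIM('a) * (\<integral>x. indicator (slab 0 \<rho>) (?D x) *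
        (indicator F (z + (1/\<rho>) *\<^sub>R (proj (?D x) - z)) * h (proj (?D x))) \<partial>lborel)"
    by (rule integral_lborel_homothety[OF _ \<rho>]) measurable
  also have "(\<integral>x. indicator (slab 0 \<rho>) (?D x) *
        (indicator F (z + (1/\<rho>) *\<^sub>R (proj (?D x) - z)) * h (proj (?D x))) \<partial>lborel) =
     (\<integral>x. \<rho> ^ m * (indicator (slab 0 1) x * (indicator F (proj x) * h (proj x))) \<partial>lborel)"
    unfolding proj_D hom using \<rho> by (intro Bochner_Integration.integral_cong refl)
      (auto simp: indicator_def slab_def height_D zero_le_mult_iff)
  finally show ?thesis by (simp add: power_add)
qed

text \<open>Both \<open>1 - bc z\<close> and the other coordinates are homogeneous of degree 1 about
  \<open>z\<close>, so shrinking \<open>F\<close> towards \<open>z\<close> only lowers the bound on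
  \<open>1 - bc z\<close> from 1 to \<rho>.\<close>

lemma shrunk_facet:
  assumes z: "z \<in> V" "z \<noteq> opp" and \<rho>: "0 < \<rho>" "\<rho> \<le> 1"
  shows "z + (1/\<rho>) *\<^sub>R (y - z) \<in> F \<longleftrightarrow> y \<in> F \<and> 1 - bc z y \<le> \<rho>"
proof -
  have e: "bc v (z + (1/\<rho>) *\<^sub>R (y - z)) = (if v = z then 1 - (1 - bc z y) / \<rho> else bc v y / \<rho>)" for v
    unfolding affine_fn_segment[OF affine_bc] using \<rho> by (simp add: bc_vertex z(1) field_simps)
  have "z + (1/\<rho>) *\<^sub>R (y - z) \<in> F \<longleftrightarrow>
      (\<forall>v\<in>V - {z}. 0 \<le> bc v y) \<and> 1 - bc z y \<le> \<rho> \<and> bc opp y = 0"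
    unfolding mem_facet_iff[OF facet] mem_K_iff e using z \<rho>
    by (auto simp: zero_le_divide_iff divide_le_eq split: if_splits)
  also have "\<dots> \<longleftrightarrow> y \<in> F \<and> 1 - bc z y \<le> \<rho>"
    unfolding mem_facet_iff[OF facet] mem_K_iff using z \<rho> by force
  finally show ?thesis .
qed

lemma facet_integral_slab01:
  fixes h :: "'a \<Rightarrow> real"
  assumes [measurable]: "h \<in> borel_measurable borel"
  shows "(\<integral>x. h x \<partial>facet_measure F) =
    (\<integral>x. indicator (slab 0 1) x * (indicator F (proj x) * h (proj x)) \<partial>lborel)"
  using slab_translate[of "\<lambda>x. indicator F (proj x) * h (proj x)" "-1/2" "1/2" "1/2"]
  by (simp add: integral_facet_measure proj_add)

text \<open>The homothety also shrinks the thickness of the slab; dividing this factor \<rho> out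
  turns the volume exponent d into the surface exponent d - 1. The scale is rational because of
  \<open>slab_ratio\<close>.\<close>

lemma facet_integral_homothety:
  fixes h :: "'a \<Rightarrow> real"
  assumes h: "continuous_on UNIV h" and z: "z \<in> V" "z \<noteq> opp"
    and \<rho>: "\<rho> = real p / real N" "0 < p" "p \<le> N"
    and hom: "\<And>x. h (z + \<rho> *\<^sub>R (x - z)) = \<rho> ^ m * h x"
  shows "(\<integral>x. indicator {x. 1 - bc z x \<le> \<rho>} x * h x \<partial>facet_measure F) =
    \<rho> ^ (DIM('a) + m - 1) * (\<integral>x. h x \<partial>facet_measure F)"
proof -
  have [measurable]: "h \<in> borel_measurable borel" "bc z \<in> borel_measurable borel"
    using h by (auto intro!: borel_measurable_continuous_onI continuous_intros)
  have \<rho>0: "0 < \<rho>" "\<rho> \<le> 1" using \<rho> by auto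
  let ?g = "\<lambda>x. indicator {x. 1 - bc z x \<le> \<rho>} x * h x"
  let ?H = "\<lambda>x. indicator F (proj x) * ?g (proj x)"
  have gm: "?g \<in> borel_measurable borel" by measurable
  have "bounded (h ` F)" using h compact_F by (intro compact_imp_bounded compact_continuous_image)
      (auto intro: continuous_on_subset)
  then obtain B where B: "\<And>x. x \<in> F \<Longrightarrow> \<bar>h x\<bar> \<le> B" by (auto simp: bounded_iff)
  have gB: "\<bar>?g x\<bar> \<le> \<bar>B\<bar>" if "x \<in> F" for x
    using B[OF that] by (auto simp: indicator_def)
  have "\<rho> * (\<integral>x. ?g x \<partial>facet_measure F) = \<rho> * (\<integral>x. indicator (slab 0 1) x * ?H x \<partial>lborel)"
    by (subst facet_integral_slab01[OF gm]) simp
  also have "\<dots> = (\<integral>x. indicator (slab 0 \<rho>) x * ?H x \<partial>lborel)" unfolding \<rho>(1)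
    by (rule slab_ratio[symmetric])
      (use \<rho> integrable_slab[OF gm gB, unfolded \<rho>(1)] in \<open>auto simp: proj_add\<close>)
  also have "\<dots> = (\<integral>x. indicator (slab 0 \<rho>) x *
      (indicator F (z + (1/\<rho>) *\<^sub>R (proj x - z)) * h (proj x)) \<partial>lborel)"
    using shrunk_facet[OF z \<rho>0] by (intro Bochner_Integration.integral_cong refl) (auto simp: indicator_def)
  also have "\<dots> = \<rho> ^ (DIM('a) + m) * (\<integral>x. h x \<partial>facet_measure F)"
    unfolding slab_homothety[OF h z \<rho>0(1) hom] by (subst facet_integral_slab01) auto
  also have "\<rho> ^ (DIM('a) + m) = \<rho> * \<rho> ^ (DIM('a) + m - 1)"
    using DIM_positive[where 'a='a] by (simp flip: power_Suc)
  finally show ?thesis using \<rho>0 by simp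
qed

text \<open>Comparing the shells \<open>\<rho> < 1 - \<lambda>\<^sub>z \<le> 1\<close> as \<open>\<rho> \<rightarrow> 1\<close> replaces Fubini's theorem in
  polar coordinates about \<open>z\<close>.\<close>

lemma facet_integral_moment:
  fixes h :: "'a \<Rightarrow> real"
  assumes h: "continuous_on UNIV h" and z: "z \<in> V" "z \<noteq> opp"
    and hom: "\<And>\<rho> x. 0 < \<rho> \<Longrightarrow> h (z + \<rho> *\<^sub>R (x - z)) = \<rho> ^ m * h x"
  shows "real (DIM('a) + m - 1 + j) * (\<integral>x. (1 - bc z x) ^ j * h x \<partial>facet_measure F) =
    real (DIM('a) + m - 1) * (\<integral>x. h x \<partial>facet_measure F)"
proof -
  let ?\<mu> = "facet_measure F"
  define b where "b = DIM('a) + m - 1"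
  \<comment> \<open>Rational scales tending to 1 from below, as the homothety formula
    requires.\<close>
  define \<rho> where "\<rho> n = real (Suc n) / real (Suc (Suc n))" for n
  have \<rho>: "0 < \<rho> n" "\<rho> n < 1" for n by (simp_all add: \<rho>_def)
  have [measurable]: "h \<in> borel_measurable borel" "bc z \<in> borel_measurable borel"
    using h by (auto intro!: borel_measurable_continuous_onI continuous_intros)
  have cj: "continuous_on UNIV (\<lambda>x. (1 - bc z x) ^ j * h x)" using h by (intro continuous_intros)
  have ca: "continuous_on UNIV (\<lambda>x. \<bar>h x\<bar>)" using h by (intro continuous_intros)
  have homj: "(1 - bc z (z + r *\<^sub>R (x - z))) ^ j * h (z + r *\<^sub>R (x - z)) =
      r ^ (m + j) * ((1 - bc z x) ^ j * h x)" if "r > 0" for r x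
  proof -
    have "1 - bc z (z + r *\<^sub>R (x - z)) = r * (1 - bc z x)"
      unfolding affine_fn_segment[OF affine_bc] by (simp add: bc_vertex z algebra_simps)
    thus ?thesis by (simp add: hom[OF that] power_add power_mult_distrib mult_ac)
  qed
  have homa: "\<bar>h (z + r *\<^sub>R (x - z))\<bar> = r ^ m * \<bar>h x\<bar>" if "r > 0" for r x
    using that by (simp add: hom abs_mult)
  define G G0 A where "G = (\<integral>x. (1 - bc z x) ^ j * h x \<partial>?\<mu>)"
    and "G0 = (\<integral>x. h x \<partial>?\<mu>)" and "A = (\<integral>x. \<bar>h x\<bar> \<partial>?\<mu>)"
  have shell: "(\<integral>x. indicator {x. \<rho> n < 1 - bc z x} x * f x \<partial>?\<mu>) =
      (1 - \<rho> n ^ (DIM('a) + i - 1)) * (\<integral>x. f x \<partial>?\<mu>)"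
      "integrable ?\<mu> (\<lambda>x. indicator {x. \<rho> n < 1 - bc z x} x * f x)"
    if f: "continuous_on UNIV f" "\<And>r x. 0 < r \<Longrightarrow> f (z + r *\<^sub>R (x - z)) = r ^ i * f x"
    for f :: "'a \<Rightarrow> real" and i n
  proof -
    have [measurable]: "f \<in> borel_measurable borel" using f(1) by (rule borel_measurable_continuous_onI)
    have "bounded (f ` F)" using f(1) compact_F by (intro compact_imp_bounded compact_continuous_image)
        (auto intro: continuous_on_subset)
    then obtain B where B: "\<And>x. x \<in> F \<Longrightarrow> \<bar>f x\<bar> \<le> B"
      by (auto simp: bounded_iff)
    have i1: "integrable ?\<mu> (\<lambda>x. indicator {x. 1 - bc z x \<le> \<rho> n} x * f x)"
      by (rule integrable_facet[where B = "\<bar>B\<bar>"]) (measurable, use B in \<open>force simp: indicator_def\<close>)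
    show i2: "integrable ?\<mu> (\<lambda>x. indicator {x. \<rho> n < 1 - bc z x} x * f x)"
      by (rule integrable_facet[where B = "\<bar>B\<bar>"]) (measurable, use B in \<open>force simp: indicator_def\<close>)
    have "(\<integral>x. f x \<partial>?\<mu>) = (\<integral>x. indicator {x. 1 - bc z x \<le> \<rho> n} x * f x
        + indicator {x. \<rho> n < 1 - bc z x} x * f x \<partial>?\<mu>)"
      by (intro Bochner_Integration.integral_cong refl) (auto simp: indicator_def)
    also have "\<dots> = (\<integral>x. indicator {x. 1 - bc z x \<le> \<rho> n} x * f x \<partial>?\<mu>)
        + (\<integral>x. indicator {x. \<rho> n < 1 - bc z x} x * f x \<partial>?\<mu>)"
      by (rule Bochner_Integration.integral_add[OF i1 i2])
    also have "(\<integral>x. indicator {x. 1 - bc z x \<le> \<rho> n} x * f x \<partial>?\<mu>) =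
        \<rho> n ^ (DIM('a) + i - 1) * (\<integral>x. f x \<partial>?\<mu>)"
      by (rule facet_integral_homothety[OF f(1) z \<rho>_def]) (use f(2) \<rho> in auto)
    finally show "(\<integral>x. indicator {x. \<rho> n < 1 - bc z x} x * f x \<partial>?\<mu>) =
      (1 - \<rho> n ^ (DIM('a) + i - 1)) * (\<integral>x. f x \<partial>?\<mu>)"
      unfolding left_diff_distrib by linarith
  qed
  \<comment> \<open>On the shell the factor \<open>(1 - bc z x) ^ j\<close> differs from 1 by at
    most \<open>1 - \<rho> n ^ j\<close>, and the shell itself carries only the share
    \<open>1 - \<rho> n ^ b\<close> of the integral of the absolute value. The error is thus of
    second order in the thickness of the shell.\<close>
  have bound: "\<bar>(1 - \<rho> n ^ (b + j)) * G - (1 - \<rho> n ^ b) * G0\<bar> \<le> (1 - \<rho> n ^ j) * ((1 - \<rho> n ^ b) * A)" for n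
  proof -
    have e: "DIM('a) + (m + j) - 1 = b + j" unfolding b_def using DIM_positive[where 'a='a] by linarith
    let ?I = "\<lambda>x. indicator {x. \<rho> n < 1 - bc z x} x :: real"
    have diff: "(1 - \<rho> n ^ (b + j)) * G - (1 - \<rho> n ^ b) * G0 =
        (\<integral>x. ?I x * ((1 - bc z x) ^ j * h x) - ?I x * h x \<partial>?\<mu>)"
      using shell[OF cj homj, of n, unfolded e, folded G_def] shell[OF h hom, of n, folded b_def G0_def]
      by (subst Bochner_Integration.integral_diff) simp_all
    have "\<bar>(1 - \<rho> n ^ (b + j)) * G - (1 - \<rho> n ^ b) * G0\<bar> \<le>
        (\<integral>x. \<bar>?I x * ((1 - bc z x) ^ j * h x) - ?I x * h x\<bar> \<partial>?\<mu>)"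
      unfolding diff by (rule integral_abs_bound)
    also have "\<dots> \<le> (\<integral>x. (1 - \<rho> n ^ j) * (?I x * \<bar>h x\<bar>) \<partial>?\<mu>)"
    proof (rule integral_mono_AE)
      show "integrable ?\<mu> (\<lambda>x. \<bar>?I x * ((1 - bc z x) ^ j * h x) - ?I x * h x\<bar>)"
        using shell(2)[OF cj homj, of n] shell(2)[OF h hom, of n] by auto
      show "integrable ?\<mu> (\<lambda>x. (1 - \<rho> n ^ j) * (?I x * \<bar>h x\<bar>))"
        using shell(2)[OF ca homa, of n] by auto
      show "AE x in ?\<mu>. \<bar>?I x * ((1 - bc z x) ^ j * h x) - ?I x * h x\<bar> \<le> (1 - \<rho> n ^ j) * (?I x * \<bar>h x\<bar>)"
        using AE_facet_measure
      proof (rule eventually_mono)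
        fix x assume "x \<in> F"
        hence "x \<in> K" using mem_facet_iff[OF facet] by blast
        hence "0 \<le> 1 - bc z x" "1 - bc z x \<le> 1" using bc_le_1 bc_nonneg by simp_all
        moreover have "\<rho> n ^ j \<le> (1 - bc z x) ^ j" if "\<rho> n < 1 - bc z x"
          using that \<rho>[of n] by (intro power_mono) auto
        ultimately have "\<bar>(1 - bc z x) ^ j - 1\<bar> \<le> 1 - \<rho> n ^ j" if "\<rho> n < 1 - bc z x"
          using that power_le_one[of "1 - bc z x" j] by (simp add: abs_if)
        hence "\<bar>(1 - bc z x) ^ j - 1\<bar> * \<bar>h x\<bar> \<le> (1 - \<rho> n ^ j) * \<bar>h x\<bar>" if "\<rho> n < 1 - bc z x"
          using that by (intro mult_right_mono) auto
        thus "\<bar>?I x * ((1 - bc z x) ^ j * h x) - ?I x * h x\<bar> \<le> (1 - \<rho> n ^ j) * (?I x * \<bar>h x\<bar>)"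
          by (auto simp: indicator_def abs_mult[symmetric] left_diff_distrib)
      qed
    qed
    also have "\<dots> = (1 - \<rho> n ^ j) * ((1 - \<rho> n ^ b) * A)"
      using shell(1)[OF ca homa, of n] by (simp add: A_def b_def)
    finally show ?thesis .
  qed
  \<comment> \<open>The factor \<open>Suc (Suc n)\<close> is 1/(1 - \<rho> n), so the limit is the
    derivative of the i-th power at 1.\<close>
  have lim: "(\<lambda>n. real (Suc (Suc n)) * (1 - \<rho> n ^ i)) \<longlonglongrightarrow> real i" for i
  proof -
    have e: "real (Suc (Suc n)) * (1 - \<rho> n ^ i) = (\<Sum>k<i. \<rho> n ^ k)" for n
    proof -
      have "1 - \<rho> n ^ i = (1 - \<rho> n) * (\<Sum>k<i. \<rho> n ^ k)" by (rule one_diff_power_eq)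
      moreover have "real (Suc (Suc n)) * (1 - \<rho> n) = 1" by (simp add: \<rho>_def field_simps)
      ultimately show ?thesis by (metis mult.assoc mult_1)
    qed
    have "\<rho> \<longlonglongrightarrow> 1"
      unfolding \<rho>_def[abs_def] using LIMSEQ_Suc[OF LIMSEQ_n_over_Suc_n[where 'a=real]] by simp
    hence "(\<lambda>n. \<Sum>k<i. \<rho> n ^ k) \<longlonglongrightarrow> (\<Sum>k<i. 1 ^ k)"
      by (intro tendsto_sum tendsto_power)
    thus ?thesis unfolding e by simp
  qed
  define N where "N n = real (Suc (Suc n))" for n
  define X where "X n = (1 - \<rho> n ^ (b + j)) * G - (1 - \<rho> n ^ b) * G0" for n
  have "(\<lambda>n. N n * (1 - \<rho> n ^ (b + j)) * G - N n * (1 - \<rho> n ^ b) * G0) \<longlonglongrightarrow> real (b + j) * G - real b * G0"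
    unfolding N_def by (intro tendsto_intros lim)
  moreover have "N n * (1 - \<rho> n ^ (b + j)) * G - N n * (1 - \<rho> n ^ b) * G0 = N n * X n" for n
    by (simp add: X_def algebra_simps)
  ultimately have "(\<lambda>n. N n * X n) \<longlonglongrightarrow> real (b + j) * G - real b * G0" by (simp only:)
  \<comment> \<open>A product of two first-order quantities, magnified only once, still tends to
    zero.\<close>
  moreover have "(\<lambda>n. N n * X n) \<longlonglongrightarrow> 0"
  proof (rule Lim_null_comparison)
    show "(\<lambda>n. (1 / N n) * ((N n * (1 - \<rho> n ^ j)) * ((N n * (1 - \<rho> n ^ b)) * A))) \<longlonglongrightarrow> 0"
      unfolding N_def using tendsto_mult[OF LIMSEQ_Suc[OF LIMSEQ_Suc[OF lim_1_over_n]]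
          tendsto_mult[OF lim[of j] tendsto_mult[OF lim[of b] tendsto_const[of A]]]] by simp
    have N: "N n > 0" for n by (simp add: N_def)
    have "norm (N n * X n) \<le> N n * ((1 - \<rho> n ^ j) * ((1 - \<rho> n ^ b) * A))" for n
      using mult_left_mono[OF bound[of n, folded X_def], of "N n"] N[of n] by (simp add: abs_mult)
    moreover have "(1 / N n) * ((N n * (1 - \<rho> n ^ j)) * ((N n * (1 - \<rho> n ^ b)) * A)) =
        N n * ((1 - \<rho> n ^ j) * ((1 - \<rho> n ^ b) * A))" for n
      using N[of n] by simp
    ultimately show "\<forall>\<^sub>F n in sequentially. norm (N n * X n) \<le>
        (1 / N n) * ((N n * (1 - \<rho> n ^ j)) * ((N n * (1 - \<rho> n ^ b)) * A))"
      by (simp only: eventually_True)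
  qed
  ultimately have "real (b + j) * G - real b * G0 = 0" by (rule LIMSEQ_unique)
  thus ?thesis by (simp add: G_def G0_def b_def)
qed

end

section \<open>Graded spans and the orthogonality of Jacobi polynomials on facets\<close>

lemma span_mult_graded:
  fixes f g :: "'a \<Rightarrow> real"
  assumes mult: "\<And>f g. f \<in> A \<Longrightarrow> g \<in> B \<Longrightarrow> (\<lambda>x. f x * g x) \<in> C"
    and f: "f \<in> span A" and g: "g \<in> span B"
  shows "(\<lambda>x. f x * g x) \<in> span C" using f
proof (rule span_induct)
  show "subspace {f. (\<lambda>x. f x * g x) \<in> span C}"
  proof (rule subspaceI; unfold mem_Collect_eq)
    show "(\<lambda>x. (0::'a \<Rightarrow> real) x * g x) \<in> span C"
      using span_zero[of C] by (simp add: zero_fun_def)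
  next
    fix u v assume "(\<lambda>x. u x * g x) \<in> span C" "(\<lambda>x. v x * g x) \<in> span C"
    from span_add[OF this] show "(\<lambda>x. (u + v) x * g x) \<in> span C"
      by (simp add: plus_fun_def distrib_right)
  next
    fix c u assume "(\<lambda>x. u x * g x) \<in> span C"
    from span_scale[OF this, of c] show "(\<lambda>x. (c *\<^sub>R u) x * g x) \<in> span C"
      by (simp add: scaleR_fun_def mult_ac)
  qed
next
  fix f assume f: "f \<in> A"
  show "(\<lambda>x. f x * g x) \<in> span C" using g
  proof (rule span_induct)
    show "subspace {g. (\<lambda>x. f x * g x) \<in> span C}"
    proof (rule subspaceI; unfold mem_Collect_eq)
      show "(\<lambda>x. f x * (0::'a \<Rightarrow> real) x) \<in> span C"
        using span_zero[of C] by (simp add: zero_fun_def)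
    next
      fix u v assume "(\<lambda>x. f x * u x) \<in> span C" "(\<lambda>x. f x * v x) \<in> span C"
      from span_add[OF this] show "(\<lambda>x. f x * (u + v) x) \<in> span C"
        by (simp add: plus_fun_def distrib_left)
    next
      fix c u assume "(\<lambda>x. f x * u x) \<in> span C"
      from span_scale[OF this, of c] show "(\<lambda>x. f x * (c *\<^sub>R u) x) \<in> span C"
        by (simp add: scaleR_fun_def mult_ac)
    qed
  qed (use f mult in \<open>auto intro: span_base\<close>)
qed

text \<open>Polynomials arise from 1 and the coordinates by multiplication, so any filtered family
  closed under products spans them once it captures these. It is applied to functions homogeneous
  about a vertex and to monomials in barycentric coordinates.\<close>

lemma poly_space_graded:
  fixes A :: "nat \<Rightarrow> ('a::euclidean_space \<Rightarrow> real) set"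
  assumes mono: "\<And>a b. a \<le> b \<Longrightarrow> A a \<subseteq> A b"
    and one: "(\<lambda>x. 1) \<in> span (A 0)"
    and lin: "\<And>b. b \<in> Basis \<Longrightarrow> (\<lambda>x. x \<bullet> b) \<in> span (A 1)"
    and mult: "\<And>a b f g. f \<in> A a \<Longrightarrow> g \<in> A b \<Longrightarrow> (\<lambda>x. f x * g x) \<in> A (a + b)"
  shows "poly_space n \<subseteq> span (A n)"
proof -
  have pw: "(\<lambda>x. (x \<bullet> b) ^ m) \<in> span (A m)" if "b \<in> Basis" for b m
  proof (induction m)
    case (Suc m)
    from span_mult_graded[where A = "A 1" and B = "A m" and C = "A (1 + m)", OF mult lin[OF that] this] show ?case
      by simp
  qed (use one in simp)
  have mon: "(\<lambda>x. \<Prod>b\<in>B. (x \<bullet> b) ^ m b) \<in> span (A (\<Sum>b\<in>B. m b))"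
    if "finite B" "B \<subseteq> Basis" for B and m :: "'a \<Rightarrow> nat" using that
  proof (induction B)
    case (insert b B)
    thus ?case
      using span_mult_graded[where C = "A (m b + (\<Sum>b\<in>B. m b))", OF mult pw[of b "m b"] insert.IH] by simp
  qed (use one in simp)
  have "(\<lambda>x. \<Prod>b\<in>Basis. (x \<bullet> b) ^ m b) \<in> span (A n)" if "(\<Sum>b\<in>Basis. m b) \<le> n" for m
    using mon[of Basis m] span_mono[OF mono[OF that]] by auto
  thus ?thesis unfolding poly_space_def by (intro span_minimal subspace_span) auto
qed

definition homogeneous_about :: "'a::euclidean_space \<Rightarrow> nat \<Rightarrow> ('a \<Rightarrow> real) \<Rightarrow> bool" where
  "homogeneous_about z m h \<longleftrightarrow> continuous_on UNIV h \<and>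
     (\<forall>\<rho> x. 0 < \<rho> \<longrightarrow> h (z + \<rho> *\<^sub>R (x - z)) = \<rho> ^ m * h x)"

lemma homogeneous_about_mult:
  "homogeneous_about z m f \<Longrightarrow> homogeneous_about z n g \<Longrightarrow> homogeneous_about z (m + n) (\<lambda>x. f x * g x)"
  by (auto simp: homogeneous_about_def power_add intro!: continuous_intros)

lemma homogeneous_about_one: "homogeneous_about z 0 (\<lambda>x. 1)" by (simp add: homogeneous_about_def)

lemma homogeneous_about_power:
  "homogeneous_about z m f \<Longrightarrow> homogeneous_about z (m * n) (\<lambda>x. f x ^ n)"
  by (auto simp: homogeneous_about_def power_mult power_mult_distrib intro!: continuous_intros)

lemma homogeneous_about_affine:
  assumes "affine_fn l" "l z = 0"
  shows "homogeneous_about z 1 l"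
  using affine_fn_segment[OF assms(1), of z] affine_fn_continuous[OF assms(1), of UNIV] assms(2)
  by (simp add: homogeneous_about_def)

text \<open>A coordinate is the sum of a function homogeneous of degree 1 about \<open>z\<close> and
  a constant, which is homogeneous of degree 0.\<close>

lemma poly_space_homogeneous_parts:
  "poly_space n \<subseteq> span {h. \<exists>m\<le>n. homogeneous_about z m h}"
proof (rule poly_space_graded)
  show "(\<lambda>x. 1) \<in> span {h. \<exists>m\<le>0. homogeneous_about z m h}"
    by (rule span_base) (simp add: homogeneous_about_one)
next
  fix b :: 'a
  have a: "affine_fn (\<lambda>x. x \<bullet> b - z \<bullet> b)" by (intro affine_fn_diff) auto
  have "(\<lambda>x. x \<bullet> b - z \<bullet> b) \<in> span {h. \<exists>m\<le>1. homogeneous_about z m h}"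
    using homogeneous_about_affine[OF a] by (intro span_base) auto
  moreover have "(\<lambda>x. 1) \<in> span {h. \<exists>m\<le>1. homogeneous_about z m h}"
    by (rule span_base) (auto intro!: exI[of _ 0] homogeneous_about_one)
  ultimately show "(\<lambda>x. x \<bullet> b) \<in> span {h. \<exists>m\<le>1. homogeneous_about z m h}"
    using span_add[OF _ span_scale[of "\<lambda>x. 1" _ "z \<bullet> b"]]
    by (fastforce simp: plus_fun_def scaleR_fun_def)
next
  fix a b and f g :: "'a \<Rightarrow> real"
  assume "f \<in> {h. \<exists>m\<le>a. homogeneous_about z m h}" "g \<in> {h. \<exists>m\<le>b. homogeneous_about z m h}"
  thus "(\<lambda>x. f x * g x) \<in> {h. \<exists>m\<le>a + b. homogeneous_about z m h}"
    using homogeneous_about_mult[of z _ f _ g] by (blast intro: add_mono)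
qed (blast intro: order_trans)

context simplex_facet
begin

lemma facet_integral_linear:
  fixes f g :: "'a \<Rightarrow> real"
  assumes "continuous_on UNIV f" "continuous_on UNIV g"
  shows "(\<integral>x. f x + g x \<partial>facet_measure F) = (\<integral>x. f x \<partial>facet_measure F) + (\<integral>x. g x \<partial>facet_measure F)"
    "(\<integral>x. f x - g x \<partial>facet_measure F) = (\<integral>x. f x \<partial>facet_measure F) - (\<integral>x. g x \<partial>facet_measure F)"
  using assms integrable_facet_continuous by auto

lemma facet_integral_sum:
  fixes f :: "'i \<Rightarrow> 'a \<Rightarrow> real"
  assumes "\<And>i. i \<in> I \<Longrightarrow> continuous_on UNIV (f i)"
  shows "(\<integral>x. (\<Sum>i\<in>I. f i x) \<partial>facet_measure F) = (\<Sum>i\<in>I. \<integral>x. f i x \<partial>facet_measure F)"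
  using assms integrable_facet_continuous by (intro Bochner_Integration.integral_sum) auto

lemma facet_integral_cong:
  fixes f g :: "'a \<Rightarrow> real"
  assumes "continuous_on UNIV f" "continuous_on UNIV g" "\<And>x. x \<in> F \<Longrightarrow> f x = g x"
  shows "(\<integral>x. f x \<partial>facet_measure F) = (\<integral>x. g x \<partial>facet_measure F)"
proof (rule integral_cong_AE)
  show "AE x in facet_measure F. f x = g x" using AE_facet_measure by (rule eventually_mono) (use assms in auto)
qed (use assms measurable_cong_sets[OF sets_facet_measure refl] borel_measurable_continuous_onI in auto)

text \<open>With b = d + m - 1 the moment formula replaces (1 - lambda_z)^j by the factor b/(b+j),
  that is, b times the integral of r^(b-1+j) over [0,1]. The facet integral is therefore a multiple
  of a one-dimensional one, and with t = 1 - r this is the orthogonality of the Jacobi polynomial to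
  (1-t)^m under the weight (1-t)^(d-2).\<close>

lemma jacobi_orthogonal_homogeneous:
  assumes d: "DIM('a) \<ge> 2" and z: "z \<in> V" "z \<noteq> opp" and h: "homogeneous_about z m h" and m: "m < k"
  shows "(\<integral>x. poly (shifted_jacobi k (DIM('a) - 2)) (bc z x) * h x \<partial>facet_measure F) = 0"
proof -
  let ?f = "shifted_jacobi k (DIM('a) - 2)"
  define g where "g = pcompose ?f [:1, -1:]"
  define b where "b = DIM('a) + m - 1"
  have b: "b > 0" "b - 1 = DIM('a) - 2 + m" using d by (auto simp: b_def)
  have hc: "continuous_on UNIV h" using h by (simp add: homogeneous_about_def)
  let ?G = "\<integral>x. h x \<partial>facet_measure F"
  have "poly ?f (bc z x) = poly g (1 - bc z x)" for x by (simp add: g_def poly_pcompose)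
  hence "(\<integral>x. poly ?f (bc z x) * h x \<partial>facet_measure F) =
      (\<integral>x. (\<Sum>j\<le>degree g. coeff g j * ((1 - bc z x) ^ j * h x)) \<partial>facet_measure F)"
    by (simp add: poly_altdef[of g] sum_distrib_right mult.assoc)
  also have "\<dots> = (\<Sum>j\<le>degree g. \<integral>x. coeff g j * ((1 - bc z x) ^ j * h x) \<partial>facet_measure F)"
    using hc by (intro facet_integral_sum continuous_intros)
  also have "\<dots> = (\<Sum>j\<le>degree g. coeff g j * (1 / real (b + j)) * (real b * ?G))"
  proof (intro sum.cong refl)
    fix j
    have "real (b + j) * (\<integral>x. (1 - bc z x) ^ j * h x \<partial>facet_measure F) = real b * ?G"
      using facet_integral_moment[OF hc z, of m j] h by (simp add: homogeneous_about_def b_def)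
    hence "(\<integral>x. (1 - bc z x) ^ j * h x \<partial>facet_measure F) = 1 / real (b + j) * (real b * ?G)"
      using b by (simp add: field_simps)
    thus "(\<integral>x. coeff g j * ((1 - bc z x) ^ j * h x) \<partial>facet_measure F) =
        coeff g j * (1 / real (b + j)) * (real b * ?G)"
      by simp
  qed
  also have "\<dots> = (\<Sum>j\<le>degree g. coeff g j * (1 / real (b + j))) * (real b * ?G)"
    by (simp add: sum_distrib_right)
  also have "(\<Sum>j\<le>degree g. coeff g j * (1 / real (b + j))) = 0"
  proof -
    have pw: "((\<lambda>r. r ^ (b - 1 + j)) has_integral 1 / real (b + j)) {0..1::real}" for j
      using has_integral_beta[of "b - 1 + j" 0] b(1) by (simp add: fact_reduce)
    have "((\<lambda>r. \<Sum>j\<le>degree g. coeff g j * r ^ (b - 1 + j)) has_integral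
        (\<Sum>j\<le>degree g. coeff g j * (1 / real (b + j)))) {0..1}"
      by (intro has_integral_sum has_integral_mult_right pw) simp
    moreover have "(\<Sum>j\<le>degree g. coeff g j * r ^ (b - 1 + j)) = r ^ (b - 1) * poly g r" for r
      by (simp add: poly_altdef sum_distrib_left power_add mult_ac)
    ultimately have I1: "((\<lambda>r. r ^ (b - 1) * poly g r) has_integral
        (\<Sum>j\<le>degree g. coeff g j * (1 / real (b + j)))) {0..1}"
      by simp
    have "degree ([:1, -1:] ^ m :: real poly) < k" using m by (simp add: degree_power_eq)
    from shifted_jacobi_orthogonal[OF this, of "DIM('a) - 2"]
    have "((\<lambda>t. (1 - t) ^ (b - 1) * poly ?f t) has_integral 0) (cbox 0 1)"
      unfolding b(2) by (simp add: power_add mult_ac)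
    from has_integral_affinity[OF this, of "-1" 1]
    have "((\<lambda>r. r ^ (b - 1) * poly ?f (1 - r)) has_integral 0) ((\<lambda>x. 1 - x) ` {0..1})" by simp
    hence I2: "((\<lambda>r. r ^ (b - 1) * poly g r) has_integral 0) {0..1}" by (simp add: g_def poly_pcompose)
    show ?thesis using has_integral_unique[OF I1 I2] .
  qed
  finally show ?thesis by simp
qed

theorem jacobi_orthogonal_facet:
  assumes d: "DIM('a) \<ge> 2" and z: "z \<in> V" "z \<noteq> opp" and q: "q \<in> poly_space n" and n: "n < k"
  shows "(\<integral>x. poly (shifted_jacobi k (DIM('a) - 2)) (bc z x) * q x \<partial>facet_measure F) = 0"
proof -
  let ?f = "shifted_jacobi k (DIM('a) - 2)"
  have cf: "continuous_on UNIV (\<lambda>x. poly ?f (bc z x))" by (intro continuous_intros)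
  let ?P = "\<lambda>q. continuous_on UNIV q \<and> (\<integral>x. poly ?f (bc z x) * q x \<partial>facet_measure F) = 0"
  have "q \<in> span {h. \<exists>m\<le>n. homogeneous_about z m h}" using q poly_space_homogeneous_parts by blast
  hence "?P q"
  proof (rule span_induct)
    show "subspace {q. ?P q}"
    proof (rule subspaceI; unfold mem_Collect_eq)
      show "?P 0" by (simp add: zero_fun_def)
    next
      fix u v assume "?P u" "?P v"
      thus "?P (u + v)"
        using facet_integral_linear(1)[OF continuous_on_mult[OF cf, of u] continuous_on_mult[OF cf, of v]]
        by (auto simp: plus_fun_def distrib_left intro!: continuous_intros)
    next
      fix c u assume u: "?P u"
      have "(\<integral>x. poly ?f (bc z x) * (c * u x) \<partial>facet_measure F) =
          (\<integral>x. c * (poly ?f (bc z x) * u x) \<partial>facet_measure F)"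
        by (simp add: mult_ac)
      thus "?P (c *\<^sub>R u)" using u by (auto simp: scaleR_fun_def intro!: continuous_intros)
    qed
  next
    fix h assume "h \<in> {h. \<exists>m\<le>n. homogeneous_about z m h}"
    then obtain m where m: "m \<le> n" "homogeneous_about z m h" by blast
    thus "?P h" using jacobi_orthogonal_homogeneous[OF d z m(2), of k] n by (auto simp: homogeneous_about_def)
  qed
  thus ?thesis ..
qed

text \<open>Induction on \<open>a\<close> by lambda^(a+1) = lambda^a - lambda^a (1 - lambda): the
  factor 1 - lambda raises the degree of homogeneity by one, and the moment formula with j = 1
  compares the two integrals of the homogeneous factors.\<close>

lemma facet_integral_beta:
  assumes z: "z \<in> V" "z \<noteq> opp"
  shows "homogeneous_about z m h \<Longrightarrow> (\<integral>x. bc z x ^ a * h x \<partial>facet_measure F) =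
    fact a * fact (DIM('a) + m - 1) / fact (a + (DIM('a) + m - 1)) * (\<integral>x. h x \<partial>facet_measure F)"
proof (induction a arbitrary: m h)
  case (Suc a)
  define b where "b = DIM('a) + m - 1"
  have b: "DIM('a) + (m + 1) - 1 = Suc b" unfolding b_def using DIM_positive[where 'a='a] by linarith
  have hc: "continuous_on UNIV h" using Suc.prems by (simp add: homogeneous_about_def)
  have l: "homogeneous_about z 1 (\<lambda>x. 1 - bc z x)"
    by (rule homogeneous_about_affine) (use z in \<open>auto simp: bc_vertex\<close>)
  have hl: "homogeneous_about z (m + 1) (\<lambda>x. h x * (1 - bc z x))"
    by (rule homogeneous_about_mult[OF Suc.prems l])
  let ?G = "\<integral>x. h x \<partial>facet_measure F"
  have G1: "(\<integral>x. h x * (1 - bc z x) \<partial>facet_measure F) = real b / real (Suc b) * ?G"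
  proof -
    have "real (b + 1) * (\<integral>x. (1 - bc z x) ^ 1 * h x \<partial>facet_measure F) = real b * ?G"
      unfolding b_def using Suc.prems by (intro facet_integral_moment[OF hc z]) (simp add: homogeneous_about_def)
    moreover have "(\<lambda>x. (1 - bc z x) ^ 1 * h x) = (\<lambda>x. h x * (1 - bc z x))"
      by (simp add: mult.commute)
    ultimately have "real (Suc b) * (\<integral>x. h x * (1 - bc z x) \<partial>facet_measure F) = real b * ?G"
      by simp
    thus ?thesis by (simp add: eq_divide_eq mult.commute del: of_nat_Suc)
  qed
  have "bc z x ^ Suc a * h x = bc z x ^ a * h x - bc z x ^ a * (h x * (1 - bc z x))" for x
    by (simp add: algebra_simps)
  hence "(\<integral>x. bc z x ^ Suc a * h x \<partial>facet_measure F) =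
      (\<integral>x. bc z x ^ a * h x \<partial>facet_measure F) - (\<integral>x. bc z x ^ a * (h x * (1 - bc z x)) \<partial>facet_measure F)"
    using hc by (simp only:) (intro facet_integral_linear continuous_intros)
  also have "\<dots> = fact a * fact b / fact (a + b) * ?G
      - fact a * fact (Suc b) / fact (a + Suc b) * (real b / real (Suc b) * ?G)"
    unfolding Suc.IH[OF Suc.prems] Suc.IH[OF hl] b G1 b_def[symmetric] ..
  also have "\<dots> = fact (Suc a) * fact b / fact (Suc a + b) * ?G"
  proof -
    have "fact a * fact b / fact (a + b) - fact a * fact (Suc b) / fact (a + Suc b) * (real b / real (Suc b))
        = (fact (Suc a) * fact b / fact (Suc a + b) :: real)"
      by (simp add: divide_simps del: of_nat_Suc) (simp add: algebra_simps)
    thus ?thesis by (simp only: left_diff_distrib[symmetric] mult.assoc[symmetric])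
  qed
  finally show ?case by (simp only: b_def)
qed simp

end

section \<open>Smooth functions\<close>

text \<open>The classical function exp(-1/t) with a polynomial in 1/t in front: a family closed
  under differentiation, so smoothness needs no formula for the higher derivatives.\<close>

definition flat :: "real poly \<Rightarrow> real \<Rightarrow> real" where
  "flat q t = (if t > 0 then poly q (1 / t) * exp (- (1 / t)) else 0)"

lemma poly_div_exp_tendsto_0: "((\<lambda>u. poly q u * exp (- u)) \<longlongrightarrow> 0) at_top"
  for q :: "real poly"
proof -
  have "((\<lambda>u. \<Sum>i\<le>degree q. coeff q i * (u ^ i / exp u)) \<longlongrightarrow> (\<Sum>i\<le>degree q. coeff q i * 0)) at_top"
    by (intro tendsto_sum tendsto_mult_left tendsto_power_div_exp_0)
  thus ?thesis by (simp add: poly_altdef sum_distrib_right exp_minus divide_inverse mult.assoc)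
qed

text \<open>In u = 1/t differentiation is -u^2 d/du, which turns q(u) exp(-u) into u^2 (q - q')(u)
  exp(-u). At 0 the difference quotient from the right is u q(u) exp(-u) and decays.\<close>

lemma flat_has_derivative:
  "(flat q has_real_derivative flat ([:0, 0, 1:] * (q - pderiv q)) t) (at t)"
proof -
  consider "t > 0" | "t < 0" | "t = 0" by linarith
  thus ?thesis
  proof cases
    case 1
    have "((\<lambda>t. poly q (1 / t) * exp (- (1 / t))) has_real_derivative
        flat ([:0, 0, 1:] * (q - pderiv q)) t) (at t)"
      using 1 by (auto intro!: derivative_eq_intros simp: flat_def divide_simps power2_eq_square)
         (simp add: algebra_simps)?
    thus ?thesis by (rule has_field_derivative_transform_within_open[where S = "{0<..}"])
         (use 1 in \<open>auto simp: flat_def\<close>)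
  next
    case 2
    have "((\<lambda>t. 0) has_real_derivative flat ([:0, 0, 1:] * (q - pderiv q)) t) (at t)"
      using 2 by (simp add: flat_def)
    thus ?thesis by (rule has_field_derivative_transform_within_open[where S = "{..<0}"])
         (use 2 in \<open>auto simp: flat_def\<close>)
  next
    case 3
    have "((\<lambda>y. (flat q y - flat q 0) / (y - 0)) \<longlongrightarrow> 0) (at 0)"
      proof (rule filterlim_split_at_real)
      show "((\<lambda>y. (flat q y - flat q 0) / (y - 0)) \<longlongrightarrow> 0) (at_left 0)"
        by (rule tendsto_eventually) (auto simp: eventually_at_left_field flat_def intro!: exI[of _ "-1"])
      have "((\<lambda>y. poly ([:0, 1:] * q) (inverse y) * exp (- inverse y)) \<longlongrightarrow> 0) (at_right 0)"
        by (rule filterlim_compose[OF poly_div_exp_tendsto_0 filterlim_inverse_at_top_right])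
      moreover have "\<forall>\<^sub>F y in at_right 0. poly ([:0, 1:] * q) (inverse y) * exp (- inverse y) =
          (flat q y - flat q 0) / (y - 0)"
        unfolding eventually_at_right_field by (intro exI[of _ 1]) (auto simp: flat_def divide_simps)
      ultimately show "((\<lambda>y. (flat q y - flat q 0) / (y - 0)) \<longlongrightarrow> 0) (at_right 0)"
        by (rule Lim_transform_eventually)
    qed
    thus ?thesis by (simp add: 3 has_field_derivative_iff flat_def)
  qed
qed

lemma flat_1_pos: "flat 1 t > 0 \<longleftrightarrow> t > 0" and flat_1_nonneg: "flat 1 t \<ge> 0"
  and flat_1_le: "flat 1 t \<le> 1" by (auto simp: flat_def)

text \<open>A syntactic class closed under partial derivatives, so that its members are
  \<open>smooth\<close> by coinduction. It contains the polynomials, bumps and cut-offs used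
  below.\<close>

inductive smth :: "('a::euclidean_space \<Rightarrow> real) \<Rightarrow> bool" where
  const: "smth (\<lambda>x. c)"
| inner: "smth (\<lambda>x. x \<bullet> a)"
| add: "smth f \<Longrightarrow> smth g \<Longrightarrow> smth (\<lambda>x. f x + g x)"
| mult: "smth f \<Longrightarrow> smth g \<Longrightarrow> smth (\<lambda>x. f x * g x)"
| flat: "smth f \<Longrightarrow> smth (\<lambda>x. flat q (f x))"

lemma partial_deriv_eq: "(f has_derivative f') (at x) \<Longrightarrow> partial_deriv b f x = f' b"
  by (metis frechet_derivative_at partial_deriv_def)

lemma has_derivative_partial_deriv:
  "f differentiable (at x) \<Longrightarrow> (f has_derivative (\<lambda>h. partial_deriv h f x)) (at x)"
  unfolding partial_deriv_def using frechet_derivative_works by blast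

lemma smth_differentiable_partial:
  "smth f \<Longrightarrow> (\<forall>x. f differentiable (at x)) \<and> (\<forall>b. smth (partial_deriv b f))"
proof (induction rule: smth.induct)
  case (const c)
  have "((\<lambda>x::'a. c) has_derivative (\<lambda>h. 0)) (at x)" for x by (rule has_derivative_const)
  hence "partial_deriv b (\<lambda>x::'a. c) = (\<lambda>x. 0)" for b using partial_deriv_eq by blast
  thus ?case by (simp add: smth.const)
next
  case (inner a)
  have d: "((\<lambda>x. x \<bullet> a) has_derivative (\<lambda>h. h \<bullet> a)) (at x)" for x :: 'a
    by (auto intro!: derivative_eq_intros)
  hence "partial_deriv b (\<lambda>x. x \<bullet> a) = (\<lambda>x. b \<bullet> a)" for b
    using partial_deriv_eq by blast
  with d show ?case by (auto simp: smth.const differentiable_def)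
next
  case (add f g)
  have d: "((\<lambda>x. f x + g x) has_derivative (\<lambda>h. partial_deriv h f x + partial_deriv h g x)) (at x)" for x
    using add.IH by (intro has_derivative_add has_derivative_partial_deriv) auto
  hence "partial_deriv b (\<lambda>x. f x + g x) = (\<lambda>x. partial_deriv b f x + partial_deriv b g x)" for b
    by (intro ext partial_deriv_eq)
  with d add show ?case by (auto simp: differentiable_def intro: smth.add)
next
  case (mult f g)
  have d: "((\<lambda>x. f x * g x) has_derivative
      (\<lambda>h. f x * partial_deriv h g x + partial_deriv h f x * g x)) (at x)" for x
    using mult.IH by (intro has_derivative_mult has_derivative_partial_deriv) auto
  hence "partial_deriv b (\<lambda>x. f x * g x) = (\<lambda>x. f x * partial_deriv b g x + partial_deriv b f x * g x)" for b
    by (intro ext partial_deriv_eq)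
  hence "smth (partial_deriv b (\<lambda>x. f x * g x))" for b
    using mult by (simp only:) (intro smth.add smth.mult; simp)
  with d show ?case by (auto simp: differentiable_def)
next
  case (flat f q)
  let ?q = "[:0, 0, 1:] * (q - pderiv q)"
  have d: "((\<lambda>x. flat q (f x)) has_derivative (\<lambda>h. partial_deriv h f x * flat ?q (f x))) (at x)" for x
    using flat.IH by (intro DERIV_compose_FDERIV flat_has_derivative has_derivative_partial_deriv) auto
  hence "partial_deriv b (\<lambda>x. flat q (f x)) = (\<lambda>x. partial_deriv b f x * flat ?q (f x))" for b
    by (intro ext partial_deriv_eq)
  with d flat show ?case by (auto simp del: mult_pCons_left simp: differentiable_def intro: smth.flat smth.mult)
qed

lemma smth_differentiable: "smth f \<Longrightarrow> f differentiable (at x)"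
  and smth_partial: "smth f \<Longrightarrow> smth (partial_deriv b f)" using smth_differentiable_partial by blast+

lemma smooth_coinduct_set:
  assumes "f \<in> X" and "\<And>f x. f \<in> X \<Longrightarrow> f differentiable (at x)"
    and "\<And>f b. f \<in> X \<Longrightarrow> b \<in> Basis \<Longrightarrow> partial_deriv b f \<in> X"
  shows "smooth f" using assms(1)
proof (coinduction arbitrary: f)
  case smooth
  thus ?case using assms(2,3) by (auto simp: partial_deriv_def[abs_def])
qed

lemma smth_smooth: "smth f \<Longrightarrow> smooth f"
  by (rule smooth_coinduct_set[of _ "Collect smth"]) (auto intro: smth_differentiable smth_partial)

lemma smooth_differentiable: "smooth f \<Longrightarrow> f differentiable (at x)" by (erule smooth.cases) auto

lemma smooth_partial: "smooth f \<Longrightarrow> b \<in> Basis \<Longrightarrow> smooth (partial_deriv b f)"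
  unfolding partial_deriv_def[abs_def] by (erule smooth.cases) auto

lemma smooth_continuous: "smooth f \<Longrightarrow> continuous_on S f"
  by (meson differentiable_imp_continuous_on differentiable_on_def differentiable_at_withinI smooth_differentiable)

lemma smth_continuous: "smth f \<Longrightarrow> continuous_on S f" by (intro smooth_continuous smth_smooth)

lemma smth_sum: "(\<And>i. i \<in> I \<Longrightarrow> smth (f i)) \<Longrightarrow> smth (\<lambda>x. \<Sum>i\<in>I. f i x)"
  by (induction I rule: infinite_finite_induct) (auto intro: smth.const smth.add)

lemma smth_prod: "(\<And>i. i \<in> I \<Longrightarrow> smth (f i)) \<Longrightarrow> smth (\<lambda>x. \<Prod>i\<in>I. f i x)"
  by (induction I rule: infinite_finite_induct) (auto intro: smth.const smth.mult)

lemma smth_power: "smth f \<Longrightarrow> smth (\<lambda>x. f x ^ n)"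
  by (induction n) (auto intro: smth.const smth.mult)

lemma smth_diff: "smth f \<Longrightarrow> smth g \<Longrightarrow> smth (\<lambda>x. f x - g x)"
  using smth.add[of f "\<lambda>x. (-1) * g x"] smth.mult[OF smth.const, of g "-1"] by simp

lemma poly_space_smth: "f \<in> poly_space k \<Longrightarrow> smth f" by (induction rule: poly_space_induct)
    (auto intro!: smth.const smth.add smth.mult smth_prod smth_power smth.inner)

definition bump :: "'a::euclidean_space \<Rightarrow> real \<Rightarrow> 'a \<Rightarrow> real" where
  "bump a r x = flat 1 (r\<^sup>2 - (x - a) \<bullet> (x - a))"

lemma smth_bump: "smth (bump a r)"
proof -
  have "(x - a) \<bullet> (x - a) = (\<Sum>b\<in>Basis. (x \<bullet> b - a \<bullet> b) * (x \<bullet> b - a \<bullet> b))" for x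
    by (subst euclidean_inner) (simp add: inner_diff_left)
  thus ?thesis
    unfolding bump_def by (simp only:) (intro smth.flat smth_diff smth.const smth_sum smth.mult smth.inner)
qed

lemma bump_nonneg: "bump a r x \<ge> 0" and bump_le_1: "bump a r x \<le> 1"
  by (simp_all add: bump_def flat_1_nonneg flat_1_le)

lemma bump_pos: "r > 0 \<Longrightarrow> bump a r x > 0 \<longleftrightarrow> dist a x < r"
proof -
  assume r: "r > 0"
  have "bump a r x > 0 \<longleftrightarrow> (norm (x - a))\<^sup>2 < r\<^sup>2"
    unfolding bump_def flat_1_pos dot_square_norm by simp
  also have "\<dots> \<longleftrightarrow> norm (x - a) < r"
    using r power_mono_iff[of r "norm (x - a)" 2] by (auto simp: not_le[symmetric] simp del: not_le)
  finally show ?thesis by (simp add: dist_norm norm_minus_commute)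
qed

lemma bump_partial: "partial_deriv b (bump a r) x =
    - 2 * ((x - a) \<bullet> b) * flat [:0, 0, 1:] (r\<^sup>2 - (x - a) \<bullet> (x - a))"
proof -
  have "((\<lambda>x. r\<^sup>2 - (x - a) \<bullet> (x - a)) has_derivative (\<lambda>h. - 2 * ((x - a) \<bullet> h))) (at x)"
    by (auto intro!: derivative_eq_intros simp: inner_commute)
  from DERIV_compose_FDERIV[OF flat_has_derivative this, of 1]
  have "((\<lambda>x. flat 1 (r\<^sup>2 - (x - a) \<bullet> (x - a))) has_derivative
      (\<lambda>h. - 2 * ((x - a) \<bullet> h) * flat [:0, 0, 1:] (r\<^sup>2 - (x - a) \<bullet> (x - a)))) (at x)"
    by (simp add: pderiv_1)
  from partial_deriv_eq[OF this, of b] show ?thesis by (simp add: bump_def[abs_def])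
qed

lemma partial_deriv_mult:
  "f differentiable (at x) \<Longrightarrow> g differentiable (at x) \<Longrightarrow>
    partial_deriv b (\<lambda>x. f x * g x) x = f x * partial_deriv b g x + partial_deriv b f x * g x"
  by (rule partial_deriv_eq[OF has_derivative_mult]) (rule has_derivative_partial_deriv; assumption)+

lemma partial_deriv_linear:
  "f differentiable (at x) \<Longrightarrow> linear (\<lambda>h. partial_deriv h f x)"
  using has_derivative_partial_deriv has_derivative_linear by blast

lemma partial_deriv_expansion:
  assumes "f differentiable (at x)"
  shows "partial_deriv h f x = (\<Sum>b\<in>Basis. (h \<bullet> b) * partial_deriv b f x)"
proof -
  have "partial_deriv h f x = partial_deriv (\<Sum>b\<in>Basis. (h \<bullet> b) *\<^sub>R b) f x"
    by (simp add: euclidean_representation)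
  thus ?thesis
    using linear_sum[OF partial_deriv_linear[OF assms], of "\<lambda>b. (h \<bullet> b) *\<^sub>R b" Basis]
      linear_cmul[OF partial_deriv_linear[OF assms]] by simp
qed

lemma partial_deriv_outside_support:
  assumes "x \<notin> closure {x. f x \<noteq> 0}"
  shows "partial_deriv b f x = 0"
proof -
  have "((\<lambda>x. 0) has_derivative (\<lambda>h. 0)) (at x)" by (rule has_derivative_const)
  hence "(f has_derivative (\<lambda>h. 0)) (at x)"
    by (rule has_derivative_transform_within_open[where s = "- closure {x. f x \<noteq> 0}"])
      (use assms closure_subset[of "{x. f x \<noteq> 0}"] in \<open>auto simp: open_closed\<close>)
  thus ?thesis by (rule partial_deriv_eq)
qed

section \<open>Integration by parts\<close>

lemma directional_derivative_limit:
  assumes "f differentiable (at x)"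
  shows "((\<lambda>h. (f (x + h *\<^sub>R b) - f x) / h) \<longlongrightarrow> partial_deriv b f x) (at 0)"
proof -
  have "((\<lambda>h. x + h *\<^sub>R b) has_derivative (\<lambda>h. h *\<^sub>R b)) (at 0)"
    by (auto intro!: derivative_eq_intros)
  moreover have "(f has_derivative (\<lambda>h. partial_deriv h f x)) (at (x + 0 *\<^sub>R b))"
    using has_derivative_partial_deriv[OF assms] by simp
  ultimately have "((\<lambda>h. f (x + h *\<^sub>R b)) has_derivative (\<lambda>h. partial_deriv (h *\<^sub>R b) f x)) (at 0)"
    by (rule has_derivative_compose)
  hence "((\<lambda>h. f (x + h *\<^sub>R b)) has_real_derivative partial_deriv b f x) (at 0)"
    using linear_cmul[OF partial_deriv_linear[OF assms], of _ b]
    by (simp add: has_field_derivative_def mult.commute[of _ "partial_deriv b f x"])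
  thus ?thesis by (simp add: has_field_derivative_iff)
qed

text \<open>The integral of the difference quotients vanishes by translation invariance.\<close>

lemma integral_directional_derivative_eq_0:
  fixes P :: "'a::euclidean_space \<Rightarrow> real"
  assumes meas [measurable]: "P \<in> borel_measurable borel" "D \<in> borel_measurable borel"
    and lip: "\<And>x h. \<bar>P (x + h *\<^sub>R b) - P x\<bar> \<le> L * \<bar>h\<bar>"
    and supp: "\<And>x. x \<notin> cball 0 R \<Longrightarrow> P x = 0" and bnd: "\<And>x. \<bar>P x\<bar> \<le> B"
    and lim: "AE x in lborel. ((\<lambda>h. (P (x + h *\<^sub>R b) - P x) / h) \<longlongrightarrow> D x) (at 0)"
  shows "integrable lborel D \<and> (\<integral>x. D x \<partial>lborel) = 0"
proof -
  define s where "s n x = (P (x + (1 / real (Suc n)) *\<^sub>R b) - P x) / (1 / real (Suc n))" for n x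
  \<comment> \<open>A common majorant of the difference quotients: the shifts are at most
    \<open>norm b\<close> long, so all quotients vanish outside the enlarged ball.\<close>
  define W where "W x = indicator (cball 0 (R + norm b)) x * L" for x :: 'a
  have intP: "integrable lborel P" by (rule integrableI_bounded_set[where A = "cball 0 R" and B = B])
      (use supp bnd emeasure_lborel_cball_finite in auto)
  have s0: "(\<integral>x. s n x \<partial>lborel) = 0" for n
  proof -
    have "integrable lborel (\<lambda>x. P (x + (1 / real (Suc n)) *\<^sub>R b))"
    proof (rule integrableI_bounded_set[where A = "cball (- (1 / real (Suc n)) *\<^sub>R b) R" and B = B])
      show "AE x in lborel. x \<notin> cball (- (1 / real (Suc n)) *\<^sub>R b) R \<longrightarrow> P (x + (1 / real (Suc n)) *\<^sub>R b) = 0"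
      proof (intro AE_I2 impI supp)
        have minus_diff: "- c - x = - (x + c)" for c x :: 'a by (simp add: algebra_simps)
        fix x assume "x \<notin> cball (- (1 / real (Suc n)) *\<^sub>R b) R"
        thus "x + (1 / real (Suc n)) *\<^sub>R b \<notin> cball 0 R"
          by (simp only: mem_cball dist_norm scaleR_minus_left minus_diff norm_minus_cancel diff_0
            not_False_eq_True)
      qed
    qed (use bnd emeasure_lborel_cball_finite in auto)
    thus ?thesis using integral_lborel_translate[OF meas(1), of "(1 / real (Suc n)) *\<^sub>R b"] intP
      by (simp add: s_def add.commute del: of_nat_Suc)
  qed
  have s_meas: "s n \<in> borel_measurable lborel" for n unfolding s_def by measurable
  have W: "integrable lborel W" unfolding W_def by (intro integrable_mult_left integrable_real_indicator)
      (use emeasure_lborel_cball_finite in auto)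
  have s_bound: "AE x in lborel. norm (s n x) \<le> W x" for n
  proof (rule AE_I2)
    fix x
    show "norm (s n x) \<le> W x"
    proof (cases "x \<in> cball 0 (R + norm b)")
      case True
      have "\<bar>P (x + (1 / real (Suc n)) *\<^sub>R b) - P x\<bar> \<le> L * (1 / real (Suc n))"
        using lip[of x "1 / real (Suc n)"] by simp
      hence "\<bar>P (x + (1 / real (Suc n)) *\<^sub>R b) - P x\<bar> * real (Suc n) \<le> L * (1 / real (Suc n)) * real (Suc n)"
        by (intro mult_right_mono) auto
      thus ?thesis using True by (simp add: s_def W_def abs_mult del: of_nat_Suc)
    next
      case False
      hence nx: "norm x > R + norm b" by simp
      have "norm (x + (1 / real (Suc n)) *\<^sub>R b) \<ge> norm x - norm ((1 / real (Suc n)) *\<^sub>R b)"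
        by (rule norm_diff_ineq)
      moreover have "norm ((1 / real (Suc n)) *\<^sub>R b) \<le> 1 * norm b"
        unfolding norm_scaleR by (intro mult_right_mono) auto
      ultimately have "x + (1 / real (Suc n)) *\<^sub>R b \<notin> cball 0 R" "x \<notin> cball 0 R"
        using nx norm_ge_zero[of b] unfolding mem_cball_0 by linarith+
      hence "P (x + (1 / real (Suc n)) *\<^sub>R b) = 0" "P x = 0" using supp by blast+
      thus ?thesis using False by (simp add: s_def W_def)
    qed
  qed
  have s_lim: "AE x in lborel. (\<lambda>n. s n x) \<longlonglongrightarrow> D x" using lim
  proof (rule eventually_mono)
    fix x assume l: "((\<lambda>h. (P (x + h *\<^sub>R b) - P x) / h) \<longlongrightarrow> D x) (at 0)"
    have "filterlim (\<lambda>n. 1 / real (Suc n)) (at 0) sequentially"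
      unfolding filterlim_at using LIMSEQ_Suc[OF lim_1_over_n[where 'a = real]] by simp
    from filterlim_compose[OF l this] show "(\<lambda>n. s n x) \<longlonglongrightarrow> D x"
      by (simp add: s_def del: of_nat_Suc)
  qed
  have Dm: "D \<in> borel_measurable lborel" by measurable
  have "integrable lborel D" and "(\<lambda>n. integral\<^sup>L lborel (s n)) \<longlonglongrightarrow> integral\<^sup>L lborel D"
    using integrable_dominated_convergence[OF Dm s_meas W s_lim s_bound]
      integral_dominated_convergence[OF Dm s_meas W s_lim s_bound] by auto
  thus ?thesis by (simp add: s0 LIMSEQ_const_iff)
qed

lemma differentiable_bounded_partial_imp_lipschitz:
  assumes "\<And>x. f differentiable (at x)" "\<And>x. \<bar>partial_deriv b f x\<bar> \<le> L"
  shows "\<bar>f (x + h *\<^sub>R b) - f x\<bar> \<le> L * \<bar>h\<bar>"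
proof -
  have "norm (f (x + h *\<^sub>R b) - f (x + 0 *\<^sub>R b)) \<le> L * norm (h - 0)"
  proof (rule field_differentiable_bound[where S = UNIV and f' = "\<lambda>t. partial_deriv b f (x + t *\<^sub>R b)"])
    fix t :: real
    have "((\<lambda>h. (f ((x + t *\<^sub>R b) + h *\<^sub>R b) - f (x + t *\<^sub>R b)) / h) \<longlongrightarrow> partial_deriv b f (x + t *\<^sub>R b)) (at 0)"
      by (rule directional_derivative_limit[OF assms(1)])
    thus "((\<lambda>t. f (x + t *\<^sub>R b)) has_field_derivative partial_deriv b f (x + t *\<^sub>R b)) (at t within UNIV)"
      by (simp add: DERIV_def algebra_simps)
  qed (use assms(2) in auto)
  thus ?thesis by simp
qed

lemma continuous_compact_support_bounded:
  fixes f :: "'a::euclidean_space \<Rightarrow> real"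
  assumes "continuous_on UNIV f" "\<And>x. x \<notin> cball 0 R \<Longrightarrow> f x = 0"
  obtains B where "B \<ge> 0" "\<And>x. \<bar>f x\<bar> \<le> B"
proof -
  have "bounded (f ` cball 0 R)"
    using assms(1) by (intro compact_imp_bounded compact_continuous_image) (auto intro: continuous_on_subset)
  then obtain B where "\<forall>y\<in>f ` cball 0 R. norm y \<le> B" unfolding bounded_iff by blast
  hence B: "\<bar>f x\<bar> \<le> B" if "x \<in> cball 0 R" for x
    using that by (simp only: ball_simps real_norm_def)
  have "\<bar>f x\<bar> \<le> \<bar>B\<bar>" for x using B[of x] assms(2)[of x] by (cases "x \<in> cball 0 R") auto
  thus ?thesis using that[of "\<bar>B\<bar>"] by auto
qed

lemma integrable_compact_support:
  fixes f :: "'a::euclidean_space \<Rightarrow> real"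
  assumes f: "continuous_on UNIV f" "\<And>x. x \<notin> cball 0 R \<Longrightarrow> f x = 0"
  shows "integrable lborel f"
proof -
  obtain B where "B \<ge> 0" "\<And>x. \<bar>f x\<bar> \<le> B"
    using continuous_compact_support_bounded[OF f] by blast
  thus ?thesis by (intro integrableI_bounded_set[where A = "cball 0 R" and B = B])
      (use f emeasure_lborel_cball_finite in \<open>auto intro: borel_measurable_continuous_onI\<close>)
qed

lemma partial_deriv_outside_cball:
  assumes "\<And>x. x \<notin> cball a R \<Longrightarrow> f x = 0" "x \<notin> cball a R"
  shows "partial_deriv b f x = 0"
proof (rule partial_deriv_outside_support)
  have "closure {x. f x \<noteq> 0} \<subseteq> cball a R"
    by (intro closure_minimal closed_cball) (use assms(1) in blast)
  with assms(2) show "x \<notin> closure {x. f x \<noteq> 0}" by blast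
qed

text \<open>\<open>w\<close> is only Lipschitz, as piecewise polynomial functions are. The product
  with \<phi> is Lipschitz with bounded support, so its almost everywhere derivative integrates to
  zero.\<close>

lemma integration_by_parts:
  fixes w \<phi> :: "'a::euclidean_space \<Rightarrow> real"
  assumes w: "continuous_on UNIV w" "\<And>x. \<bar>w x\<bar> \<le> B" and gm [measurable]: "g \<in> borel_measurable borel"
    and lip: "\<And>x y. \<bar>w x - w y\<bar> \<le> L * norm (x - y)"
    and lim: "AE x in lborel. ((\<lambda>h. (w (x + h *\<^sub>R b) - w x) / h) \<longlongrightarrow> g x) (at 0)"
    and \<phi>: "\<And>x. \<phi> differentiable (at x)" "continuous_on UNIV (partial_deriv b \<phi>)"
      "\<And>x. x \<notin> cball 0 R \<Longrightarrow> \<phi> x = 0"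
  shows "(\<integral>x. w x * partial_deriv b \<phi> x \<partial>lborel) = - (\<integral>x. g x * \<phi> x \<partial>lborel)"
proof -
  have \<phi>c: "continuous_on UNIV \<phi>"
    using \<phi>(1) by (simp add: differentiable_imp_continuous_on differentiable_on_def)
  have [measurable]: "w \<in> borel_measurable borel" "\<phi> \<in> borel_measurable borel"
      "partial_deriv b \<phi> \<in> borel_measurable borel"
    using w(1) \<phi>c \<phi>(2) by (auto intro: borel_measurable_continuous_onI)
  have pd0: "partial_deriv b \<phi> x = 0" if "x \<notin> cball 0 R" for x
    by (rule partial_deriv_outside_cball[OF _ that]) (rule \<phi>(3))
  obtain B1 where B1: "B1 \<ge> 0" "\<And>x. \<bar>\<phi> x\<bar> \<le> B1"
    using continuous_compact_support_bounded[OF \<phi>c \<phi>(3)] by blast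
  obtain B2 where B2: "B2 \<ge> 0" "\<And>x. \<bar>partial_deriv b \<phi> x\<bar> \<le> B2"
    using continuous_compact_support_bounded[OF \<phi>(2) pd0] by blast
  have B: "B \<ge> 0" using w(2)[of 0] by linarith
  have 0: "integrable lborel (\<lambda>x. w x * partial_deriv b \<phi> x + g x * \<phi> x) \<and>
      (\<integral>x. w x * partial_deriv b \<phi> x + g x * \<phi> x \<partial>lborel) = 0"
  proof (rule integral_directional_derivative_eq_0[where P = "\<lambda>x. w x * \<phi> x" and b = b and R = R])
    show "\<bar>w (x + h *\<^sub>R b) * \<phi> (x + h *\<^sub>R b) - w x * \<phi> x\<bar> \<le> (\<bar>L\<bar> * norm b * B1 + B * B2) * \<bar>h\<bar>" for x h
    proof -
      have "w (x + h *\<^sub>R b) * \<phi> (x + h *\<^sub>R b) - w x * \<phi> x =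
          (w (x + h *\<^sub>R b) - w x) * \<phi> (x + h *\<^sub>R b) + w x * (\<phi> (x + h *\<^sub>R b) - \<phi> x)"
        by (simp add: algebra_simps)
      also have "\<bar>\<dots>\<bar> \<le> \<bar>w (x + h *\<^sub>R b) - w x\<bar> * \<bar>\<phi> (x + h *\<^sub>R b)\<bar> + \<bar>w x\<bar> * \<bar>\<phi> (x + h *\<^sub>R b) - \<phi> x\<bar>"
        by (metis abs_mult abs_triangle_ineq)
      also have "\<dots> \<le> (\<bar>L\<bar> * (\<bar>h\<bar> * norm b)) * B1 + B * (B2 * \<bar>h\<bar>)"
      proof (intro add_mono mult_mono)
        show "\<bar>w (x + h *\<^sub>R b) - w x\<bar> \<le> \<bar>L\<bar> * (\<bar>h\<bar> * norm b)"
          using lip[of "x + h *\<^sub>R b" x] mult_right_mono[OF abs_ge_self[of L], of "\<bar>h\<bar> * norm b"] by simp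
        show "\<bar>\<phi> (x + h *\<^sub>R b) - \<phi> x\<bar> \<le> B2 * \<bar>h\<bar>"
          by (rule differentiable_bounded_partial_imp_lipschitz[OF \<phi>(1) B2(2)])
      qed (use w(2) B B1 B2 in auto)
      finally show ?thesis by (simp add: algebra_simps)
    qed
    show "\<bar>w x * \<phi> x\<bar> \<le> B * B1" for x
      unfolding abs_mult using w(2) B B1 by (intro mult_mono) auto
    show "AE x in lborel. ((\<lambda>h. (w (x + h *\<^sub>R b) * \<phi> (x + h *\<^sub>R b) - w x * \<phi> x) / h) \<longlongrightarrow>
        w x * partial_deriv b \<phi> x + g x * \<phi> x) (at 0)"
      using lim
    proof (rule eventually_mono)
      fix x assume l: "((\<lambda>h. (w (x + h *\<^sub>R b) - w x) / h) \<longlongrightarrow> g x) (at 0)"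
      have "((\<lambda>h. w (x + h *\<^sub>R b)) \<longlongrightarrow> w (x + 0 *\<^sub>R b)) (at 0)"
        using w(1) by (intro tendsto_intros continuous_on_tendsto_compose[where f = w and s = UNIV]) auto
      hence "((\<lambda>h. w (x + h *\<^sub>R b) * ((\<phi> (x + h *\<^sub>R b) - \<phi> x) / h) + (w (x + h *\<^sub>R b) - w x) / h * \<phi> x) \<longlongrightarrow>
          w (x + 0 *\<^sub>R b) * partial_deriv b \<phi> x + g x * \<phi> x) (at 0)"
        by (intro tendsto_intros l directional_derivative_limit \<phi>(1))
      moreover have "w (x + h *\<^sub>R b) * ((\<phi> (x + h *\<^sub>R b) - \<phi> x) / h) + (w (x + h *\<^sub>R b) - w x) / h * \<phi> x
          = (w (x + h *\<^sub>R b) * \<phi> (x + h *\<^sub>R b) - w x * \<phi> x) / h" for h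
        by (simp add: algebra_simps add_divide_distrib diff_divide_distrib)
      ultimately show "((\<lambda>h. (w (x + h *\<^sub>R b) * \<phi> (x + h *\<^sub>R b) - w x * \<phi> x) / h) \<longlongrightarrow>
        w x * partial_deriv b \<phi> x + g x * \<phi> x) (at 0)"
        by simp
    qed
    show "w x * \<phi> x = 0" if "x \<notin> cball 0 R" for x using \<phi>(3)[OF that] by simp
  qed measurable
  have 1: "integrable lborel (\<lambda>x. w x * partial_deriv b \<phi> x)"
    by (rule integrable_compact_support[of _ R]) (use w(1) \<phi>(2) pd0 in \<open>auto intro: continuous_on_mult\<close>)
  have "integrable lborel (\<lambda>x. g x * \<phi> x)"
    using Bochner_Integration.integrable_diff[OF conjunct1[OF 0] 1] by simp
  from Bochner_Integration.integral_add[OF 1 this] show ?thesis using 0 by simp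
qed

lemma smth_integration_by_parts_compact:
  assumes f: "smth f" and \<phi>: "smooth \<phi>" "\<And>x. x \<notin> cball 0 R \<Longrightarrow> \<phi> x = 0" and b: "b \<in> Basis"
  shows "(\<integral>x. f x * partial_deriv b \<phi> x \<partial>lborel) = - (\<integral>x. partial_deriv b f x * \<phi> x \<partial>lborel)"
proof -
  let ?P = "\<lambda>x. f x * \<phi> x" and ?D = "\<lambda>x. f x * partial_deriv b \<phi> x + partial_deriv b f x * \<phi> x"
  note d = smth_differentiable[OF f] smooth_differentiable[OF \<phi>(1)]
  note c = smth_continuous[OF f, of UNIV] smooth_continuous[OF \<phi>(1), of UNIV]
    smth_continuous[OF smth_partial[OF f, of b], of UNIV] smooth_continuous[OF smooth_partial[OF \<phi>(1) b], of UNIV]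
  have pd0: "partial_deriv b \<phi> x = 0" if "x \<notin> cball 0 R" for x
    by (rule partial_deriv_outside_cball[OF _ that]) (rule \<phi>(2))
  have P: "?P x = 0" and D: "?D x = 0" if "x \<notin> cball 0 R" for x
    using \<phi>(2)[OF that] pd0[OF that] by simp_all
  have Pd: "?P differentiable (at x)" "partial_deriv b ?P x = ?D x" for x
    using d by (auto intro: differentiable_mult partial_deriv_mult)
  have Pc: "continuous_on UNIV ?P" and Dc: "continuous_on UNIV ?D"
    by (intro continuous_on_add continuous_on_mult c)+
  obtain L where "\<And>x. \<bar>?D x\<bar> \<le> L" using continuous_compact_support_bounded[OF Dc D] by blast
  hence lip: "\<bar>?P (x + h *\<^sub>R b) - ?P x\<bar> \<le> L * \<bar>h\<bar>" for x h
    using differentiable_bounded_partial_imp_lipschitz[of ?P b L x h] Pd by simp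
  obtain B where "\<And>x. \<bar>?P x\<bar> \<le> B" using continuous_compact_support_bounded[OF Pc P] by blast
  hence "(\<integral>x. ?D x \<partial>lborel) = 0" using directional_derivative_limit[of ?P _ b] Pd
    by (intro integral_directional_derivative_eq_0[OF borel_measurable_continuous_onI[OF Pc]
          borel_measurable_continuous_onI[OF Dc] lip P, THEN conjunct2]) auto
  moreover have "integrable lborel (\<lambda>x. f x * partial_deriv b \<phi> x)" "integrable lborel (\<lambda>x. partial_deriv b f x * \<phi> x)"
    by (rule integrable_compact_support[of _ R], intro continuous_on_mult c, simp add: \<phi>(2) pd0)+
  ultimately show ?thesis by simp
qed

lemma bounded_subset_cball_0: "bounded S \<Longrightarrow> \<exists>R. S \<subseteq> cball (0::'a::real_normed_vector) R"
  by (auto simp: bounded_iff subset_iff)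

section \<open>Square integrable functions\<close>

lemma integrable_mult_square_integrable:
  fixes f g :: "'a \<Rightarrow> real"
  assumes [measurable]: "f \<in> borel_measurable M" "g \<in> borel_measurable M"
    and "integrable M (\<lambda>x. (f x)\<^sup>2)" "integrable M (\<lambda>x. (g x)\<^sup>2)"
  shows "integrable M (\<lambda>x. f x * g x)"
proof (rule Bochner_Integration.integrable_bound[OF Bochner_Integration.integrable_add[OF assms(3,4)]])
  show "AE x in M. norm (f x * g x) \<le> norm ((f x)\<^sup>2 + (g x)\<^sup>2)"
  proof (rule AE_I2)
    fix x
    have "(\<bar>f x\<bar> - \<bar>g x\<bar>)\<^sup>2 = (f x)\<^sup>2 + (g x)\<^sup>2 - 2 * \<bar>f x * g x\<bar>"
      by (simp add: power2_eq_square abs_mult algebra_simps)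
    hence "\<bar>f x * g x\<bar> \<le> (f x)\<^sup>2 + (g x)\<^sup>2"
      using zero_le_power2[of "\<bar>f x\<bar> - \<bar>g x\<bar>"] abs_ge_zero[of "f x * g x"] by linarith
    thus "norm (f x * g x) \<le> norm ((f x)\<^sup>2 + (g x)\<^sup>2)" by simp
  qed
qed measurable

text \<open>The weighted inequality \<bar>a \<psi>\<bar> \<le> t a^2 + \<psi>^2/t takes the place of
  Cauchy-Schwarz: a large \<open>t\<close> controls the second term, then a large \<open>n\<close>
  the first.\<close>

lemma integral_mult_tendsto_0:
  fixes a :: "nat \<Rightarrow> 'a \<Rightarrow> real"
  assumes [measurable]: "\<And>n. a n \<in> borel_measurable M" "\<psi> \<in> borel_measurable M"
    and int: "\<And>n. integrable M (\<lambda>x. (a n x)\<^sup>2)" "integrable M (\<lambda>x. (\<psi> x)\<^sup>2)"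
    and lim: "(\<lambda>n. \<integral>x. (a n x)\<^sup>2 \<partial>M) \<longlonglongrightarrow> 0"
  shows "(\<lambda>n. \<integral>x. a n x * \<psi> x \<partial>M) \<longlonglongrightarrow> 0"
proof (rule LIMSEQ_I)
  fix e :: real assume e: "0 < e"
  define B where "B = (\<integral>x. (\<psi> x)\<^sup>2 \<partial>M)"
  have B: "B \<ge> 0" by (simp add: B_def)
  define t where "t = 2 * (B + 1) / e"
  have t: "t > 0" "B / t < e / 2" using B e by (auto simp: t_def field_simps)
  have bound: "\<bar>\<integral>x. a n x * \<psi> x \<partial>M\<bar> \<le> t * (\<integral>x. (a n x)\<^sup>2 \<partial>M) + B / t" for n
  proof -
    have "\<bar>\<integral>x. a n x * \<psi> x \<partial>M\<bar> \<le> (\<integral>x. \<bar>a n x * \<psi> x\<bar> \<partial>M)"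
      by (rule integral_abs_bound)
    also have "\<dots> \<le> (\<integral>x. t * (a n x)\<^sup>2 + (\<psi> x)\<^sup>2 / t \<partial>M)"
    proof (rule integral_mono)
      show "integrable M (\<lambda>x. \<bar>a n x * \<psi> x\<bar>)"
        using integrable_mult_square_integrable[OF _ _ int(1) int(2)] by simp
      show "integrable M (\<lambda>x. t * (a n x)\<^sup>2 + (\<psi> x)\<^sup>2 / t)" using int by simp
      fix x
      have "(t * \<bar>a n x\<bar> - \<bar>\<psi> x\<bar>)\<^sup>2 = t * (t * (a n x)\<^sup>2) + (\<psi> x)\<^sup>2 - 2 * t * \<bar>a n x * \<psi> x\<bar>"
        by (simp add: power2_eq_square abs_mult algebra_simps)
      hence "2 * t * \<bar>a n x * \<psi> x\<bar> \<le> t * (t * (a n x)\<^sup>2) + (\<psi> x)\<^sup>2"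
        using zero_le_power2[of "t * \<bar>a n x\<bar> - \<bar>\<psi> x\<bar>"] by linarith
      moreover have "0 \<le> t * \<bar>a n x * \<psi> x\<bar>" using t by simp
      ultimately have "t * \<bar>a n x * \<psi> x\<bar> \<le> t * (t * (a n x)\<^sup>2) + (\<psi> x)\<^sup>2"
        by linarith
      also have "\<dots> = t * (t * (a n x)\<^sup>2 + (\<psi> x)\<^sup>2 / t)" using t by (simp add: distrib_left)
      finally show "\<bar>a n x * \<psi> x\<bar> \<le> t * (a n x)\<^sup>2 + (\<psi> x)\<^sup>2 / t"
        using t(1) by simp
    qed
    also have "\<dots> = t * (\<integral>x. (a n x)\<^sup>2 \<partial>M) + B / t" using int by (simp add: B_def)
    finally show ?thesis .
  qed
  have "e / (2 * t) > 0" using e t by simp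
  from LIMSEQ_D[OF lim this] obtain N where N: "\<And>n. n \<ge> N \<Longrightarrow> \<bar>\<integral>x. (a n x)\<^sup>2 \<partial>M\<bar> < e / (2 * t)"
    by auto
  show "\<exists>N. \<forall>n\<ge>N. norm ((\<integral>x. a n x * \<psi> x \<partial>M) - 0) < e"
  proof (intro exI allI impI)
    fix n assume "n \<ge> N"
    hence "t * (\<integral>x. (a n x)\<^sup>2 \<partial>M) < e / 2" using N[of n] t by (simp add: field_simps)
    thus "norm ((\<integral>x. a n x * \<psi> x \<partial>M) - 0) < e"
      using bound[of n] t(2) unfolding real_norm_def diff_0_right by linarith
  qed
qed

text \<open>The function spaces are defined over \<open>lebesgue\<close>, whereas translation and
  homothety arguments run over \<open>lborel\<close>; this is the passage between the two for Borel
  data.\<close>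

lemma set_lebesgue_integral_eq_lborel:
  fixes f :: "'a::euclidean_space \<Rightarrow> real"
  assumes [measurable]: "f \<in> borel_measurable borel" "A \<in> sets borel"
  shows "(LINT x:A|lebesgue. f x) = (\<integral>x. indicator A x * f x \<partial>lborel)"
  unfolding set_lebesgue_integral_def real_scaleR_def by (subst integral_completion) auto

lemma set_lebesgue_integral_eq_lborel_support:
  fixes f :: "'a::euclidean_space \<Rightarrow> real"
  assumes "f \<in> borel_measurable borel" "A \<in> sets borel" "\<And>x. x \<notin> A \<Longrightarrow> f x = 0"
  shows "(LINT x:A|lebesgue. f x) = (\<integral>x. f x \<partial>lborel)"
  unfolding set_lebesgue_integral_eq_lborel[OF assms(1,2)]
  by (rule Bochner_Integration.integral_cong) (use assms(3) in \<open>auto simp: indicator_def\<close>)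

lemma L2_on_iff:
  "u \<in> L2_on \<Omega> \<longleftrightarrow> (\<lambda>x. indicator \<Omega> x * u x) \<in> borel_measurable lebesgue \<and>
    integrable lebesgue (\<lambda>x. (indicator \<Omega> x * u x)\<^sup>2)"
proof -
  have "(indicator \<Omega> x * u x)\<^sup>2 = indicator \<Omega> x *\<^sub>R (u x)\<^sup>2" for x
    by (simp add: indicator_def)
  thus ?thesis by (simp add: L2_on_def set_borel_measurable_def set_integrable_def)
qed

lemma L2_on_add: 
  assumes "u \<in> L2_on \<Omega>" "v \<in> L2_on \<Omega>"
  shows "(\<lambda>x. u x + v x) \<in> L2_on \<Omega>"
proof -
  note u = assms(1)[unfolded L2_on_iff] and v = assms(2)[unfolded L2_on_iff]
  have [measurable]: "(\<lambda>x. indicator \<Omega> x * u x) \<in> borel_measurable lebesgue"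
      "(\<lambda>x. indicator \<Omega> x * v x) \<in> borel_measurable lebesgue" using u v by auto
  have "integrable lebesgue (\<lambda>x. (indicator \<Omega> x * u x) * (indicator \<Omega> x * v x))"
    using u v by (intro integrable_mult_square_integrable) auto
  hence "integrable lebesgue (\<lambda>x. (indicator \<Omega> x * u x)\<^sup>2 + (indicator \<Omega> x * v x)\<^sup>2
      + 2 * ((indicator \<Omega> x * u x) * (indicator \<Omega> x * v x)))"
    using u v by simp
  moreover have "(indicator \<Omega> x * u x)\<^sup>2 + (indicator \<Omega> x * v x)\<^sup>2
      + 2 * ((indicator \<Omega> x * u x) * (indicator \<Omega> x * v x)) = (indicator \<Omega> x * (u x + v x))\<^sup>2" for x
    by (simp add: power2_eq_square algebra_simps)
  moreover have "(\<lambda>x. indicator \<Omega> x * u x + indicator \<Omega> x * v x) \<in> borel_measurable lebesgue"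
    by measurable
  ultimately show ?thesis unfolding L2_on_iff by (simp add: distrib_left)
qed

lemma L2_on_scale: 
  assumes "u \<in> L2_on \<Omega>"
  shows "(\<lambda>x. c * u x) \<in> L2_on \<Omega>"
proof -
  note u = assms(1)[unfolded L2_on_iff]
  have [measurable]: "(\<lambda>x. indicator \<Omega> x * u x) \<in> borel_measurable lebesgue" using u by auto
  have "(\<lambda>x. c * (indicator \<Omega> x * u x)) \<in> borel_measurable lebesgue" by measurable
  moreover have "integrable lebesgue (\<lambda>x. c\<^sup>2 * (indicator \<Omega> x * u x)\<^sup>2)" using u by simp
  ultimately show ?thesis unfolding L2_on_iff by (simp add: power_mult_distrib mult_ac)
qed

lemma L2_on_diff: "u \<in> L2_on \<Omega> \<Longrightarrow> v \<in> L2_on \<Omega> \<Longrightarrow> (\<lambda>x. u x - v x) \<in> L2_on \<Omega>"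
  using L2_on_add[of u \<Omega> "\<lambda>x. (-1) * v x"] L2_on_scale[of v \<Omega> "-1"] by simp

lemma L2_on_mult:
  assumes "u \<in> L2_on \<Omega>" "v \<in> L2_on \<Omega>"
  shows "set_integrable lebesgue \<Omega> (\<lambda>x. u x * v x)"
proof -
  have "integrable lebesgue (\<lambda>x. (indicator \<Omega> x * u x) * (indicator \<Omega> x * v x))"
    using assms unfolding L2_on_iff by (intro integrable_mult_square_integrable) auto
  moreover have "(indicator \<Omega> x * u x) * (indicator \<Omega> x * v x) = indicator \<Omega> x *\<^sub>R (u x * v x)" for x
    by (simp add: indicator_def)
  ultimately show ?thesis by (simp add: set_integrable_def)
qed

lemma L2_on_square: "u \<in> L2_on \<Omega> \<Longrightarrow> set_integrable lebesgue \<Omega> (\<lambda>x. (u x)\<^sup>2)"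
  by (simp add: L2_on_def)

lemma bounded_borel_L2_on:
  fixes u :: "'a::euclidean_space \<Rightarrow> real"
  assumes \<Omega>: "open \<Omega>" "bounded \<Omega>" and u [measurable]: "u \<in> borel_measurable borel"
    and B: "\<And>x. x \<in> \<Omega> \<Longrightarrow> \<bar>u x\<bar> \<le> B"
  shows "u \<in> L2_on \<Omega>"
proof -
  have [measurable]: "\<Omega> \<in> sets borel" using \<Omega> by simp
  obtain R where "\<Omega> \<subseteq> cball 0 R" using bounded_subset_cball_0[OF \<Omega>(2)] by blast
  hence "emeasure lborel \<Omega> \<le> emeasure lborel (cball (0::'a) R)" by (intro emeasure_mono) auto
  hence fin: "emeasure lborel \<Omega> < \<infinity>"
    using emeasure_lborel_cball_finite[of "0::'a" R] by (rule order.strict_trans1)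
  have "integrable lborel (\<lambda>x. (indicator \<Omega> x * u x)\<^sup>2)"
  proof (rule integrableI_bounded_set[where A = \<Omega> and B = "B\<^sup>2"])
    show "AE x in lborel. x \<in> \<Omega> \<longrightarrow> norm ((indicator \<Omega> x * u x)\<^sup>2) \<le> B\<^sup>2"
      using power_mono[OF B abs_ge_zero, of _ 2] by (intro AE_I2) (simp add: indicator_def)
  qed (use fin in auto)
  hence "integrable lebesgue (\<lambda>x. (indicator \<Omega> x * u x)\<^sup>2)"
    by (subst integrable_completion) auto
  moreover have "(\<lambda>x. indicator \<Omega> x * u x) \<in> borel_measurable lebesgue"
    by (intro measurable_completion) measurable
  ultimately show ?thesis by (simp add: L2_on_iff)
qed

lemma continuous_L2_on:
  fixes u :: "'a::euclidean_space \<Rightarrow> real"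
  assumes \<Omega>: "open \<Omega>" "bounded \<Omega>" and u: "continuous_on UNIV u"
  shows "u \<in> L2_on \<Omega>"
proof -
  have "compact (closure \<Omega>)" using \<Omega> by simp
  hence "bounded (u ` closure \<Omega>)"
    using u by (intro compact_imp_bounded compact_continuous_image) (auto intro: continuous_on_subset)
  then obtain B where "\<forall>y\<in>u ` closure \<Omega>. norm y \<le> B" unfolding bounded_iff by blast
  hence "\<bar>u x\<bar> \<le> B" if "x \<in> \<Omega>" for x using that closure_subset[of \<Omega>] by auto
  thus ?thesis using u by (intro bounded_borel_L2_on[OF \<Omega>] borel_measurable_continuous_onI)
qed

section \<open>The space \<open>H10\<close>\<close>

lemma test_functionsD:
  assumes "\<phi> \<in> test_functions \<Omega>"
  shows "smooth \<phi>" "x \<notin> \<Omega> \<Longrightarrow> \<phi> x = 0" "x \<notin> \<Omega> \<Longrightarrow> partial_deriv b \<phi> x = 0"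
    "\<exists>R. \<forall>x. x \<notin> cball 0 R \<longrightarrow> \<phi> x = 0"
    "continuous_on UNIV \<phi>" "b \<in> Basis \<Longrightarrow> continuous_on UNIV (partial_deriv b \<phi>)"
proof -
  note \<phi> = assms[unfolded test_functions_def mem_Collect_eq]
  show s: "smooth \<phi>" using \<phi> by blast
  have out: "x \<notin> closure {x. \<phi> x \<noteq> 0}" if "x \<notin> \<Omega>" using \<phi> that by blast
  show "\<phi> x = 0" if "x \<notin> \<Omega>"
    using out[OF that] closure_subset[of "{x. \<phi> x \<noteq> 0}"] by blast
  show "partial_deriv b \<phi> x = 0" if "x \<notin> \<Omega>"
    by (rule partial_deriv_outside_support[OF out[OF that]])
  obtain R where "closure {x. \<phi> x \<noteq> 0} \<subseteq> cball 0 R"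
    using \<phi> bounded_subset_cball_0[OF compact_imp_bounded] by blast
  thus "\<exists>R. \<forall>x. x \<notin> cball 0 R \<longrightarrow> \<phi> x = 0"
    using closure_subset[of "{x. \<phi> x \<noteq> 0}"] by blast
  show "continuous_on UNIV \<phi>" "b \<in> Basis \<Longrightarrow> continuous_on UNIV (partial_deriv b \<phi>)"
    using s smooth_continuous smooth_partial by blast+
qed

lemma test_functions_partial: "\<phi> \<in> test_functions \<Omega> \<Longrightarrow> b \<in> Basis \<Longrightarrow> partial_deriv b \<phi> \<in> test_functions \<Omega>"
proof -
  assume \<phi>: "\<phi> \<in> test_functions \<Omega>" and b: "b \<in> Basis"
  have "closure {x. partial_deriv b \<phi> x \<noteq> 0} \<subseteq> closure {x. \<phi> x \<noteq> 0}"
    using partial_deriv_outside_support[of _ \<phi> b] by (intro closure_minimal) auto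
  moreover have "compact (closure {x. \<phi> x \<noteq> 0})" "closure {x. \<phi> x \<noteq> 0} \<subseteq> \<Omega>"
    using \<phi> by (auto simp: test_functions_def)
  ultimately show ?thesis
    using smooth_partial[OF test_functionsD(1)[OF \<phi>] b] compact_Int_closed[of "closure {x. \<phi> x \<noteq> 0}"
        "closure {x. partial_deriv b \<phi> x \<noteq> 0}"] by (auto simp: test_functions_def Int_absorb1)
qed

lemma test_functions_L2: "open \<Omega> \<Longrightarrow> bounded \<Omega> \<Longrightarrow> \<phi> \<in> test_functions \<Omega> \<Longrightarrow> \<phi> \<in> L2_on \<Omega>"
  using continuous_L2_on test_functionsD(5) by blast

lemma test_functionsI:
  assumes "smooth \<phi>" "closed C" "bounded C" "C \<subseteq> \<Omega>" "\<And>x. x \<notin> C \<Longrightarrow> \<phi> x = 0"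
  shows "\<phi> \<in> test_functions \<Omega>"
proof -
  have "closure {x. \<phi> x \<noteq> 0} \<subseteq> C" using assms by (intro closure_minimal) auto
  thus ?thesis using assms by (auto simp: test_functions_def intro: bounded_subset)
qed

lemma smth_lipschitz_on_cball:
  assumes "smth f"
  shows "\<exists>L. \<forall>x\<in>cball 0 R. \<forall>y\<in>cball 0 R. \<bar>f x - f y\<bar> \<le> L * norm (x - y)"
proof -
  have "continuous_on (cball 0 R) (\<lambda>x. \<Sum>b\<in>Basis. \<bar>partial_deriv b f x\<bar>)"
    using assms by (intro continuous_intros smth_continuous smth_partial)
  hence "bounded ((\<lambda>x. \<Sum>b\<in>Basis. \<bar>partial_deriv b f x\<bar>) ` cball 0 R)"
    by (intro compact_imp_bounded compact_continuous_image compact_cball)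
  then obtain B where "\<forall>y\<in>(\<lambda>x. \<Sum>b\<in>Basis. \<bar>partial_deriv b f x\<bar>) ` cball 0 R. norm y \<le> B"
    unfolding bounded_iff by blast
  hence B: "(\<Sum>b\<in>Basis. \<bar>partial_deriv b f x\<bar>) \<le> B" if "x \<in> cball 0 R" for x
    using that by fastforce
  have "\<bar>f x - f y\<bar> \<le> B * norm (x - y)" if "x \<in> cball 0 R" "y \<in> cball 0 R" for x y
  proof -
    have "norm (f x - f y) \<le> B * norm (x - y)"
    proof (rule differentiable_bound[where S = "cball 0 R" and f' = "\<lambda>x h. partial_deriv h f x"])
      show "(f has_derivative (\<lambda>h. partial_deriv h f x)) (at x within cball 0 R)" for x
        using has_derivative_partial_deriv[OF smth_differentiable[OF assms]] by (rule has_derivative_at_withinI)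
      show "onorm (\<lambda>h. partial_deriv h f x) \<le> B" if x: "x \<in> cball 0 R" for x
      proof (rule onorm_le)
        fix h
        have "partial_deriv h f x = (\<Sum>b\<in>Basis. (h \<bullet> b) * partial_deriv b f x)"
          by (rule partial_deriv_expansion[OF smth_differentiable[OF assms]])
        also have "norm \<dots> \<le> (\<Sum>b\<in>Basis. norm h * \<bar>partial_deriv b f x\<bar>)"
          by (intro sum_norm_le) (auto simp: abs_mult intro!: mult_right_mono Basis_le_norm)
        also have "\<dots> \<le> B * norm h"
          using mult_left_mono[OF B[OF x] norm_ge_zero[of h]] by (simp add: sum_distrib_left mult.commute)
        finally show "norm (partial_deriv h f x) \<le> B * norm h" .
      qed
    qed (use that in auto)
    thus ?thesis by simp
  qed
  thus ?thesis by blast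
qed

lemma smth_integration_by_parts:
  assumes "smth f" "\<phi> \<in> test_functions \<Omega>" "b \<in> Basis"
  shows "(\<integral>x. f x * partial_deriv b \<phi> x \<partial>lborel) = - (\<integral>x. partial_deriv b f x * \<phi> x \<partial>lborel)"
  using smth_integration_by_parts_compact[OF assms(1) test_functionsD(1)[OF assms(2)] _ assms(3)]
    test_functionsD(4)[OF assms(2)] by blast

abbreviation L2_conv :: "'a::euclidean_space set \<Rightarrow> (nat \<Rightarrow> 'a \<Rightarrow> real) \<Rightarrow> ('a \<Rightarrow> real) \<Rightarrow> bool" where
  "L2_conv \<Omega> a l \<equiv> (\<lambda>n. LINT x:\<Omega>|lebesgue. (a n x - l x)\<^sup>2) \<longlonglongrightarrow> 0"

text \<open>The witnesses in \<open>H10\<close>, with the single limit there split into one limit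
  for the function and one for each partial derivative.\<close>

definition H10_approx ::
  "'a::euclidean_space set \<Rightarrow> ('a \<Rightarrow> real) \<Rightarrow> ('a \<Rightarrow> 'a \<Rightarrow> real) \<Rightarrow> (nat \<Rightarrow> 'a \<Rightarrow> real) \<Rightarrow> bool" where
  "H10_approx \<Omega> u g \<phi> \<longleftrightarrow> u \<in> L2_on \<Omega> \<and> (\<forall>b\<in>Basis. g b \<in> L2_on \<Omega>) \<and>
     (\<forall>b\<in>Basis. weak_partial \<Omega> b u (g b)) \<and> (\<forall>n. \<phi> n \<in> test_functions \<Omega>) \<and>
     L2_conv \<Omega> \<phi> u \<and> (\<forall>b\<in>Basis. L2_conv \<Omega> (\<lambda>n. partial_deriv b (\<phi> n)) (g b))"

lemma H10_approxD:
  assumes "H10_approx \<Omega> u g \<phi>"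
  shows "u \<in> L2_on \<Omega>" "b \<in> Basis \<Longrightarrow> g b \<in> L2_on \<Omega>" "b \<in> Basis \<Longrightarrow> weak_partial \<Omega> b u (g b)"
    "\<phi> n \<in> test_functions \<Omega>" "L2_conv \<Omega> \<phi> u" "b \<in> Basis \<Longrightarrow> L2_conv \<Omega> (\<lambda>n. partial_deriv b (\<phi> n)) (g b)"
  using assms by (auto simp: H10_approx_def)

lemma H10_E:
  assumes u: "u \<in> H10 \<Omega>" and \<Omega>: "open \<Omega>" "bounded \<Omega>"
  obtains g \<phi> where "H10_approx \<Omega> u g \<phi>"
proof -
  let ?I = "\<lambda>g \<phi> n. LINT x:\<Omega>|lebesgue. (\<phi> n x - g x :: real)\<^sup>2"
  from u obtain g \<phi> where *: "u \<in> L2_on \<Omega>" "\<And>b. b \<in> Basis \<Longrightarrow> g b \<in> L2_on \<Omega>"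
    "\<And>b. b \<in> Basis \<Longrightarrow> weak_partial \<Omega> b u (g b)" "\<And>n. \<phi> n \<in> test_functions \<Omega>"
    and lim: "(\<lambda>n. ?I u \<phi> n + (\<Sum>b\<in>Basis. ?I (g b) (\<lambda>n. partial_deriv b (\<phi> n)) n)) \<longlonglongrightarrow> 0"
    unfolding H10_def by blast
  have nn: "0 \<le> (LINT x:\<Omega>|lebesgue. (f x)\<^sup>2)" for f :: "'a \<Rightarrow> real"
    unfolding set_lebesgue_integral_def by (rule Bochner_Integration.integral_nonneg) simp
  have "L2_conv \<Omega> \<phi> u"
    by (rule tendsto_sandwich[OF _ _ tendsto_const lim]) (auto intro!: always_eventually nn sum_nonneg)
  moreover have "L2_conv \<Omega> (\<lambda>n. partial_deriv b (\<phi> n)) (g b)" if b: "b \<in> Basis" for b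
  proof (rule tendsto_sandwich[OF _ _ tendsto_const lim])
    have "?I (g b) (\<lambda>n. partial_deriv b (\<phi> n)) n \<le>
        ?I u \<phi> n + (\<Sum>b\<in>Basis. ?I (g b) (\<lambda>n. partial_deriv b (\<phi> n)) n)" for n
      using member_le_sum[OF b, of "\<lambda>b. ?I (g b) (\<lambda>n. partial_deriv b (\<phi> n)) n"] nn
      by (intro add_increasing) auto
    thus "\<forall>\<^sub>F n in sequentially. ?I (g b) (\<lambda>n. partial_deriv b (\<phi> n)) n \<le>
        ?I u \<phi> n + (\<Sum>b\<in>Basis. ?I (g b) (\<lambda>n. partial_deriv b (\<phi> n)) n)"
      by (intro always_eventually allI)
  qed (auto intro!: always_eventually nn)
  ultimately show ?thesis using that * unfolding H10_approx_def by blast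
qed

lemma H10_I:
  assumes "H10_approx \<Omega> u g \<phi>"
  shows "u \<in> H10 \<Omega>"
proof -
  note * = H10_approxD[OF assms]
  have "(\<lambda>n. (LINT x:\<Omega>|lebesgue. (\<phi> n x - u x)\<^sup>2) +
      (\<Sum>b\<in>Basis. LINT x:\<Omega>|lebesgue. (partial_deriv b (\<phi> n) x - g b x)\<^sup>2)) \<longlonglongrightarrow> 0 + (\<Sum>b\<in>(Basis :: 'a set). 0)"
    by (rule tendsto_add[OF *(5) tendsto_sum[OF *(6)]])
  thus ?thesis unfolding H10_def using * by auto
qed

lemma L2_dist_tendsto_add:
  assumes "\<And>n. a n \<in> L2_on \<Omega>" "\<And>n. b n \<in> L2_on \<Omega>"
    and "(\<lambda>n. LINT x:\<Omega>|lebesgue. (a n x)\<^sup>2) \<longlonglongrightarrow> 0" "(\<lambda>n. LINT x:\<Omega>|lebesgue. (b n x)\<^sup>2) \<longlonglongrightarrow> 0"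
  shows "(\<lambda>n. LINT x:\<Omega>|lebesgue. (a n x + b n x)\<^sup>2) \<longlonglongrightarrow> 0"
proof (rule tendsto_sandwich[OF _ _ tendsto_const])
  show "(\<lambda>n. 2 * (LINT x:\<Omega>|lebesgue. (a n x)\<^sup>2) + 2 * (LINT x:\<Omega>|lebesgue. (b n x)\<^sup>2)) \<longlonglongrightarrow> 0"
    using tendsto_add[OF tendsto_mult_left[OF assms(3), of 2] tendsto_mult_left[OF assms(4), of 2]] by simp
  show "\<forall>\<^sub>F n in sequentially. 0 \<le> (LINT x:\<Omega>|lebesgue. (a n x + b n x)\<^sup>2)"
    unfolding set_lebesgue_integral_def by (intro always_eventually allI Bochner_Integration.integral_nonneg) simp
  show "\<forall>\<^sub>F n in sequentially. (LINT x:\<Omega>|lebesgue. (a n x + b n x)\<^sup>2) \<le>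
      2 * (LINT x:\<Omega>|lebesgue. (a n x)\<^sup>2) + 2 * (LINT x:\<Omega>|lebesgue. (b n x)\<^sup>2)"
  proof (intro always_eventually allI)
    fix n
    note i = L2_on_square[OF assms(1)[of n]] L2_on_square[OF assms(2)[of n]]
    have "(LINT x:\<Omega>|lebesgue. (a n x + b n x)\<^sup>2) \<le> (LINT x:\<Omega>|lebesgue. 2 * (a n x)\<^sup>2 + 2 * (b n x)\<^sup>2)"
    proof (rule set_integral_mono)
      show "set_integrable lebesgue \<Omega> (\<lambda>x. (a n x + b n x)\<^sup>2)"
        using L2_on_square[OF L2_on_add[OF assms(1,2)]] .
      show "set_integrable lebesgue \<Omega> (\<lambda>x. 2 * (a n x)\<^sup>2 + 2 * (b n x)\<^sup>2)"
        using i by (intro set_integral_add(1)) auto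
      show "(a n x + b n x)\<^sup>2 \<le> 2 * (a n x)\<^sup>2 + 2 * (b n x)\<^sup>2" for x
        using zero_le_power2[of "a n x - b n x"] by (simp add: power2_sum power2_diff)
    qed
    also have "\<dots> = 2 * (LINT x:\<Omega>|lebesgue. (a n x)\<^sup>2) + 2 * (LINT x:\<Omega>|lebesgue. (b n x)\<^sup>2)"
      using i by (subst set_integral_add) auto
    finally show "(LINT x:\<Omega>|lebesgue. (a n x + b n x)\<^sup>2) \<le>
      2 * (LINT x:\<Omega>|lebesgue. (a n x)\<^sup>2) + 2 * (LINT x:\<Omega>|lebesgue. (b n x)\<^sup>2)" .
  qed
qed

lemma test_functions_linear:
  assumes "\<phi> \<in> test_functions \<Omega>" "\<psi> \<in> test_functions \<Omega>"
  shows "(\<lambda>x. c * \<phi> x + \<psi> x) \<in> test_functions \<Omega>"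
    "partial_deriv b (\<lambda>x. c * \<phi> x + \<psi> x) x = c * partial_deriv b \<phi> x + partial_deriv b \<psi> x"
proof -
  have pd: "partial_deriv b (\<lambda>x. c * f x + g x) = (\<lambda>x. c * partial_deriv b f x + partial_deriv b g x)"
    if "smooth f" "smooth g" for f g :: "'a \<Rightarrow> real" and b
    using that by (intro ext partial_deriv_eq has_derivative_add has_derivative_mult_right
        has_derivative_partial_deriv smooth_differentiable)
  show "partial_deriv b (\<lambda>x. c * \<phi> x + \<psi> x) x = c * partial_deriv b \<phi> x + partial_deriv b \<psi> x"
    using fun_cong[OF pd[OF test_functionsD(1)[OF assms(1)] test_functionsD(1)[OF assms(2)]]] .
  let ?L = "{\<lambda>x. c * f x + g x | f g. smooth f \<and> smooth g}"
  have "smooth (\<lambda>x. c * \<phi> x + \<psi> x)"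
  proof (rule smooth_coinduct_set[of _ ?L])
    show "(\<lambda>x. c * \<phi> x + \<psi> x) \<in> ?L" using assms test_functionsD(1) by blast
  next
    fix h :: "'a \<Rightarrow> real" and x b :: 'a
    assume "h \<in> ?L"
    then obtain f g where h: "h = (\<lambda>x. c * f x + g x)" "smooth f" "smooth g" by blast
    show "h differentiable (at x)" unfolding h(1) using h(2,3)
      by (intro differentiable_add differentiable_mult differentiable_const smooth_differentiable)
    show "partial_deriv b h \<in> ?L" if "b \<in> Basis"
      unfolding h(1) pd[OF h(2,3)] using smooth_partial[OF h(2) that] smooth_partial[OF h(3) that] by blast
  qed
  moreover have "c * \<phi> x + \<psi> x = 0" if "x \<notin> closure {x. \<phi> x \<noteq> 0} \<union> closure {x. \<psi> x \<noteq> 0}" for x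
  proof -
    have "x \<notin> {x. \<phi> x \<noteq> 0}" "x \<notin> {x. \<psi> x \<noteq> 0}"
      using that closure_subset[of "{x. \<phi> x \<noteq> 0}"] closure_subset[of "{x. \<psi> x \<noteq> 0}"] by blast+
    thus ?thesis by simp
  qed
  ultimately show "(\<lambda>x. c * \<phi> x + \<psi> x) \<in> test_functions \<Omega>"
    using assms by (intro test_functionsI[of _ "closure {x. \<phi> x \<noteq> 0} \<union> closure {x. \<psi> x \<noteq> 0}"])
      (auto simp: test_functions_def)
qed

lemma H10_linear:
  fixes u v :: "'a::euclidean_space \<Rightarrow> real"
  assumes \<Omega>: "open \<Omega>" "bounded \<Omega>" and u: "u \<in> H10 \<Omega>" and v: "v \<in> H10 \<Omega>"
  shows "(\<lambda>x. c * u x + v x) \<in> H10 \<Omega>"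
proof -
  obtain g \<phi> where 1: "H10_approx \<Omega> u g \<phi>" by (rule H10_E[OF u \<Omega>])
  obtain g' \<phi>' where 2: "H10_approx \<Omega> v g' \<phi>'" by (rule H10_E[OF v \<Omega>])
  note 1 = H10_approxD[OF 1] and 2 = H10_approxD[OF 2]
  note L2 = test_functions_L2[OF \<Omega>]
  have sum: "L2_conv \<Omega> (\<lambda>n x. c * a n x + a' n x) (\<lambda>x. c * l x + l' x)"
    if "L2_conv \<Omega> a l" "L2_conv \<Omega> a' l'" "\<And>n. a n \<in> L2_on \<Omega>" "\<And>n. a' n \<in> L2_on \<Omega>" "l \<in> L2_on \<Omega>" "l' \<in> L2_on \<Omega>"
    for a a' l l'
  proof -
    have "(c * (a n x - l x))\<^sup>2 = c\<^sup>2 * (a n x - l x)\<^sup>2" for n x by (simp add: power_mult_distrib)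
    hence "(\<lambda>n. LINT x:\<Omega>|lebesgue. (c * (a n x - l x))\<^sup>2) \<longlonglongrightarrow> 0"
      using tendsto_mult_left[OF that(1), of "c\<^sup>2"] by simp
    from L2_dist_tendsto_add[OF L2_on_scale[OF L2_on_diff[OF that(3,5)]] L2_on_diff[OF that(4,6)] this that(2)]
    show ?thesis by (simp add: algebra_simps)
  qed
  have "H10_approx \<Omega> (\<lambda>x. c * u x + v x) (\<lambda>b x. c * g b x + g' b x) (\<lambda>n x. c * \<phi> n x + \<phi>' n x)"
    unfolding H10_approx_def
  proof (intro conjI ballI allI)
    show "(\<lambda>x. c * u x + v x) \<in> L2_on \<Omega>" by (rule L2_on_add[OF L2_on_scale[OF 1(1)] 2(1)])
    show "(\<lambda>x. c * g b x + g' b x) \<in> L2_on \<Omega>" if "b \<in> Basis" for b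
      by (rule L2_on_add[OF L2_on_scale[OF 1(2)] 2(2)]; rule that)
    show "weak_partial \<Omega> b (\<lambda>x. c * u x + v x) (\<lambda>x. c * g b x + g' b x)" if b: "b \<in> Basis" for b
      unfolding weak_partial_def
    proof
      fix \<psi> assume \<psi>: "\<psi> \<in> test_functions \<Omega>"
      note T = L2[OF \<psi>] L2[OF test_functions_partial[OF \<psi> b]]
      have "set_integrable lebesgue \<Omega> (\<lambda>x. u x * partial_deriv b \<psi> x)" "set_integrable lebesgue \<Omega> (\<lambda>x. v x * partial_deriv b \<psi> x)"
        "set_integrable lebesgue \<Omega> (\<lambda>x. g b x * \<psi> x)" "set_integrable lebesgue \<Omega> (\<lambda>x. g' b x * \<psi> x)"
        using L2_on_mult[OF 1(1) T(2)] L2_on_mult[OF 2(1) T(2)] L2_on_mult[OF 1(2)[OF b] T(1)] L2_on_mult[OF 2(2)[OF b] T(1)] .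
      thus "(LINT x:\<Omega>|lebesgue. (c * u x + v x) * partial_deriv b \<psi> x) =
          - (LINT x:\<Omega>|lebesgue. (c * g b x + g' b x) * \<psi> x)"
        using 1(3)[OF b] 2(3)[OF b] \<psi> unfolding weak_partial_def distrib_right mult.assoc
        by (simp add: set_integral_add)
    qed
    show "(\<lambda>x. c * \<phi> n x + \<phi>' n x) \<in> test_functions \<Omega>" for n
      by (rule test_functions_linear[OF 1(4) 2(4)])
    show "L2_conv \<Omega> (\<lambda>n x. c * \<phi> n x + \<phi>' n x) (\<lambda>x. c * u x + v x)"
      by (rule sum[OF 1(5) 2(5) L2[OF 1(4)] L2[OF 2(4)] 1(1) 2(1)])
    show "L2_conv \<Omega> (\<lambda>n. partial_deriv b (\<lambda>x. c * \<phi> n x + \<phi>' n x)) (\<lambda>x. c * g b x + g' b x)"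
      if b: "b \<in> Basis" for b unfolding test_functions_linear(2)[OF 1(4) 2(4)]
      by (rule sum[OF 1(6)[OF b] 2(6)[OF b] L2[OF test_functions_partial[OF 1(4) b]]
            L2[OF test_functions_partial[OF 2(4) b]] 1(2)[OF b] 2(2)[OF b]])
  qed
  thus ?thesis by (rule H10_I)
qed

lemma H10_add: "open \<Omega> \<Longrightarrow> bounded \<Omega> \<Longrightarrow> u \<in> H10 \<Omega> \<Longrightarrow> v \<in> H10 \<Omega> \<Longrightarrow> (\<lambda>x. u x + v x) \<in> H10 \<Omega>"
  using H10_linear[of \<Omega> u v 1] by simp

lemma H10_scale: "open \<Omega> \<Longrightarrow> bounded \<Omega> \<Longrightarrow> u \<in> H10 \<Omega> \<Longrightarrow> (\<lambda>x. c * u x) \<in> H10 \<Omega>"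
  using H10_linear[of \<Omega> u u "c - 1"] by (simp add: algebra_simps)

text \<open>Here \<psi> need not vanish near the boundary. The approximants have compact support in
  \<Omega>, so the formula holds for each of them and passes to the limit. This absence of a
  boundary term is what zero boundary values amount to.\<close>

lemma H10_integration_by_parts:
  assumes \<Omega>: "open \<Omega>" "bounded \<Omega>" and u: "u \<in> L2_on \<Omega>" and g: "g \<in> L2_on \<Omega>" and b: "b \<in> Basis"
    and \<phi>: "\<And>n. \<phi> n \<in> test_functions \<Omega>"
    and lim: "L2_conv \<Omega> \<phi> u" "L2_conv \<Omega> (\<lambda>n. partial_deriv b (\<phi> n)) g"
    and \<psi>: "smth \<psi>"
  shows "(LINT x:\<Omega>|lebesgue. u x * partial_deriv b \<psi> x) = - (LINT x:\<Omega>|lebesgue. g x * \<psi> x)"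
proof -
  have [measurable]: "\<Omega> \<in> sets borel" using \<Omega> by simp
  have pairing: "(\<lambda>n. LINT x:\<Omega>|lebesgue. a n x * f x) \<longlonglongrightarrow> (LINT x:\<Omega>|lebesgue. v x * f x)"
    if a: "\<And>n. a n \<in> L2_on \<Omega>" and v: "v \<in> L2_on \<Omega>" and f: "smth f"
      and l: "L2_conv \<Omega> a v" for a v f
  proof -
    have fL: "f \<in> L2_on \<Omega>" by (intro continuous_L2_on \<Omega> smth_continuous f)
    note d = L2_on_diff[OF a v, unfolded L2_on_iff]
    have "(\<lambda>n. \<integral>x. (indicator \<Omega> x * (a n x - v x)) * (indicator \<Omega> x * f x) \<partial>lebesgue) \<longlonglongrightarrow> 0"
    proof (rule integral_mult_tendsto_0)
      show "(\<lambda>n. \<integral>x. (indicator \<Omega> x * (a n x - v x))\<^sup>2 \<partial>lebesgue) \<longlonglongrightarrow> 0"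
      proof -
        have "(indicator \<Omega> x * (a n x - v x))\<^sup>2 = indicator \<Omega> x *\<^sub>R (a n x - v x)\<^sup>2" for n x
          by (simp add: indicator_def)
        with l show ?thesis by (simp add: set_lebesgue_integral_def)
      qed
    qed (use d fL[unfolded L2_on_iff] in auto)
    moreover have "(indicator \<Omega> x * (a n x - v x)) * (indicator \<Omega> x * f x) =
        indicator \<Omega> x *\<^sub>R (a n x * f x - v x * f x)" for n x
      by (simp add: indicator_def algebra_simps)
    ultimately have "(\<lambda>n. LINT x:\<Omega>|lebesgue. a n x * f x - v x * f x) \<longlonglongrightarrow> 0"
      by (simp add: set_lebesgue_integral_def)
    hence "(\<lambda>n. (LINT x:\<Omega>|lebesgue. a n x * f x) - (LINT x:\<Omega>|lebesgue. v x * f x)) \<longlonglongrightarrow> 0"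
      by (simp only: set_integral_diff(2)[OF L2_on_mult[OF a fL] L2_on_mult[OF v fL]])
    thus ?thesis by (rule LIM_zero_cancel)
  qed
  note L2 = test_functions_L2[OF \<Omega>]
  have eq: "(LINT x:\<Omega>|lebesgue. \<phi> n x * partial_deriv b \<psi> x) =
      - (LINT x:\<Omega>|lebesgue. partial_deriv b (\<phi> n) x * \<psi> x)" for n
  proof -
    have m: "\<phi> n \<in> borel_measurable borel" "partial_deriv b (\<phi> n) \<in> borel_measurable borel"
        "\<psi> \<in> borel_measurable borel" "partial_deriv b \<psi> \<in> borel_measurable borel"
      using test_functionsD(5,6)[OF \<phi>] b smth_continuous[OF \<psi>] smth_continuous[OF smth_partial[OF \<psi>]]
      by (auto intro: borel_measurable_continuous_onI)
    have "(LINT x:\<Omega>|lebesgue. \<phi> n x * partial_deriv b \<psi> x) = (\<integral>x. \<phi> n x * partial_deriv b \<psi> x \<partial>lborel)"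
      by (rule set_lebesgue_integral_eq_lborel_support) (use m test_functionsD(2)[OF \<phi>] in auto)
    moreover have "(LINT x:\<Omega>|lebesgue. partial_deriv b (\<phi> n) x * \<psi> x) = (\<integral>x. partial_deriv b (\<phi> n) x * \<psi> x \<partial>lborel)"
      by (rule set_lebesgue_integral_eq_lborel_support) (use m test_functionsD(3)[OF \<phi>] in auto)
    ultimately show ?thesis using smth_integration_by_parts[OF \<psi> \<phi> b, of n] by (simp add: mult.commute)
  qed
  have "(\<lambda>n. LINT x:\<Omega>|lebesgue. \<phi> n x * partial_deriv b \<psi> x) \<longlonglongrightarrow> (LINT x:\<Omega>|lebesgue. u x * partial_deriv b \<psi> x)"
    by (rule pairing[OF L2[OF \<phi>] u smth_partial[OF \<psi>] lim(1)])
  moreover have "(\<lambda>n. LINT x:\<Omega>|lebesgue. \<phi> n x * partial_deriv b \<psi> x) \<longlonglongrightarrow> - (LINT x:\<Omega>|lebesgue. g x * \<psi> x)"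
    unfolding eq by (intro tendsto_minus pairing[OF L2[OF test_functions_partial[OF \<phi> b]] g \<psi> lim(2)])
  ultimately show ?thesis by (rule LIMSEQ_unique)
qed

text \<open>The shift keeps the function zero near the hyperplane, so that products with it have
  support inside \<Omega>. The growing factor drives the argument of \<open>flat\<close> to infinity
  on the open half-space and the value there to 1.\<close>

definition half_cutoff :: "'a::euclidean_space \<Rightarrow> 'a \<Rightarrow> nat \<Rightarrow> 'a \<Rightarrow> real" where
  "half_cutoff a n m x = flat 1 (((x - a) \<bullet> n - 1 / real (Suc m)) * (real (Suc m))\<^sup>2)"

lemma smth_half_cutoff: "smth (half_cutoff a n m)"
proof -
  have "(x - a) \<bullet> n = x \<bullet> n - a \<bullet> n" for x by (simp add: inner_diff_left)
  thus ?thesis unfolding half_cutoff_def by (simp only:) (intro smth.flat smth.mult smth_diff smth.inner smth.const)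
qed

lemma half_cutoff_bounds: "0 \<le> half_cutoff a n m x" "half_cutoff a n m x \<le> 1"
  by (simp_all add: half_cutoff_def flat_1_nonneg flat_1_le)

lemma half_cutoff_nonzeroD: "half_cutoff a n m x \<noteq> 0 \<Longrightarrow> 1 / real (Suc m) \<le> (x - a) \<bullet> n"
  by (auto simp: half_cutoff_def flat_def zero_less_mult_iff split: if_splits)

lemma half_cutoff_tendsto: "(\<lambda>m. half_cutoff a n m x) \<longlonglongrightarrow> indicator {x. 0 < (x - a) \<bullet> n} x"
proof (cases "0 < (x - a) \<bullet> n")
  case True
  define s where "s = (x - a) \<bullet> n"
  have s: "s > 0" using True by (simp add: s_def)
  have inv: "(\<lambda>m. 1 / real (Suc m)) \<longlonglongrightarrow> 0"
    using LIMSEQ_Suc[OF lim_1_over_n[where 'a = real]] by simp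
  have "(\<lambda>m. exp (- ((1 / real (Suc m))\<^sup>2 / (s - 1 / real (Suc m))))) \<longlonglongrightarrow> exp (- (0\<^sup>2 / (s - 0)))"
    using s by (intro tendsto_intros inv) auto
  moreover have "\<forall>\<^sub>F m in sequentially. exp (- ((1 / real (Suc m))\<^sup>2 / (s - 1 / real (Suc m)))) = half_cutoff a n m x"
    using order_tendstoD(2)[OF inv s]
  proof (rule eventually_mono)
    fix m assume m: "1 / real (Suc m) < s"
    have "(1 / real (Suc m))\<^sup>2 / (s - 1 / real (Suc m)) = 1 / ((s - 1 / real (Suc m)) * (real (Suc m))\<^sup>2)"
      by (simp add: power_divide del: of_nat_Suc)
    with m show "exp (- ((1 / real (Suc m))\<^sup>2 / (s - 1 / real (Suc m)))) = half_cutoff a n m x"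
      by (simp add: half_cutoff_def flat_def s_def zero_less_mult_iff del: of_nat_Suc)
  qed
  ultimately have "(\<lambda>m. half_cutoff a n m x) \<longlonglongrightarrow> exp (- (0\<^sup>2 / (s - 0)))"
    by (rule Lim_transform_eventually)
  thus ?thesis using True by simp
next
  case False
  have "half_cutoff a n m x = 0" for m
    using half_cutoff_nonzeroD[of a n m x] False by (metis of_nat_0_less_iff order.trans divide_pos_pos
      zero_less_one zero_less_Suc order.strict_trans2)
  thus ?thesis using False by simp
qed

text \<open>Testing the weak derivative with cut-offs that vanish near the hyperplane identifies it with the
  classical derivative of \<open>p\<close> on the half ball.\<close>

lemma H10_half_ball_weak_partial:
  assumes \<Omega>: "open \<Omega>" "bounded \<Omega>" and u: "u \<in> L2_on \<Omega>" and g: "g \<in> L2_on \<Omega>" and b: "b \<in> Basis"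
    and wp: "weak_partial \<Omega> b u g" and p: "smth p"
    and half: "\<Omega> \<inter> ball a r = {x \<in> ball a r. 0 < (x - a) \<bullet> n}" and up: "\<And>x. x \<in> \<Omega> \<inter> ball a r \<Longrightarrow> u x = p x"
    and \<psi>: "smth \<psi>" "closed C" "C \<subseteq> ball a r" "\<And>x. x \<notin> C \<Longrightarrow> \<psi> x = 0"
  shows "(LINT x:\<Omega>|lebesgue. g x * \<psi> x) =
    (\<integral>x. indicator {x. 0 < (x - a) \<bullet> n} x * (partial_deriv b p x * \<psi> x) \<partial>lborel)"
proof -
  have [measurable]: "\<Omega> \<in> sets borel" using \<Omega> by simp
  let ?H = "{x. 0 < (x - a) \<bullet> n}"
  define \<theta> where "\<theta> = half_cutoff a n"
  have \<psi>out: "\<psi> x = 0" if "x \<notin> ball a r" for x using that \<psi> by blast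
  have [measurable]: "\<psi> \<in> borel_measurable borel" "p \<in> borel_measurable borel"
      "partial_deriv b p \<in> borel_measurable borel" "\<And>m. \<theta> m \<in> borel_measurable borel"
    using \<psi>(1) p smth_partial[OF p] smth_half_cutoff[of a n]
    by (auto simp: \<theta>_def intro!: borel_measurable_continuous_onI smth_continuous)
  have sm: "smth (\<lambda>x. \<psi> x * \<theta> m x)" for m
    unfolding \<theta>_def by (intro smth.mult \<psi>(1) smth_half_cutoff)
  have T: "(\<lambda>x. \<psi> x * \<theta> m x) \<in> test_functions \<Omega>" for m
  proof (rule test_functionsI)
    let ?C = "C \<inter> {x. 1 / real (Suc m) \<le> (x - a) \<bullet> n}"
    show "smooth (\<lambda>x. \<psi> x * \<theta> m x)" by (rule smth_smooth[OF sm])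
    show "closed ?C" by (intro closed_Int \<psi>(2) closed_Collect_le continuous_intros)
    show "bounded ?C" using \<psi>(3) bounded_ball by (meson bounded_Int bounded_subset)
    have "0 < (x - a) \<bullet> n" if "1 / real (Suc m) \<le> (x - a) \<bullet> n" for x
      by (rule less_le_trans[OF _ that]) simp
    thus "?C \<subseteq> \<Omega>" using \<psi>(3) half by blast
    show "\<psi> x * \<theta> m x = 0" if "x \<notin> ?C" for x
      using that \<psi>(4) half_cutoff_nonzeroD[of a n m x] by (auto simp: \<theta>_def)
  qed
  have eq: "(LINT x:\<Omega>|lebesgue. g x * (\<psi> x * \<theta> m x)) = (\<integral>x. partial_deriv b p x * (\<psi> x * \<theta> m x) \<partial>lborel)" for m
  proof -
    have pd_out: "partial_deriv b (\<lambda>x. \<psi> x * \<theta> m x) x = 0" if "x \<notin> ball a r" for x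
    proof (rule partial_deriv_outside_support)
      have "closure {x. \<psi> x * \<theta> m x \<noteq> 0} \<subseteq> C"
        using \<psi> by (intro closure_minimal) auto
      thus "x \<notin> closure {x. \<psi> x * \<theta> m x \<noteq> 0}" using that \<psi>(3) by blast
    qed
    have "(LINT x:\<Omega>|lebesgue. u x * partial_deriv b (\<lambda>x. \<psi> x * \<theta> m x) x) =
        (LINT x:\<Omega>|lebesgue. p x * partial_deriv b (\<lambda>x. \<psi> x * \<theta> m x) x)"
      unfolding set_lebesgue_integral_def
      by (intro Bochner_Integration.integral_cong refl) (use up pd_out in \<open>force simp: indicator_def\<close>)
    also have "\<dots> = (\<integral>x. p x * partial_deriv b (\<lambda>x. \<psi> x * \<theta> m x) x \<partial>lborel)"
      using test_functionsD(3)[OF T[of m]] smth_partial[OF sm[of m]]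
      by (intro set_lebesgue_integral_eq_lborel_support borel_measurable_times borel_measurable_continuous_onI
          smth_continuous p) auto
    also have "\<dots> = - (\<integral>x. partial_deriv b p x * (\<psi> x * \<theta> m x) \<partial>lborel)"
      by (rule smth_integration_by_parts[OF p T b])
    finally show ?thesis using wp T[of m] unfolding weak_partial_def by fastforce
  qed
  have int_g: "integrable lebesgue (\<lambda>x. indicator \<Omega> x *\<^sub>R (g x * \<psi> x))"
    using L2_on_mult[OF g continuous_L2_on[OF \<Omega> smth_continuous[OF \<psi>(1)]]] by (simp add: set_integrable_def)
  have int_p: "integrable lborel (\<lambda>x. partial_deriv b p x * \<psi> x)"
  proof -
    obtain R where R: "ball a r \<subseteq> cball 0 R" using bounded_subset_cball_0[OF bounded_ball] by blast
    have "partial_deriv b p x * \<psi> x = 0" if "x \<notin> cball 0 R" for x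
      using \<psi>out[of x] R that by fastforce
    thus ?thesis
      by (intro integrable_compact_support[of _ R] continuous_on_mult smth_continuous smth_partial p \<psi>(1))
  qed
  have lim_\<theta>: "(\<lambda>m. \<theta> m x) \<longlonglongrightarrow> indicator ?H x" for x
    unfolding \<theta>_def by (rule half_cutoff_tendsto)
  have "(\<lambda>m. LINT x:\<Omega>|lebesgue. g x * (\<psi> x * \<theta> m x)) \<longlonglongrightarrow> (LINT x:\<Omega>|lebesgue. g x * \<psi> x)"
    unfolding set_lebesgue_integral_def
  proof (rule integral_dominated_convergence)
    show "integrable lebesgue (\<lambda>x. norm (indicator \<Omega> x *\<^sub>R (g x * \<psi> x)))"
      by (rule integrable_norm[OF int_g])
    show "(\<lambda>x. indicator \<Omega> x *\<^sub>R (g x * \<psi> x)) \<in> borel_measurable lebesgue"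
      using int_g by blast
    have "(\<lambda>x. indicator \<Omega> x *\<^sub>R (g x * \<psi> x) * \<theta> m x) \<in> borel_measurable lebesgue" for m
      by (intro borel_measurable_times[OF borel_measurable_integrable[OF int_g]] measurable_completion) simp
    thus "(\<lambda>x. indicator \<Omega> x *\<^sub>R (g x * (\<psi> x * \<theta> m x))) \<in> borel_measurable lebesgue" for m
      by (simp add: mult.assoc)
    show "AE x in lebesgue. (\<lambda>m. indicator \<Omega> x *\<^sub>R (g x * (\<psi> x * \<theta> m x))) \<longlonglongrightarrow> indicator \<Omega> x *\<^sub>R (g x * \<psi> x)"
    proof (rule AE_I2)
      fix x
      have "(\<lambda>m. indicator \<Omega> x *\<^sub>R (g x * (\<psi> x * \<theta> m x))) \<longlonglongrightarrow> indicator \<Omega> x *\<^sub>R (g x * (\<psi> x * indicator ?H x))"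
        by (intro tendsto_intros lim_\<theta>)
      moreover have "indicator \<Omega> x *\<^sub>R (g x * (\<psi> x * indicator ?H x)) = indicator \<Omega> x *\<^sub>R (g x * \<psi> x)"
      proof (cases "x \<in> ball a r")
        case True
        hence "x \<in> \<Omega> \<Longrightarrow> x \<in> ?H" using half by blast
        thus ?thesis by (cases "x \<in> \<Omega>") simp_all
      qed (simp add: \<psi>out)
      ultimately show "(\<lambda>m. indicator \<Omega> x *\<^sub>R (g x * (\<psi> x * \<theta> m x))) \<longlonglongrightarrow> indicator \<Omega> x *\<^sub>R (g x * \<psi> x)"
        by (simp only:)
    qed
    show "AE x in lebesgue. norm (indicator \<Omega> x *\<^sub>R (g x * (\<psi> x * \<theta> m x))) \<le> norm (indicator \<Omega> x *\<^sub>R (g x * \<psi> x))" for m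
      using half_cutoff_bounds[of a n m]
      by (intro AE_I2) (auto simp: abs_mult \<theta>_def indicator_def intro!: mult_left_mono mult_left_le)
  qed
  moreover have "(\<lambda>m. \<integral>x. partial_deriv b p x * (\<psi> x * \<theta> m x) \<partial>lborel) \<longlonglongrightarrow>
      (\<integral>x. indicator ?H x * (partial_deriv b p x * \<psi> x) \<partial>lborel)"
  proof (rule integral_dominated_convergence)
    show "integrable lborel (\<lambda>x. norm (partial_deriv b p x * \<psi> x))" by (rule integrable_norm[OF int_p])
    have "?H \<in> sets borel" by (intro borel_open open_Collect_less continuous_intros)
    thus "(\<lambda>x. indicator ?H x * (partial_deriv b p x * \<psi> x)) \<in> borel_measurable lborel"
      by measurable
    show "(\<lambda>x. partial_deriv b p x * (\<psi> x * \<theta> m x)) \<in> borel_measurable lborel" for m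
      by measurable
    show "AE x in lborel. (\<lambda>m. partial_deriv b p x * (\<psi> x * \<theta> m x)) \<longlonglongrightarrow> indicator ?H x * (partial_deriv b p x * \<psi> x)"
    proof (rule AE_I2)
      fix x
      have "(\<lambda>m. partial_deriv b p x * (\<psi> x * \<theta> m x)) \<longlonglongrightarrow> partial_deriv b p x * (\<psi> x * indicator ?H x)"
        by (intro tendsto_intros lim_\<theta>)
      thus "(\<lambda>m. partial_deriv b p x * (\<psi> x * \<theta> m x)) \<longlonglongrightarrow> indicator ?H x * (partial_deriv b p x * \<psi> x)"
        by (simp add: mult_ac)
    qed
    show "AE x in lborel. norm (partial_deriv b p x * (\<psi> x * \<theta> m x)) \<le> norm (partial_deriv b p x * \<psi> x)" for m
      using half_cutoff_bounds[of a n m]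
      by (intro AE_I2) (auto simp: abs_mult \<theta>_def intro!: mult_left_mono mult_left_le)
  qed
  ultimately show ?thesis unfolding eq by (rule LIMSEQ_unique)
qed

text \<open>By contradiction: for a bump \<psi>, the normal derivative of \<open>p * \<psi>\<close>
  integrates to zero over the half-space, but if \<open>p a \<noteq> 0\<close> the bump can be
  placed so that this derivative has a strict sign where it is supported.\<close>

lemma H10_trace_zero:
  assumes \<Omega>: "open \<Omega>" "bounded \<Omega>" and u: "u \<in> H10 \<Omega>" and p: "smth p" and r: "r > 0" and n: "norm n = 1"
    and half: "\<Omega> \<inter> ball a r = {x \<in> ball a r. 0 < (x - a) \<bullet> n}" and up: "\<And>x. x \<in> \<Omega> \<inter> ball a r \<Longrightarrow> u x = p x"
  shows "p a = 0"
proof (rule ccontr)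
  assume pa: "p a \<noteq> 0"
  have [measurable]: "\<Omega> \<in> sets borel" using \<Omega> by simp
  let ?H = "{x. 0 < (x - a) \<bullet> n}"
  have openH: "open ?H" by (intro open_Collect_less continuous_intros)
  have [measurable]: "?H \<in> sets borel" using openH by simp
  obtain g \<phi> where "H10_approx \<Omega> u g \<phi>" by (rule H10_E[OF u \<Omega>])
  note H = H10_approxD[OF this]
  define \<sigma> where "\<sigma> = sgn (p a)"
  have \<sigma>: "\<sigma> * p a = \<bar>p a\<bar>" "\<bar>\<sigma>\<bar> = 1"
    using pa by (auto simp: \<sigma>_def sgn_if)
  define c where "c = \<bar>p a\<bar> / 2"
  have c: "c > 0" using pa by (simp add: c_def)
  have "isCont (\<lambda>x. \<sigma> * p x) a"
    using smth_continuous[OF p, of UNIV] by (auto simp: continuous_on_eq_continuous_at intro!: continuous_intros)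
  hence "((\<lambda>x. \<sigma> * p x) \<longlongrightarrow> \<sigma> * p a) (nhds a)"
    unfolding isCont_def by (rule tendsto_at_iff_tendsto_nhds[where g = "\<lambda>x. \<sigma> * p x", THEN iffD1])
  hence "\<forall>\<^sub>F x in nhds a. c < \<sigma> * p x"
    by (rule order_tendstoD(1)) (use pa \<sigma>(1) in \<open>simp add: c_def\<close>)
  then obtain \<rho>0 where \<rho>0: "\<rho>0 > 0" "\<And>x. dist x a < \<rho>0 \<Longrightarrow> c < \<sigma> * p x"
    by (auto simp: eventually_nhds_metric)
  have "bounded ((\<lambda>x. partial_deriv n p x) ` cball a r)"
    by (intro compact_imp_bounded compact_continuous_image smth_continuous smth_partial p compact_cball)
  then obtain M where "\<forall>y\<in>(\<lambda>x. partial_deriv n p x) ` cball a r. norm y \<le> M"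
    unfolding bounded_iff by blast
  hence M: "\<bar>partial_deriv n p x\<bar> \<le> M" if "x \<in> cball a r" for x using that by fastforce
  \<comment> \<open>Small enough that the ball of radius 3\<rho> about \<open>a\<close>, which
    contains the support of the bump, stays in the half-ball region and where
    \<open>\<sigma> * p > c\<close>; the last bound yields the estimate below.\<close>
  define \<rho> where "\<rho> = min (min (\<rho>0 / 4) (r / 4)) (min 1 (c / (8 * (\<bar>M\<bar> + 1))))"
  have \<rho>: "\<rho> > 0" "3 * \<rho> < \<rho>0" "3 * \<rho> < r" "\<rho> \<le> 1" "\<rho> \<le> c / (8 * (\<bar>M\<bar> + 1))"
    using \<rho>0(1) r c by (auto simp: \<rho>_def)
  \<comment> \<open>The logarithmic normal derivative of the bump is at least 2\<rho>/(4\<rho>^2)^2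
    = 1/(8\<rho>^3) in size on the half-space. Multiplied by \<open>c\<close> it must exceed the
    bound \<open>M\<close> on the derivative of \<open>p\<close>.\<close>
  have \<rho>3: "8 * M * \<rho> ^ 3 < c"
  proof -
    have "\<rho> ^ 3 \<le> \<rho> * 1" using \<rho> by (simp add: power3_eq_cube mult_le_one)
    have "8 * M * \<rho> ^ 3 \<le> 8 * \<bar>M\<bar> * \<rho> ^ 3" using \<rho>(1) by (intro mult_right_mono) auto
    also have "\<dots> \<le> 8 * \<bar>M\<bar> * \<rho>"
      using \<open>\<rho> ^ 3 \<le> \<rho> * 1\<close> by (intro mult_left_mono) auto
    also have "\<dots> < 8 * (\<bar>M\<bar> + 1) * \<rho>" using \<rho>(1) by simp
    also have "\<dots> \<le> c" using \<rho>(5) by (simp add: pos_le_divide_eq mult_ac)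
    finally show ?thesis .
  qed
  \<comment> \<open>The centre is at depth \<rho> on the far side of the hyperplane, so
    \<open>(x - a1) \<bullet> n \<ge> \<rho>\<close> on the half-space and the bump decreases in the
    direction \<open>n\<close> throughout its support there.\<close>
  define a1 where "a1 = a - \<rho> *\<^sub>R n"
  define \<psi> where "\<psi> = bump a1 (2 * \<rho>)"
  have \<psi>: "smth \<psi>" unfolding \<psi>_def by (rule smth_bump)
  have ball1: "dist x a < 3 * \<rho>" if "dist a1 x < 2 * \<rho>" for x
  proof -
    have "dist x a \<le> dist x a1 + dist a1 a" by (rule dist_triangle)
    also have "dist a1 a = \<rho>" using \<rho>(1) n by (simp add: a1_def dist_norm)
    finally show ?thesis using that by (simp add: dist_commute)
  qed
  have \<psi>0: "\<psi> x = 0" if "\<not> dist a1 x < 2 * \<rho>" for x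
    using that bump_pos[of "2 * \<rho>" a1 x] bump_nonneg[of a1 "2 * \<rho>" x] \<rho>(1) by (simp add: \<psi>_def)
  have C: "closed (cball a1 (2 * \<rho>))" "cball a1 (2 * \<rho>) \<subseteq> ball a r" "\<And>x. x \<notin> cball a1 (2 * \<rho>) \<Longrightarrow> \<psi> x = 0"
  proof -
    show "cball a1 (2 * \<rho>) \<subseteq> ball a r"
    proof
      fix x assume "x \<in> cball a1 (2 * \<rho>)"
      hence "dist a x \<le> \<rho> + 2 * \<rho>"
        using dist_triangle[of a x a1] n \<rho>(1) by (simp add: a1_def dist_norm)
      thus "x \<in> ball a r" using \<rho>(3) by simp
    qed
  qed (use \<psi>0 in auto)
  have pd0: "partial_deriv b \<psi> x = 0" if "x \<notin> cball a1 (2 * \<rho>)" for b x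
    by (rule partial_deriv_outside_cball[OF _ that]) (rule C(3))
  define f where "f b x = indicator ?H x * (p x * partial_deriv b \<psi> x + partial_deriv b p x * \<psi> x)" for b x
  have int: "integrable lborel (\<lambda>x. indicator ?H x * h x)"
    if hc: "continuous_on UNIV h" and hz: "\<And>x. x \<notin> cball a1 (2 * \<rho>) \<Longrightarrow> h x = 0" for h :: "'a \<Rightarrow> real"
  proof -
    obtain R where R: "ball a r \<subseteq> cball 0 R" using bounded_subset_cball_0[OF bounded_ball] by blast
    hence "h x = 0" if "x \<notin> cball 0 R" for x using that C(2) hz by blast
    hence "integrable lborel h" by (rule integrable_compact_support[OF hc])
    thus ?thesis by (rule integrable_real_mult_indicator[rotated, unfolded mult.commute[of _ "indicator _ _"]]) simp
  qed
  have i1: "integrable lborel (\<lambda>x. indicator ?H x * (p x * partial_deriv b \<psi> x))" for b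
    by (rule int[OF continuous_on_mult[OF smth_continuous[OF p] smth_continuous[OF smth_partial[OF \<psi>]]]])
      (simp add: pd0)
  have i2: "integrable lborel (\<lambda>x. indicator ?H x * (partial_deriv b p x * \<psi> x))" for b
    by (rule int[OF continuous_on_mult[OF smth_continuous[OF smth_partial[OF p]] smth_continuous[OF \<psi>]]])
      (simp add: C(3))
  have f_split: "f b = (\<lambda>x. indicator ?H x * (p x * partial_deriv b \<psi> x) + indicator ?H x * (partial_deriv b p x * \<psi> x))" for b
    by (simp add: f_def distrib_left fun_eq_iff)
  have fint: "integrable lborel (f b)" for b unfolding f_split by (intro Bochner_Integration.integrable_add i1 i2)
  \<comment> \<open>The pairing of \<open>g b\<close> with \<psi> is computed twice: through the
    approximation by test functions, and through the weak derivative on the half-space. The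
    difference is the integral of the derivative of \<open>p * \<psi>\<close>.\<close>
  have f0: "(\<integral>x. f b x \<partial>lborel) = 0" if b: "b \<in> Basis" for b
  proof -
    have m: "p \<in> borel_measurable borel" "partial_deriv b \<psi> \<in> borel_measurable borel"
      by (auto intro!: borel_measurable_continuous_onI smth_continuous smth_partial p \<psi>)
    have "(LINT x:\<Omega>|lebesgue. u x * partial_deriv b \<psi> x) = (LINT x:\<Omega>|lebesgue. p x * partial_deriv b \<psi> x)"
      unfolding set_lebesgue_integral_def
    proof (intro Bochner_Integration.integral_cong refl)
      fix x
      show "indicat_real \<Omega> x *\<^sub>R (u x * partial_deriv b \<psi> x) = indicat_real \<Omega> x *\<^sub>R (p x * partial_deriv b \<psi> x)"
        using up[of x] pd0[of x b] C(2) by (cases "x \<in> cball a1 (2 * \<rho>)") (auto simp: indicator_def)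
    qed
    also have "\<dots> = (\<integral>x. indicator \<Omega> x * (p x * partial_deriv b \<psi> x) \<partial>lborel)"
      using m by (intro set_lebesgue_integral_eq_lborel) auto
    also have "\<dots> = (\<integral>x. indicator ?H x * (p x * partial_deriv b \<psi> x) \<partial>lborel)"
    proof (intro Bochner_Integration.integral_cong refl)
      fix x
      have "x \<in> \<Omega> \<longleftrightarrow> x \<in> ?H" if "x \<in> ball a r" using that half by blast
      thus "indicator \<Omega> x * (p x * partial_deriv b \<psi> x) = indicator ?H x * (p x * partial_deriv b \<psi> x)"
        using pd0[of x b] C(2) by (cases "x \<in> cball a1 (2 * \<rho>)") (auto simp: indicator_def)
    qed
    finally have "(\<integral>x. indicator ?H x * (p x * partial_deriv b \<psi> x) \<partial>lborel) = - (LINT x:\<Omega>|lebesgue. g b x * \<psi> x)"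
      using H10_integration_by_parts[OF \<Omega> H(1) H(2)[OF b] b H(4,5) H(6)[OF b] \<psi>] by simp
    also have "(LINT x:\<Omega>|lebesgue. g b x * \<psi> x) = (\<integral>x. indicator ?H x * (partial_deriv b p x * \<psi> x) \<partial>lborel)"
      by (rule H10_half_ball_weak_partial[OF \<Omega> H(1) H(2)[OF b] b H(3)[OF b] p half up \<psi> C])
    finally show ?thesis unfolding f_split by (subst Bochner_Integration.integral_add[OF i1 i2]) simp
  qed
  have f_n: "f n x = (\<Sum>b\<in>Basis. (n \<bullet> b) * f b x)" for x
  proof -
    note exp = partial_deriv_expansion[OF smth_differentiable, of _ n x]
    show ?thesis unfolding f_def exp[OF p] exp[OF \<psi>] sum_distrib_left sum_distrib_right sum.distrib[symmetric]
      by (intro sum.cong refl) (simp add: algebra_simps)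
  qed
  have "(\<integral>x. f n x \<partial>lborel) = (\<Sum>b\<in>Basis. (n \<bullet> b) * (\<integral>x. f b x \<partial>lborel))"
    unfolding f_n using fint by (subst Bochner_Integration.integral_sum) auto
  hence fn0: "(\<integral>x. - \<sigma> * f n x \<partial>lborel) = 0" using f0 by simp
  have neg: "- \<sigma> * f n x > 0" if x: "x \<in> ?H" "dist a1 x < 2 * \<rho>" for x
  proof -
    define w where "w = (2 * \<rho>)\<^sup>2 - (x - a1) \<bullet> (x - a1)"
    have wpos: "w > 0" using x(2) bump_pos[of "2 * \<rho>" a1 x] \<rho>(1) by (simp add: w_def bump_def flat_1_pos)
    have w4: "w \<le> 4 * \<rho>\<^sup>2" by (simp add: w_def power_mult_distrib)
    have \<psi>x: "\<psi> x = flat 1 w" "\<psi> x > 0"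
      using wpos by (auto simp: \<psi>_def bump_def w_def flat_1_pos)
    have pd\<psi>: "partial_deriv n \<psi> x = - 2 * ((x - a1) \<bullet> n) * ((1 / w)\<^sup>2 * \<psi> x)"
    proof -
      have "partial_deriv n \<psi> x = - 2 * ((x - a1) \<bullet> n) * flat [:0, 0, 1:] w"
        unfolding \<psi>_def w_def by (rule bump_partial)
      also have "flat [:0, 0, 1:] w = (1 / w)\<^sup>2 * flat 1 w"
        using wpos by (simp add: flat_def power2_eq_square)
      finally show ?thesis by (simp only: \<psi>x(1))
    qed
    have s: "(x - a1) \<bullet> n \<ge> \<rho>"
      using x(1) n by (simp add: a1_def inner_diff_left inner_add_left dot_square_norm)
    have pc: "c < \<sigma> * p x" using \<rho>0(2) ball1[OF x(2)] \<rho>(2) by simp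
    have Mx: "\<bar>partial_deriv n p x\<bar> \<le> M" using M ball1[OF x(2)] \<rho>(3) by (simp add: dist_commute)
    have "- \<sigma> * f n x = \<psi> x * (2 * ((x - a1) \<bullet> n) * (1 / w)\<^sup>2 * (\<sigma> * p x) - \<sigma> * partial_deriv n p x)"
      using x(1) by (simp add: f_def pd\<psi> algebra_simps)
    moreover have "2 * ((x - a1) \<bullet> n) * (1 / w)\<^sup>2 * (\<sigma> * p x) - \<sigma> * partial_deriv n p x > 0"
    proof -
      have "M < 2 * \<rho> * (1 / (4 * \<rho>\<^sup>2))\<^sup>2 * c"
        using \<rho>3 \<rho>(1) by (simp add: field_simps power2_eq_square power3_eq_cube)
      also have "\<dots> \<le> 2 * ((x - a1) \<bullet> n) * (1 / w)\<^sup>2 * (\<sigma> * p x)"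
        using s pc c \<rho>(1) w4 wpos
        by (intro mult_mono power_mono divide_left_mono) (auto intro!: mult_nonneg_nonneg)
      finally show ?thesis using Mx \<sigma>(2) by (auto simp: abs_if split: if_splits)
    qed
    ultimately show ?thesis using \<psi>x(2) by simp
  qed
  have nonneg: "- \<sigma> * f n x \<ge> 0" for x
  proof (cases "x \<in> ?H \<and> dist a1 x < 2 * \<rho>")
    case True
    thus ?thesis using neg[of x] by simp
  next
    case False
    have "f n x = 0"
    proof (cases "x \<in> ?H")
      case True
      with False have d: "\<not> dist a1 x < 2 * \<rho>" by blast
      hence "flat [:0, 0, 1:] ((2 * \<rho>)\<^sup>2 - (x - a1) \<bullet> (x - a1)) = 0"
        using bump_pos[of "2 * \<rho>" a1 x] \<rho>(1) by (auto simp: bump_def flat_1_pos flat_def)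
      hence "partial_deriv n \<psi> x = 0" by (simp add: \<psi>_def bump_partial)
      thus ?thesis using \<psi>0[OF d] by (simp add: f_def)
    qed (simp add: f_def)
    thus ?thesis by simp
  qed
  have "AE x in lborel. - \<sigma> * f n x = 0"
  proof (rule integral_nonneg_eq_0_iff_AE[THEN iffD1, OF _ _ fn0])
    show "integrable lborel (\<lambda>x. - \<sigma> * f n x)" using fint[of n] by simp
    show "AE x in lborel. 0 \<le> - \<sigma> * f n x" using nonneg by (intro AE_I2)
  qed
  moreover define O' where "O' = ?H \<inter> ball a1 (2 * \<rho>)"
  have "open O'" unfolding O'_def by (intro open_Int openH open_ball)
  ultimately have "AE x in lborel. x \<notin> O'" using neg by (force elim!: eventually_mono simp: O'_def)
  hence "O' \<in> null_sets lborel" using \<open>open O'\<close> by (subst (asm) AE_iff_null_sets[symmetric]) auto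
  hence "negligible O'" by (simp add: negligible_iff_null_sets null_sets_completionI)
  hence "O' = {}" using \<open>open O'\<close> open_not_negligible by blast
  moreover have "a + (\<rho> / 2) *\<^sub>R n \<in> O'"
  proof -
    have "a1 - (a + (\<rho> / 2) *\<^sub>R n) = - ((3 / 2 * \<rho>) *\<^sub>R n)"
      by (simp add: a1_def algebra_simps flip: scaleR_add_left)
    hence "dist a1 (a + (\<rho> / 2) *\<^sub>R n) = 3 / 2 * \<rho>" using n \<rho>(1) by (simp add: dist_norm)
    thus ?thesis using n \<rho>(1) by (simp add: O'_def dot_square_norm)
  qed
  ultimately show False by blast
qed

section \<open>Mollification\<close>

definition conv :: "('a::euclidean_space \<Rightarrow> real) \<Rightarrow> ('a \<Rightarrow> real) \<Rightarrow> 'a \<Rightarrow> real" where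
  "conv w k x = (\<integral>y. w y * k (x - y) \<partial>lborel)"

text \<open>Differentiation under the integral over a box containing the support of
  \<open>w\<close>. The Leibniz rule asks for the derivative as a bounded linear map, which
  \<open>?fx\<close> assembles from the partial derivatives.\<close>

lemma conv_has_derivative:
  fixes w k :: "'a::euclidean_space \<Rightarrow> real"
  assumes w: "continuous_on UNIV w" "\<And>x. x \<notin> cball 0 R \<Longrightarrow> w x = 0" and k: "smth k"
  shows "conv w k differentiable (at x)" "partial_deriv b (conv w k) x = conv w (partial_deriv b k) x"
proof -
  obtain a c :: 'a where box: "cball 0 R \<subseteq> cbox a c"
    using bounded_subset_cbox_symmetric[OF bounded_cball] by blast
  have conv_eq: "conv w f x = integral (cbox a c) (\<lambda>y. w y * f (x - y))" if f: "continuous_on UNIV f" for f x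
  proof -
    have c: "continuous_on UNIV (\<lambda>y. w y * f (x - y))"
      using w(1) by (intro continuous_intros continuous_on_compose2[OF f]) auto
    have "set_integrable lborel (cbox a c) (\<lambda>y. w y * f (x - y))"
      by (rule borel_integrable_compact[folded set_integrable_def real_scaleR_def, OF compact_cbox])
        (use c continuous_on_subset in blast)
    hence "integral (cbox a c) (\<lambda>y. w y * f (x - y)) = (LINT y:cbox a c|lborel. w y * f (x - y))"
      using set_borel_integral_eq_integral(2) by metis
    also have "\<dots> = conv w f x" unfolding conv_def set_lebesgue_integral_def
    proof (intro Bochner_Integration.integral_cong refl)
      fix y
      show "indicat_real (cbox a c) y *\<^sub>R (w y * f (x - y)) = w y * f (x - y)"
      proof (cases "y \<in> cbox a c")
        case False
        hence "w y = 0" using w(2) box by blast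
        thus ?thesis by simp
      qed simp
    qed
    finally show ?thesis ..
  qed
  let ?fx = "\<lambda>x t. \<Sum>b\<in>Basis. (w t * partial_deriv b k (x - t)) *\<^sub>R blinfun_inner_right b"
  have pc: "continuous_on UNIV (partial_deriv b k)" for b by (intro smth_continuous smth_partial k)
  have exp: "partial_deriv h k x = (\<Sum>b\<in>Basis. (b \<bullet> h) * partial_deriv b k x)" for h x
    by (subst partial_deriv_expansion[OF smth_differentiable[OF k]]) (simp add: inner_commute)
  have fx_app: "blinfun_apply (?fx x t) h = w t * partial_deriv h k (x - t)" for x t h
    by (simp add: blinfun.sum_left blinfun.scaleR_left exp[of h] sum_distrib_left mult_ac)
  have der: "((\<lambda>x. integral (cbox a c) (\<lambda>t. w t * k (x - t))) has_derivative
      blinfun_apply (integral (cbox a c) (?fx x))) (at x within UNIV)"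
  proof (rule leibniz_rule)
    fix x t
    have "((\<lambda>x. w t * k (x - t)) has_derivative (\<lambda>h. w t * partial_deriv h k (x - t))) (at x)"
    proof (rule has_derivative_mult_right)
      have "((\<lambda>x. x - t) has_derivative (\<lambda>h. h)) (at x)" by (auto intro!: derivative_eq_intros)
      from has_derivative_compose[OF this has_derivative_partial_deriv[OF smth_differentiable[OF k]]]
      show "((\<lambda>x. k (x - t)) has_derivative (\<lambda>h. partial_deriv h k (x - t))) (at x)" .
    qed
    thus "((\<lambda>x. w t * k (x - t)) has_derivative blinfun_apply (?fx x t)) (at x within UNIV)"
      by (simp add: fx_app[abs_def])
  next
    fix x
    show "(\<lambda>t. w t * k (x - t)) integrable_on cbox a c"
      by (intro integrable_continuous continuous_intros continuous_on_compose2[OF smth_continuous[OF k, of UNIV]]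
          continuous_on_subset[OF w(1)]) auto
  next
    show "continuous_on (UNIV \<times> cbox a c) (\<lambda>(x, t). ?fx x t)" unfolding split_beta
      by (intro continuous_intros continuous_on_compose2[OF pc] continuous_on_compose2[OF w(1)]) auto
  qed auto
  have der': "(conv w k has_derivative blinfun_apply (integral (cbox a c) (?fx x))) (at x)"
    using der by (simp add: conv_eq[OF smth_continuous[OF k], abs_def])
  thus "conv w k differentiable (at x)" by (rule differentiableI)
  have int: "?fx x integrable_on cbox a c"
    by (intro integrable_continuous continuous_intros continuous_on_compose2[OF pc] continuous_on_subset[OF w(1)]) auto
  have "partial_deriv b (conv w k) x = blinfun_apply (integral (cbox a c) (?fx x)) b"
    by (rule partial_deriv_eq[OF der'])
  also have "\<dots> = integral (cbox a c) ((\<lambda>f. blinfun_apply f b) \<circ> ?fx x)"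
    by (rule integral_linear[symmetric, OF int blinfun.bounded_linear_left])
  also have "\<dots> = conv w (partial_deriv b k) x" by (simp only: o_def fx_app conv_eq[OF pc])
  finally show "partial_deriv b (conv w k) x = conv w (partial_deriv b k) x" .
qed

text \<open>A partial derivative of a convolution is the convolution of \<open>w\<close> with a
  partial derivative of the kernel, so these convolutions form a class closed under
  differentiation.\<close>

lemma smooth_conv:
  fixes w k :: "'a::euclidean_space \<Rightarrow> real"
  assumes w: "continuous_on UNIV w" "\<And>x. x \<notin> cball 0 R \<Longrightarrow> w x = 0" and k: "smth k"
  shows "smooth (conv w k)"
proof (rule smooth_coinduct_set[of _ "{conv w k | k. smth k}"])
  show "conv w k \<in> {conv w k | k. smth k}" using k by blast
next
  fix f :: "'a \<Rightarrow> real" and x b :: 'a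
  assume "f \<in> {conv w k | k. smth k}"
  then obtain k' where k': "f = conv w k'" "smth k'" by blast
  show "f differentiable (at x)" unfolding k'(1) by (rule conv_has_derivative(1)[OF w k'(2)])
  have "partial_deriv b f = conv w (partial_deriv b k')"
    unfolding k'(1) using conv_has_derivative(2)[OF w k'(2)] by blast
  thus "partial_deriv b f \<in> {conv w k | k. smth k}" using smth_partial[OF k'(2)] by blast
qed

definition mollifier :: "real \<Rightarrow> 'a::euclidean_space \<Rightarrow> real" where
  "mollifier r x = bump 0 r x / (\<integral>y. bump (0::'a) r y \<partial>lborel)"

lemma bump_0_outside: "r > 0 \<Longrightarrow> x \<notin> cball 0 r \<Longrightarrow> bump 0 r x = 0"
  using bump_pos[of r 0 x] bump_nonneg[of 0 r x] by (metis less_eq_real_def mem_cball)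

lemma integrable_bump: "integrable lborel (bump (0::'a::euclidean_space) r)" if "r > 0"
  by (rule integrableI_bounded_set[where A = "cball 0 r" and B = 1])
    (use bump_0_outside[OF that, where 'a = 'a] emeasure_lborel_cball_finite[of "0::'a" r]
        bump_nonneg[of "0::'a" r] bump_le_1[of "0::'a" r] in
      \<open>auto intro!: AE_I2 borel_measurable_continuous_onI smth_continuous smth_bump\<close>)

lemma integral_bump_pos:
  assumes "r > 0"
  shows "(\<integral>y. bump (0::'a::euclidean_space) r y \<partial>lborel) > 0"
proof (rule ccontr)
  assume "\<not> ?thesis"
  moreover have "(\<integral>y. bump (0::'a) r y \<partial>lborel) \<ge> 0"
    by (intro Bochner_Integration.integral_nonneg bump_nonneg)
  ultimately have "(\<integral>y. bump (0::'a) r y \<partial>lborel) = 0" by simp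
  hence "AE x in lborel. bump (0::'a) r x = 0"
    by (subst (asm) integral_nonneg_eq_0_iff_AE[OF integrable_bump[OF assms]]) (auto intro: bump_nonneg)
  hence "AE x in lborel. x \<notin> ball (0::'a) r"
    by (rule eventually_mono) (use bump_pos[OF assms, of 0] in force)
  hence "ball (0::'a) r \<in> null_sets lborel" by (subst (asm) AE_iff_null_sets[symmetric]) auto
  hence "negligible (ball (0::'a) r)" by (simp add: negligible_iff_null_sets null_sets_completionI)
  hence "ball (0::'a) r = {}" using open_not_negligible[of "ball (0::'a) r"] by blast
  thus False using assms by simp
qed

context
  fixes r :: real assumes r: "r > 0"
begin

lemma smth_mollifier: "smth (mollifier r)"
  unfolding mollifier_def divide_inverse by (intro smth.mult smth_bump smth.const)

lemma mollifier_nonneg: "mollifier r x \<ge> 0"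
  unfolding mollifier_def using integral_bump_pos[OF r] by (intro divide_nonneg_pos bump_nonneg)

lemma mollifier_outside: "x \<notin> cball 0 r \<Longrightarrow> mollifier r x = 0"
  using bump_0_outside[OF r, of x] by (simp add: mollifier_def)

lemma mollifier_measurable: "(\<lambda>y. mollifier r (x - y)) \<in> borel_measurable borel"
  by (intro borel_measurable_continuous_onI continuous_on_compose2[OF smth_continuous[OF smth_mollifier, of UNIV]]
      continuous_intros) auto

lemma mollifier_reflect: "mollifier r (x - y) = mollifier r (- x + y)"
proof -
  have "(x - y) \<bullet> (x - y) = (- x + y) \<bullet> (- x + y)" by (simp add: algebra_simps inner_commute)
  thus ?thesis by (simp add: mollifier_def bump_def)
qed

lemma integral_mollifier:
  fixes x :: "'a::euclidean_space"
  shows "integrable lborel (\<lambda>y. mollifier r (x - y))" "(\<integral>y. mollifier r (x - y) \<partial>lborel) = 1"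
proof -
  have m: "mollifier r \<in> borel_measurable borel"
    by (intro borel_measurable_continuous_onI smth_continuous smth_mollifier)
  have i: "integrable lborel (mollifier r :: 'a \<Rightarrow> real)"
    unfolding mollifier_def[abs_def] using integrable_bump[OF r, where 'a = 'a] by simp
  have "integrable (distr lborel borel ((+) (- x))) (mollifier r)" using i by (simp add: lborel_distr_plus)
  thus "integrable lborel (\<lambda>y. mollifier r (x - y))"
    unfolding mollifier_reflect by (subst (asm) integrable_distr_eq) (use m in auto)
  have "(\<integral>y. mollifier r (x - y) \<partial>lborel) = (\<integral>y. mollifier r y \<partial>(lborel :: 'a measure))"
    unfolding mollifier_reflect by (rule integral_lborel_translate[OF m])
  also have "\<dots> = 1" using integral_bump_pos[OF r, where 'a = 'a] by (simp add: mollifier_def[abs_def])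
  finally show "(\<integral>y. mollifier r (x - y) \<partial>lborel) = 1" .
qed

text \<open>The convolution is a weighted mean of \<open>q\<close> over the ball of radius
  \<open>r\<close>. With small \<open>e\<close> this gives convergence, with large \<open>e\<close>
  a uniform bound.\<close>

lemma conv_mollifier_close:
  assumes q: "q \<in> borel_measurable borel" "\<And>y. \<bar>q y\<bar> \<le> B"
    and close: "\<And>y. dist y x \<le> r \<Longrightarrow> \<bar>q y - Q\<bar> \<le> e"
  shows "\<bar>conv q (mollifier r) x - Q\<bar> \<le> e"
proof -
  note m = integral_mollifier[of x]
  have i: "integrable lborel (\<lambda>y. q y * mollifier r (x - y))"
    by (rule Bochner_Integration.integrable_bound[OF integrable_mult_right[OF m(1), of B]])
      (use q mollifier_measurable[of x] mollifier_nonneg in \<open>auto intro!: AE_I2 mult_right_mono order.trans[OF q(2)] simp: abs_mult\<close>)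
  have "conv q (mollifier r) x - Q = (\<integral>y. q y * mollifier r (x - y) - Q * mollifier r (x - y) \<partial>lborel)"
    unfolding conv_def using i m by (subst Bochner_Integration.integral_diff) auto
  also have "\<bar>\<dots>\<bar> \<le> (\<integral>y. \<bar>q y * mollifier r (x - y) - Q * mollifier r (x - y)\<bar> \<partial>lborel)"
    by (rule integral_abs_bound)
  also have "\<dots> \<le> (\<integral>y. e * mollifier r (x - y) \<partial>lborel)"
  proof (rule integral_mono)
    show "integrable lborel (\<lambda>y. \<bar>q y * mollifier r (x - y) - Q * mollifier r (x - y)\<bar>)"
      using i m by auto
    show "integrable lborel (\<lambda>y. e * mollifier r (x - y))" using m by auto
    fix y
    show "\<bar>q y * mollifier r (x - y) - Q * mollifier r (x - y)\<bar> \<le> e * mollifier r (x - y)"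
    proof (cases "dist y x \<le> r")
      case True
      have "\<bar>q y * mollifier r (x - y) - Q * mollifier r (x - y)\<bar> = \<bar>q y - Q\<bar> * mollifier r (x - y)"
        using mollifier_nonneg[of "x - y"] by (simp add: left_diff_distrib[symmetric] abs_mult)
      thus ?thesis using close[OF True] mollifier_nonneg[of "x - y"] by (simp add: mult_right_mono)
    next
      case False
      hence "mollifier r (x - y) = 0" by (intro mollifier_outside) (simp add: dist_norm norm_minus_commute)
      thus ?thesis by simp
    qed
  qed
  also have "\<dots> = e" using m by simp
  finally show ?thesis .
qed

end

lemma AE_lborel_homothety:
  fixes t :: "'a::euclidean_space"
  assumes N: "N \<in> null_sets lborel" and c: "c > 0"
  shows "AE x in lborel. t + c *\<^sub>R x \<notin> N"
proof -
  have "AE x in lborel. x \<notin> N" using N by (rule AE_not_in)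
  moreover have eq: "lborel = density (distr lborel borel (\<lambda>x. t + c *\<^sub>R x)) (\<lambda>_. ennreal (c ^ DIM('a)))"
    using lborel_affine[of c t] c by (simp add: ennreal_power)
  ultimately have "AE x in density (distr lborel borel (\<lambda>x. t + c *\<^sub>R x)) (\<lambda>_. ennreal (c ^ DIM('a))). x \<notin> N"
    by (simp only: eq[symmetric])
  hence "AE x in distr lborel borel (\<lambda>x. t + c *\<^sub>R x). x \<notin> N"
    using c by (subst (asm) AE_density) auto
  thus ?thesis
    using N by (subst (asm) AE_distr_iff) (auto simp: null_setsD2 space_borel[symmetric] simp del: space_borel)
qed

lemma L2_dist_tendsto_0_dominated:
  fixes a :: "nat \<Rightarrow> 'a::euclidean_space \<Rightarrow> real"
  assumes \<Omega>: "open \<Omega>" "bounded \<Omega>" and a: "\<And>n. a n \<in> borel_measurable borel"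
    and B: "\<And>n x. \<bar>a n x\<bar> \<le> B" and lim: "AE x in lborel. (\<lambda>n. a n x) \<longlonglongrightarrow> 0"
  shows "(\<lambda>n. LINT x:\<Omega>|lebesgue. (a n x)\<^sup>2) \<longlonglongrightarrow> 0"
proof -
  have [measurable]: "\<Omega> \<in> sets borel" "\<And>n. a n \<in> borel_measurable borel"
    using \<Omega> a by auto
  obtain R where "\<Omega> \<subseteq> cball 0 R" using bounded_subset_cball_0[OF \<Omega>(2)] by blast
  hence "emeasure lborel \<Omega> \<le> emeasure lborel (cball (0::'a) R)" by (intro emeasure_mono) auto
  hence fin: "emeasure lborel \<Omega> < \<infinity>"
    using emeasure_lborel_cball_finite[of "0::'a" R] by (rule order.strict_trans1)
  have eq: "(LINT x:\<Omega>|lebesgue. (a n x)\<^sup>2) = (\<integral>x. indicator \<Omega> x * (a n x)\<^sup>2 \<partial>lborel)" for n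
    by (rule set_lebesgue_integral_eq_lborel) measurable
  have "(\<lambda>n. \<integral>x. indicator \<Omega> x * (a n x)\<^sup>2 \<partial>lborel) \<longlonglongrightarrow> (\<integral>x. 0 \<partial>(lborel :: 'a measure))"
  proof (rule integral_dominated_convergence)
    show "integrable lborel (\<lambda>x. indicator \<Omega> x * B\<^sup>2)"
      using fin by (intro integrable_mult_left integrable_real_indicator) auto
    show "AE x in lborel. (\<lambda>n. indicator \<Omega> x * (a n x)\<^sup>2) \<longlonglongrightarrow> 0"
      using lim
    proof (rule eventually_mono)
      fix x assume "(\<lambda>n. a n x) \<longlonglongrightarrow> 0"
      from tendsto_mult[OF tendsto_const[of "indicator \<Omega> x"] tendsto_power[OF this, of 2]]
      show "(\<lambda>n. indicator \<Omega> x * (a n x)\<^sup>2) \<longlonglongrightarrow> 0" by simp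
    qed
    show "AE x in lborel. norm (indicator \<Omega> x * (a n x)\<^sup>2) \<le> indicator \<Omega> x * B\<^sup>2" for n
      using power_mono[OF B abs_ge_zero, of _ _ 2] by (intro AE_I2) (simp add: indicator_def)
  qed measurable
  thus ?thesis by (simp add: eq)
qed

text \<open>Shrinking about \<open>z\<close> moves the support of \<open>w\<close> into \<open>\<Omega>\<close>, after which it can be mollified.\<close>

lemma H10_starshaped_I:
  fixes w :: "'a::euclidean_space \<Rightarrow> real"
  assumes \<Omega>: "open \<Omega>" "bounded \<Omega>" and S: "compact S"
    and w0: "\<And>x. x \<notin> S \<Longrightarrow> w x = 0" "\<And>x. x \<notin> \<Omega> \<Longrightarrow> w x = 0"
    and star: "\<And>t x. 0 < t \<Longrightarrow> t < 1 \<Longrightarrow> x \<in> S \<Longrightarrow> z + t *\<^sub>R (x - z) \<in> \<Omega>"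
    and lip: "\<And>x y. \<bar>w x - w y\<bar> \<le> L * norm (x - y)"
    and g: "\<And>b. b \<in> Basis \<Longrightarrow> g b \<in> borel_measurable borel" "\<And>b x. b \<in> Basis \<Longrightarrow> \<bar>g b x\<bar> \<le> G"
    and N: "N \<in> null_sets lborel"
    and deriv: "\<And>b x. b \<in> Basis \<Longrightarrow> x \<notin> N \<Longrightarrow> ((\<lambda>h. (w (x + h *\<^sub>R b) - w x) / h) \<longlongrightarrow> g b x) (at 0)"
    and cont: "\<And>b x. b \<in> Basis \<Longrightarrow> x \<notin> N \<Longrightarrow> isCont (g b) x"
  shows "w \<in> H10 \<Omega>"
proof -
  have L0: "L \<ge> 0"
  proof -
    obtain b :: 'a where "b \<in> Basis" using nonempty_Basis by blast
    thus ?thesis using lip[of b 0] abs_ge_zero[of "w b - w 0"] by (simp add: norm_Basis)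
  qed
  have wc: "continuous_on X w" for X
  proof (rule continuous_on_subset[OF _ subset_UNIV])
    have "L-lipschitz_on UNIV w" using lip L0 by (intro lipschitz_onI) (simp_all add: dist_norm)
    thus "continuous_on UNIV w" by (rule lipschitz_on_continuous_on)
  qed
  obtain R where R: "S \<subseteq> cball 0 R" using bounded_subset_cball_0[OF compact_imp_bounded[OF S]] by blast
  have wR: "w x = 0" if "x \<notin> cball 0 R" for x using that R w0(1) by blast
  obtain B where B: "B \<ge> 0" "\<And>x. \<bar>w x\<bar> \<le> B"
    using continuous_compact_support_bounded[OF wc wR] by blast
  have wm: "w \<in> borel_measurable borel" by (rule borel_measurable_continuous_onI[OF wc])
  \<comment> \<open>Composing with the dilation by \<open>s n > 1\<close> about \<open>z\<close>
    shrinks the support towards \<open>z\<close>, and the factors tend to 1.\<close>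
  define s where "s n = 1 + 1 / real (Suc n)" for n
  have s: "1 < s n" "s n \<le> 2" for n by (auto simp: s_def)
  define D where "D n x = z + s n *\<^sub>R (x - z)" for n x
  have D_aff: "D n x = (z - s n *\<^sub>R z) + s n *\<^sub>R x" for n x by (simp add: D_def algebra_simps)
  define Sn where "Sn n = (\<lambda>x. z + (1 / s n) *\<^sub>R (x - z)) ` S" for n
  have Sn_compact: "compact (Sn n)" for n unfolding Sn_def by (intro compact_continuous_image S continuous_intros)
  have Sn_\<Omega>: "Sn n \<subseteq> \<Omega>" for n using star[of "1 / s n"] s[of n] by (auto simp: Sn_def)
  have D_Sn: "x \<in> Sn n" if "D n x \<in> S" for n x
  proof -
    have "x = z + (1 / s n) *\<^sub>R (D n x - z)" using s[of n] by (simp add: D_def)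
    thus ?thesis unfolding Sn_def using that by blast
  qed
  have "\<exists>\<delta>>0. (\<Union>x\<in>Sn n. cball x \<delta>) \<subseteq> \<Omega>" for n
    using compact_subset_open_imp_cball_epsilon_subset[OF Sn_compact \<Omega>(1) Sn_\<Omega>] by blast
  then obtain \<delta> where \<delta>: "\<And>n. \<delta> n > 0" "\<And>n. (\<Union>x\<in>Sn n. cball x (\<delta> n)) \<subseteq> \<Omega>"
    by metis
  \<comment> \<open>The first bound keeps the support after mollification inside \<Omega>, the
    second makes the mollification converge.\<close>
  define r where "r n = min (\<delta> n) (1 / real (Suc n))" for n
  have r: "r n > 0" "r n \<le> \<delta> n" "r n \<le> 1 / real (Suc n)" for n
    using \<delta>(1)[of n] by (auto simp: r_def)
  define W where "W n x = w (D n x)" for n x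
  have DD: "D n x - D n y = s n *\<^sub>R (x - y)" for n x y by (simp add: D_def algebra_simps)
  have Wlip: "\<bar>W n x - W n y\<bar> \<le> (L * s n) * norm (x - y)" for n x y
    using lip[of "D n x" "D n y"] s[of n] by (simp add: W_def DD mult.assoc)
  have Wc: "continuous_on UNIV (W n)" for n
    unfolding W_def D_def by (intro continuous_on_compose2[OF wc[of UNIV]] continuous_intros) auto
  have Wm: "W n \<in> borel_measurable borel" for n by (rule borel_measurable_continuous_onI[OF Wc])
  have W0: "W n x = 0" if "x \<notin> Sn n" for n x using that D_Sn w0(1) by (auto simp: W_def)
  have "\<exists>R. Sn n \<subseteq> cball 0 R" for n
    using bounded_subset_cball_0[OF compact_imp_bounded[OF Sn_compact]] .
  then obtain Rn where Rn: "\<And>n. Sn n \<subseteq> cball 0 (Rn n)" by metis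
  have WR: "W n x = 0" if "x \<notin> cball 0 (Rn n)" for n x using that Rn W0 by blast
  define \<phi> where "\<phi> n = conv (W n) (mollifier (r n))" for n
  have D_close: "dist (D n y) x \<le> (2 + norm (x - z)) / real (Suc n)" if "dist y x \<le> r n" for n x y
  proof -
    have "D n y - x = s n *\<^sub>R (y - x) + (1 / real (Suc n)) *\<^sub>R (x - z)"
      by (simp add: D_def s_def algebra_simps)
    hence "norm (D n y - x) \<le> s n * norm (y - x) + (1 / real (Suc n)) * norm (x - z)"
      using norm_triangle_ineq[of "s n *\<^sub>R (y - x)" "(1 / real (Suc n)) *\<^sub>R (x - z)"] s[of n] by simp
    also have "s n * norm (y - x) \<le> 2 * (1 / real (Suc n))"
      using that r(3)[of n] s[of n] by (intro mult_mono) (auto simp: dist_norm)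
    finally show ?thesis by (simp add: dist_norm add_divide_distrib)
  qed
  have D_lim: "(\<lambda>n. (2 + norm (x - z)) / real (Suc n)) \<longlonglongrightarrow> 0" for x
    using tendsto_mult_left[OF LIMSEQ_Suc[OF lim_1_over_n[where 'a = real]], of "2 + norm (x - z)"] by simp
  have T: "\<phi> n \<in> test_functions \<Omega>" for n
  proof (rule test_functionsI)
    let ?C = "{x + y | x y. x \<in> Sn n \<and> y \<in> cball 0 (r n)}"
    show "smooth (\<phi> n)" unfolding \<phi>_def by (rule smooth_conv[OF Wc WR smth_mollifier[OF r(1)]])
    have "compact ?C" by (rule compact_sums[OF Sn_compact compact_cball])
    thus "closed ?C" "bounded ?C" by (auto intro: compact_imp_closed compact_imp_bounded)
    show "?C \<subseteq> \<Omega>"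
    proof
      fix v assume "v \<in> ?C"
      then obtain x y where v: "v = x + y" "x \<in> Sn n" "norm y \<le> r n" by auto
      hence "v \<in> cball x (\<delta> n)" using r(2)[of n] by (simp add: dist_norm)
      thus "v \<in> \<Omega>" using \<delta>(2)[of n] v(2) by blast
    qed
    show "\<phi> n x = 0" if x: "x \<notin> ?C" for x
    proof -
      have "W n y * mollifier (r n) (x - y) = 0" for y
      proof (cases "y \<in> Sn n")
        case True
        have "x = y + (x - y)" by simp
        hence "x - y \<notin> cball 0 (r n)" using x True by blast
        thus ?thesis using mollifier_outside[OF r(1)[of n], of "x - y"] by simp
      qed (simp add: W0)
      thus ?thesis by (simp only: \<phi>_def conv_def Bochner_Integration.integral_zero)
    qed
  qed
  \<comment> \<open>The almost everywhere derivative of the dilated function \<open>W n\<close>,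
    with the factor \<open>s n\<close> from the chain rule.\<close>
  define q where "q n b y = s n * g b (D n y)" for n b y
  have qm: "q n b \<in> borel_measurable borel" if "b \<in> Basis" for n b
  proof -
    have "D n \<in> borel_measurable borel"
      unfolding D_def by (intro borel_measurable_continuous_onI continuous_intros)
    thus ?thesis unfolding q_def using measurable_compose[OF _ g(1)[OF that]] by measurable
  qed
  have qB: "\<bar>q n b y\<bar> \<le> 2 * G" if "b \<in> Basis" for n b y
    unfolding q_def abs_mult using g(2)[OF that, of "D n y"] s[of n] by (intro mult_mono) auto
  \<comment> \<open>Differentiating the convolution falls on the kernel; integration by parts moves
    the derivative to the Lipschitz function \<open>W n\<close>. The sign is absorbed by the
    reflection \<open>x - y\<close>.\<close>
  have pd: "partial_deriv b (\<phi> n) x = conv (q n b) (mollifier (r n)) x" if b: "b \<in> Basis" for n b x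
  proof -
    let ?k = "\<lambda>y. mollifier (r n) (x - y)"
    note sm = smth_mollifier[OF r(1), of n]
    have kd: "(?k has_derivative (\<lambda>h. partial_deriv (- h) (mollifier (r n)) (x - y))) (at y)" for y
    proof -
      have "((\<lambda>y. x - y) has_derivative (\<lambda>h. - h)) (at y)" by (auto intro!: derivative_eq_intros)
      from has_derivative_compose[OF this has_derivative_partial_deriv[OF smth_differentiable[OF sm]]]
      show ?thesis .
    qed
    have kp: "partial_deriv b ?k = (\<lambda>y. - partial_deriv b (mollifier (r n)) (x - y))" by (intro ext)
        (simp only: partial_deriv_eq[OF kd] linear_neg[OF partial_deriv_linear[OF smth_differentiable[OF sm]]])
    have "(\<integral>y. W n y * partial_deriv b ?k y \<partial>lborel) = - (\<integral>y. q n b y * ?k y \<partial>lborel)"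
    proof (rule integration_by_parts[where R = "norm x + r n" and L = "L * s n" and B = B])
      show "AE y in lborel. ((\<lambda>h. (W n (y + h *\<^sub>R b) - W n y) / h) \<longlongrightarrow> q n b y) (at 0)"
      proof -
        have "AE y in lborel. D n y \<notin> N" unfolding D_aff using s[of n] by (intro AE_lborel_homothety N) simp
        thus ?thesis
        proof (rule eventually_mono)
          fix y assume "D n y \<notin> N"
          from deriv[OF b this]
          have l: "((\<lambda>h. (w (D n y + h *\<^sub>R b) - w (D n y)) / h) \<longlongrightarrow> g b (D n y)) (at 0)" .
          have "filterlim (\<lambda>h. s n * h) (at 0) (at 0)" unfolding filterlim_at using s[of n]
            by (auto intro!: tendsto_eq_intros simp: eventually_at_filter)
          from filterlim_compose[OF l this]
          have "((\<lambda>h. s n * ((w (D n y + (s n * h) *\<^sub>R b) - w (D n y)) / (s n * h))) \<longlongrightarrow> s n * g b (D n y)) (at 0)"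
            by (intro tendsto_intros)
          moreover have "s n * ((w (D n y + (s n * h) *\<^sub>R b) - w (D n y)) / (s n * h)) =
              (W n (y + h *\<^sub>R b) - W n y) / h" for h
          proof -
            have "D n y + (s n * h) *\<^sub>R b = D n (y + h *\<^sub>R b)" by (simp add: D_def algebra_simps)
            thus ?thesis using s[of n] by (simp add: W_def)
          qed
          ultimately show "((\<lambda>h. (W n (y + h *\<^sub>R b) - W n y) / h) \<longlongrightarrow> q n b y) (at 0)"
            by (simp add: q_def)
        qed
      qed
      show "?k differentiable (at y)" for y using kd by (rule differentiableI)
      show "continuous_on UNIV (partial_deriv b ?k)" unfolding kp
        by (intro continuous_intros continuous_on_compose2[OF smth_continuous[OF smth_partial[OF sm], of UNIV]]) auto
      show "?k y = 0" if "y \<notin> cball 0 (norm x + r n)" for y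
      proof (rule mollifier_outside[OF r(1)])
        show "x - y \<notin> cball 0 (r n)" using that norm_triangle_ineq2[of y x] by (simp add: norm_minus_commute)
      qed
    qed (use Wc qm[OF b] Wlip B(2) in \<open>auto simp: W_def\<close>)
    hence "conv (q n b) (mollifier (r n)) x = conv (W n) (partial_deriv b (mollifier (r n))) x"
      by (simp add: kp conv_def)
    thus ?thesis
      using conv_has_derivative(2)[where w = "W n" and R = "Rn n" and k = "mollifier (r n)" and b = b and x = x]
        Wc[of n] WR sm by (simp add: \<phi>_def)
  qed
  have \<phi>_lim: "(\<lambda>n. \<phi> n x - w x) \<longlonglongrightarrow> 0" for x
  proof (rule Lim_null_comparison)
    show "\<forall>\<^sub>F n in sequentially. norm (\<phi> n x - w x) \<le> L * ((2 + norm (x - z)) / real (Suc n))"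
    proof (intro always_eventually allI)
      fix n
      have "\<bar>conv (W n) (mollifier (r n)) x - w x\<bar> \<le> L * ((2 + norm (x - z)) / real (Suc n))"
      proof (rule conv_mollifier_close[OF r(1) Wm])
        show "\<bar>W n y\<bar> \<le> B" for y using B(2) by (simp add: W_def)
        fix y assume "dist y x \<le> r n"
        from mult_left_mono[OF D_close[OF this] L0] lip[of "D n y" x]
        show "\<bar>W n y - w x\<bar> \<le> L * ((2 + norm (x - z)) / real (Suc n))" by (simp add: W_def dist_norm)
      qed
      thus "norm (\<phi> n x - w x) \<le> L * ((2 + norm (x - z)) / real (Suc n))" by (simp add: \<phi>_def)
    qed
    show "(\<lambda>n. L * ((2 + norm (x - z)) / real (Suc n))) \<longlonglongrightarrow> 0"
      using tendsto_mult_left[OF D_lim, of L] by simp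
  qed
  have pd_lim: "(\<lambda>n. partial_deriv b (\<phi> n) x - g b x) \<longlonglongrightarrow> 0" if b: "b \<in> Basis" and x: "x \<notin> N" for b x
  proof (rule LIMSEQ_I)
    fix e :: real assume e: "e > 0"
    from cont[OF b x] e obtain \<eta> where \<eta>: "\<eta> > 0" "\<And>y. dist y x < \<eta> \<Longrightarrow> dist (g b y) (g b x) < e / 8"
      unfolding continuous_at_eps_delta by (metis zero_less_divide_iff zero_less_numeral)
    have sl: "(\<lambda>n. (1 / real (Suc n)) * G) \<longlonglongrightarrow> 0 * G"
      using LIMSEQ_Suc[OF lim_1_over_n[where 'a = real]] by (intro tendsto_intros)
    have "\<forall>\<^sub>F n in sequentially. (2 + norm (x - z)) / real (Suc n) < \<eta> \<and> (1 / real (Suc n)) * G < e / 4"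
      using order_tendstoD(2)[OF D_lim \<eta>(1)] order_tendstoD(2)[OF sl, of "e / 4"] e
      by (intro eventually_conj) simp_all
    then obtain n0 where n0: "\<And>n. n \<ge> n0 \<Longrightarrow> (2 + norm (x - z)) / real (Suc n) < \<eta> \<and> (1 / real (Suc n)) * G < e / 4"
      by (auto simp: eventually_sequentially)
    show "\<exists>no. \<forall>n\<ge>no. norm (partial_deriv b (\<phi> n) x - g b x - 0) < e"
    proof (intro exI allI impI)
      fix n assume n: "n \<ge> n0"
      have "\<bar>conv (q n b) (mollifier (r n)) x - g b x\<bar> \<le> e / 2"
      proof (rule conv_mollifier_close[OF r(1) qm[OF b] qB[OF b]])
        fix y assume "dist y x \<le> r n"
        hence "dist (D n y) x < \<eta>" using D_close n0[OF n] by (meson order.strict_trans1)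
        hence "\<bar>g b (D n y) - g b x\<bar> < e / 8" using \<eta>(2) by (simp add: dist_real_def)
        moreover have "\<bar>(1 / real (Suc n)) * g b (D n y)\<bar> < e / 4"
        proof -
          have "\<bar>(1 / real (Suc n)) * g b (D n y)\<bar> \<le> (1 / real (Suc n)) * G"
            unfolding abs_mult using g(2)[OF b, of "D n y"] by (intro mult_mono) auto
          thus ?thesis using n0[OF n] by linarith
        qed
        moreover have "q n b y - g b x = (g b (D n y) - g b x) + (1 / real (Suc n)) * g b (D n y)"
          by (simp add: q_def s_def algebra_simps)
        ultimately show "\<bar>q n b y - g b x\<bar> \<le> e / 2" using e by linarith
      qed
      thus "norm (partial_deriv b (\<phi> n) x - g b x - 0) < e" using e by (simp add: pd[OF b])
    qed
  qed
  have "H10_approx \<Omega> w g \<phi>" unfolding H10_approx_def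
  proof (intro conjI ballI allI)
    show "w \<in> L2_on \<Omega>" by (rule continuous_L2_on[OF \<Omega> wc])
    show "g b \<in> L2_on \<Omega>" if "b \<in> Basis" for b
      using g that by (intro bounded_borel_L2_on[OF \<Omega>]) auto
    show "weak_partial \<Omega> b w (g b)" if b: "b \<in> Basis" for b unfolding weak_partial_def
    proof
      fix \<psi> assume \<psi>: "\<psi> \<in> test_functions \<Omega>"
      obtain R' where R': "\<And>x. x \<notin> cball 0 R' \<Longrightarrow> \<psi> x = 0"
        using test_functionsD(4)[OF \<psi>] by blast
      have m: "\<psi> \<in> borel_measurable borel" "partial_deriv b \<psi> \<in> borel_measurable borel"
        using test_functionsD(5,6)[OF \<psi>] b by (auto intro: borel_measurable_continuous_onI)
      have "(\<integral>x. w x * partial_deriv b \<psi> x \<partial>lborel) = - (\<integral>x. g b x * \<psi> x \<partial>lborel)"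
      proof (rule integration_by_parts[where R = R' and L = L and B = B])
        show "AE x in lborel. ((\<lambda>h. (w (x + h *\<^sub>R b) - w x) / h) \<longlongrightarrow> g b x) (at 0)"
          using AE_not_in[OF N] by (rule eventually_mono) (rule deriv[OF b])
        show "\<psi> differentiable (at x)" for x by (rule smooth_differentiable[OF test_functionsD(1)[OF \<psi>]])
        show "continuous_on UNIV (partial_deriv b \<psi>)" by (rule test_functionsD(6)[OF \<psi> b])
      qed (use wc g(1)[OF b] lip R' B(2) in auto)
      moreover have "(LINT x:\<Omega>|lebesgue. w x * partial_deriv b \<psi> x) = (\<integral>x. w x * partial_deriv b \<psi> x \<partial>lborel)"
        by (rule set_lebesgue_integral_eq_lborel_support) (use m wm \<Omega> w0(2) in auto)
      moreover have "(LINT x:\<Omega>|lebesgue. g b x * \<psi> x) = (\<integral>x. g b x * \<psi> x \<partial>lborel)"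
        by (rule set_lebesgue_integral_eq_lborel_support)
          (use m g(1)[OF b] \<Omega> test_functionsD(2)[OF \<psi>] in auto)
      ultimately show "(LINT x:\<Omega>|lebesgue. w x * partial_deriv b \<psi> x) = - (LINT x:\<Omega>|lebesgue. g b x * \<psi> x)"
        by simp
    qed
    show "\<phi> n \<in> test_functions \<Omega>" for n by (rule T)
    show "L2_conv \<Omega> \<phi> w"
    proof (rule L2_dist_tendsto_0_dominated[OF \<Omega>])
      show "(\<lambda>x. \<phi> n x - w x) \<in> borel_measurable borel" for n
        by (rule borel_measurable_diff[OF borel_measurable_continuous_onI[OF test_functionsD(5)[OF T]] wm])
      show "\<bar>\<phi> n x - w x\<bar> \<le> B + B" for n x unfolding \<phi>_def
      proof (rule conv_mollifier_close[OF r(1) Wm])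
        show "\<bar>W n y\<bar> \<le> B" for y using B(2) by (simp add: W_def)
        show "\<bar>W n y - w x\<bar> \<le> B + B" for y
          using B(2)[of "D n y"] B(2)[of x] unfolding W_def by linarith
      qed
    qed (use \<phi>_lim in auto)
    show "L2_conv \<Omega> (\<lambda>n. partial_deriv b (\<phi> n)) (g b)" if b: "b \<in> Basis" for b
    proof (rule L2_dist_tendsto_0_dominated[OF \<Omega>])
      show "(\<lambda>x. partial_deriv b (\<phi> n) x - g b x) \<in> borel_measurable borel" for n
        by (rule borel_measurable_diff[OF borel_measurable_continuous_onI[OF test_functionsD(6)[OF T b]] g(1)[OF b]])
      show "\<bar>partial_deriv b (\<phi> n) x - g b x\<bar> \<le> 2 * G + G" for n x unfolding pd[OF b]
      proof (rule conv_mollifier_close[OF r(1) qm[OF b] qB[OF b]])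
        show "\<bar>q n b y - g b x\<bar> \<le> 2 * G + G" for y using qB[OF b, of n y] g(2)[OF b, of x] by linarith
      qed
      show "AE x in lborel. (\<lambda>n. partial_deriv b (\<phi> n) x - g b x) \<longlonglongrightarrow> 0"
        using AE_not_in[OF N] by (rule eventually_mono) (rule pd_lim[OF b])
    qed
  qed
  thus ?thesis by (rule H10_I)
qed

section \<open>Geometry of the mesh\<close>

text \<open>Next to a boundary point, the open set below the Lipschitz graph is free of \<Omega>,
  and a small step from the point against \<open>e\<close> enters it. Hence no boundary point is
  interior to the closure: the domain has no slits.\<close>

lemma lipschitz_boundary_interior_closure:
  assumes \<Omega>: "open \<Omega>" and lb: "lipschitz_boundary \<Omega>"
  shows "interior (closure \<Omega>) = \<Omega>"
proof
  show "\<Omega> \<subseteq> interior (closure \<Omega>)"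
    using \<Omega> closure_subset by (rule interior_maximal[rotated])
  show "interior (closure \<Omega>) \<subseteq> \<Omega>"
  proof (rule ccontr)
    assume "\<not> interior (closure \<Omega>) \<subseteq> \<Omega>"
    then obtain x where x: "x \<in> interior (closure \<Omega>)" "x \<notin> \<Omega>" by blast
    hence "x \<in> frontier \<Omega>" using \<Omega> interior_subset by (auto simp: frontier_def interior_open)
    then obtain U e g L where U: "open U" "x \<in> U" "norm e = 1"
        and g: "L-lipschitz_on {y. y \<bullet> e = 0} (g :: 'a \<Rightarrow> real)"
        and \<Omega>U: "\<Omega> \<inter> U = {y \<in> U. g (y - (y \<bullet> e) *\<^sub>R e) < y \<bullet> e}"
      using lb[unfolded lipschitz_boundary_def, rule_format, of x] by blast
    define q where "q y = y - (y \<bullet> e) *\<^sub>R e" for y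
    have ee: "e \<bullet> e = 1" using U(3) by (simp add: dot_square_norm)
    have gq: "continuous_on UNIV (\<lambda>y. g (q y))"
      by (rule continuous_on_compose2[OF lipschitz_on_continuous_on[OF g]])
        (auto simp: q_def inner_diff_left ee intro!: continuous_intros)
    let ?V = "U \<inter> {y. y \<bullet> e < g (q y)}"
    have "open ?V" by (intro open_Int U(1) open_Collect_less gq continuous_intros)
    moreover have "?V \<inter> \<Omega> = {}"
    proof -
      have False if "y \<in> ?V" "y \<in> \<Omega>" for y
      proof -
        have "y \<in> {y \<in> U. g (y - (y \<bullet> e) *\<^sub>R e) < y \<bullet> e}"
          unfolding \<Omega>U[symmetric] using that by blast
        thus False using that by (simp add: q_def)
      qed
      thus ?thesis by blast
    qed
    ultimately have V: "?V \<inter> closure \<Omega> = {}" using open_Int_closure_eq_empty by blast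
    have xg: "x \<bullet> e \<le> g (q x)" using \<Omega>U U(2) x(2) by (auto simp: q_def not_less[symmetric])
    have "open (U \<inter> interior (closure \<Omega>))" "x \<in> U \<inter> interior (closure \<Omega>)"
      using U x by auto
    then obtain \<epsilon> where \<epsilon>: "\<epsilon> > 0" "ball x \<epsilon> \<subseteq> U \<inter> interior (closure \<Omega>)"
      using open_contains_ball by blast
    define y where "y = x - (\<epsilon> / 2) *\<^sub>R e"
    have "dist x y = \<epsilon> / 2" using U(3) \<epsilon>(1) by (simp add: y_def dist_norm)
    hence yU: "y \<in> U" "y \<in> interior (closure \<Omega>)" using \<epsilon> by auto
    have "q y = q x" "y \<bullet> e = x \<bullet> e - \<epsilon> / 2"
      by (simp_all add: q_def y_def inner_diff_left ee algebra_simps)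
    hence "y \<in> ?V" using xg \<epsilon>(1) yU(1) by simp
    thus False using V yU(2) interior_subset by blast
  qed
qed

lemma open_Collect_ball_finite:
  assumes "finite A" "\<And>v. v \<in> A \<Longrightarrow> open {x. P v x}"
  shows "open {x. \<forall>v\<in>A. P v x}"
proof -
  have "{x. \<forall>v\<in>A. P v x} = (\<Inter>v\<in>A. {x. P v x})" by auto
  thus ?thesis using assms by (simp add: open_INT)
qed

context simplex_facet
begin

text \<open>The relative interior of the facet, in barycentric terms.\<close>

definition core :: "'a set" where "core = {m \<in> F. \<forall>v\<in>V - {opp}. 0 < bc v m}"

lemma core_subset: "core \<subseteq> F" by (auto simp: core_def)

lemma F_subset: "F \<subseteq> K" using mem_facet_iff[OF facet] by blast

definition centroid :: 'a where "centroid = (\<Sum>v\<in>V. (if v = opp then 0 else 1 / real (card V - 1)) *\<^sub>R v)"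

lemma bc_centroid: "v \<in> V \<Longrightarrow> bc v centroid = (if v = opp then 0 else 1 / real (card V - 1))"
  unfolding centroid_def
proof (rule bc_comb)
  have "(\<Sum>v\<in>V. if v = opp then 0 else 1 / real (card V - 1)) = (\<Sum>v\<in>V - {opp}. 1 / real (card V - 1))"
    using finite_V opp_V by (simp add: sum.remove)
  also have "\<dots> = 1" using card_V opp_V finite_V by (simp add: card_Diff_singleton)
  finally show "(\<Sum>v\<in>V. if v = opp then 0 else 1 / real (card V - 1)) = 1" .
qed

lemma centroid_core: "centroid \<in> core"
  using card_V opp_V by (auto simp: core_def mem_facet_iff[OF facet] mem_K_iff bc_centroid)

lemma towards_centroid:
  assumes "x \<in> F" "0 < t" "t \<le> 1"
  shows "x + t *\<^sub>R (centroid - x) \<in> core"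
proof -
  have e: "bc v (x + t *\<^sub>R (centroid - x)) = (1 - t) * bc v x + t * bc v centroid" for v
    unfolding affine_fn_segment[OF affine_bc] by (simp add: algebra_simps)
  have c: "centroid \<in> F" "\<And>v. v \<in> V - {opp} \<Longrightarrow> 0 < bc v centroid"
    using centroid_core by (auto simp: core_def)
  have nn: "0 \<le> (1 - t) * bc v x" for v using assms bc_nonneg F_subset by (intro mult_nonneg_nonneg) auto
  have "0 < bc v (x + t *\<^sub>R (centroid - x))" if "v \<in> V - {opp}" for v
    unfolding e using nn[of v] mult_pos_pos[OF assms(2) c(2)[OF that]] by linarith
  moreover have "bc opp (x + t *\<^sub>R (centroid - x)) = 0"
    unfolding e using assms(1) c(1) mem_facet_iff[OF facet] by auto
  ultimately show ?thesis using opp_V by (auto simp: core_def mem_facet_iff[OF facet] mem_K_iff less_imp_le)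
      (metis Diff_iff less_imp_le order_refl singletonD)
qed

lemma towards_centroid_tendsto:
  "(\<lambda>n. x + (1 / real (Suc n)) *\<^sub>R (centroid - x)) \<longlonglongrightarrow> x"
proof -
  have "(\<lambda>n. x + (1 / real (Suc n)) *\<^sub>R (centroid - x)) \<longlonglongrightarrow> x + 0 *\<^sub>R (centroid - x)"
    using LIMSEQ_Suc[OF lim_1_over_n[where 'a = real]] by (intro tendsto_intros)
  thus ?thesis by simp
qed

lemma zero_on_core_imp_zero:
  assumes "continuous_on UNIV p" "\<And>m. m \<in> core \<Longrightarrow> p m = (0::real)" "x \<in> F"
  shows "p x = 0"
proof -
  have "(\<lambda>n. p (x + (1 / real (Suc n)) *\<^sub>R (centroid - x))) \<longlonglongrightarrow> p x"
    by (rule continuous_on_tendsto_compose[OF assms(1) towards_centroid_tendsto]) auto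
  moreover have "p (x + (1 / real (Suc n)) *\<^sub>R (centroid - x)) = 0" for n
    by (intro assms(2) towards_centroid assms(3)) auto
  ultimately show ?thesis by (simp add: LIMSEQ_const_iff)
qed

lemma core_neighbourhood:
  assumes "m \<in> core"
  shows "\<exists>r>0. \<forall>x\<in>ball m r. \<forall>v\<in>V - {opp}. 0 < bc v x"
proof -
  have "open {x. \<forall>v\<in>V - {opp}. 0 < bc v x}"
    using finite_V by (intro open_Collect_ball_finite) (auto intro!: open_Collect_less continuous_intros)
  moreover have "m \<in> {x. \<forall>v\<in>V - {opp}. 0 < bc v x}" using assms by (auto simp: core_def)
  ultimately obtain r where "r > 0" "ball m r \<subseteq> {x. \<forall>v\<in>V - {opp}. 0 < bc v x}"
    using open_contains_ball by blast
  thus ?thesis by blast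
qed

end

locale mesh =
  fixes \<Omega> :: "'a::euclidean_space set" and \<T> :: "'a set set"
  assumes dim: "DIM('a) \<ge> 2" and polytope: "lipschitz_polytope \<Omega>" and mesh: "conforming_mesh \<Omega> \<T>"
begin

lemma open_\<Omega>: "open \<Omega>" and connected_\<Omega>: "connected \<Omega>" and nonempty_\<Omega>: "\<Omega> \<noteq> {}" and bounded_\<Omega>: "bounded \<Omega>"
  and interior_closure: "interior (closure \<Omega>) = \<Omega>"
  using polytope lipschitz_boundary_interior_closure by (auto simp: lipschitz_polytope_def)

lemma finite_\<T>: "finite \<T>" and Union_\<T>: "\<Union>\<T> = closure \<Omega>"
  and simplex_\<T>: "K \<in> \<T> \<Longrightarrow> full_simplex K"
  and face_\<T>: "K \<in> \<T> \<Longrightarrow> K' \<in> \<T> \<Longrightarrow> (K \<inter> K') face_of K"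
  using mesh by (auto simp: conforming_mesh_def triangulation_def full_simplex_def)

lemma simplex_facet_\<T>: "K \<in> \<T> \<Longrightarrow> F facet_of K \<Longrightarrow> simplex_facet K F"
  by (simp add: simplex_facet_def simplex_facet_axioms_def simplex_\<T>)

lemma face_\<T>': "K \<in> \<T> \<Longrightarrow> K' \<in> \<T> \<Longrightarrow> (K \<inter> K') face_of K'"
  using face_\<T>[of K' K] by (simp add: Int_commute)

lemma nonempty_\<T>: "\<T> \<noteq> {}" using Union_\<T> nonempty_\<Omega> closure_subset[of \<Omega>] by auto

lemma closed_Union: "\<A> \<subseteq> \<T> \<Longrightarrow> closed (\<Union>\<A>)"
  using finite_\<T> simplex_\<T> full_simplex.closed_K by (meson closed_Union finite_subset subsetD)

lemma interior_simplex_subset: "K \<in> \<T> \<Longrightarrow> interior K \<subseteq> \<Omega>"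
  by (metis Union_\<T> Union_upper interior_closure interior_mono)

text \<open>The intersection is a face of both simplices. A face that meets the interior is the
  whole simplex, and this applies first to \<open>K\<close>, then to \<open>K'\<close>.\<close>

lemma simplex_eq_if_interior_meets:
  assumes "K \<in> \<T>" "K' \<in> \<T>" "x \<in> interior K" "x \<in> K'"
  shows "K = K'"
proof -
  have x: "x \<in> K" using assms(3) interior_subset by blast
  have "K \<inter> K' = K" using face_of_disjoint_interior[OF face_\<T>[OF assms(1,2)]] assms(3,4) x by blast
  hence "K face_of K'" "interior K \<subseteq> interior K'"
    using face_\<T>'[OF assms(1,2)] by (auto intro!: interior_mono)
  thus ?thesis using face_of_disjoint_interior[of K K'] assms(3) x by blast
qed

lemma common_face_vertices:
  assumes "K \<in> \<T>" "K' \<in> \<T>"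
  shows "K \<inter> K' = convex hull (\<V> K \<inter> \<V> K')"
proof -
  interpret K: full_simplex K by (rule simplex_\<T>[OF assms(1)])
  interpret K': full_simplex K' by (rule simplex_\<T>[OF assms(2)])
  obtain C where C: "C \<subseteq> \<V> K" "K \<inter> K' = convex hull C"
    using face_of_convex_hull_affine_independent[OF K.indep, of "K \<inter> K'"] face_\<T>[OF assms] by (auto simp: K.hull_V)
  obtain C' where C': "C' \<subseteq> \<V> K'" "K \<inter> K' = convex hull C'"
    using face_of_convex_hull_affine_independent[OF K'.indep, of "K \<inter> K'"] face_\<T>'[OF assms] by (auto simp: K'.hull_V)
  have "C = C'" using simplex_vertices_convex_hull[OF affine_independent_subset[OF K.indep C(1)]]
      simplex_vertices_convex_hull[OF affine_independent_subset[OF K'.indep C'(1)]] C C' by metis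
  moreover have "\<V> K \<inter> \<V> K' \<subseteq> C"
  proof
    fix v assume v: "v \<in> \<V> K \<inter> \<V> K'"
    hence "v \<in> convex hull C" using K.V_subset K'.V_subset C(2) by blast
    thus "v \<in> C" using K.mem_face_iff[OF C(1), of v] v K.bc_vertex[of v v] by (cases "v \<in> C") auto
  qed
  ultimately have "C = \<V> K \<inter> \<V> K'" using C(1) C'(1) by blast
  thus ?thesis using C(2) by simp
qed

text \<open>The point lies in the affine hull of the common vertices, where affine functions with
  the same vertex values agree. This is what makes nodal functions continuous across
  simplices.\<close>

lemma barycentric_eq:
  assumes "K \<in> \<T>" "K' \<in> \<T>" "x \<in> K" "x \<in> K'"
  shows "barycentric K z x = barycentric K' z x"
proof -
  interpret K: full_simplex K by (rule simplex_\<T>[OF assms(1)])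
  interpret K': full_simplex K' by (rule simplex_\<T>[OF assms(2)])
  have "x \<in> affine hull (\<V> K \<inter> \<V> K')"
    using common_face_vertices[OF assms(1,2)] assms(3,4) convex_hull_subset_affine_hull by blast
  thus ?thesis by (rule affine_fn_eq_on_affine_hull[OF K.affine_bc K'.affine_bc, rotated])
      (simp add: K.bc_vertex K'.bc_vertex)
qed

lemma positive_vertex_common:
  assumes "K \<in> \<T>" "K' \<in> \<T>" "x \<in> K" "x \<in> K'" "v \<in> \<V> K" "barycentric K v x > 0"
  shows "v \<in> \<V> K'"
proof -
  interpret K': full_simplex K' by (rule simplex_\<T>[OF assms(2)])
  show ?thesis using barycentric_eq[OF assms(1-4), of v] assms(6) K'.bc_not_vertex[of v x] by fastforce
qed

text \<open>At a core point all vertices of \<open>F\<close> have positive coordinates, and vertices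
  with positive coordinate at a common point belong to both simplices.\<close>

lemma core_imp_facet_subset:
  assumes K: "K \<in> \<T>" "K' \<in> \<T>" and F: "F facet_of K" and m: "m \<in> simplex_facet.core K F" "m \<in> K'"
  shows "F \<subseteq> K'"
proof -
  interpret K: simplex_facet K F by (rule simplex_facet_\<T>[OF K(1) F])
  interpret K': full_simplex K' by (rule simplex_\<T>[OF K(2)])
  have "m \<in> K" using m(1) K.core_subset K.F_subset by blast
  hence "\<V> K - {K.opp} \<subseteq> \<V> K'"
    using positive_vertex_common[OF K _ m(2)] m(1) by (auto simp: K.core_def)
  hence "convex hull (\<V> K - {K.opp}) \<subseteq> convex hull (\<V> K')" by (rule hull_mono)
  thus ?thesis using K.F_eq K'.hull_V by metis
qed

text \<open>A dimension count: for distinct simplices the intersection is a proper face of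
  \<open>K\<close> containing \<open>F\<close>, hence has the dimension of \<open>F\<close> and
  equals it.\<close>

lemma shared_facet:
  assumes "K \<in> \<T>" "K' \<in> \<T>" "F facet_of K" "F \<subseteq> K'"
  shows "F facet_of K'"
proof (cases "K = K'")
  case False
  interpret K: full_simplex K by (rule simplex_\<T>[OF assms(1)])
  interpret K': full_simplex K' by (rule simplex_\<T>[OF assms(2)])
  let ?G = "K \<inter> K'"
  have FK: "F face_of K" "F \<noteq> {}" "aff_dim F = aff_dim K - 1" using assms(3) by (auto simp: facet_of_def)
  have FG: "F \<subseteq> ?G" using FK(1) face_of_imp_subset assms(4) by blast
  have "?G \<noteq> K"
    using K.interior_nonempty simplex_eq_if_interior_meets[OF assms(1,2)] False interior_subset by blast
  hence "aff_dim ?G < aff_dim K" using face_of_aff_dim_lt[OF K.convex_K face_\<T>[OF assms(1,2)]] by simp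
  moreover have "aff_dim F \<le> aff_dim ?G" by (rule aff_dim_subset[OF FG])
  ultimately have dimG: "aff_dim ?G = aff_dim F" using FK(3) by linarith
  have "F face_of ?G" using face_of_subset[OF FK(1) FG] by blast
  hence "F = ?G" using face_of_aff_dim_lt[of ?G F] dimG convex_Int[OF K.convex_K K'.convex_K] by fastforce
  moreover have "aff_dim K = aff_dim K'" using K.simplex K'.simplex aff_dim_simplex by metis
  ultimately show ?thesis using face_\<T>'[OF assms(1,2)] FK by (simp add: facet_of_def)
qed (use assms in simp)

lemma facet_patchD:
  assumes "F \<in> mesh_facets \<T>" "K \<in> facet_patch \<T> F"
  shows "K \<in> \<T>" "F facet_of K" "simplex_facet K F"
proof -
  obtain K0 where K0: "K0 \<in> \<T>" "F facet_of K0" using assms(1) by (auto simp: mesh_facets_def)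
  show K: "K \<in> \<T>" using assms(2) by (simp add: facet_patch_def)
  show F: "F facet_of K" using shared_facet[OF K0(1) K K0(2)] assms(2) by (simp add: facet_patch_def)
  show "simplex_facet K F" by (rule simplex_facet_\<T>[OF K F])
qed

lemma facet_patch_iff: "F \<in> mesh_facets \<T> \<Longrightarrow> K \<in> facet_patch \<T> F \<longleftrightarrow> K \<in> \<T> \<and> F facet_of K"
  using facet_patchD(1,2) by (auto simp: facet_patch_def facet_of_def dest: face_of_imp_subset)

text \<open>Two simplices with a common facet lie on opposite sides of it.\<close>

lemma core_interior_Un:
  assumes K: "K \<in> \<T>" "K' \<in> \<T>" "K \<noteq> K'" and F: "F facet_of K" "F \<subseteq> K'" and m: "m \<in> simplex_facet.core K F"
  shows "m \<in> interior (K \<union> K')"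
proof -
  interpret K: simplex_facet K F by (rule simplex_facet_\<T>[OF K(1) F(1)])
  interpret K': simplex_facet K' F by (rule simplex_facet_\<T>[OF K(2) shared_facet[OF K(1,2) F]])
  have V: "\<V> K - {K.opp} = \<V> K' - {K'.opp}"
    using K.facet_vertices(1)[OF K.facet] K'.facet_vertices(1)[OF K'.facet] by simp
  have mF: "m \<in> F" "m \<in> K" "m \<in> K'" using m K.core_subset K.F_subset F(2) by auto
  have m': "m \<in> K'.core" using m mF barycentric_eq[OF K(1,2) mF(2,3)] V by (auto simp: K.core_def K'.core_def)
  \<comment> \<open>Both opposite coordinates vanish on the vertices of \<open>F\<close>, so they
    are proportional, with ratio the value at the opposite vertex of \<open>K\<close>. Its sign
    tells whether the simplices are on the same side.\<close>
  define c where "c = K'.bc K'.opp K.opp"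
  have l': "K'.bc K'.opp x = c * K.bc K.opp x" for x
  proof -
    have "K'.bc K'.opp x = (\<Sum>v\<in>\<V> K. K'.bc K'.opp v * K.bc v x)"
      by (rule K.affine_fn_expansion[OF K'.affine_bc])
    also have "\<dots> = c * K.bc K.opp x + (\<Sum>v\<in>\<V> K - {K.opp}. K'.bc K'.opp v * K.bc v x)"
      unfolding c_def by (rule sum.remove[OF K.finite_V K.opp_V])
    also have "(\<Sum>v\<in>\<V> K - {K.opp}. K'.bc K'.opp v * K.bc v x) = 0"
      unfolding V by (rule sum.neutral) (auto simp: K'.bc_vertex)
    finally show ?thesis by simp
  qed
  obtain r where r: "r > 0" "\<And>x v. x \<in> ball m r \<Longrightarrow> v \<in> \<V> K - {K.opp} \<Longrightarrow> 0 < K.bc v x"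
    using K.core_neighbourhood[OF m] by blast
  obtain r' where r': "r' > 0" "\<And>x v. x \<in> ball m r' \<Longrightarrow> v \<in> \<V> K' - {K'.opp} \<Longrightarrow> 0 < K'.bc v x"
    using K'.core_neighbourhood[OF m'] by blast
  define \<rho> where "\<rho> = min r r'"
  have \<rho>: "\<rho> > 0" using r(1) r'(1) by (simp add: \<rho>_def)
  have ir: "x \<in> interior K" if "x \<in> ball m \<rho>" "0 < K.bc K.opp x" for x
    unfolding K.mem_interior_iff using r(2)[of x] that by (auto simp: \<rho>_def)
  have ir': "x \<in> interior K'" if "x \<in> ball m \<rho>" "0 < K'.bc K'.opp x" for x
    unfolding K'.mem_interior_iff using r'(2)[of x] that by (auto simp: \<rho>_def)
  \<comment> \<open>With a positive ratio, a point slightly above the facet would lie in both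
    interiors.\<close>
  have "\<not> c > 0"
  proof
    assume c: "c > 0"
    define y where "y = m + (\<rho> / 2) *\<^sub>R K.normal"
    have hm: "K.height m = 0" using mF(1) K.mem_facet_iff[OF K.facet] by (simp add: K.height_def)
    have "K.height y = \<rho> / 2" unfolding y_def K.height_add hm by simp
    hence "0 < K.bc K.opp y"
      using \<rho> K.grad_nonzero by (smt (verit) K.height_def half_gt_zero norm_ge_zero zero_less_divide_iff)
    moreover have "y \<in> ball m \<rho>" using \<rho> by (simp add: y_def dist_norm K.norm_normal)
    ultimately have "y \<in> interior K" "y \<in> interior K'" using ir ir' l' c by auto
    thus False using simplex_eq_if_interior_meets[OF K(1,2)] K(3) interior_subset by blast
  qed
  moreover have "c \<noteq> 0" using l'[of K'.opp] K'.bc_vertex[OF K'.opp_V, of K'.opp] by auto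
  ultimately have c: "c < 0" by simp
  have "ball m \<rho> \<subseteq> K \<union> K'"
  proof
    fix x assume x: "x \<in> ball m \<rho>"
    show "x \<in> K \<union> K'"
    proof (cases "0 \<le> K.bc K.opp x")
      case True
      hence "x \<in> K" unfolding K.mem_K_iff using r(2)[of x] x by (auto simp: \<rho>_def less_imp_le)
          (metis Diff_iff dist_commute less_imp_le mem_ball singletonD)
      thus ?thesis by blast
    next
      case False
      hence "0 < K'.bc K'.opp x" unfolding l' using c by (simp add: mult_neg_neg)
      thus ?thesis using ir'[OF x] interior_subset by blast
    qed
  qed
  thus ?thesis using \<rho> by (meson centre_in_ball interior_maximal open_ball subsetD)
qed

lemma frontier_\<Omega>: "frontier \<Omega> = closure \<Omega> - \<Omega>"
  using open_\<Omega> by (simp add: frontier_def interior_open)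

lemma mesh_facet_subset: "F \<in> mesh_facets \<T> \<Longrightarrow> F \<subseteq> closure \<Omega>"
  using Union_\<T> by (force simp: mesh_facets_def facet_of_def dest: face_of_imp_subset)

lemma facet_in_mesh: "K \<in> \<T> \<Longrightarrow> F facet_of K \<Longrightarrow> F \<in> mesh_facets \<T>"
  by (auto simp: mesh_facets_def)

text \<open>An interior facet is merely not contained in the frontier. A point of \<open>F\<close>
  in \<Omega> is moved into the core without leaving \<Omega>; points of \<Omega> just outside
  \<open>K\<close> converge to it. They lie in the other simplices, whose finite union is closed, so
  the core point lies in one of these.\<close>

lemma interior_facet_neighbour:
  assumes F: "F \<in> interior_facets \<Omega> \<T>" and K: "K \<in> \<T>" "F facet_of K"
  obtains K' where "K' \<in> \<T>" "K' \<noteq> K" "F \<subseteq> K'"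
proof -
  interpret K: simplex_facet K F by (rule simplex_facet_\<T>[OF K(1) K(2)])
  have "F \<in> mesh_facets \<T>" "\<not> F \<subseteq> frontier \<Omega>"
    using F by (auto simp: interior_facets_def boundary_facets_def)
  then obtain x where x: "x \<in> F" "x \<in> \<Omega>" using mesh_facet_subset frontier_\<Omega> by blast
  have "\<forall>\<^sub>F n in sequentially. x + (1 / real (Suc n)) *\<^sub>R (K.centroid - x) \<in> \<Omega>"
    using topological_tendstoD[OF K.towards_centroid_tendsto open_\<Omega> x(2)] .
  then obtain n where n: "x + (1 / real (Suc n)) *\<^sub>R (K.centroid - x) \<in> \<Omega>"
    by (meson eventually_sequentially order_refl)
  define m where "m = x + (1 / real (Suc n)) *\<^sub>R (K.centroid - x)"
  have m: "m \<in> K.core" "m \<in> \<Omega>"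
    using K.towards_centroid[OF x(1), of "1 / real (Suc n)"] n by (auto simp: m_def)
  have hm: "K.height m = 0" using m(1) K.core_subset K.mem_facet_iff[OF K.facet] by (auto simp: K.height_def)
  define y where "y j = m + (- (1 / real (Suc j))) *\<^sub>R K.normal" for j
  have "(\<lambda>j. m + (- (1 / real (Suc j))) *\<^sub>R K.normal) \<longlonglongrightarrow> m + (- 0) *\<^sub>R K.normal"
    using LIMSEQ_Suc[OF lim_1_over_n[where 'a = real]] by (intro tendsto_intros)
  hence y: "y \<longlonglongrightarrow> m" by (simp add: y_def[abs_def])
  have yK: "y j \<notin> K" for j
  proof
    assume "y j \<in> K"
    hence "0 \<le> K.height (y j)" using K.bc_nonneg by (simp add: K.height_def)
    thus False unfolding y_def K.height_add hm by simp
  qed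
  have "\<forall>\<^sub>F j in sequentially. y j \<in> \<Union>(\<T> - {K})"
    using topological_tendstoD[OF y open_\<Omega> m(2)]
  proof (rule eventually_mono)
    fix j assume "y j \<in> \<Omega>"
    hence "y j \<in> \<Union>\<T>" using Union_\<T> closure_subset by blast
    thus "y j \<in> \<Union>(\<T> - {K})" using yK by blast
  qed
  hence "m \<in> \<Union>(\<T> - {K})"
    using Lim_in_closed_set[OF closed_Union _ trivial_limit_sequentially y] by blast
  then obtain K' where K': "K' \<in> \<T>" "K' \<noteq> K" "m \<in> K'" by blast
  thus ?thesis using that core_imp_facet_subset[OF K(1) K'(1) K(2) m(1) K'(3)] by blast
qed

text \<open>The core lies in the interior of the union of the two simplices, hence in the interior
  of the closure of \<Omega>, which is \<Omega>.\<close>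

lemma facet_interior_if_shared:
  assumes K: "K \<in> \<T>" "K' \<in> \<T>" "K \<noteq> K'" and F: "F facet_of K" "F \<subseteq> K'"
  shows "F \<in> interior_facets \<Omega> \<T>" "simplex_facet.core K F \<subseteq> \<Omega>"
proof -
  interpret K: simplex_facet K F by (rule simplex_facet_\<T>[OF K(1) F(1)])
  have "K \<union> K' \<subseteq> closure \<Omega>" using K Union_\<T> by blast
  hence "interior (K \<union> K') \<subseteq> \<Omega>" using interior_mono interior_closure by metis
  thus "K.core \<subseteq> \<Omega>" using core_interior_Un[OF K F] by blast
  thus "F \<in> interior_facets \<Omega> \<T>"
    using K.centroid_core K.core_subset facet_in_mesh[OF K(1) F(1)] frontier_\<Omega>
    by (auto simp: interior_facets_def boundary_facets_def)
qed

lemma boundary_facet_unique: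
  assumes "F \<in> boundary_facets \<Omega> \<T>" "K \<in> \<T>" "K' \<in> \<T>" "F facet_of K" "F \<subseteq> K'"
  shows "K = K'"
  using facet_interior_if_shared(1)[OF assms(2,3) _ assms(4,5)] assms(1) by (auto simp: interior_facets_def)

lemma mesh_facets_cases: "F \<in> mesh_facets \<T> \<longleftrightarrow> F \<in> interior_facets \<Omega> \<T> \<or> F \<in> boundary_facets \<Omega> \<T>"
  by (auto simp: interior_facets_def boundary_facets_def)

text \<open>No other simplex comes near a core point of a boundary facet, so locally \<Omega> is the
  part of \<open>K\<close> above the facet. This is the local picture required by
  \<open>H10_trace_zero\<close>.\<close>

lemma boundary_facet_half_ball:
  assumes F: "F \<in> boundary_facets \<Omega> \<T>" and K: "K \<in> \<T>" "F facet_of K" and m: "m \<in> simplex_facet.core K F"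
  shows "\<exists>r n. r > 0 \<and> norm n = 1 \<and> \<Omega> \<inter> ball m r = {x \<in> ball m r. 0 < (x - m) \<bullet> n} \<and> \<Omega> \<inter> ball m r \<subseteq> K"
proof -
  interpret K: simplex_facet K F by (rule simplex_facet_\<T>[OF K(1) K(2)])
  have mK: "m \<in> F" "m \<in> K" using m K.core_subset K.F_subset by auto
  have hm: "K.height m = 0" using mK K.mem_facet_iff[OF K.facet] by (auto simp: K.height_def)
  have h: "K.height x = (x - m) \<bullet> K.normal" for x
    using K.height_diff[of x m] hm by (simp add: inner_commute)
  have "m \<notin> \<Union>(\<T> - {K})"
    using core_imp_facet_subset[OF K(1) _ K(2) m] boundary_facet_unique[OF F K(1) _ K(2)] by blast
  moreover have "closed (\<Union>(\<T> - {K}))" by (rule closed_Union) blast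
  ultimately have "open (- \<Union>(\<T> - {K}))" "m \<in> - \<Union>(\<T> - {K})" by auto
  then obtain r1 where r1: "r1 > 0" "ball m r1 \<subseteq> - \<Union>(\<T> - {K})" using open_contains_ball by blast
  obtain r2 where r2: "r2 > 0" "\<And>x v. x \<in> ball m r2 \<Longrightarrow> v \<in> \<V> K - {K.opp} \<Longrightarrow> 0 < K.bc v x"
    using K.core_neighbourhood[OF m] by blast
  define r where "r = min r1 r2"
  have r: "r > 0" "ball m r \<subseteq> ball m r1" "ball m r \<subseteq> ball m r2"
    using r1 r2 by (auto simp: r_def)
  have cl: "x \<in> K" if "x \<in> closure \<Omega>" "x \<in> ball m r" for x
    using that r1(2) r(2) Union_\<T> by blast
  have "\<Omega> \<inter> ball m r = {x \<in> ball m r. 0 < (x - m) \<bullet> K.normal}"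
  proof (intro set_eqI iffI)
    fix x assume x: "x \<in> \<Omega> \<inter> ball m r"
    hence "x \<in> \<Omega> \<inter> ball m r" "open (\<Omega> \<inter> ball m r)" using open_\<Omega> by auto
    then obtain e where e: "e > 0" "ball x e \<subseteq> \<Omega> \<inter> ball m r"
      using open_contains_ball by blast
    \<comment> \<open>A point of the open set \<Omega> can be moved a little downwards and still
      lies in \<open>K\<close>, so its height was strictly positive.\<close>
    define y where "y = x + (- e / 2) *\<^sub>R K.normal"
    have "y \<in> ball x e" using e(1) by (simp add: y_def dist_norm K.norm_normal)
    hence "y \<in> K" using e(2) cl closure_subset[of \<Omega>] by blast
    hence "0 \<le> K.height y" using K.bc_nonneg by (simp add: K.height_def)
    hence "0 < K.height x" unfolding y_def K.height_add using e(1) by simp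
    thus "x \<in> {x \<in> ball m r. 0 < (x - m) \<bullet> K.normal}" using x h by simp
  next
    fix x assume x: "x \<in> {x \<in> ball m r. 0 < (x - m) \<bullet> K.normal}"
    hence "0 < K.height x" using h[of x] by simp
    hence "0 < K.bc K.opp x" using K.grad_nonzero unfolding K.height_def by (auto simp: zero_less_divide_iff)
    hence "x \<in> interior K" unfolding K.mem_interior_iff using r2(2)[of x] r(3) x by blast
    thus "x \<in> \<Omega> \<inter> ball m r" using x interior_simplex_subset[OF K(1)] by blast
  qed
  moreover have "\<Omega> \<inter> ball m r \<subseteq> K" using cl closure_subset by blast
  ultimately show ?thesis using r(1) K.norm_normal by blast
qed

text \<open>Two closed unions that cover the connected set \<Omega> and both meet it have a common
  point; there the common face of two simplices is nonempty and so has a vertex. Contact in a vertex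
  suffices, since coefficients are compared through vertex values.\<close>

lemma vertex_connected:
  assumes \<A>: "\<A> \<subseteq> \<T>" "\<A> \<noteq> {}" "\<A> \<noteq> \<T>"
  obtains K K' v where "K \<in> \<A>" "K' \<in> \<T> - \<A>" "v \<in> \<V> K" "v \<in> \<V> K'"
proof -
  let ?A = "\<Union>\<A>" and ?B = "\<Union>(\<T> - \<A>)"
  have meets: "K \<inter> \<Omega> \<noteq> {}" if "K \<in> \<T>" for K
    using full_simplex.interior_nonempty[OF simplex_\<T>[OF that]] interior_simplex_subset[OF that]
      interior_subset[of K] by blast
  obtain K1 K2 where K12: "K1 \<in> \<A>" "K2 \<in> \<T> - \<A>" using \<A> by blast
  have "?A \<inter> ?B \<inter> \<Omega> \<noteq> {}"
  proof
    assume disj: "?A \<inter> ?B \<inter> \<Omega> = {}"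
    have cover: "\<Omega> \<subseteq> ?A \<union> ?B" using Union_\<T> closure_subset[of \<Omega>] by blast
    have "?A \<inter> \<Omega> \<noteq> {}" "?B \<inter> \<Omega> \<noteq> {}"
      using K12 \<A>(1) meets[of K1] meets[of K2] by blast+
    thus False
      using connected_closedD[OF connected_\<Omega> disj cover closed_Union[OF \<A>(1)] closed_Union[of "\<T> - \<A>"]]
      by blast
  qed
  then obtain x K K' where x: "K \<in> \<A>" "K' \<in> \<T> - \<A>" "x \<in> K" "x \<in> K'" by blast
  hence "K \<in> \<T>" "K' \<in> \<T>" using \<A>(1) by blast+
  hence "\<V> K \<inter> \<V> K' \<noteq> {}" using common_face_vertices[of K K'] x(3,4) by auto
  thus ?thesis using that x(1,2) by blast
qed

text \<open>If all facets of \<open>K\<close> were boundary facets, the frontier of \<open>K\<close>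
  would miss \<Omega>, and connectedness would confine \<Omega> to \<open>K\<close>.\<close>

lemma interior_facet_exists:
  assumes K: "K \<in> \<T>" "K' \<in> \<T>" "K \<noteq> K'"
  shows "interior_facets \<Omega> \<T> \<noteq> {}"
proof
  assume none: "interior_facets \<Omega> \<T> = {}"
  interpret K: full_simplex K by (rule simplex_\<T>[OF K(1)])
  have "\<Omega> \<inter> frontier K = {}"
  proof (rule ccontr)
    assume "\<Omega> \<inter> frontier K \<noteq> {}"
    then obtain x where x: "x \<in> \<Omega>" "x \<in> K" "x \<notin> interior K"
      using K.closed_K by (auto simp: frontier_def)
    then obtain u where u: "u \<in> \<V> K" "\<not> 0 < K.bc u x" using K.mem_interior_iff[of x] by blast
    hence "K.bc u x = 0" using K.bc_nonneg[OF x(2), of u] by simp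
    hence "x \<in> convex hull (\<V> K - {u})" using K.mem_face_iff[of "\<V> K - {u}" x] x(2) u(1) by auto
    moreover have "convex hull (\<V> K - {u}) \<in> boundary_facets \<Omega> \<T>"
      using facet_in_mesh[OF K(1) K.facet_of_vertex(1)[OF u(1)]] none mesh_facets_cases by blast
    ultimately have "x \<in> frontier \<Omega>" unfolding boundary_facets_def by blast
    thus False using x(1) frontier_\<Omega> by blast
  qed
  moreover have "\<Omega> \<inter> K \<noteq> {}"
    using K.interior_nonempty interior_simplex_subset[OF K(1)] interior_subset[of K] by blast
  ultimately have "\<Omega> \<subseteq> K" using connected_Int_frontier[OF connected_\<Omega>, of K] by blast
  hence "closure \<Omega> \<subseteq> K" using K.closed_K by (rule closure_minimal)
  moreover obtain x where x: "x \<in> interior K'"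
    using full_simplex.interior_nonempty[OF simplex_\<T>[OF K(2)]] by blast
  ultimately have "x \<in> K" using K(2) Union_\<T> interior_subset by blast
  thus False using simplex_eq_if_interior_meets[OF K(2,1) x] K(3) by blast
qed

lemma finite_mesh_facets: "finite (mesh_facets \<T>)"
proof -
  have "finite {F. F facet_of K}" if "K \<in> \<T>" for K
  proof -
    interpret full_simplex K by (rule simplex_\<T>[OF that])
    show ?thesis using bij_betw_finite[OF bij_betw_opposite] finite_V by blast
  qed
  moreover have "mesh_facets \<T> = (\<Union>K\<in>\<T>. {F. F facet_of K})" by (auto simp: mesh_facets_def)
  ultimately show ?thesis using finite_\<T> by simp
qed

text \<open>A segment in general position from \<open>\<Omega>\<close> to a point outside its closure meets the simplex
  boundaries only in the cores of facets, and the cores of interior facets lie in \<open>\<Omega>\<close>.\<close>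

lemma frontier_subset_boundary_facets: "frontier \<Omega> \<subseteq> \<Union>(boundary_facets \<Omega> \<T>)"
proof (intro subsetI, rule ccontr)
  let ?B = "\<Union>(boundary_facets \<Omega> \<T>)"
  fix x assume x: "x \<in> frontier \<Omega>" and xB: "x \<notin> ?B"
  have "closed F" if "F \<in> boundary_facets \<Omega> \<T>" for F
    using that simplex_facet.compact_F[OF simplex_facet_\<T>]
    by (auto simp: boundary_facets_def mesh_facets_def intro: compact_imp_closed)
  hence "closed ?B"
    using finite_mesh_facets by (intro Topological_Spaces.closed_Union) (auto simp: boundary_facets_def)
  hence "open (- ?B)" "x \<in> - ?B" using xB by auto
  then obtain e where e: "e > 0" "ball x e \<subseteq> - ?B" using open_contains_ball by blast
  have "x \<in> closure \<Omega>" "x \<notin> interior (closure \<Omega>)"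
    using x frontier_\<Omega> interior_closure by auto
  then obtain p where p: "p \<in> \<Omega>" "p \<in> ball x e"
    using e(1) by (auto simp: closure_approachable dist_commute)
  \<comment> \<open>General position: \<open>H (K, u, v)\<close> is spanned by \<open>p\<close> and
    the face of \<open>K\<close> without the vertices \<open>u\<close> and \<open>v\<close>. It has
    dimension below d, so an open set of candidates for \<open>q\<close> is not covered by these
    finitely many sets.\<close>
  define I where "I = (SIGMA K:\<T>. {(u, v). u \<in> \<V> K \<and> v \<in> \<V> K \<and> u \<noteq> v})"
  define H where "H = (\<lambda>(K, u, v). affine hull (insert p (\<V> K - {u, v})))"
  have finI: "finite I" unfolding I_def
  proof (intro finite_SigmaI finite_\<T>)
    fix K assume "K \<in> \<T>"
    hence "finite (\<V> K \<times> \<V> K)" using full_simplex.finite_V[OF simplex_\<T>] by simp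
    thus "finite {(u, v). u \<in> \<V> K \<and> v \<in> \<V> K \<and> u \<noteq> v}"
      by (rule rev_finite_subset) auto
  qed
  have "negligible (H i)" if iI: "i \<in> I" for i
  proof -
    obtain K u v where i: "i = (K, u, v)" "K \<in> \<T>" "u \<in> \<V> K" "v \<in> \<V> K" "u \<noteq> v"
      using iI unfolding I_def by blast
    interpret K: full_simplex K by (rule simplex_\<T>[OF i(2)])
    have "card (\<V> K - {u, v}) = DIM('a) - 1" using i K.card_V K.finite_V by (simp add: card_Diff_subset)
    hence "aff_dim (\<V> K - {u, v}) \<le> int (DIM('a) - 1) - 1"
      using aff_dim_le_card[of "\<V> K - {u, v}"] K.finite_V by simp
    hence "aff_dim (insert p (\<V> K - {u, v})) < int DIM('a)" using dim by (auto simp: aff_dim_insert)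
    hence "interior (H i) = {}"
      using aff_dim_nonempty_interior[of "H i"] by (auto simp: H_def i(1) aff_dim_affine_hull)
    thus ?thesis using negligible_convex_interior[of "H i"] by (simp add: H_def i(1) affine_imp_convex)
  qed
  hence neg: "negligible (\<Union>i\<in>I. H i)" using finI by (intro negligible_Union) auto
  have "\<not> ball x e \<subseteq> closure \<Omega>"
    using \<open>x \<notin> interior (closure \<Omega>)\<close> e(1) by (meson centre_in_ball interior_maximal open_ball subsetD)
  hence "open (ball x e - closure \<Omega>)" "ball x e - closure \<Omega> \<noteq> {}" by auto
  hence "\<not> ball x e - closure \<Omega> \<subseteq> (\<Union>i\<in>I. H i)"
    using negligible_subset[OF neg] open_not_negligible by blast
  then obtain q where q: "q \<in> ball x e" "q \<notin> closure \<Omega>" "\<And>i. i \<in> I \<Longrightarrow> q \<notin> H i"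
    by blast
  define \<gamma> where "\<gamma> s = p + s *\<^sub>R (q - p)" for s :: real
  have \<gamma>_ball: "\<gamma> s \<in> ball x e" if "s \<in> {0..1}" for s
  proof -
    have "\<gamma> s = (1 - s) *\<^sub>R p + s *\<^sub>R q" by (simp add: \<gamma>_def algebra_simps)
    thus ?thesis using convexD[OF convex_ball p(2) q(1), of "1 - s" s] that by simp
  qed
  have inside: "\<gamma> s \<in> \<Omega>" if s: "s \<in> {0..1}" "\<gamma> s \<in> closure \<Omega>" for s
  proof (rule ccontr)
    assume out: "\<gamma> s \<notin> \<Omega>"
    hence "s \<noteq> 0" using p(1) by (auto simp: \<gamma>_def)
    obtain K where K: "K \<in> \<T>" "\<gamma> s \<in> K" using s(2) Union_\<T> by blast
    interpret K: full_simplex K by (rule simplex_\<T>[OF K(1)])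
    have "\<gamma> s \<notin> interior K" using out interior_simplex_subset[OF K(1)] by blast
    then obtain u where "u \<in> \<V> K" "\<not> 0 < K.bc u (\<gamma> s)"
      using K.mem_interior_iff[of "\<gamma> s"] by blast
    hence u: "u \<in> \<V> K" "K.bc u (\<gamma> s) = 0" using K.bc_nonneg[OF K(2), of u] by auto
    define F where "F = convex hull (\<V> K - {u})"
    have F: "F facet_of K" "opposite_vertex K F = u" unfolding F_def using K.facet_of_vertex[OF u(1)] by auto
    interpret K: simplex_facet K F using F(1) by unfold_locales
    have \<gamma>F: "\<gamma> s \<in> F" using K.mem_facet_iff[OF F(1)] K(2) u F(2) by simp
    have "\<gamma> s \<in> K.core" unfolding K.core_def
    proof (intro CollectI conjI ballI \<gamma>F)
      fix v assume v: "v \<in> \<V> K - {opposite_vertex K F}"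
      hence uv: "v \<in> \<V> K" "u \<noteq> v" using F(2) by auto
      show "0 < K.bc v (\<gamma> s)"
      proof (rule ccontr)
        assume "\<not> 0 < K.bc v (\<gamma> s)"
        hence "K.bc v (\<gamma> s) = 0" using K.bc_nonneg[OF K(2), of v] by simp
        hence "\<gamma> s \<in> convex hull (\<V> K - {u, v})" using u uv K(2) by (subst K.mem_face_iff) auto
        hence "\<gamma> s \<in> H (K, u, v)" unfolding H_def using convex_hull_subset_affine_hull
            hull_mono[of "\<V> K - {u, v}" "insert p (\<V> K - {u, v})" affine] by fastforce
        moreover have "p \<in> H (K, u, v)" by (simp add: H_def hull_inc)
        \<comment> \<open>\<open>q\<close> is recovered by extrapolating the segment from
          \<open>p\<close> through the point at parameter \<open>s\<close>, and so it would lie in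
          an affine set that it was chosen to avoid.\<close>
        ultimately have "(1 - 1 / s) *\<^sub>R p + (1 / s) *\<^sub>R \<gamma> s \<in> H (K, u, v)"
          unfolding H_def by (intro mem_affine) (auto simp: affine_affine_hull)
        moreover have "(1 - 1 / s) *\<^sub>R p + (1 / s) *\<^sub>R \<gamma> s = q"
          using \<open>s \<noteq> 0\<close> by (simp add: \<gamma>_def algebra_simps)
        moreover have "(K, u, v) \<in> I" using K(1) u uv by (simp add: I_def)
        ultimately show False using q(3) by metis
      qed
    qed
    moreover have "F \<in> interior_facets \<Omega> \<T>"
      using \<gamma>F \<gamma>_ball[OF s(1)] e(2) facet_in_mesh[OF K(1) F(1)] mesh_facets_cases by blast
    then obtain K' where "K' \<in> \<T>" "K' \<noteq> K" "F \<subseteq> K'"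
      by (rule interior_facet_neighbour[OF _ K(1) F(1)])
    ultimately show False using facet_interior_if_shared(2)[OF K(1) _ _ F(1)] out by blast
  qed
  have "connected (\<gamma> ` {0..1})"
    unfolding \<gamma>_def by (intro connected_continuous_image continuous_intros connected_Icc)
  moreover have "\<gamma> 0 = p" "\<gamma> 1 = q" by (simp_all add: \<gamma>_def)
  hence "\<gamma> ` {0..1} \<inter> \<Omega> \<noteq> {}" "\<gamma> ` {0..1} - \<Omega> \<noteq> {}"
    using p(1) q(2) closure_subset[of \<Omega>] image_eqI[of p \<gamma> 0 "{0..1}"] image_eqI[of q \<gamma> 1 "{0..1}"] by auto
  ultimately have "\<gamma> ` {0..1} \<inter> frontier \<Omega> \<noteq> {}" by (rule connected_Int_frontier)
  thus False using inside frontier_\<Omega> by auto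
qed

text \<open>If the point were on a boundary facet, every vertex with positive coordinate there would
  be a vertex of that facet, which puts \<open>z\<close> on the frontier.\<close>

lemma positive_coordinate_interior_vertex:
  assumes z: "z \<in> \<Omega>" and K: "K \<in> \<T>" "z \<in> \<V> K" and x: "x \<in> K" "barycentric K z x > 0"
  shows "x \<in> \<Omega>"
proof (rule ccontr)
  assume "x \<notin> \<Omega>"
  hence "x \<in> frontier \<Omega>" using x(1) K(1) Union_\<T> frontier_\<Omega> by blast
  then obtain F where F: "F \<in> boundary_facets \<Omega> \<T>" "x \<in> F"
    using frontier_subset_boundary_facets by blast
  then obtain L where L: "L \<in> \<T>" "F facet_of L" by (auto simp: boundary_facets_def mesh_facets_def)
  interpret L: simplex_facet L F by (rule simplex_facet_\<T>[OF L])
  have "x \<in> L" using F(2) L.F_subset by blast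
  hence "z \<in> L.V" "L.bc z x > 0"
    using positive_vertex_common[OF K(1) L(1) x(1) _ K(2) x(2)] barycentric_eq[OF K(1) L(1) x(1)] x(2) by auto
  hence "z \<in> F" using L.facet_vertices(2)[OF L(2)] L.mem_facet_iff[OF L(2)] F(2) by fastforce
  thus False using F(1) z frontier_\<Omega> by (auto simp: boundary_facets_def)
qed

lemma boundary_facet_exists: obtains F where "F \<in> boundary_facets \<Omega> \<T>"
proof -
  have "frontier \<Omega> \<noteq> {}"
    using nonempty_\<Omega> bounded_\<Omega> not_bounded_UNIV by (auto simp: frontier_eq_empty)
  thus ?thesis using that frontier_subset_boundary_facets by blast
qed

end

section \<open>Hat functions and traces\<close>

text \<open>On the segment between two points the pieces pull back to finitely many closed sets that
  cover the unit interval, where Lipschitz bounds with a common constant glue.\<close>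

lemma lipschitz_on_closed_pieces:
  fixes w :: "'a::euclidean_space \<Rightarrow> real"
  assumes fin: "finite \<C>" and cl: "\<And>C. C \<in> \<C> \<Longrightarrow> closed C" and cover: "\<Union>\<C> = UNIV" and L: "L \<ge> 0"
    and lip: "\<And>C x y. C \<in> \<C> \<Longrightarrow> x \<in> C \<Longrightarrow> y \<in> C \<Longrightarrow> \<bar>w x - w y\<bar> \<le> L * norm (x - y)"
  shows "\<bar>w x - w y\<bar> \<le> L * norm (x - y)"
proof -
  define \<gamma> where "\<gamma> t = y + t *\<^sub>R (x - y)" for t :: real
  have c: "continuous_on UNIV \<gamma>" unfolding \<gamma>_def by (intro continuous_intros)
  have "(L * norm (x - y))-lipschitz_on {0..1} (\<lambda>t. w (\<gamma> t))"
  proof (rule lipschitz_on_closed_Union[where I = \<C> and U = "\<lambda>C. \<gamma> -` C"])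
    fix C assume C: "C \<in> \<C>"
    show "(L * norm (x - y))-lipschitz_on (\<gamma> -` C) (\<lambda>t. w (\<gamma> t))"
    proof (rule lipschitz_onI)
      fix s t assume "s \<in> \<gamma> -` C" "t \<in> \<gamma> -` C"
      hence "\<bar>w (\<gamma> s) - w (\<gamma> t)\<bar> \<le> L * norm (\<gamma> s - \<gamma> t)"
        using lip[OF C] by blast
      also have "\<gamma> s - \<gamma> t = (s - t) *\<^sub>R (x - y)" by (simp add: \<gamma>_def algebra_simps)
      finally show "dist (w (\<gamma> s)) (w (\<gamma> t)) \<le> L * norm (x - y) * dist s t"
        by (simp add: dist_real_def mult_ac)
    qed (use L in simp)
    show "closed (\<gamma> -` C)"
      by (rule continuous_closed_vimage[OF cl[OF C]]) (use c in \<open>simp add: continuous_on_eq_continuous_at\<close>)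
  qed (use fin cover L in auto)
  hence "dist (w (\<gamma> 1)) (w (\<gamma> 0)) \<le> L * norm (x - y) * dist 1 (0::real)"
    by (rule lipschitz_onD) auto
  thus ?thesis by (simp add: \<gamma>_def dist_real_def)
qed

context mesh
begin

text \<open>The piecewise affine nodal function of \<open>z\<close>; the choice of a simplex is
  immaterial by \<open>barycentric_eq\<close>.\<close>

definition hat :: "'a \<Rightarrow> 'a \<Rightarrow> real" where
  "hat z x = (if \<exists>K\<in>\<T>. x \<in> K then barycentric (SOME K. K \<in> \<T> \<and> x \<in> K) z x else 0)"

lemma hat_eq:
  assumes "K \<in> \<T>" "x \<in> K"
  shows "hat z x = barycentric K z x"
proof -
  have ex: "\<exists>K\<in>\<T>. x \<in> K" "\<exists>K. K \<in> \<T> \<and> x \<in> K" using assms by blast+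
  from someI_ex[OF ex(2)] show ?thesis unfolding hat_def if_P[OF ex(1)] using assms by (intro barycentric_eq) auto
qed

lemma hat_outside: "x \<notin> closure \<Omega> \<Longrightarrow> hat z x = 0"
  using Union_\<T> by (auto simp: hat_def)

lemma continuous_on_closure:
  assumes "\<And>K. K \<in> \<T> \<Longrightarrow> continuous_on K w"
  shows "continuous_on (closure \<Omega>) w"
proof -
  have "continuous_on (\<Union>K\<in>\<T>. K) w"
    using finite_\<T> simplex_\<T> full_simplex.closed_K assms by (intro continuous_on_closed_Union) auto
  thus ?thesis by (simp add: Union_\<T>)
qed

lemma conforming_fnsI:
  assumes "\<And>K. K \<in> \<T> \<Longrightarrow> \<exists>p\<in>poly_space k. \<forall>x\<in>K. w x = p x"
  shows "w \<in> conforming_fns \<Omega> \<T> k"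
proof -
  have "continuous_on K w" if "K \<in> \<T>" for K
    using assms[OF that] poly_space_continuous[of _ k K] continuous_on_cong[of K K w] by metis
  thus ?thesis using assms continuous_on_closure[of w] by (simp add: conforming_fns_def)
qed

lemma hat_zero_off_\<Omega>:
  assumes "z \<in> \<Omega>" "x \<notin> \<Omega>"
  shows "hat z x = 0"
proof (cases "x \<in> closure \<Omega>")
  case True
  then obtain K where K: "K \<in> \<T>" "x \<in> K" using Union_\<T> by blast
  interpret K: full_simplex K by (rule simplex_\<T>[OF K(1)])
  have "\<not> K.bc z x > 0"
    using positive_coordinate_interior_vertex[OF assms(1) K(1) _ K(2)] assms(2) K.bc_not_vertex[of z x] by fastforce
  thus ?thesis using K.bc_nonneg[OF K(2), of z] by (simp add: hat_eq[OF K])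
qed (rule hat_outside)

lemma frontier_simplices_null: "(\<Union>K\<in>\<T>. frontier K) \<in> null_sets lborel"
proof -
  have "frontier K \<in> null_sets lborel" if "K \<in> \<T>" for K
  proof -
    interpret K: full_simplex K by (rule simplex_\<T>[OF that])
    have "negligible (frontier K)" by (rule negligible_convex_frontier[OF K.convex_K])
    moreover have "frontier K \<in> sets borel" by (intro borel_closed frontier_closed)
    ultimately show ?thesis by (simp add: negligible_iff_null_sets null_sets_completion_iff)
  qed
  thus ?thesis using finite_\<T> by (intro null_sets_UN') (auto simp: countable_finite)
qed

text \<open>\<open>poly q 0 = 0\<close> makes the function vanish off the star of \<open>z\<close>
  and off \<Omega>. The star is starshaped about \<open>z\<close>, and after shrinking the
  coordinate of \<open>z\<close> is positive, which keeps the point in \<Omega>. So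
  \<open>H10_starshaped_I\<close> applies.\<close>

lemma hat_H10:
  assumes z: "z \<in> \<Omega>" and q0: "poly q 0 = 0"
  shows "(\<lambda>x. poly q (hat z x)) \<in> H10 \<Omega>"
proof -
  define w where "w x = poly q (hat z x)" for x
  define P where "P K x = poly q (barycentric K z x)" for K x
  have wP: "w x = P K x" if "K \<in> \<T>" "x \<in> K" for K x by (simp add: w_def P_def hat_eq[OF that])
  have smP: "smth (P K)" if "K \<in> \<T>" for K unfolding P_def
    by (rule poly_space_smth[OF poly_space_poly[OF full_simplex.affine_bc[OF simplex_\<T>[OF that]] order_refl]])
  have w\<Omega>: "w x = 0" if "x \<notin> \<Omega>" for x by (simp add: w_def hat_zero_off_\<Omega>[OF z that] q0)
  define S where "S = \<Union>{K \<in> \<T>. z \<in> \<V> K}"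
  have wS: "w x = 0" if "x \<notin> S" for x
  proof (cases "x \<in> closure \<Omega>")
    case True
    then obtain K where K: "K \<in> \<T>" "x \<in> K" using Union_\<T> by blast
    hence "z \<notin> \<V> K" using that by (auto simp: S_def)
    hence "barycentric K z x = 0" by (rule full_simplex.bc_not_vertex[OF simplex_\<T>[OF K(1)]])
    thus ?thesis by (simp add: wP[OF K] P_def q0)
  qed (simp add: w_def hat_outside q0)
  have "compact S"
    unfolding S_def using finite_\<T> full_simplex.compact_K[OF simplex_\<T>] by (intro compact_Union) auto
  obtain R where R: "closure \<Omega> \<subseteq> cball 0 R"
    using bounded_subset_cball_0 bounded_\<Omega> bounded_closure by blast
  have "\<forall>K\<in>\<T>. \<exists>L. \<forall>x\<in>cball 0 R. \<forall>y\<in>cball 0 R. \<bar>P K x - P K y\<bar> \<le> L * norm (x - y)"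
    using smth_lipschitz_on_cball[OF smP] by blast
  then obtain LK where LK: "\<And>K x y. K \<in> \<T> \<Longrightarrow> x \<in> cball 0 R \<Longrightarrow> y \<in> cball 0 R \<Longrightarrow> \<bar>P K x - P K y\<bar> \<le> LK K * norm (x - y)"
    by metis
  define L where "L = (\<Sum>K\<in>\<T>. \<bar>LK K\<bar>)"
  have L: "L \<ge> 0" "\<And>K. K \<in> \<T> \<Longrightarrow> LK K \<le> L"
  proof -
    show "L \<ge> 0" by (simp add: L_def sum_nonneg)
    show "LK K \<le> L" if "K \<in> \<T>" for K
      using member_le_sum[OF that, of "\<lambda>K. \<bar>LK K\<bar>"] finite_\<T> by (simp add: L_def)
  qed
  have lip: "\<bar>w x - w y\<bar> \<le> L * norm (x - y)" for x y
  proof (rule lipschitz_on_closed_pieces[of "insert (- \<Omega>) \<T>"])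
    show "closed C" if "C \<in> insert (- \<Omega>) \<T>" for C
      using that open_\<Omega> full_simplex.closed_K[OF simplex_\<T>] by auto
    show "\<Union>(insert (- \<Omega>) \<T>) = UNIV" using Union_\<T> closure_subset[of \<Omega>] by auto
    show "\<bar>w x - w y\<bar> \<le> L * norm (x - y)" if C: "C \<in> insert (- \<Omega>) \<T>" "x \<in> C" "y \<in> C" for C x y
    proof (cases "C \<in> \<T>")
      case True
      hence "x \<in> cball 0 R" "y \<in> cball 0 R" using C R Union_\<T> by blast+
      hence "\<bar>P C x - P C y\<bar> \<le> LK C * norm (x - y)" by (rule LK[OF True])
      also have "\<dots> \<le> L * norm (x - y)" using L(2)[OF True] by (intro mult_right_mono) auto
      finally show ?thesis by (simp add: wP[OF True C(2)] wP[OF True C(3)])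
    next
      case False
      thus ?thesis using C w\<Omega> L(1) by auto
    qed
  qed (use finite_\<T> L(1) in auto)
  \<comment> \<open>The broken gradient, zero on the simplex boundaries. These form the null set
    \<open>N\<close>, off which the function is locally smooth.\<close>
  define g where "g b x = (\<Sum>K\<in>\<T>. indicator (interior K) x * partial_deriv b (P K) x)" for b x
  have g_int: "g b x = partial_deriv b (P K) x" if "K \<in> \<T>" "x \<in> interior K" for b K x
  proof -
    have "g b x = (\<Sum>K'\<in>{K}. indicator (interior K') x * partial_deriv b (P K') x)" unfolding g_def
    proof (rule sum.mono_neutral_right[OF finite_\<T>])
      show "\<forall>K'\<in>\<T> - {K}. indicator (interior K') x * partial_deriv b (P K') x = 0"
        using simplex_eq_if_interior_meets[OF that(1) _ that(2)] interior_subset by (auto simp: indicator_def)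
    qed (use that in auto)
    thus ?thesis using that by simp
  qed
  have g_out: "g b x = 0" if "x \<notin> closure \<Omega>" for b x unfolding g_def
    using that Union_\<T> interior_subset by (intro sum.neutral) (auto simp: indicator_def)
  define N where "N = (\<Union>K\<in>\<T>. frontier K)"
  have regular: "(\<exists>K\<in>\<T>. x \<in> interior K) \<or> x \<notin> closure \<Omega>" if "x \<notin> N" for x
    using that Union_\<T> by (auto simp: N_def frontier_def) (metis UnionE closure_subset subsetD)
  have gm: "g b \<in> borel_measurable borel" for b
  proof -
    have "partial_deriv b (P K) \<in> borel_measurable borel" if "K \<in> \<T>" for K
      by (intro borel_measurable_continuous_onI smth_continuous smth_partial smP that)
    thus ?thesis unfolding g_def by (intro borel_measurable_sum borel_measurable_times) auto
  qed
  have "\<exists>G. \<forall>x\<in>cball 0 R. \<bar>partial_deriv b (P K) x\<bar> \<le> G" if "K \<in> \<T>" for K b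
  proof -
    have "bounded (partial_deriv b (P K) ` cball 0 R)"
      by (intro compact_imp_bounded compact_continuous_image compact_cball smth_continuous smth_partial smP that)
    thus ?thesis unfolding bounded_iff by auto
  qed
  then obtain GK where GK: "\<And>K b x. K \<in> \<T> \<Longrightarrow> x \<in> cball 0 R \<Longrightarrow> \<bar>partial_deriv b (P K) x\<bar> \<le> GK K b"
    by metis
  define G where "G = (\<Sum>K\<in>\<T>. \<Sum>b\<in>Basis. \<bar>GK K b\<bar>)"
  have gB: "\<bar>g b x\<bar> \<le> G" if b: "b \<in> Basis" for b x
  proof -
    have "\<bar>g b x\<bar> \<le> (\<Sum>K\<in>\<T>. \<bar>GK K b\<bar>)" unfolding g_def
    proof (rule order.trans[OF sum_abs], rule sum_mono)
      fix K assume K: "K \<in> \<T>"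
      show "\<bar>indicator (interior K) x * partial_deriv b (P K) x\<bar> \<le> \<bar>GK K b\<bar>"
      proof (cases "x \<in> interior K")
        case True
        hence "x \<in> cball 0 R" using K interior_subset R Union_\<T> by blast
        thus ?thesis using GK[OF K, of x b] True by simp
      qed simp
    qed
    also have "\<dots> \<le> G" unfolding G_def using b by (intro sum_mono member_le_sum) auto
    finally show ?thesis .
  qed
  have near: "\<exists>U. open U \<and> x \<in> U \<and> (\<exists>p. smth p \<and> (\<forall>y\<in>U. w y = p y) \<and> (\<forall>b. \<forall>y\<in>U. g b y = partial_deriv b p y))"
    if "x \<notin> N" for x using regular[OF that]
  proof
    assume "\<exists>K\<in>\<T>. x \<in> interior K"
    then obtain K where K: "K \<in> \<T>" "x \<in> interior K" by blast
    thus ?thesis using smP[OF K(1)] wP[OF K(1)] g_int[OF K(1)] interior_subset[of K]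
      by (intro exI[of _ "interior K"] conjI exI[of _ "P K"]) auto
  next
    assume x: "x \<notin> closure \<Omega>"
    have "partial_deriv b (\<lambda>x::'a. 0::real) y = 0" for b y
      by (rule partial_deriv_eq[OF has_derivative_const])
    moreover have "w y = 0" if "y \<notin> closure \<Omega>" for y
      using that w\<Omega> closure_subset[of \<Omega>] by blast
    ultimately show ?thesis using x g_out smth.const[of 0]
      by (intro exI[of _ "- closure \<Omega>"] conjI exI[of _ "\<lambda>x. 0"]) auto
  qed
  have "w \<in> H10 \<Omega>"
  proof (rule H10_starshaped_I[OF open_\<Omega> bounded_\<Omega> \<open>compact S\<close> wS w\<Omega> _ lip gm gB frontier_simplices_null[folded N_def]])
    fix t :: real and x assume t: "0 < t" "t < 1" and "x \<in> S"
    then obtain K where K: "K \<in> \<T>" "z \<in> \<V> K" "x \<in> K" by (auto simp: S_def)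
    interpret K: full_simplex K by (rule simplex_\<T>[OF K(1)])
    have "(1 - t) *\<^sub>R z + t *\<^sub>R x \<in> K" using t K K.V_subset by (intro convexD[OF K.convex_K]) auto
    moreover have "(1 - t) *\<^sub>R z + t *\<^sub>R x = z + t *\<^sub>R (x - z)" by (simp add: algebra_simps)
    moreover have "0 < K.bc z (z + t *\<^sub>R (x - z))"
    proof -
      have "K.bc z (z + t *\<^sub>R (x - z)) = (1 - t) + t * K.bc z x"
        unfolding affine_fn_segment[OF K.affine_bc] by (simp add: K.bc_vertex K(2) algebra_simps)
      thus ?thesis using t K.bc_nonneg[OF K(3), of z] by (simp add: add_pos_nonneg)
    qed
    ultimately show "z + t *\<^sub>R (x - z) \<in> \<Omega>"
      using positive_coordinate_interior_vertex[OF z K(1,2)] by simp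
  next
    fix b x :: 'a assume "x \<notin> N"
    from near[OF this] obtain U p where U: "open U" "x \<in> U" "smth p" "\<forall>y\<in>U. w y = p y"
        "\<forall>b. \<forall>y\<in>U. g b y = partial_deriv b p y" by (elim exE conjE) (rule that; assumption)
    have "(w has_derivative (\<lambda>h. partial_deriv h p x)) (at x)"
      by (rule has_derivative_transform_within_open[OF has_derivative_partial_deriv[OF smth_differentiable[OF U(3)]] U(1,2)])
        (simp add: U(4))
    hence "w differentiable (at x)" "partial_deriv b w x = g b x"
      using partial_deriv_eq[of w "\<lambda>h. partial_deriv h p x" x b] U(2,5) by (auto simp: differentiable_def)
    thus "((\<lambda>h. (w (x + h *\<^sub>R b) - w x) / h) \<longlongrightarrow> g b x) (at 0)"
      using directional_derivative_limit[of w x b] by simp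
    have "continuous_on U (partial_deriv b p)" by (intro smth_continuous smth_partial U(3))
    hence "continuous_on U (g b)" using U(5) by (simp cong: continuous_on_cong)
    thus "isCont (g b) x" using U(1,2) by (simp add: continuous_on_eq_continuous_at)
  qed
  thus ?thesis by (simp add: w_def[abs_def])
qed

text \<open>The half-ball argument gives zero at core points, and continuity of the polynomial
  extends it to the whole facet.\<close>

lemma conforming_H10_trace:
  assumes w: "w \<in> conforming_fns \<Omega> \<T> k" "w \<in> H10 \<Omega>" and F: "F \<in> boundary_facets \<Omega> \<T>" and x: "x \<in> F"
  shows "w x = 0"
proof -
  obtain K where K: "K \<in> \<T>" "F facet_of K" using F by (auto simp: boundary_facets_def mesh_facets_def)
  interpret K: simplex_facet K F by (rule simplex_facet_\<T>[OF K(1) K(2)])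
  obtain p where p: "p \<in> poly_space k" "\<And>x. x \<in> K \<Longrightarrow> w x = p x"
    using w(1) K(1) unfolding conforming_fns_def by blast
  have "p m = 0" if m: "m \<in> K.core" for m
  proof -
    obtain r n where r: "r > 0" "norm n = 1" "\<Omega> \<inter> ball m r = {x \<in> ball m r. 0 < (x - m) \<bullet> n}" "\<Omega> \<inter> ball m r \<subseteq> K"
      using boundary_facet_half_ball[OF F K m] by blast
    show ?thesis
      by (rule H10_trace_zero[OF open_\<Omega> bounded_\<Omega> w(2) poly_space_smth[OF p(1)] r(1-3)]) (use p(2) r(4) in blast)
  qed
  hence "p x = 0" using K.zero_on_core_imp_zero[OF poly_space_continuous[OF p(1)] _ x] by blast
  thus ?thesis using p(2) x K.F_subset by auto
qed

lemma conforming_H10_zero_on_frontier: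
  assumes "w \<in> conforming_fns \<Omega> \<T> k" "w \<in> H10 \<Omega>" "x \<in> frontier \<Omega>"
  shows "w x = 0" using frontier_subset_boundary_facets assms(3) conforming_H10_trace[OF assms(1,2)] by blast

end

section \<open>Linear algebra\<close>

lemma span_image_finite:
  assumes "finite I" "v \<in> span (b ` I)"
  shows "\<exists>u. v = (\<Sum>i\<in>I. u i *\<^sub>R b i)" using assms(2)
proof (rule span_induct)
  show "subspace {v. \<exists>u. v = (\<Sum>i\<in>I. u i *\<^sub>R b i)}"
  proof (rule subspaceI; unfold mem_Collect_eq)
    show "\<exists>u. 0 = (\<Sum>i\<in>I. u i *\<^sub>R b i)" by (intro exI[of _ "\<lambda>_. 0"]) simp
  next
    fix x y assume "\<exists>u. x = (\<Sum>i\<in>I. u i *\<^sub>R b i)" "\<exists>u. y = (\<Sum>i\<in>I. u i *\<^sub>R b i)"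
    then obtain u u' where "x = (\<Sum>i\<in>I. u i *\<^sub>R b i)" "y = (\<Sum>i\<in>I. u' i *\<^sub>R b i)"
      by blast
    thus "\<exists>u. x + y = (\<Sum>i\<in>I. u i *\<^sub>R b i)"
      by (intro exI[of _ "\<lambda>i. u i + u' i"]) (simp add: scaleR_add_left sum.distrib)
  next
    fix c x assume "\<exists>u. x = (\<Sum>i\<in>I. u i *\<^sub>R b i)"
    then obtain u where "x = (\<Sum>i\<in>I. u i *\<^sub>R b i)" by blast
    thus "\<exists>u. c *\<^sub>R x = (\<Sum>i\<in>I. u i *\<^sub>R b i)"
      by (intro exI[of _ "\<lambda>i. c * u i"]) (simp add: scaleR_sum_right)
  qed
next
  fix x assume "x \<in> b ` I"
  then obtain j where j: "j \<in> I" "x = b j" by blast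
  have "(\<Sum>i\<in>I. (if i = j then 1 else 0) *\<^sub>R b i) = (\<Sum>i\<in>I. if i = j then b i else 0)"
    by (intro sum.cong) auto
  thus "\<exists>u. x = (\<Sum>i\<in>I. u i *\<^sub>R b i)"
    using assms(1) j by (intro exI[of _ "\<lambda>i. if i = j then 1 else 0"]) simp
qed

lemma family_basisI:
  assumes fin: "finite I"
    and ind: "\<And>u. (\<Sum>i\<in>I. u i *\<^sub>R b i) = 0 \<Longrightarrow> \<forall>i\<in>I. u i = 0"
  shows "family_basis b I (span (b ` I))"
proof -
  have inj: "inj_on b I"
  proof (rule inj_onI, rule ccontr)
    fix i j assume ij: "i \<in> I" "j \<in> I" "b i = b j" "i \<noteq> j"
    have "(\<Sum>l\<in>I. (if l = i then 1 else if l = j then -1 else 0) *\<^sub>R b l) =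
        (\<Sum>l\<in>{i, j}. (if l = i then 1 else if l = j then -1 else 0) *\<^sub>R b l)"
      using fin ij by (intro sum.mono_neutral_right) auto
    also have "\<dots> = 0" using ij by simp
    finally show False using ind[of "\<lambda>l. if l = i then 1 else if l = j then -1 else 0"] ij by auto
  qed
  have "independent (b ` I)"
  proof (rule independent_if_scalars_zero)
    fix f x assume f: "(\<Sum>x\<in>b ` I. f x *\<^sub>R x) = 0" and x: "x \<in> b ` I"
    have "(\<Sum>i\<in>I. f (b i) *\<^sub>R b i) = 0" using f by (simp add: sum.reindex[OF inj])
    thus "f x = 0" using ind[of "\<lambda>i. f (b i)"] x by blast
  qed (use fin in simp)
  with inj show ?thesis by (simp add: family_basis_def)
qed

section \<open>Broken functions\<close>

text \<open>Summing the d+1 equations gives s = (d+1) s/d, hence s = 0. It is the injectivity of the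
  map from facet coefficients to nodal coefficients on one simplex.\<close>

lemma sum_const_off_by_one:
  assumes "finite V" "card V = d + 1" "d > 0" "\<And>z. z \<in> V \<Longrightarrow> a z = (\<Sum>z\<in>V. a z) / real d" "z \<in> V"
  shows "a z = (0::real)"
proof -
  define s where "s = (\<Sum>z\<in>V. a z)"
  have "s = (\<Sum>z\<in>V. s / real d)" unfolding s_def by (rule sum.cong[OF refl]) (rule assms(4))
  also have "\<dots> = (real d + 1) * (s / real d)" using assms(2) by simp
  finally have "s = 0" using assms(3) by (simp add: field_simps)
  thus ?thesis using assms(4)[OF assms(5)] by (metis s_def div_0)
qed

locale mesh_degree = mesh +
  fixes k :: nat
  assumes k_pos: "k \<ge> 1"
begin

definition jac :: "real poly" where "jac = shifted_jacobi k (DIM('a) - 2)"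
text \<open>The value of P_k(1 - 2 lambda_z) at \<open>z\<close> itself; at the other vertices it is
  1. Hence \<eta> is the value of a simplex function at each vertex of its simplex.\<close>

definition \<rho> :: real where "\<rho> = poly jac 1"
definition \<eta> :: real where "\<eta> = (real DIM('a) - 1 + \<rho>) / real DIM('a)"

lemma jac_0 [simp]: "poly jac 0 = 1" unfolding jac_def by (rule poly_shifted_jacobi_0)

lemma degree_jac: "degree jac = k" unfolding jac_def by (rule degree_shifted_jacobi)

lemma \<rho>_eq: "\<rho> = (-1) ^ k * real ((k + DIM('a) - 2) choose k)"
  using dim by (simp add: \<rho>_def jac_def poly_shifted_jacobi_1)

lemma choose_pos: "real ((k + DIM('a) - 2) choose k) > 0" using dim by simp

lemma \<rho>_odd: "odd k \<Longrightarrow> \<rho> < 0" and \<rho>_even: "even k \<Longrightarrow> \<rho> > 0"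
  using choose_pos by (auto simp: \<rho>_eq)

lemma \<rho>_odd': "odd k \<Longrightarrow> \<rho> \<noteq> 1" using \<rho>_odd by fastforce

lemma \<eta>_even: "even k \<Longrightarrow> \<eta> > 0"
  using \<rho>_even dim by (simp add: \<eta>_def add_nonneg_pos)

text \<open>Each \<open>P K\<close> may be a function on the whole space, so broken functions can be
  handled through global polynomials and compared up to the simplex boundaries.\<close>

definition glue :: "('a set \<Rightarrow> 'a \<Rightarrow> real) \<Rightarrow> 'a \<Rightarrow> real" where
  "glue P x = (\<Sum>K\<in>\<T>. if x \<in> interior K then P K x else 0)"

lemma glue_interior:
  assumes "K \<in> \<T>" "x \<in> interior K"
  shows "glue P x = P K x"
proof -
  have "glue P x = (\<Sum>K'\<in>{K}. if x \<in> interior K' then P K' x else 0)" unfolding glue_def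
    using assms simplex_eq_if_interior_meets[OF assms(1) _ assms(2)] interior_subset
    by (intro sum.mono_neutral_right finite_\<T>) auto
  thus ?thesis using assms by simp
qed

lemma glue_outside: "x \<notin> (\<Union>K\<in>\<T>. interior K) \<Longrightarrow> glue P x = 0"
  unfolding glue_def by (intro sum.neutral) auto

lemma glue_eqI:
  assumes "\<And>x. x \<notin> (\<Union>K\<in>\<T>. interior K) \<Longrightarrow> v x = 0"
    and "\<And>K x. K \<in> \<T> \<Longrightarrow> x \<in> interior K \<Longrightarrow> v x = P K x"
  shows "v = glue P"
proof
  fix x show "v x = glue P x"
  proof (cases "x \<in> (\<Union>K\<in>\<T>. interior K)")
    case True
    thus ?thesis using assms(2) glue_interior by auto
  qed (use assms(1) glue_outside in simp)
qed

lemma on_open_simplices_eq_glue: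
  assumes "\<And>K x. K \<in> \<T> \<Longrightarrow> x \<in> K \<Longrightarrow> w x = P K x"
  shows "on_open_simplices \<T> w = glue P"
  by (rule glue_eqI) (use assms interior_subset in \<open>auto simp: on_open_simplices_def\<close>)

lemma glue_add: "glue P + glue Q = glue (\<lambda>K x. P K x + Q K x)"
  by (rule glue_eqI) (auto simp: glue_outside glue_interior)

lemma glue_diff: "glue P - glue Q = glue (\<lambda>K x. P K x - Q K x)"
  by (rule glue_eqI) (auto simp: glue_outside glue_interior)

lemma glue_scale: "c *\<^sub>R glue P = glue (\<lambda>K x. c * P K x)"
  by (rule glue_eqI) (auto simp: glue_outside glue_interior)

lemma glue_0: "glue (\<lambda>K x. 0) = 0" by (auto simp: glue_def fun_eq_iff)

lemma glue_sum: "(\<Sum>i\<in>I. c i *\<^sub>R glue (P i)) = glue (\<lambda>K x. \<Sum>i\<in>I. c i * P i K x)"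
proof (induction I rule: infinite_finite_induct)
  case (insert i I)
  thus ?case by (simp add: glue_scale glue_add)
qed (simp_all add: glue_0)

text \<open>Equality on the open simplices extends to the closed ones by density. This allows
  equations between broken functions to be evaluated at vertices.\<close>

lemma glue_eq_iff:
  assumes "\<And>K. K \<in> \<T> \<Longrightarrow> continuous_on UNIV (P K)" "\<And>K. K \<in> \<T> \<Longrightarrow> continuous_on UNIV (Q K)"
  shows "glue P = glue Q \<longleftrightarrow> (\<forall>K\<in>\<T>. \<forall>x\<in>K. P K x = Q K x)"
proof
  assume eq: "glue P = glue Q"
  show "\<forall>K\<in>\<T>. \<forall>x\<in>K. P K x = Q K x"
  proof (intro ballI)
    fix K x assume K: "K \<in> \<T>" and x: "x \<in> K"
    have "x \<in> closure (interior K)" using full_simplex.closure_interior[OF simplex_\<T>[OF K]] x by simp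
    moreover have "closed {x. P K x = Q K x}" using assms[OF K] by (intro closed_Collect_eq)
    moreover have "interior K \<subseteq> {x. P K x = Q K x}"
      using eq glue_interior[OF K] by (metis (mono_tags, lifting) mem_Collect_eq subsetI)
    ultimately show "P K x = Q K x" using closure_minimal by blast
  qed
next
  assume "\<forall>K\<in>\<T>. \<forall>x\<in>K. P K x = Q K x"
  thus "glue P = glue Q" using interior_subset by (intro glue_eqI) (auto simp: glue_outside glue_interior)
qed

lemma elem_restr_glue:
  assumes K: "K \<in> \<T>" "x \<in> K" and P: "continuous_on UNIV (P K)"
  shows "elem_restr K (glue P) x = P K x" unfolding elem_restr_def
proof (rule tendsto_Lim)
  interpret K: full_simplex K by (rule simplex_\<T>[OF K(1)])
  have "x islimpt interior K"
  proof (cases "x \<in> interior K")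
    case True
    thus ?thesis using interior_limit_point[of x "interior K"] by (simp add: interior_interior)
  next
    case False
    thus ?thesis using K(2) K.closure_interior by (metis Un_iff closure_def mem_Collect_eq)
  qed
  thus "at x within interior K \<noteq> bot" by (simp add: trivial_limit_within)
  have "(P K \<longlongrightarrow> P K x) (at x within interior K)"
    using P by (meson continuous_on_subset continuous_on subset_UNIV UNIV_I tendsto_within_subset)
  thus "(glue P \<longlongrightarrow> P K x) (at x within interior K)" by (rule Lim_transform_eventually)
      (auto simp: eventually_at_filter glue_interior[OF K(1)] intro!: always_eventually)
qed

lemma glue_broken:
  assumes "\<And>K. K \<in> \<T> \<Longrightarrow> P K \<in> poly_space k"
  shows "glue P \<in> broken_polys \<T> k"
  unfolding broken_polys_def using assms glue_outside glue_interior by blast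

text \<open>The global polynomial whose truncation to the open simplex is
  \<open>B_simplex\<close>.\<close>

definition BP :: "'a set \<Rightarrow> 'a \<Rightarrow> real" where
  "BP K x = (-1 + (\<Sum>z\<in>\<V> K. poly jac (barycentric K z x))) / real DIM('a)"

definition nodal :: "'a set \<Rightarrow> ('a \<Rightarrow> real) \<Rightarrow> 'a \<Rightarrow> real" where
  "nodal K b x = (\<Sum>z\<in>\<V> K. b z * (poly jac (barycentric K z x) - 1))"

lemma B_simplex_eq: "K \<in> \<T> \<Longrightarrow> B_simplex k K = glue (\<lambda>K' x. if K' = K then BP K x else 0)"
proof (rule glue_eqI)
  fix K' x assume "K \<in> \<T>" "K' \<in> \<T>" "x \<in> interior K'"
  thus "B_simplex k K x = (if K' = K then BP K x else 0)"
    using simplex_eq_if_interior_meets[of K' K x] interior_subset[of K]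
    by (auto simp: B_simplex_def BP_def poly_jacobi jac_def)
qed (auto simp: B_simplex_def)

definition facet_poly :: "'a set \<Rightarrow> 'a set \<Rightarrow> 'a \<Rightarrow> real" where
  "facet_poly F K x = (if F facet_of K then poly jac (barycentric K (opposite_vertex K F) x) - BP K x else 0)"

lemma B_facet_eq: "F \<in> mesh_facets \<T> \<Longrightarrow> B_facet \<T> k F = glue (facet_poly F)"
proof (rule glue_eqI)
  fix x assume "x \<notin> (\<Union>K\<in>\<T>. interior K)"
  thus "B_facet \<T> k F x = 0" unfolding B_facet_def by (intro sum.neutral) (auto simp: facet_patch_def)
next
  fix K x assume F: "F \<in> mesh_facets \<T>" and K: "K \<in> \<T>" "x \<in> interior K"
  have fin: "finite (facet_patch \<T> F)" using finite_\<T> by (simp add: facet_patch_def)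
  let ?g = "\<lambda>K. if x \<in> interior K
      then poly (jacobi k 0 (DIM('a) - 2)) (1 - 2 * barycentric_facet K F x) - B_simplex k K x else 0"
  have "B_facet \<T> k F x = (\<Sum>K'\<in>facet_patch \<T> F. if K' = K then ?g K else 0)" unfolding B_facet_def
  proof (intro sum.cong refl)
    fix K' assume "K' \<in> facet_patch \<T> F"
    hence "K' \<in> \<T>" by (simp add: facet_patch_def)
    thus "?g K' = (if K' = K then ?g K else 0)"
      using simplex_eq_if_interior_meets[OF K(1) _ K(2), of K'] interior_subset[of K'] by auto
  qed
  also have "\<dots> = (if K \<in> facet_patch \<T> F then ?g K else 0)" using fin by simp
  also have "\<dots> = facet_poly F K x" using K facet_patch_iff[OF F, of K]
    by (simp add: facet_poly_def barycentric_facet_def poly_jacobi jac_def B_simplex_def BP_def)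
  finally show "B_facet \<T> k F x = facet_poly F K x" .
qed

lemma BP_poly_space: "K \<in> \<T> \<Longrightarrow> BP K \<in> poly_space k"
proof -
  assume K: "K \<in> \<T>"
  have "(\<lambda>x. (1 / real DIM('a)) * (-1 + (\<Sum>z\<in>\<V> K. poly jac (barycentric K z x)))) \<in> poly_space k"
    by (intro poly_space_scale poly_space_add poly_space_const poly_space_sum
        poly_space_poly[OF full_simplex.affine_bc[OF simplex_\<T>[OF K]]]) (simp add: degree_jac)
  thus ?thesis by (simp add: BP_def[abs_def])
qed

lemma nodal_poly_space: "K \<in> \<T> \<Longrightarrow> nodal K b \<in> poly_space k"
proof -
  assume K: "K \<in> \<T>"
  show ?thesis unfolding nodal_def[abs_def]
    by (intro poly_space_scale poly_space_diff poly_space_const poly_space_sum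
        poly_space_poly[OF full_simplex.affine_bc[OF simplex_\<T>[OF K]]]) (simp add: degree_jac)
qed

lemma BP_vertex: 
  assumes "K \<in> \<T>" "y \<in> \<V> K"
  shows "BP K y = \<eta>"
proof -
  interpret K: full_simplex K by (rule simplex_\<T>[OF assms(1)])
  have "(\<Sum>z\<in>\<V> K. poly jac (K.bc z y)) =
      \<rho> + (\<Sum>z\<in>\<V> K - {y}. poly jac (K.bc z y))"
    using assms(2) by (subst sum.remove[OF K.finite_V assms(2)]) (simp add: K.bc_vertex \<rho>_def)
  also have "(\<Sum>z\<in>\<V> K - {y}. poly jac (K.bc z y)) = (\<Sum>z\<in>\<V> K - {y}. 1)"
    using assms(2) by (intro sum.cong) (auto simp: K.bc_vertex)
  also have "\<dots> = real DIM('a)" using assms(2) K.card_V K.finite_V by (simp add: card_Diff_singleton)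
  finally show ?thesis by (simp add: BP_def \<eta>_def)
qed

lemma nodal_vertex:
  assumes "K \<in> \<T>" "y \<in> \<V> K"
  shows "nodal K b y = b y * (\<rho> - 1)"
proof -
  interpret K: full_simplex K by (rule simplex_\<T>[OF assms(1)])
  have "nodal K b y = (\<Sum>z\<in>\<V> K. if z = y then b y * (\<rho> - 1) else 0)"
    unfolding nodal_def using assms(2) by (intro sum.cong) (auto simp: K.bc_vertex \<rho>_def)
  thus ?thesis using K.finite_V assms(2) by simp
qed

lemma sum_facets_simplex:
  assumes K: "K \<in> \<T>"
  shows "(\<Sum>F\<in>mesh_facets \<T>. if F facet_of K then h F else 0) =
    (\<Sum>z\<in>\<V> K. h (convex hull (\<V> K - {z})) :: real)"
proof -
  interpret K: full_simplex K by (rule simplex_\<T>[OF K])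
  have sub: "{F. F facet_of K} \<subseteq> mesh_facets \<T>" using facet_in_mesh[OF K] by blast
  have "(\<Sum>F\<in>mesh_facets \<T>. if F facet_of K then h F else 0) = (\<Sum>F\<in>{F. F facet_of K}. if F facet_of K then h F else 0)"
    using sub by (intro sum.mono_neutral_right finite_mesh_facets) auto
  also have "\<dots> = (\<Sum>F\<in>{F. F facet_of K}. h F)" by simp
  also have "\<dots> = (\<Sum>z\<in>\<V> K. h (convex hull (\<V> K - {z})))"
    by (rule sum.reindex_bij_witness[where i = "\<lambda>z. convex hull (\<V> K - {z})" and j = "opposite_vertex K"])
      (use K.opposite K.facet_of_vertex in auto)
  finally show ?thesis .
qed

text \<open>Facets are indexed by their opposite vertices. In the sum of a_F (P_F - B_K) the part
  B_K = (-1 + sum of P_z)/d takes s/d away from each coefficient, where s is the sum of all a_F over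
  the facets of \<open>K\<close>.\<close>

definition facet_coeff :: "('a set \<Rightarrow> real) \<Rightarrow> 'a set \<Rightarrow> 'a \<Rightarrow> real" where
  "facet_coeff a K z = a (convex hull (\<V> K - {z})) -
    (\<Sum>z\<in>\<V> K. a (convex hull (\<V> K - {z}))) / real DIM('a)"

lemma sum_facet_coeff:
  assumes "K \<in> \<T>"
  shows "(\<Sum>z\<in>\<V> K. facet_coeff a K z) =
    - (\<Sum>z\<in>\<V> K. a (convex hull (\<V> K - {z}))) / real DIM('a)"
proof -
  define s where "s = (\<Sum>z\<in>\<V> K. a (convex hull (\<V> K - {z})))"
  have "(\<Sum>z\<in>\<V> K. facet_coeff a K z) = s - (real DIM('a) + 1) * (s / real DIM('a))"
    using full_simplex.card_V[OF simplex_\<T>[OF assms]] by (simp add: facet_coeff_def sum_subtractf s_def)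
  also have "\<dots> = - s / real DIM('a)" by (simp add: field_simps)
  finally show ?thesis by (simp add: s_def)
qed

text \<open>On each simplex, a combination of the facet functions is a combination of the functions
  \<open>P\<^sub>k(1 - 2\<lambda>\<^sub>z) - 1\<close>, which vanish on the facet opposite to \<open>z\<close>.\<close>

lemma B_facet_sum: "(\<Sum>F\<in>mesh_facets \<T>. a F *\<^sub>R B_facet \<T> k F) = glue (\<lambda>K. nodal K (facet_coeff a K))"
proof -
  have "(\<Sum>F\<in>mesh_facets \<T>. a F *\<^sub>R B_facet \<T> k F) = (\<Sum>F\<in>mesh_facets \<T>. a F *\<^sub>R glue (facet_poly F))"
    by (intro sum.cong refl) (simp add: B_facet_eq)
  also have "\<dots> = glue (\<lambda>K x. \<Sum>F\<in>mesh_facets \<T>. a F * facet_poly F K x)" by (rule glue_sum)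
  also have "\<dots> = glue (\<lambda>K. nodal K (facet_coeff a K))"
  proof (rule glue_eqI)
    fix K x assume K: "K \<in> \<T>" "x \<in> interior K"
    interpret K: full_simplex K by (rule simplex_\<T>[OF K(1)])
    let ?V = "\<V> K"
    define A where "A z = a (convex hull (?V - {z}))" for z
    define s where "s = (\<Sum>z\<in>?V. A z)"
    have "glue (\<lambda>K x. \<Sum>F\<in>mesh_facets \<T>. a F * facet_poly F K x) x = (\<Sum>F\<in>mesh_facets \<T>. a F * facet_poly F K x)"
      by (rule glue_interior[OF K])
    also have "\<dots> = (\<Sum>F\<in>mesh_facets \<T>. if F facet_of K then a F * (poly jac (K.bc (opposite_vertex K F) x) - BP K x) else 0)"
      by (intro sum.cong refl) (simp add: facet_poly_def)
    also have "\<dots> = (\<Sum>z\<in>?V. A z * (poly jac (K.bc z x) - BP K x))"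
      unfolding sum_facets_simplex[OF K(1)] by (intro sum.cong refl) (simp add: K.facet_of_vertex A_def)
    also have "\<dots> = (\<Sum>z\<in>?V. A z * poly jac (K.bc z x)) - s * BP K x"
      by (simp add: right_diff_distrib sum_subtractf s_def sum_distrib_right)
    also have "\<dots> = nodal K (facet_coeff a K) x"
    proof -
      have co: "facet_coeff a K z = A z - s / real DIM('a)" for z by (simp add: facet_coeff_def A_def s_def)
      have sc: "(\<Sum>z\<in>?V. A z - s / real DIM('a)) = - s / real DIM('a)"
        using sum_facet_coeff[OF K(1), of a] by (simp add: co A_def s_def)
      have "nodal K (facet_coeff a K) x =
          (\<Sum>z\<in>?V. (A z - s / real DIM('a)) * poly jac (K.bc z x)) - (\<Sum>z\<in>?V. A z - s / real DIM('a))"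
        by (simp add: nodal_def co right_diff_distrib sum_subtractf)
      also have "\<dots> = (\<Sum>z\<in>?V. A z * poly jac (K.bc z x)) - s / real DIM('a) * (\<Sum>z\<in>?V. poly jac (K.bc z x)) + s / real DIM('a)"
        unfolding sc by (simp add: left_diff_distrib sum_subtractf sum_distrib_left)
      finally show ?thesis by (simp add: BP_def field_simps)
    qed
    finally show "glue (\<lambda>K x. \<Sum>F\<in>mesh_facets \<T>. a F * facet_poly F K x) x = nodal K (facet_coeff a K) x" .
  qed (rule glue_outside)
  finally show ?thesis .
qed

lemma nodal_continuous: "K \<in> \<T> \<Longrightarrow> continuous_on X (nodal K b)"
  by (rule poly_space_continuous[OF nodal_poly_space])

lemma BP_continuous: "K \<in> \<T> \<Longrightarrow> continuous_on X (BP K)"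
  by (rule poly_space_continuous[OF BP_poly_space])

text \<open>Since \<rho> \<noteq> 1, zero vertex values make every \<open>facet_coeff\<close> zero:
  each coefficient is 1/d of the sum of all d+1 of them, which leaves only zero.\<close>

lemma facet_coeffs_zero:
  assumes K: "K \<in> \<T>" and \<rho>: "\<rho> \<noteq> 1"
    and zero: "\<And>y. y \<in> \<V> K \<Longrightarrow> nodal K (facet_coeff a K) y = 0"
    and F: "F facet_of K"
  shows "a F = 0"
proof -
  interpret K: full_simplex K by (rule simplex_\<T>[OF K])
  let ?A = "\<lambda>z. a (convex hull (\<V> K - {z}))"
  have "?A (opposite_vertex K F) = 0"
  proof (rule sum_const_off_by_one[OF K.finite_V K.card_V])
    fix z assume z: "z \<in> \<V> K"
    have "facet_coeff a K z = 0" using zero[OF z] \<rho> by (simp add: nodal_vertex[OF K z])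
    thus "?A z = (\<Sum>z\<in>\<V> K. ?A z) / real DIM('a)" by (simp add: facet_coeff_def)
  qed (use K.opposite_vertex_in[OF F] in simp_all)
  thus ?thesis using K.facet_eq_hull[OF F] by simp
qed

lemma V_facets_eq:
  assumes "\<G> \<subseteq> mesh_facets \<T>"
  shows "V_facets \<T> k \<G> = {glue (\<lambda>K. nodal K (facet_coeff a K)) | a. \<forall>F. F \<notin> \<G> \<longrightarrow> a F = 0}"
proof (intro set_eqI iffI)
  fix v assume "v \<in> V_facets \<T> k \<G>"
  then obtain u where u: "v = (\<Sum>F\<in>\<G>. u F *\<^sub>R B_facet \<T> k F)"
    using span_image_finite[OF finite_subset[OF assms finite_mesh_facets]] unfolding V_facets_def by blast
  define a where "a F = (if F \<in> \<G> then u F else 0)" for F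
  have "v = (\<Sum>F\<in>mesh_facets \<T>. a F *\<^sub>R B_facet \<T> k F)"
    unfolding u using assms by (intro sum.mono_neutral_cong_left finite_mesh_facets) (auto simp: a_def)
  thus "v \<in> {glue (\<lambda>K. nodal K (facet_coeff a K)) | a. \<forall>F. F \<notin> \<G> \<longrightarrow> a F = 0}"
    unfolding B_facet_sum by (auto simp: a_def)
next
  fix v assume "v \<in> {glue (\<lambda>K. nodal K (facet_coeff a K)) | a. \<forall>F. F \<notin> \<G> \<longrightarrow> a F = 0}"
  then obtain a where a: "v = (\<Sum>F\<in>mesh_facets \<T>. a F *\<^sub>R B_facet \<T> k F)" "\<And>F. F \<notin> \<G> \<Longrightarrow> a F = 0"
    unfolding B_facet_sum by blast
  have "v = (\<Sum>F\<in>\<G>. a F *\<^sub>R B_facet \<T> k F)"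
    unfolding a(1) using assms a(2) by (intro sum.mono_neutral_right finite_mesh_facets) auto
  thus "v \<in> V_facets \<T> k \<G>" unfolding V_facets_def by (auto intro!: span_sum span_scale intro: span_base)
qed

lemma B_simplex_sum:
  assumes "\<M> \<subseteq> \<T>"
  shows "(\<Sum>K\<in>\<M>. c K *\<^sub>R B_simplex k K) = glue (\<lambda>K x. (if K \<in> \<M> then c K else 0) * BP K x)"
proof -
  have fin: "finite \<M>" using assms finite_\<T> by (rule finite_subset)
  have "(\<Sum>K\<in>\<M>. c K *\<^sub>R B_simplex k K) = (\<Sum>K\<in>\<M>. c K *\<^sub>R glue (\<lambda>K' x. if K' = K then BP K x else 0))"
    using assms by (intro sum.cong refl) (auto simp: B_simplex_eq)
  also have "\<dots> = glue (\<lambda>K' x. \<Sum>K\<in>\<M>. c K * (if K' = K then BP K x else 0))"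
    by (rule glue_sum)
  also have "(\<lambda>K' x. \<Sum>K\<in>\<M>. c K * (if K' = K then BP K x else 0)) = (\<lambda>K x. (if K \<in> \<M> then c K else 0) * BP K x)"
  proof (intro ext)
    fix K' x
    have "(\<Sum>K\<in>\<M>. c K * (if K' = K then BP K x else 0)) = (\<Sum>K\<in>\<M>. if K' = K then c K' * BP K' x else 0)"
      by (intro sum.cong) auto
    thus "(\<Sum>K\<in>\<M>. c K * (if K' = K then BP K x else 0)) = (if K' \<in> \<M> then c K' else 0) * BP K' x"
      using fin by simp
  qed
  finally show ?thesis .
qed

lemma V_simplices_eq:
  assumes "\<M> \<subseteq> \<T>"
  shows "V_simplices k \<M> = {glue (\<lambda>K x. c K * BP K x) | c. \<forall>K. K \<notin> \<M> \<longrightarrow> c K = 0}"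
proof (intro set_eqI iffI)
  fix v assume "v \<in> V_simplices k \<M>"
  then obtain u where u: "v = (\<Sum>K\<in>\<M>. u K *\<^sub>R B_simplex k K)"
    using span_image_finite[OF finite_subset[OF assms finite_\<T>]] unfolding V_simplices_def by blast
  hence "v = glue (\<lambda>K x. (if K \<in> \<M> then u K else 0) * BP K x)" using B_simplex_sum[OF assms] by simp
  thus "v \<in> {glue (\<lambda>K x. c K * BP K x) | c. \<forall>K. K \<notin> \<M> \<longrightarrow> c K = 0}"
    by (intro CollectI exI[of _ "\<lambda>K. if K \<in> \<M> then u K else 0"]) auto
next
  fix v assume "v \<in> {glue (\<lambda>K x. c K * BP K x) | c. \<forall>K. K \<notin> \<M> \<longrightarrow> c K = 0}"
  then obtain c where c: "v = glue (\<lambda>K x. c K * BP K x)" "\<And>K. K \<notin> \<M> \<Longrightarrow> c K = 0"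
    by blast
  have "(\<lambda>K x. (if K \<in> \<M> then c K else 0) * BP K x) = (\<lambda>K x. c K * BP K x)"
    using c(2) by (auto simp: fun_eq_iff)
  hence "v = (\<Sum>K\<in>\<M>. c K *\<^sub>R B_simplex k K)" unfolding B_simplex_sum[OF assms] c(1) by simp
  thus "v \<in> V_simplices k \<M>" unfolding V_simplices_def by (auto intro!: span_sum span_scale intro: span_base)
qed

section \<open>Conforming functions\<close>

abbreviation "conf \<equiv> conforming_fns \<Omega> \<T> k"
abbreviation "conf0 \<equiv> conforming_fns \<Omega> \<T> k \<inter> H10 \<Omega>"

lemma conf_add: "u \<in> conf \<Longrightarrow> v \<in> conf \<Longrightarrow> (\<lambda>x. u x + v x) \<in> conf"
  unfolding conforming_fns_def by (auto intro!: continuous_on_add) (metis (mono_tags, lifting) poly_space_add)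

lemma conf_scale: "u \<in> conf \<Longrightarrow> (\<lambda>x. c * u x) \<in> conf" unfolding conforming_fns_def
  by (auto intro!: continuous_on_mult_left) (metis (mono_tags, lifting) poly_space_scale)

lemma conf_zero: "(\<lambda>x. 0) \<in> conf"
  by (rule conforming_fnsI) (auto intro!: bexI[of _ "\<lambda>x. 0"] poly_space_const)

lemma H10_zero: "(\<lambda>x. 0) \<in> H10 \<Omega>"
proof -
  obtain z where "z \<in> \<Omega>" using nonempty_\<Omega> by blast
  from hat_H10[OF this, of 0] show ?thesis by simp
qed

lemma H10_sum: "(\<And>i. i \<in> I \<Longrightarrow> u i \<in> H10 \<Omega>) \<Longrightarrow> (\<lambda>x. \<Sum>i\<in>I. u i x) \<in> H10 \<Omega>"
  by (induction I rule: infinite_finite_induct) (auto intro: H10_zero H10_add[OF open_\<Omega> bounded_\<Omega>])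

lemma on_open_simplices_linear:
  "on_open_simplices \<T> (\<lambda>x. u x + v x) = on_open_simplices \<T> u + on_open_simplices \<T> v"
  "on_open_simplices \<T> (\<lambda>x. c * u x) = c *\<^sub>R on_open_simplices \<T> u"
  by (auto simp: on_open_simplices_def fun_eq_iff)

lemma subspace_on_open_simplices:
  assumes "(\<lambda>x. 0) \<in> A" "\<And>u v. u \<in> A \<Longrightarrow> v \<in> A \<Longrightarrow> (\<lambda>x. u x + v x) \<in> A" "\<And>c u. u \<in> A \<Longrightarrow> (\<lambda>x. c * u x) \<in> A"
  shows "subspace (on_open_simplices \<T> ` A)"
proof (rule subspaceI)
  have "on_open_simplices \<T> (\<lambda>x. 0) = 0" by (auto simp: on_open_simplices_def fun_eq_iff)
  thus "0 \<in> on_open_simplices \<T> ` A" using assms(1) by (metis imageI)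
next
  fix x y assume "x \<in> on_open_simplices \<T> ` A" "y \<in> on_open_simplices \<T> ` A"
  then obtain u v where "u \<in> A" "v \<in> A" "x = on_open_simplices \<T> u" "y = on_open_simplices \<T> v"
    by blast
  thus "x + y \<in> on_open_simplices \<T> ` A"
    by (auto simp flip: on_open_simplices_linear(1) intro!: imageI assms(2))
next
  fix c x assume "x \<in> on_open_simplices \<T> ` A"
  then obtain u where "u \<in> A" "x = on_open_simplices \<T> u" by blast
  thus "c *\<^sub>R x \<in> on_open_simplices \<T> ` A"
    by (auto simp flip: on_open_simplices_linear(2) intro!: imageI assms(3))
qed

lemma subspace_S: "subspace (S_space \<Omega> \<T> k)"
  unfolding S_space_def by (intro subspace_on_open_simplices conf_zero conf_add conf_scale)

lemma subspace_S0: "subspace (S0_space \<Omega> \<T> k)" unfolding S0_space_def by (rule subspace_on_open_simplices)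
    (auto intro: conf_zero conf_add conf_scale H10_zero H10_add[OF open_\<Omega> bounded_\<Omega>] H10_scale[OF open_\<Omega> bounded_\<Omega>])

lemma subspace_S_bullet: "subspace (S_bullet \<Omega> \<T> k)" unfolding S_bullet_def
  by (rule subspace_on_open_simplices) (auto intro: conf_zero conf_add conf_scale)

lemma subspace_S0_bullet: "subspace (S0_bullet \<Omega> \<T> k)" unfolding S0_bullet_def
  by (rule subspace_on_open_simplices)
    (auto intro: conf_zero conf_add conf_scale H10_zero H10_add[OF open_\<Omega> bounded_\<Omega>] H10_scale[OF open_\<Omega> bounded_\<Omega>])

lemma conf_glue:
  assumes "w \<in> conf"
  obtains p where "\<And>K. K \<in> \<T> \<Longrightarrow> p K \<in> poly_space k" "\<And>K x. K \<in> \<T> \<Longrightarrow> x \<in> K \<Longrightarrow> w x = p K x"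
    "on_open_simplices \<T> w = glue p"
proof -
  from assms have "\<forall>K\<in>\<T>. \<exists>p\<in>poly_space k. \<forall>x\<in>K. w x = p x"
    by (simp add: conforming_fns_def)
  then obtain p where p: "\<And>K. K \<in> \<T> \<Longrightarrow> p K \<in> poly_space k" "\<And>K x. K \<in> \<T> \<Longrightarrow> x \<in> K \<Longrightarrow> w x = p K x"
    by metis
  from that[OF p on_open_simplices_eq_glue[OF p(2)]] show ?thesis .
qed

lemma conf_eq_glue_iff:
  assumes w: "w \<in> conf" and Q: "\<And>K. K \<in> \<T> \<Longrightarrow> continuous_on UNIV (Q K)"
  shows "on_open_simplices \<T> w = glue Q \<longleftrightarrow> (\<forall>K\<in>\<T>. \<forall>x\<in>K. w x = Q K x)"
proof -
  obtain p where p: "\<And>K. K \<in> \<T> \<Longrightarrow> p K \<in> poly_space k" "\<And>K x. K \<in> \<T> \<Longrightarrow> x \<in> K \<Longrightarrow> w x = p K x"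
      "on_open_simplices \<T> w = glue p" by (rule conf_glue[OF w]) blast
  show ?thesis unfolding p(3) using glue_eq_iff[of p Q] poly_space_continuous[OF p(1)] Q p(2) by auto
qed

text \<open>The conforming function with nodal values \<open>b z * (\<rho> - 1)\<close>.\<close>

definition global_nodal :: "('a \<Rightarrow> real) \<Rightarrow> 'a \<Rightarrow> real" where
  "global_nodal b x = (\<Sum>z\<in>mesh_vertices \<T>. b z * poly (jac - 1) (hat z x))"

lemma finite_mesh_vertices: "finite (mesh_vertices \<T>)"
  unfolding mesh_vertices_def using finite_\<T> full_simplex.finite_V[OF simplex_\<T>] by auto

lemma global_nodal_eq:
  assumes "K \<in> \<T>" "x \<in> K"
  shows "global_nodal b x = nodal K b x"
proof -
  have "global_nodal b x = (\<Sum>z\<in>\<V> K. b z * (poly jac (barycentric K z x) - 1))"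
    unfolding global_nodal_def
  proof (rule sum.mono_neutral_cong_right[OF finite_mesh_vertices])
    show "\<V> K \<subseteq> mesh_vertices \<T>" using assms(1) by (auto simp: mesh_vertices_def)
    show "\<forall>z\<in>mesh_vertices \<T> - \<V> K. b z * poly (jac - 1) (hat z x) = 0"
      using full_simplex.bc_not_vertex[OF simplex_\<T>[OF assms(1)]] by (simp add: hat_eq[OF assms])
  qed (simp add: hat_eq[OF assms])
  thus ?thesis by (simp add: nodal_def)
qed

lemma global_nodal_conf: "global_nodal b \<in> conf"
  by (rule conforming_fnsI) (use nodal_poly_space global_nodal_eq in blast)

lemma global_nodal_H10:
  assumes "\<And>z. z \<in> mesh_vertices \<T> \<Longrightarrow> z \<notin> \<Omega> \<Longrightarrow> b z = 0"
  shows "global_nodal b \<in> H10 \<Omega>" unfolding global_nodal_def[abs_def]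
proof (rule H10_sum)
  fix z assume "z \<in> mesh_vertices \<T>"
  thus "(\<lambda>x. b z * poly (jac - 1) (hat z x)) \<in> H10 \<Omega>"
    using assms[of z] hat_H10[of z "jac - 1"] H10_zero
    by (cases "z \<in> \<Omega>") (auto intro: H10_scale[OF open_\<Omega> bounded_\<Omega>])
qed

lemma global_nodal_vertex: "z \<in> mesh_vertices \<T> \<Longrightarrow> global_nodal b z = b z * (\<rho> - 1)"
  using global_nodal_eq nodal_vertex full_simplex.V_subset[OF simplex_\<T>] by (fastforce simp: mesh_vertices_def)

text \<open>The inverse of \<open>facet_coeff\<close>: on each simplex b_z = a_z - (sum of a)/d is
  solved by a_z = b_z - (sum of b), which is minus the sum over the vertices of the facet opposite
  to \<open>z\<close>. It depends on the facet alone, so both adjacent simplices agree on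
  it.\<close>

definition vertex_sum :: "('a \<Rightarrow> real) \<Rightarrow> 'a set \<Rightarrow> real" where
  "vertex_sum b F = - (\<Sum>y\<in>\<V> F. b y)"

lemma facet_coeff_vertex_sum:
  assumes K: "K \<in> \<T>" and a: "\<And>F. F facet_of K \<Longrightarrow> a F = vertex_sum b F" and z: "z \<in> \<V> K"
  shows "facet_coeff a K z = b z"
proof -
  interpret K: full_simplex K by (rule simplex_\<T>[OF K])
  define B where "B = (\<Sum>y\<in>\<V> K. b y)"
  have A: "a (convex hull (\<V> K - {z})) = b z - B" if z: "z \<in> \<V> K" for z
    using K.facet_vertices(1)[OF K.facet_of_vertex(1)[OF z]] K.facet_of_vertex[OF z]
      sum.remove[OF K.finite_V z, of b] a by (simp add: vertex_sum_def B_def)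
  have "(\<Sum>z\<in>\<V> K. a (convex hull (\<V> K - {z}))) = (\<Sum>z\<in>\<V> K. b z - B)"
    by (intro sum.cong refl) (simp add: A)
  also have "\<dots> = - real DIM('a) * B"
    using K.card_V by (simp add: sum_subtractf B_def[symmetric] algebra_simps)
  finally show ?thesis using A[OF z] by (simp add: facet_coeff_def)
qed

lemma global_nodal_glue:
  assumes "\<And>F. F \<in> mesh_facets \<T> \<Longrightarrow> a F = vertex_sum b F"
  shows "on_open_simplices \<T> (global_nodal b) = glue (\<lambda>K. nodal K (facet_coeff a K))"
proof (rule on_open_simplices_eq_glue)
  fix K x assume K: "K \<in> \<T>" "x \<in> K"
  have "nodal K b x = nodal K (facet_coeff a K) x"
    unfolding nodal_def using facet_coeff_vertex_sum[OF K(1)] assms facet_in_mesh[OF K(1)]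
    by (intro sum.cong refl) auto
  thus "global_nodal b x = nodal K (facet_coeff a K) x" by (simp add: global_nodal_eq[OF K])
qed

lemma mesh_vertices_subset: "mesh_vertices \<T> \<subseteq> closure \<Omega>"
  using full_simplex.V_subset[OF simplex_\<T>] Union_\<T> by (auto simp: mesh_vertices_def)

text \<open>The nodal function with the same vertex values is subtracted; through
  \<open>vertex_sum\<close> it is a combination of facet functions. In the \<open>H10\<close> case
  \<open>w\<close> is zero at vertices on the frontier, so boundary facets receive coefficient zero
  and the correction stays in \<open>H10\<close>.\<close>

lemma split_conf:
  assumes w: "w \<in> conf" and \<rho>: "\<rho> \<noteq> 1"
  shows "on_open_simplices \<T> w \<in> S_bullet \<Omega> \<T> k + V_facets \<T> k (mesh_facets \<T>)"
    "w \<in> H10 \<Omega> \<Longrightarrow> on_open_simplices \<T> w \<in> S0_bullet \<Omega> \<T> k + V_facets \<T> k (interior_facets \<Omega> \<T>)"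
proof -
  define b where "b z = w z / (\<rho> - 1)" for z
  define u where "u x = w x + (-1) * global_nodal b x" for x
  have u: "u \<in> conf" unfolding u_def by (intro conf_add w conf_scale global_nodal_conf)
  have u0: "u z = 0" if "z \<in> mesh_vertices \<T>" for z
    using \<rho> that by (simp add: u_def global_nodal_vertex b_def)
  have "w = (\<lambda>x. u x + global_nodal b x)" by (simp add: u_def)
  hence sum: "on_open_simplices \<T> w = on_open_simplices \<T> u + on_open_simplices \<T> (global_nodal b)"
    by (metis on_open_simplices_linear(1))
  define a where "a F = (if F \<in> mesh_facets \<T> then vertex_sum b F else 0)" for F
  have glue: "on_open_simplices \<T> (global_nodal b) = glue (\<lambda>K. nodal K (facet_coeff a K))"
    by (rule global_nodal_glue) (simp add: a_def)
  have "on_open_simplices \<T> (global_nodal b) \<in> V_facets \<T> k (mesh_facets \<T>)"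
    unfolding glue V_facets_eq[OF order_refl] by (auto simp: a_def)
  moreover have "on_open_simplices \<T> u \<in> S_bullet \<Omega> \<T> k" using u u0 by (auto simp: S_bullet_def)
  ultimately show "on_open_simplices \<T> w \<in> S_bullet \<Omega> \<T> k + V_facets \<T> k (mesh_facets \<T>)"
    unfolding sum by (intro set_plus_intro)
  assume w0: "w \<in> H10 \<Omega>"
  have b0: "b z = 0" if "z \<in> mesh_vertices \<T>" "z \<notin> \<Omega>" for z
    using conforming_H10_zero_on_frontier[OF w w0, of z] that mesh_vertices_subset frontier_\<Omega>
    by (auto simp: b_def)
  have "global_nodal b \<in> H10 \<Omega>" by (rule global_nodal_H10) (rule b0)
  hence "u \<in> H10 \<Omega>"
    unfolding u_def by (intro H10_add[OF open_\<Omega> bounded_\<Omega>] w0 H10_scale[OF open_\<Omega> bounded_\<Omega>])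
  hence "on_open_simplices \<T> u \<in> S0_bullet \<Omega> \<T> k" using u u0 by (auto simp: S0_bullet_def)
  moreover have "a F = 0" if "F \<notin> interior_facets \<Omega> \<T>" for F
  proof (cases "F \<in> mesh_facets \<T>")
    case True
    hence F: "F \<in> boundary_facets \<Omega> \<T>" using that mesh_facets_cases by blast
    obtain K where K: "K \<in> \<T>" "F facet_of K" using True by (auto simp: mesh_facets_def)
    interpret simplex_facet K F by (rule simplex_facet_\<T>[OF K(1) K(2)])
    have "b y = 0" if "y \<in> \<V> F" for y
    proof (rule b0)
      have "y \<in> \<V> K" "y \<in> F" using that facet_vertices[OF K(2)] by auto
      thus "y \<in> mesh_vertices \<T>" "y \<notin> \<Omega>"
        using K(1) F frontier_\<Omega> by (auto simp: mesh_vertices_def boundary_facets_def)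
    qed
    thus ?thesis by (simp add: a_def vertex_sum_def)
  qed (simp add: a_def)
  hence "on_open_simplices \<T> (global_nodal b) \<in> V_facets \<T> k (interior_facets \<Omega> \<T>)"
    unfolding glue by (subst V_facets_eq) (auto simp: interior_facets_def)
  ultimately show "on_open_simplices \<T> w \<in> S0_bullet \<Omega> \<T> k + V_facets \<T> k (interior_facets \<Omega> \<T>)"
    unfolding sum by (intro set_plus_intro)
qed

lemma S_bullet_Int_V_facets:
  assumes \<G>: "\<G> \<subseteq> mesh_facets \<T>" and \<rho>: "\<rho> \<noteq> 1" and w: "w \<in> conf" "\<And>z. z \<in> mesh_vertices \<T> \<Longrightarrow> w z = 0"
    and v: "on_open_simplices \<T> w \<in> V_facets \<T> k \<G>"
  shows "on_open_simplices \<T> w = 0"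
proof -
  obtain a where a: "on_open_simplices \<T> w = glue (\<lambda>K. nodal K (facet_coeff a K))" "\<And>F. F \<notin> \<G> \<Longrightarrow> a F = 0"
    using v unfolding V_facets_eq[OF \<G>] by blast
  have eq: "w x = nodal K (facet_coeff a K) x" if "K \<in> \<T>" "x \<in> K" for K x
    using a(1) conf_eq_glue_iff[OF w(1), of "\<lambda>K. nodal K (facet_coeff a K)"] nodal_continuous that by blast
  have "a F = 0" for F
  proof (cases "F \<in> \<G>")
    case True
    then obtain K where K: "K \<in> \<T>" "F facet_of K" using \<G> by (auto simp: mesh_facets_def)
    show ?thesis
    proof (rule facet_coeffs_zero[OF K(1) \<rho> _ K(2)])
      fix y assume "y \<in> \<V> K"
      hence "y \<in> mesh_vertices \<T>" "y \<in> K"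
        using K(1) full_simplex.V_subset[OF simplex_\<T>[OF K(1)]] by (auto simp: mesh_vertices_def)
      thus "nodal K (facet_coeff a K) y = 0" using w(2) eq[OF K(1)] by metis
    qed
  qed (rule a(2))
  hence "facet_coeff a K z = 0" for K z by (simp add: facet_coeff_def)
  hence "on_open_simplices \<T> w = glue (\<lambda>K x. 0)" by (simp add: a(1) nodal_def[abs_def])
  thus ?thesis by (simp add: glue_0)
qed

text \<open>At a shared vertex every adjacent simplex shows the value \<open>c K * \<eta>\<close>,
  so the set of simplices with one given coefficient cannot be a proper part of the mesh.\<close>

lemma conf_V_simplices_const:
  assumes \<eta>: "\<eta> \<noteq> 0" and w: "\<And>K x. K \<in> \<T> \<Longrightarrow> x \<in> K \<Longrightarrow> w x = c K * BP K x" and K: "K \<in> \<T>" "K' \<in> \<T>"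
  shows "c K = c K'"
proof (rule ccontr)
  assume ne: "c K \<noteq> c K'"
  let ?A = "{L \<in> \<T>. c L = c K}"
  have "K \<in> ?A" "K' \<notin> ?A" using K ne by auto
  hence "?A \<subseteq> \<T>" "?A \<noteq> {}" "?A \<noteq> \<T>" using K by blast+
  then obtain L L' v where L: "L \<in> ?A" "L' \<in> \<T> - ?A" "v \<in> \<V> L" "v \<in> \<V> L'"
    by (rule vertex_connected)
  have *: "w v = c M * \<eta>" if "M \<in> \<T>" "v \<in> \<V> M" for M
    using w[OF that(1), of v] BP_vertex[OF that] full_simplex.V_subset[OF simplex_\<T>[OF that(1)]] that(2) by auto
  have "w v = c L * \<eta>" "w v = c L' * \<eta>" using L *[of L] *[of L'] by simp_all
  thus False using L \<eta> by auto
qed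

text \<open>With d+1 vertices, (-1 + sum of P_z)/d = 1 + (1/d) (sum of P_z - 1), and the right-hand
  side is conforming. This relation between simplex functions and conforming functions is why one
  simplex is left out of the submesh.\<close>

lemma B_simplex_total:
  "(\<Sum>K\<in>\<T>. B_simplex k K) \<in> S_space \<Omega> \<T> k"
proof -
  define U where "U x = 1 + (1 / real DIM('a)) * global_nodal (\<lambda>_. 1) x" for x
  have one: "(\<lambda>x. 1) \<in> conf"
    by (rule conforming_fnsI) (auto intro!: bexI[of _ "\<lambda>x. 1"] poly_space_const)
  have U: "U \<in> conf" unfolding U_def by (intro conf_add one conf_scale global_nodal_conf)
  have "U x = BP K x" if "K \<in> \<T>" "x \<in> K" for K x
  proof -
    have "nodal K (\<lambda>_. 1) x = (\<Sum>z\<in>\<V> K. poly jac (barycentric K z x)) - (real DIM('a) + 1)"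
      using full_simplex.card_V[OF simplex_\<T>[OF that(1)]] by (simp add: nodal_def sum_subtractf)
    thus ?thesis by (simp add: U_def BP_def global_nodal_eq[OF that] field_simps)
  qed
  hence "on_open_simplices \<T> U = glue BP" by (rule on_open_simplices_eq_glue)
  also have "glue BP = (\<Sum>K\<in>\<T>. 1 *\<^sub>R B_simplex k K)"
    unfolding B_simplex_sum[OF order_refl] by (rule glue_eqI) (auto simp: glue_outside glue_interior)
  finally have "(\<Sum>K\<in>\<T>. B_simplex k K) = on_open_simplices \<T> U" by simp
  thus ?thesis using U by (auto simp: S_space_def)
qed

end

section \<open>Direct sums and bases\<close>

lemma direct_sumI:
  assumes A: "subspace A" and B: "subspace B" and sub: "A \<subseteq> S" "B \<subseteq> V"
    and gen: "S \<subseteq> A + B" "V \<subseteq> A + B" and int: "\<And>v. v \<in> A \<Longrightarrow> v \<in> B \<Longrightarrow> v = 0"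
  shows "is_direct_sum (S + V) A B"
proof -
  have AB: "A + B = {x + y | x y. x \<in> A \<and> y \<in> B}" by (auto simp: set_plus_def)
  have "subspace (A + B)" unfolding AB by (rule subspace_sums[OF A B])
  hence "S + V \<subseteq> A + B" using gen by (auto elim!: set_plus_elim intro: subspace_add)
  moreover have "A + B \<subseteq> S + V" using sub by (rule set_plus_mono2)
  ultimately show ?thesis unfolding is_direct_sum_def using A B subspace_0[OF A] subspace_0[OF B] int by auto
qed

context mesh_degree
begin

lemma S_bullet_subset: "S_bullet \<Omega> \<T> k \<subseteq> S_space \<Omega> \<T> k"
  and S0_bullet_subset: "S0_bullet \<Omega> \<T> k \<subseteq> S0_space \<Omega> \<T> k"
  by (auto simp: S_bullet_def S_space_def S0_bullet_def S0_space_def)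

lemma subspace_V: "subspace (V_simplices k \<M>)" "subspace (V_facets \<T> k \<G>)"
  by (simp_all add: V_simplices_def V_facets_def)

lemma interior_facets_subset: "interior_facets \<Omega> \<T> \<subseteq> mesh_facets \<T>"
  by (auto simp: interior_facets_def)

lemma direct_sum_odd:
  assumes "odd k"
  shows "is_direct_sum (CR \<Omega> \<T> k) (S_bullet \<Omega> \<T> k) (V_facets \<T> k (mesh_facets \<T>))"
    and "is_direct_sum (CR0 \<Omega> \<T> k) (S0_bullet \<Omega> \<T> k) (V_facets \<T> k (interior_facets \<Omega> \<T>))"
proof -
  note \<rho> = \<rho>_odd'[OF assms]
  have V: "V \<subseteq> A + V" if "subspace A" for A V :: "('a \<Rightarrow> real) set"
    using set_plus_intro[OF subspace_0[OF that]] by fastforce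
  have "is_direct_sum (S_space \<Omega> \<T> k + V_facets \<T> k (mesh_facets \<T>)) (S_bullet \<Omega> \<T> k) (V_facets \<T> k (mesh_facets \<T>))"
  proof (rule direct_sumI[OF subspace_S_bullet subspace_V(2) S_bullet_subset order_refl _ V[OF subspace_S_bullet]])
    show "S_space \<Omega> \<T> k \<subseteq> S_bullet \<Omega> \<T> k + V_facets \<T> k (mesh_facets \<T>)"
      using split_conf(1)[OF _ \<rho>] by (auto simp: S_space_def)
  next
    fix v assume "v \<in> S_bullet \<Omega> \<T> k" "v \<in> V_facets \<T> k (mesh_facets \<T>)"
    thus "v = 0" using S_bullet_Int_V_facets[OF order_refl \<rho>] by (auto simp: S_bullet_def)
  qed
  thus "is_direct_sum (CR \<Omega> \<T> k) (S_bullet \<Omega> \<T> k) (V_facets \<T> k (mesh_facets \<T>))"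
    using assms by (simp add: CR_def)
  have "is_direct_sum (S0_space \<Omega> \<T> k + V_facets \<T> k (interior_facets \<Omega> \<T>)) (S0_bullet \<Omega> \<T> k) (V_facets \<T> k (interior_facets \<Omega> \<T>))"
  proof (rule direct_sumI[OF subspace_S0_bullet subspace_V(2) S0_bullet_subset order_refl _ V[OF subspace_S0_bullet]])
    show "S0_space \<Omega> \<T> k \<subseteq> S0_bullet \<Omega> \<T> k + V_facets \<T> k (interior_facets \<Omega> \<T>)"
      using split_conf(2)[OF _ \<rho>] by (auto simp: S0_space_def)
  next
    fix v assume "v \<in> S0_bullet \<Omega> \<T> k" "v \<in> V_facets \<T> k (interior_facets \<Omega> \<T>)"
    thus "v = 0" using S_bullet_Int_V_facets[OF interior_facets_subset \<rho>] by (auto simp: S0_bullet_def)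
  qed
  thus "is_direct_sum (CR0 \<Omega> \<T> k) (S0_bullet \<Omega> \<T> k) (V_facets \<T> k (interior_facets \<Omega> \<T>))"
    using assms by (simp add: CR0_def)
qed

lemma conf_V_simplicesE:
  assumes w: "w \<in> conf" and v: "on_open_simplices \<T> w \<in> V_simplices k \<M>" and \<M>: "\<M> \<subseteq> \<T>"
  obtains c where "on_open_simplices \<T> w = glue (\<lambda>K x. c K * BP K x)" "\<And>K. K \<notin> \<M> \<Longrightarrow> c K = 0"
    "\<And>K x. K \<in> \<T> \<Longrightarrow> x \<in> K \<Longrightarrow> w x = c K * BP K x"
proof -
  obtain c where c: "on_open_simplices \<T> w = glue (\<lambda>K x. c K * BP K x)" "\<And>K. K \<notin> \<M> \<Longrightarrow> c K = 0"
    using v unfolding V_simplices_eq[OF \<M>] by blast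
  have "w x = c K * BP K x" if "K \<in> \<T>" "x \<in> K" for K x
    using c(1) conf_eq_glue_iff[OF w, of "\<lambda>K x. c K * BP K x"] BP_continuous that
    by (auto intro: continuous_on_mult_left)
  with c show ?thesis by (rule that)
qed

lemma conf_Int_V_simplices:
  assumes \<eta>: "\<eta> \<noteq> 0" and w: "w \<in> conf" and \<M>: "\<M> \<subseteq> \<T>" "\<M> \<noteq> \<T>"
    and v: "on_open_simplices \<T> w \<in> V_simplices k \<M>"
  shows "on_open_simplices \<T> w = 0"
proof -
  obtain c where c: "on_open_simplices \<T> w = glue (\<lambda>K x. c K * BP K x)" "\<And>K. K \<notin> \<M> \<Longrightarrow> c K = 0"
    "\<And>K x. K \<in> \<T> \<Longrightarrow> x \<in> K \<Longrightarrow> w x = c K * BP K x"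
    by (rule conf_V_simplicesE[OF w v \<M>(1)]) blast
  obtain K0 where K0: "K0 \<in> \<T>" "K0 \<notin> \<M>" using \<M> by blast
  have "c K = 0" if "K \<in> \<T>" for K
    using conf_V_simplices_const[OF \<eta> c(3) that K0(1)] c(2)[OF K0(2)] by simp
  hence "(\<lambda>K x. c K * BP K x) = (\<lambda>K x. 0)" using c(2) \<M>(1) by (auto simp: fun_eq_iff)
  thus ?thesis using c(1) by (simp add: glue_0)
qed

text \<open>One vertex on a boundary facet settles the common coefficient: \<open>w\<close> is zero
  there while the simplex function has the value \<eta>.\<close>

lemma conf0_Int_V_simplices:
  assumes \<eta>: "\<eta> \<noteq> 0" and w: "w \<in> conf0" and v: "on_open_simplices \<T> w \<in> V_simplices k \<T>"
  shows "on_open_simplices \<T> w = 0"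
proof -
  obtain c where c: "on_open_simplices \<T> w = glue (\<lambda>K x. c K * BP K x)" "\<And>K. K \<notin> \<T> \<Longrightarrow> c K = 0"
    "\<And>K x. K \<in> \<T> \<Longrightarrow> x \<in> K \<Longrightarrow> w x = c K * BP K x"
    by (rule conf_V_simplicesE[OF _ v order_refl]) (use w in auto)
  obtain F where F: "F \<in> boundary_facets \<Omega> \<T>" by (rule boundary_facet_exists)
  then obtain K0 where K0: "K0 \<in> \<T>" "F facet_of K0" by (auto simp: boundary_facets_def mesh_facets_def)
  interpret K0: simplex_facet K0 F by (rule simplex_facet_\<T>[OF K0(1) K0(2)])
  obtain y where y: "y \<in> K0.V" "y \<noteq> K0.opp" by (rule K0.other_vertex)
  hence "y \<in> F" using K0.facet_vertices(2)[OF K0(2)] by blast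
  hence "w y = 0" using conforming_H10_trace[of w k F y] w F by blast
  hence "c K0 = 0" using c(3)[OF K0(1), of y] y K0.V_subset BP_vertex[OF K0(1) y(1)] \<eta> by auto
  hence "c K = 0" if "K \<in> \<T>" for K using conf_V_simplices_const[OF \<eta> c(3) that K0(1)] by simp
  hence "(\<lambda>K x. c K * BP K x) = (\<lambda>K x. 0)" using c(2) by (auto simp: fun_eq_iff)
  thus ?thesis using c(1) by (simp add: glue_0)
qed

lemma direct_sum_even:
  assumes "even k" and \<M>: "\<M> \<subseteq> \<T>" "card \<M> = card \<T> - 1"
  shows "is_direct_sum (CR \<Omega> \<T> k) (S_space \<Omega> \<T> k) (V_simplices k \<M>)"
proof -
  have \<eta>: "\<eta> \<noteq> 0" using \<eta>_even[OF assms(1)] by simp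
  have fin: "finite \<M>" using \<M>(1) finite_\<T> by (rule finite_subset)
  have "card \<T> > 0" using finite_\<T> nonempty_\<T> by (simp add: card_gt_0_iff)
  hence "card (\<T> - \<M>) = 1" using \<M> fin by (simp add: card_Diff_subset)
  then obtain K0 where K0: "\<T> - \<M> = {K0}" by (rule card_1_singletonE)
  have S: "subspace (S_space \<Omega> \<T> k + V_simplices k \<M>)"
  proof -
    have eq: "S_space \<Omega> \<T> k + V_simplices k \<M> = {x + y | x y. x \<in> S_space \<Omega> \<T> k \<and> y \<in> V_simplices k \<M>}"
      by (auto simp: set_plus_def)
    show ?thesis unfolding eq by (rule subspace_sums[OF subspace_S subspace_V(1)])
  qed
  have inV: "v \<in> S_space \<Omega> \<T> k + V_simplices k \<M>" if "v \<in> V_simplices k \<M>" for v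
    using set_plus_intro[OF subspace_0[OF subspace_S] that] by simp
  have inS: "v \<in> S_space \<Omega> \<T> k + V_simplices k \<M>" if "v \<in> S_space \<Omega> \<T> k" for v
    using set_plus_intro[OF that subspace_0[OF subspace_V(1)]] by simp
  have inM: "B_simplex k K \<in> V_simplices k \<M>" if "K \<in> \<M>" for K
    unfolding V_simplices_def using that by (auto intro: span_base)
  have "is_direct_sum (S_space \<Omega> \<T> k + V_simplices k \<T>) (S_space \<Omega> \<T> k) (V_simplices k \<M>)"
  proof (rule direct_sumI[OF subspace_S subspace_V(1) order_refl])
    show "V_simplices k \<M> \<subseteq> V_simplices k \<T>"
      unfolding V_simplices_def using \<M>(1) by (intro span_mono image_mono)
    show "S_space \<Omega> \<T> k \<subseteq> S_space \<Omega> \<T> k + V_simplices k \<M>" using inS by blast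
    show "V_simplices k \<T> \<subseteq> S_space \<Omega> \<T> k + V_simplices k \<M>"
      unfolding V_simplices_def[of k \<T>]
    proof (rule span_minimal[OF _ S], rule image_subsetI)
      fix K assume K: "K \<in> \<T>"
      show "B_simplex k K \<in> S_space \<Omega> \<T> k + V_simplices k \<M>"
      proof (cases "K \<in> \<M>")
        \<comment> \<open>The one omitted function is the conforming total minus the functions of
          the submesh.\<close>
        case False
        hence "\<T> = insert K \<M>" using K K0 \<M>(1) by blast
        hence "(\<Sum>K\<in>\<T>. B_simplex k K) = B_simplex k K + (\<Sum>K\<in>\<M>. B_simplex k K)"
          using False fin by simp
        hence "B_simplex k K = (\<Sum>K\<in>\<T>. B_simplex k K) - (\<Sum>K\<in>\<M>. B_simplex k K)" by simp
        moreover have "(\<Sum>K\<in>\<M>. B_simplex k K) \<in> V_simplices k \<M>"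
          by (intro subspace_sum[OF subspace_V(1)] inM)
        ultimately show ?thesis using subspace_diff[OF S inS[OF B_simplex_total] inV] by metis
      qed (use inV inM in blast)
    qed
  next
    fix v assume "v \<in> S_space \<Omega> \<T> k" "v \<in> V_simplices k \<M>"
    thus "v = 0" using conf_Int_V_simplices[OF \<eta> _ \<M>(1)] K0 by (auto simp: S_space_def)
  qed
  thus ?thesis using assms(1) by (simp add: CR_def)
qed

lemma direct_sum_even0:
  assumes "even k"
  shows "is_direct_sum (CR0 \<Omega> \<T> k) (S0_space \<Omega> \<T> k) (V_simplices k \<T>)"
proof -
  have \<eta>: "\<eta> \<noteq> 0" using \<eta>_even[OF assms] by simp
  have "is_direct_sum (S0_space \<Omega> \<T> k + V_simplices k \<T>) (S0_space \<Omega> \<T> k) (V_simplices k \<T>)"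
  proof (rule direct_sumI[OF subspace_S0 subspace_V(1) order_refl order_refl])
    show "S0_space \<Omega> \<T> k \<subseteq> S0_space \<Omega> \<T> k + V_simplices k \<T>"
      using set_plus_intro[OF _ subspace_0[OF subspace_V(1)]] by fastforce
    show "V_simplices k \<T> \<subseteq> S0_space \<Omega> \<T> k + V_simplices k \<T>"
      using set_plus_intro[OF subspace_0[OF subspace_S0]] by fastforce
  next
    fix v assume "v \<in> S0_space \<Omega> \<T> k" "v \<in> V_simplices k \<T>"
    thus "v = 0" using conf0_Int_V_simplices[OF \<eta>] by (auto simp: S0_space_def)
  qed
  thus ?thesis using assms by (simp add: CR0_def)
qed

lemma B_facet_basis:
  assumes \<rho>: "\<rho> \<noteq> 1" and \<G>: "\<G> \<subseteq> mesh_facets \<T>"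
  shows "family_basis (B_facet \<T> k) \<G> (V_facets \<T> k \<G>)" unfolding V_facets_def
proof (rule family_basisI)
  show fin: "finite \<G>" using \<G> finite_mesh_facets by (rule finite_subset)
  fix u assume u: "(\<Sum>F\<in>\<G>. u F *\<^sub>R B_facet \<T> k F) = 0"
  define a where "a F = (if F \<in> \<G> then u F else 0)" for F
  have "(\<Sum>F\<in>\<G>. u F *\<^sub>R B_facet \<T> k F) = (\<Sum>F\<in>mesh_facets \<T>. a F *\<^sub>R B_facet \<T> k F)"
    using \<G> by (intro sum.mono_neutral_cong_left finite_mesh_facets) (auto simp: a_def)
  hence "glue (\<lambda>K. nodal K (facet_coeff a K)) = glue (\<lambda>K x. 0)"
    using u by (simp add: B_facet_sum glue_0)
  hence zero: "nodal K (facet_coeff a K) x = 0" if "K \<in> \<T>" "x \<in> K" for K x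
    using that nodal_continuous by (subst (asm) glue_eq_iff) auto
  show "\<forall>F\<in>\<G>. u F = 0"
  proof
    fix F assume F: "F \<in> \<G>"
    then obtain K where K: "K \<in> \<T>" "F facet_of K" using \<G> by (auto simp: mesh_facets_def)
    have "a F = 0" by (rule facet_coeffs_zero[OF K(1) \<rho> _ K(2)])
        (use zero[OF K(1)] full_simplex.V_subset[OF simplex_\<T>[OF K(1)]] in blast)
    with F show "u F = 0" by (simp add: a_def)
  qed
qed

text \<open>If \<open>BP K\<close> vanished, comparing \<open>t u + t v + (1 - 2 t) w\<close> with \<open>2 t u + (1 - 2 t) w\<close> would give
  \<open>2 jac(t) = jac(2 t) + 1\<close>, which forces degree at most 1.\<close>

lemma BP_nonzero:
  assumes K: "K \<in> \<T>" and k: "k \<ge> 2"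
  shows "\<exists>x\<in>K. BP K x \<noteq> 0"
proof (rule ccontr)
  assume "\<not> (\<exists>x\<in>K. BP K x \<noteq> 0)"
  hence zero: "(\<Sum>z\<in>\<V> K. poly jac (barycentric K z x)) = 1" if "x \<in> K" for x
    using that dim by (auto simp: BP_def)
  interpret K: full_simplex K by (rule simplex_\<T>[OF K])
  have "3 \<le> card K.V" using K.card_V dim by simp
  then obtain S where S: "S \<subseteq> K.V" "card S = 3" by (meson obtain_subset_with_card_n)
  then obtain u v w where uvw: "u \<noteq> v" "u \<noteq> w" "v \<noteq> w" "S = {u, v, w}"
    by (auto simp: card_3_iff)
  have V: "u \<in> K.V" "v \<in> K.V" "w \<in> K.V" using S uvw by auto
  \<comment> \<open>The point has coordinates r, s, t at three vertices and 0 at the other d - 2,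
    each of which contributes P_k(1) = 1 to the sum.\<close>
  have eq: "poly jac r + poly jac s + poly jac t = 3 - real DIM('a)"
    if "0 \<le> r" "0 \<le> s" "0 \<le> t" "r + s + t = 1" for r s t
  proof -
    define c where "c y = (if y = u then r else 0) + (if y = v then s else 0) + (if y = w then t else 0)" for y
    have c1: "sum c K.V = 1" using V K.finite_V that(4) by (simp add: c_def sum.distrib)
    define x where "x = (\<Sum>y\<in>K.V. c y *\<^sub>R y)"
    have bc: "K.bc y x = c y" if "y \<in> K.V" for y unfolding x_def by (rule K.bc_comb[OF c1 that])
    have "x \<in> K" using bc that by (auto simp: K.mem_K_iff c_def)
    have "(\<Sum>z\<in>K.V. poly jac (K.bc z x)) = (\<Sum>z\<in>K.V. poly jac (c z))"
      by (intro sum.cong) (simp_all add: bc)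
    also have "\<dots> = (\<Sum>z\<in>K.V. 1 + ((if z = u then poly jac r - 1 else 0) + (if z = v then poly jac s - 1 else 0)
        + (if z = w then poly jac t - 1 else 0)))"
      using uvw by (intro sum.cong) (auto simp: c_def)
    also have "\<dots> = (real DIM('a) + 1) + (poly jac r - 1) + (poly jac s - 1) + (poly jac t - 1)"
      using V K.finite_V K.card_V by (simp add: sum.distrib)
    finally show ?thesis using zero[OF \<open>x \<in> K\<close>] by simp
  qed
  define P where "P = smult 2 jac - jac \<circ>\<^sub>p [:0, 2:] - 1"
  have "poly P t = 0" if "t \<in> {0..1/2}" for t
    using eq[of t t "1 - 2 * t"] eq[of "2 * t" 0 "1 - 2 * t"] that by (simp add: P_def poly_pcompose mult.commute)
  hence "{0..1/2} \<subseteq> {t. poly P t = 0}" by blast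
  moreover have "infinite {0..1/2::real}" by (simp add: infinite_Icc)
  ultimately have "P = 0" using poly_roots_finite[of P] finite_subset by blast
  hence "coeff P k = 0" by simp
  moreover have "coeff (jac \<circ>\<^sub>p [:0, 2:]) k = coeff jac k * 2 ^ k"
    using lead_coeff_comp[of "[:0, 2 :: real:]" jac] degree_jac by (simp add: degree_pcompose)
  moreover have "coeff 1 k = (0::real)" using k by simp
  \<comment> \<open>The coefficient of t^k in 2 jac(t) - jac(2t) - 1; the constant 1 does not reach
    it because k \<ge> 2.\<close>
  ultimately have "coeff jac k * (2 - 2 ^ k) = 0" by (simp add: P_def algebra_simps)
  moreover have "coeff jac k \<noteq> 0"
    using degree_jac k by (metis leading_coeff_0_iff degree_0 not_numeral_le_zero)
  moreover have "(2::real) ^ k > 2 ^ 1" using k by (intro power_strict_increasing) auto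
  ultimately show False by simp
qed

lemma B_simplex_basis:
  assumes "k \<ge> 2"
  shows "family_basis (B_simplex k) \<T> (V_simplices k \<T>)" unfolding V_simplices_def
proof (rule family_basisI[OF finite_\<T>])
  fix u assume "(\<Sum>K\<in>\<T>. u K *\<^sub>R B_simplex k K) = 0"
  hence eq: "glue (\<lambda>K x. (if K \<in> \<T> then u K else 0) * BP K x) = glue (\<lambda>K x. 0)"
    by (simp add: B_simplex_sum glue_0)
  have "u K * BP K x = 0" if "K \<in> \<T>" "x \<in> K" for K x
  proof -
    have "\<forall>K\<in>\<T>. \<forall>x\<in>K. (if K \<in> \<T> then u K else 0) * BP K x = 0"
      by (rule glue_eq_iff[THEN iffD1, OF _ _ eq]) (auto intro: continuous_on_mult_left BP_continuous)
    thus ?thesis using that by auto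
  qed
  thus "\<forall>K\<in>\<T>. u K = 0" using BP_nonzero[OF _ assms] by (metis mult_eq_0_iff)
qed

text \<open>In degree 1 the polynomial is 1 - d t; the coordinates sum to 1, so the d+1 terms add up
  to 1 and the simplex function is zero.\<close>

lemma V_simplices_1:
  assumes "k = 1"
  shows "V_simplices k \<T> = {0}"
proof -
  have "\<rho> = - (real DIM('a) - 1)" unfolding \<rho>_eq using dim assms by (simp add: of_nat_diff)
  hence j1: "poly jac 1 = 1 - real DIM('a)" by (simp add: \<rho>_def)
  have "degree jac \<le> 1" using degree_jac assms by linarith
  moreover obtain a q where "jac = pCons a q" by (rule pCons_cases)
  ultimately obtain b where ab: "jac = [:a, b:]"
    by (auto simp: degree_pCons_eq_if split: if_splits elim: degree_eq_zeroE)
  have "poly jac t = 1 - real DIM('a) * t" for t using j1 jac_0 by (simp add: ab)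
  hence "BP K x = 0" if "K \<in> \<T>" for K x
    using full_simplex.sum_bc[OF simplex_\<T>[OF that]] full_simplex.card_V[OF simplex_\<T>[OF that]]
    by (simp add: BP_def sum_subtractf flip: sum_distrib_left)
  hence "B_simplex k K = 0" if "K \<in> \<T>" for K
    unfolding B_simplex_eq[OF that] using that by (intro ext) (auto simp: glue_def intro!: sum.neutral)
  hence "B_simplex k ` \<T> \<subseteq> {0}" by blast
  thus ?thesis unfolding V_simplices_def using span_minimal[OF _ subspace_single_0] span_zero by blast
qed

section \<open>Orthogonality of traces\<close>

text \<open>On \<open>F\<close> the nodal combination involves only the vertices of
  \<open>F\<close>, and its constants -1 add up to \<open>a F\<close>. This number is the same from
  both sides of the facet.\<close>

lemma facet_coeff_sum:
  assumes K: "K \<in> \<T>" "F facet_of K"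
  shows "a F = - (\<Sum>y\<in>\<V> F. facet_coeff a K y)"
proof -
  interpret K: full_simplex K by (rule simplex_\<T>[OF K(1)])
  let ?o = "opposite_vertex K F"
  note o = K.opposite_vertex_in[OF K(2)]
  have "(\<Sum>y\<in>K.V. facet_coeff a K y) = facet_coeff a K ?o + (\<Sum>y\<in>\<V> F. facet_coeff a K y)"
    unfolding K.facet_vertices(1)[OF K(2)] by (rule sum.remove[OF K.finite_V o])
  thus ?thesis using K.facet_eq_hull[OF K(2)] unfolding sum_facet_coeff[OF K(1)] facet_coeff_def[of a K ?o] by simp
qed

text \<open>Traces such as \<open>elem_restr\<close> and \<open>jump\<close> are controlled only on
  \<open>F\<close>, which carries the measure. When the product with a polynomial is not integrable,
  the integral is zero by convention.\<close>

lemma orth_polys_transfer: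
  fixes F :: "'a set"
  assumes "simplex_facet K F" and g: "continuous_on UNIV g" and eq: "\<And>x. x \<in> F \<Longrightarrow> f x = g x"
    and orth: "orth_polys F n g"
  shows "orth_polys F n f" unfolding orth_polys_def
proof
  interpret simplex_facet K F by fact
  fix p :: "'a \<Rightarrow> real" assume p: "p \<in> poly_space n"
  show "(\<integral>x. f x * p x \<partial>facet_measure F) = 0"
  proof (cases "integrable (facet_measure F) (\<lambda>x. f x * p x)")
    case True
    have "integrable (facet_measure F) (\<lambda>x. g x * p x)"
      by (intro integrable_facet_continuous continuous_on_mult g poly_space_continuous[OF p])
    with True have "(\<integral>x. f x * p x \<partial>facet_measure F) = (\<integral>x. g x * p x \<partial>facet_measure F)"
      using AE_facet_measure eq by (intro integral_cong_AE) auto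
    thus ?thesis using orth p by (simp add: orth_polys_def)
  qed (rule not_integrable_integral_eq)
qed

lemma orth_polys_diff:
  fixes F :: "'a set"
  assumes "simplex_facet K F" "continuous_on UNIV f" "continuous_on UNIV g" "orth_polys F n f" "orth_polys F n g"
  shows "orth_polys F n (\<lambda>x. f x - g x)" unfolding orth_polys_def
proof
  interpret simplex_facet K F by fact
  fix p :: "'a \<Rightarrow> real" assume p: "p \<in> poly_space n"
  have "(\<integral>x. (f x - g x) * p x \<partial>facet_measure F) = (\<integral>x. f x * p x - g x * p x \<partial>facet_measure F)"
    by (simp add: left_diff_distrib)
  also have "\<dots> = (\<integral>x. f x * p x \<partial>facet_measure F) - (\<integral>x. g x * p x \<partial>facet_measure F)"
    by (intro facet_integral_linear continuous_on_mult poly_space_continuous[OF p] assms)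
  finally show "(\<integral>x. (f x - g x) * p x \<partial>facet_measure F) = 0"
    using assms(4,5) p by (simp add: orth_polys_def)
qed

lemma orth_polys_jac:
  assumes K: "K \<in> \<T>" "F facet_of K"
  shows "orth_polys F (k - 1) (\<lambda>x. \<Sum>z\<in>\<V> F. c z * poly jac (barycentric K z x))"
  unfolding orth_polys_def
proof
  interpret simplex_facet K F by (rule simplex_facet_\<T>[OF K(1) K(2)])
  fix p :: "'a \<Rightarrow> real" assume p: "p \<in> poly_space (k - 1)"
  have cont: "continuous_on UNIV (\<lambda>x. poly jac (bc z x) * p x)" for z
    by (intro continuous_on_mult poly_space_continuous[OF p] continuous_intros)
  have "(\<integral>x. (\<Sum>z\<in>\<V> F. c z * poly jac (bc z x)) * p x \<partial>facet_measure F) =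
      (\<integral>x. (\<Sum>z\<in>\<V> F. c z * (poly jac (bc z x) * p x)) \<partial>facet_measure F)"
    by (simp add: sum_distrib_right mult.assoc)
  also have "\<dots> = (\<Sum>z\<in>\<V> F. \<integral>x. c z * (poly jac (bc z x) * p x) \<partial>facet_measure F)"
    by (intro facet_integral_sum continuous_on_mult_left cont)
  also have "\<dots> = 0"
  proof (rule sum.neutral, rule ballI)
    fix z assume "z \<in> \<V> F"
    hence "z \<in> V" "z \<noteq> opp" using facet_vertices[OF K(2)] by auto
    thus "(\<integral>x. c z * (poly jac (bc z x) * p x) \<partial>facet_measure F) = 0"
      using jacobi_orthogonal_facet[OF dim _ _ p] k_pos by (simp add: jac_def)
  qed
  finally show "(\<integral>x. (\<Sum>z\<in>\<V> F. c z * poly jac (bc z x)) * p x \<partial>facet_measure F) = 0" .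
qed

text \<open>On \<open>F\<close> the opposite coordinate is zero and contributes P_k(1) = 1, which
  cancels the constant -1; the remaining terms are orthogonal one by one.\<close>

lemma BP_trace_orth:
  assumes K: "K \<in> \<T>" "F facet_of K"
  shows "orth_polys F (k - 1) (\<lambda>x. c * BP K x)"
proof -
  interpret simplex_facet K F by (rule simplex_facet_\<T>[OF K(1) K(2)])
  show ?thesis
  proof (rule orth_polys_transfer[OF simplex_facet_axioms _ _ orth_polys_jac[OF K]])
    fix x assume x: "x \<in> F"
    have "(\<Sum>z\<in>V. poly jac (bc z x)) = 1 + (\<Sum>z\<in>\<V> F. poly jac (bc z x))"
      unfolding facet_vertices(1)[OF K(2)] using mem_facet_iff[OF K(2), of x] x
      by (subst sum.remove[OF finite_V opposite_vertex_in[OF K(2)]]) simp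
    thus "c * BP K x = (\<Sum>z\<in>\<V> F. (c / real DIM('a)) * poly jac (bc z x))"
      by (simp add: BP_def sum_distrib_left sum_divide_distrib)
  qed (intro continuous_intros)
qed

lemma nodal_trace_orth:
  assumes K: "K \<in> \<T>" "F facet_of K"
  shows "orth_polys F (k - 1) (\<lambda>x. nodal K (facet_coeff a K) x - a F)"
proof -
  interpret simplex_facet K F by (rule simplex_facet_\<T>[OF K(1) K(2)])
  show ?thesis
  proof (rule orth_polys_transfer[OF simplex_facet_axioms _ _ orth_polys_jac[OF K]])
    fix x assume x: "x \<in> F"
    have "nodal K (facet_coeff a K) x = (\<Sum>z\<in>\<V> F. facet_coeff a K z * (poly jac (bc z x) - 1))"
      unfolding nodal_def facet_vertices(1)[OF K(2)] using mem_facet_iff[OF K(2), of x] x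
      by (subst sum.remove[OF finite_V opposite_vertex_in[OF K(2)]]) simp
    also have "\<dots> = (\<Sum>z\<in>\<V> F. facet_coeff a K z * poly jac (bc z x)) + a F"
      unfolding facet_coeff_sum[OF K, of a] by (simp add: right_diff_distrib sum_subtractf)
    finally show "nodal K (facet_coeff a K) x - a F = (\<Sum>z\<in>\<V> F. facet_coeff a K z * poly jac (bc z x))"
      by simp
  qed (intro continuous_intros)
qed

text \<open>The constant \<open>a F\<close> belongs to the facet, so it cancels in the jump; on
  boundary facets it has to be zero. This form serves simplex functions, with \<open>a = 0\<close>,
  as well as facet functions.\<close>

lemma conf_plus_glue_CR_max:
  assumes w: "w \<in> conf" and N: "\<And>K. K \<in> \<T> \<Longrightarrow> N K \<in> poly_space k"
    and orth: "\<And>K F. K \<in> \<T> \<Longrightarrow> F facet_of K \<Longrightarrow> orth_polys F (k - 1) (\<lambda>x. N K x - a F)"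
  shows "on_open_simplices \<T> w + glue N \<in> CR_max \<Omega> \<T> k"
    and "(\<And>F. F \<in> boundary_facets \<Omega> \<T> \<Longrightarrow> a F = 0) \<Longrightarrow> w \<in> H10 \<Omega> \<Longrightarrow>
      on_open_simplices \<T> w + glue N \<in> CR0_max \<Omega> \<T> k"
proof -
  obtain p where p: "\<And>K. K \<in> \<T> \<Longrightarrow> p K \<in> poly_space k" "\<And>K x. K \<in> \<T> \<Longrightarrow> x \<in> K \<Longrightarrow> w x = p K x"
      "on_open_simplices \<T> w = glue p" by (rule conf_glue[OF w]) blast
  let ?P = "\<lambda>K x. p K x + N K x"
  have eq: "on_open_simplices \<T> w + glue N = glue ?P" unfolding p(3) by (rule glue_add)
  have P: "?P K \<in> poly_space k" if "K \<in> \<T>" for K by (intro poly_space_add p(1) N that)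
  have N': "continuous_on UNIV (\<lambda>x. N K x - c)" if "K \<in> \<T>" for K c
    by (intro continuous_on_diff continuous_on_const poly_space_continuous[OF N[OF that]])
  have restr: "elem_restr K (glue ?P) x = w x + N K x" if "K \<in> \<T>" "F facet_of K" "x \<in> F" for K F x
    using that facet_of_imp_subset[OF that(2)] elem_restr_glue[of K x ?P, OF that(1) _ poly_space_continuous[OF P[OF that(1)]]]
      p(2)[OF that(1), of x] by auto
  have sf: "simplex_facet K F" if "K \<in> \<T>" "F facet_of K" for K F by (rule simplex_facet_\<T>[OF that(1) that(2)])
  show max: "on_open_simplices \<T> w + glue N \<in> CR_max \<Omega> \<T> k" unfolding eq CR_max_def
  proof (intro CollectI conjI glue_broken P ballI impI)
    fix F K K' assume F: "F \<in> interior_facets \<Omega> \<T>" and K: "K \<in> facet_patch \<T> F" "K' \<in> facet_patch \<T> F"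
    have F': "F \<in> mesh_facets \<T>" using F interior_facets_subset by blast
    note KF = facet_patchD(1,2)[OF F' K(1)] and KF' = facet_patchD(1,2)[OF F' K(2)]
    have "orth_polys F (k - 1) (\<lambda>x. (N K x - a F) - (N K' x - a F))"
      by (rule orth_polys_diff[OF sf[OF KF] N'[OF KF(1)] N'[OF KF'(1)] orth[OF KF] orth[OF KF']])
    thus "orth_polys F (k - 1) (jump K K' (glue ?P))"
      by (rule orth_polys_transfer[OF sf[OF KF] continuous_on_diff[OF N'[OF KF(1)] N'[OF KF'(1)]], rotated])
        (simp add: jump_def restr[OF KF] restr[OF KF'])
  qed
  assume a: "\<And>F. F \<in> boundary_facets \<Omega> \<T> \<Longrightarrow> a F = 0" and w0: "w \<in> H10 \<Omega>"
  show "on_open_simplices \<T> w + glue N \<in> CR0_max \<Omega> \<T> k" unfolding CR0_max_def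
  proof (intro CollectI conjI max ballI)
    fix F K assume F: "F \<in> boundary_facets \<Omega> \<T>" and K: "K \<in> facet_patch \<T> F"
    have F': "F \<in> mesh_facets \<T>" using F by (simp add: boundary_facets_def)
    note KF = facet_patchD(1,2)[OF F' K]
    show "orth_polys F (k - 1) (elem_restr K (on_open_simplices \<T> w + glue N))" unfolding eq
      by (rule orth_polys_transfer[OF sf[OF KF] N'[OF KF(1)] _ orth[OF KF]])
        (use restr[OF KF] conforming_H10_trace[OF w w0 F] a[OF F] in simp)
  qed
qed

lemma CR_subset_max: "CR \<Omega> \<T> k \<subseteq> CR_max \<Omega> \<T> k"
  and CR0_subset_max: "CR0 \<Omega> \<T> k \<subseteq> CR0_max \<Omega> \<T> k"
proof -
  have c: "on_open_simplices \<T> w + glue (\<lambda>K x. c K * BP K x) \<in> CR_max \<Omega> \<T> k"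
    "w \<in> H10 \<Omega> \<Longrightarrow> on_open_simplices \<T> w + glue (\<lambda>K x. c K * BP K x) \<in> CR0_max \<Omega> \<T> k"
    if "w \<in> conf" for w c
  proof -
    have "(\<lambda>x. c K * BP K x) \<in> poly_space k" if "K \<in> \<T>" for K
      by (intro poly_space_scale BP_poly_space that)
    moreover have "orth_polys F (k - 1) (\<lambda>x. c K * BP K x - 0)" if "K \<in> \<T>" "F facet_of K" for K F
      using BP_trace_orth[OF that] by simp
    ultimately show "on_open_simplices \<T> w + glue (\<lambda>K x. c K * BP K x) \<in> CR_max \<Omega> \<T> k"
      "w \<in> H10 \<Omega> \<Longrightarrow> on_open_simplices \<T> w + glue (\<lambda>K x. c K * BP K x) \<in> CR0_max \<Omega> \<T> k"
      using conf_plus_glue_CR_max[OF that, of "\<lambda>K x. c K * BP K x" "\<lambda>F. 0"] by blast+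
  qed
  have a: "on_open_simplices \<T> w + glue (\<lambda>K. nodal K (facet_coeff a K)) \<in> CR_max \<Omega> \<T> k"
    "w \<in> H10 \<Omega> \<Longrightarrow> (\<And>F. F \<in> boundary_facets \<Omega> \<T> \<Longrightarrow> a F = 0) \<Longrightarrow>
      on_open_simplices \<T> w + glue (\<lambda>K. nodal K (facet_coeff a K)) \<in> CR0_max \<Omega> \<T> k"
    if "w \<in> conf" for w a
    using conf_plus_glue_CR_max[OF that, of "\<lambda>K. nodal K (facet_coeff a K)" a] nodal_poly_space nodal_trace_orth by blast+
  show "CR \<Omega> \<T> k \<subseteq> CR_max \<Omega> \<T> k"
    using a(1) c(1) by (auto simp: CR_def S_space_def V_simplices_eq V_facets_eq elim!: set_plus_elim split: if_splits)
  have i: "F \<notin> interior_facets \<Omega> \<T>" if "F \<in> boundary_facets \<Omega> \<T>" for F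
    using that by (simp add: interior_facets_def)
  show "CR0 \<Omega> \<T> k \<subseteq> CR0_max \<Omega> \<T> k"
    using a(2) c(2) i by (auto simp: CR0_def S0_space_def V_simplices_eq V_facets_eq[OF interior_facets_subset]
        elim!: set_plus_elim split: if_splits)
qed

lemma S_subset_CR: "S_space \<Omega> \<T> k \<subseteq> CR \<Omega> \<T> k" and S0_subset_CR0: "S0_space \<Omega> \<T> k \<subseteq> CR0 \<Omega> \<T> k"
proof -
  have "A \<subseteq> A + V" if "subspace V" for A V :: "('a \<Rightarrow> real) set"
    using set_plus_intro[OF _ subspace_0[OF that]] by fastforce
  thus "S_space \<Omega> \<T> k \<subseteq> CR \<Omega> \<T> k" "S0_space \<Omega> \<T> k \<subseteq> CR0 \<Omega> \<T> k"
    using subspace_V by (auto simp: CR_def CR0_def)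
qed

section \<open>Strictness\<close>

lemma on_open_simplices_0: "on_open_simplices \<T> (\<lambda>x. 0) = 0"
  by (auto simp: on_open_simplices_def fun_eq_iff)

lemma facet_coeff_cong:
  assumes "K \<in> \<T>" "\<And>F. F facet_of K \<Longrightarrow> a F = a' F" "z \<in> \<V> K"
  shows "facet_coeff a K z = facet_coeff a' K z"
  using assms full_simplex.facet_of_vertex(1)[OF simplex_\<T>[OF assms(1)]] by (simp add: facet_coeff_def)

text \<open>The trace of a facet function on a neighbouring facet \<open>F'\<close> separates two vertices of \<open>F'\<close>,
  whereas conforming functions and simplex functions on the far side of \<open>F'\<close> do not.\<close>

lemma B_facet_nonconforming:
  assumes \<rho>: "\<rho> \<noteq> 1" and F: "F \<in> interior_facets \<Omega> \<T>" and w: "w \<in> conf0"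
    and eq: "\<And>K x. K \<in> \<T> \<Longrightarrow> x \<in> K \<Longrightarrow> nodal K (facet_coeff (\<lambda>G. if G = F then 1 else 0) K) x = w x + c K * BP K x"
  shows False
proof -
  let ?a = "\<lambda>G. if G = F then 1 else 0 :: real"
  obtain K where K: "K \<in> \<T>" "F facet_of K" using F by (auto simp: interior_facets_def mesh_facets_def)
  interpret K: simplex_facet K F by (rule simplex_facet_\<T>[OF K(1) K(2)])
  define o' where "o' = K.opp"
  have o': "o' \<in> K.V" unfolding o'_def by (rule K.opposite_vertex_in[OF K(2)])
  have "2 \<le> card (K.V - {o'})" using K.card_V dim o' K.finite_V by simp
  then obtain S where S: "S \<subseteq> K.V - {o'}" "card S = 2" by (meson obtain_subset_with_card_n)
  then obtain y z where yz: "y \<in> K.V" "z \<in> K.V" "y \<noteq> z" "y \<noteq> o'" "z \<noteq> o'"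
    by (auto simp: card_2_iff)
  \<comment> \<open>The facet opposite to \<open>z\<close> contains both \<open>o'\<close> and
    \<open>y\<close>, which exist because d \<ge> 2 leaves two vertices besides
    \<open>o'\<close>.\<close>
  define F' where "F' = convex hull (K.V - {z})"
  have F': "F' facet_of K" "opposite_vertex K F' = z" unfolding F'_def using K.facet_of_vertex[OF yz(2)] by auto
  have in_F': "v \<in> F'" if "v \<in> K.V" "v \<noteq> z" for v
    using K.facet_vertices(2)[OF F'(1)] F'(2) that by blast
  have hull: "convex hull (K.V - {v}) = F \<longleftrightarrow> v = o'" if "v \<in> K.V" for v
    using K.facet_of_vertex(2)[OF that] K.facet_eq_hull[OF K(2)] by (auto simp: o'_def)
  have s: "(\<Sum>v\<in>K.V. ?a (convex hull (K.V - {v}))) = 1"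
  proof -
    have "(\<Sum>v\<in>K.V. ?a (convex hull (K.V - {v}))) = (\<Sum>v\<in>K.V. if v = o' then 1 else 0)"
      by (intro sum.cong refl) (simp add: hull)
    thus ?thesis using K.finite_V o' by simp
  qed
  have co: "facet_coeff ?a K v = (if v = o' then 1 else 0) - 1 / real DIM('a)" if "v \<in> K.V" for v
    using that unfolding facet_coeff_def s by (simp add: hull)
  have val: "w v + c K * \<eta> = facet_coeff ?a K v * (\<rho> - 1)" if "v \<in> K.V" for v
    using eq[OF K(1), of v] that K.V_subset by (auto simp: nodal_vertex[OF K(1)] BP_vertex[OF K(1)])
  \<comment> \<open>The coefficients of the facet function at \<open>o'\<close> and \<open>y\<close>
    differ by 1, while the simplex function takes equal values there; so \<open>w\<close> has to
    account for \<rho> - 1.\<close>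
  have diff: "w o' - w y = \<rho> - 1"
    using val[OF o'] val[OF yz(1)] co[OF o'] co[OF yz(1)] yz by (simp add: algebra_simps)
  have "w o' = w y"
  proof (cases "F' \<in> boundary_facets \<Omega> \<T>")
    case True
    thus ?thesis using conforming_H10_trace[of w k F'] w in_F' o' yz by auto
  next
    case False
    hence "F' \<in> interior_facets \<Omega> \<T>" using facet_in_mesh[OF K(1) F'(1)] mesh_facets_cases by blast
    then obtain K' where K': "K' \<in> \<T>" "K' \<noteq> K" "F' \<subseteq> K'"
      by (rule interior_facet_neighbour[OF _ K(1) F'(1)])
    interpret K': full_simplex K' by (rule simplex_\<T>[OF K'(1)])
    \<comment> \<open>Otherwise \<open>K'\<close> would contain all vertices of \<open>K\<close>,
      those of \<open>F'\<close> as well as \<open>z\<close>. So the facet function of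
      \<open>F\<close> is zero on \<open>K'\<close>.\<close>
    have "\<not> F facet_of K'"
    proof
      assume "F facet_of K'"
      hence "F \<subseteq> K'" by (rule facet_of_imp_subset)
      moreover have "z \<in> F" using K.facet_vertices(2)[OF K(2)] yz by (auto simp: o'_def)
      ultimately have "K.V \<subseteq> K'" using in_F' K'(3) by blast
      hence "K \<subseteq> K'" using hull_minimal[of K.V K' convex] K.hull_V K'.convex_K by simp
      moreover obtain x where "x \<in> interior K" using K.interior_nonempty by blast
      ultimately show False using simplex_eq_if_interior_meets[OF K(1) K'(1), of x] interior_subset K'(2) by blast
    qed
    hence "facet_coeff ?a K' v = 0" if "v \<in> K'.V" for v
    proof -
      have "facet_coeff ?a K' v = facet_coeff (\<lambda>_. 0) K' v"
        using \<open>\<not> F facet_of K'\<close> that by (intro facet_coeff_cong[OF K'(1)]) auto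
      thus ?thesis by (simp add: facet_coeff_def)
    qed
    hence "nodal K' (facet_coeff ?a K') x = 0" for x by (simp add: nodal_def)
    hence wK': "w x = - c K' * BP K' x" if "x \<in> K'" for x using eq[OF K'(1) that] by simp
    have "\<V> F' \<subseteq> K'.V" using K'.facet_vertices(1)[OF shared_facet[OF K(1) K'(1) F'(1) K'(3)]] by blast
    have "w v = - c K' * \<eta>" if "v \<in> K.V" "v \<noteq> z" for v
    proof -
      have "v \<in> K'.V"
        using \<open>\<V> F' \<subseteq> K'.V\<close> K.facet_vertices(1)[OF F'(1)] F'(2) that by blast
      thus ?thesis using wK'[of v] K'.V_subset BP_vertex[OF K'(1), of v] by auto
    qed
    thus ?thesis using o' yz by auto
  qed
  thus False using diff \<rho> by simp
qed

lemma B_facet_glue: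
  assumes "F \<in> mesh_facets \<T>"
  shows "B_facet \<T> k F = glue (\<lambda>K. nodal K (facet_coeff (\<lambda>G. if G = F then 1 else 0) K))"
proof -
  have "(\<Sum>G\<in>mesh_facets \<T>. (if G = F then 1 else 0) *\<^sub>R B_facet \<T> k G) = (\<Sum>G\<in>mesh_facets \<T>. if G = F then B_facet \<T> k F else 0)"
    by (intro sum.cong) auto
  also have "\<dots> = B_facet \<T> k F" using assms finite_mesh_facets by simp
  finally show ?thesis by (simp add: B_facet_sum)
qed

lemma interior_facetE:
  assumes "card \<T> > 1"
  obtains F where "F \<in> interior_facets \<Omega> \<T>"
proof -
  obtain K K' where "K \<in> \<T>" "K' \<in> \<T>" "K \<noteq> K'"
    using assms card_le_Suc0_iff_eq[OF finite_\<T>] by fastforce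
  thus ?thesis using interior_facet_exists that by blast
qed

lemma glue_eq_conf_plus:
  assumes w: "w \<in> conf" and N: "\<And>K. K \<in> \<T> \<Longrightarrow> N K \<in> poly_space k" and M: "\<And>K. K \<in> \<T> \<Longrightarrow> M K \<in> poly_space k"
    and eq: "glue N = on_open_simplices \<T> w + glue M"
  shows "\<And>K x. K \<in> \<T> \<Longrightarrow> x \<in> K \<Longrightarrow> N K x = w x + M K x"
proof -
  have "on_open_simplices \<T> w = glue (\<lambda>K x. N K x - M K x)" using eq by (simp flip: glue_diff)
  thus "\<And>K x. K \<in> \<T> \<Longrightarrow> x \<in> K \<Longrightarrow> N K x = w x + M K x"
    using conf_eq_glue_iff[OF w, of "\<lambda>K x. N K x - M K x"]
      poly_space_continuous[OF poly_space_diff[OF N M]] by force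
qed

lemma S0_strict:
  assumes "even k \<or> odd k \<and> card \<T> > 1"
  shows "S0_space \<Omega> \<T> k \<subset> CR0 \<Omega> \<T> k"
proof (cases "even k")
  case True
  have \<eta>: "\<eta> \<noteq> 0" using \<eta>_even[OF True] by simp
  obtain K where K: "K \<in> \<T>" using nonempty_\<T> by blast
  have B: "B_simplex k K \<in> V_simplices k \<T>" unfolding V_simplices_def using K by (auto intro: span_base)
  have "B_simplex k K \<notin> S0_space \<Omega> \<T> k"
  proof
    assume "B_simplex k K \<in> S0_space \<Omega> \<T> k"
    hence "B_simplex k K = 0" using conf0_Int_V_simplices[OF \<eta>] B by (auto simp: S0_space_def)
    hence "glue (\<lambda>K' x. if K' = K then BP K x else 0) = glue (\<lambda>K x. 0)"
      by (simp add: B_simplex_eq[OF K] glue_0)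
    moreover have "continuous_on UNIV (\<lambda>x. if K' = K then BP K x else 0)" for K'
      by (cases "K' = K") (simp_all add: BP_continuous[OF K])
    ultimately have "\<forall>K'\<in>\<T>. \<forall>x\<in>K'. (if K' = K then BP K x else 0) = 0"
      by (subst (asm) glue_eq_iff) auto
    hence "BP K x = 0" if "x \<in> K" for x using K that by auto
    moreover obtain y where "y \<in> \<V> K" using full_simplex.V_nonempty[OF simplex_\<T>[OF K]] by blast
    ultimately show False using BP_vertex[OF K, of y] full_simplex.V_subset[OF simplex_\<T>[OF K]] \<eta> by auto
  qed
  moreover have "B_simplex k K \<in> CR0 \<Omega> \<T> k"
    using set_plus_intro[OF subspace_0[OF subspace_S0] B] True by (simp add: CR0_def)
  ultimately show ?thesis using S0_subset_CR0 by blast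
next
  case False
  note \<rho> = \<rho>_odd'[OF False]
  obtain F where F: "F \<in> interior_facets \<Omega> \<T>" using interior_facetE assms False by blast
  hence F': "F \<in> mesh_facets \<T>" using interior_facets_subset by blast
  have B: "B_facet \<T> k F \<in> V_facets \<T> k (interior_facets \<Omega> \<T>)"
    unfolding V_facets_def using F by (auto intro: span_base)
  have "B_facet \<T> k F \<notin> S0_space \<Omega> \<T> k"
  proof
    assume "B_facet \<T> k F \<in> S0_space \<Omega> \<T> k"
    then obtain w where w: "w \<in> conf0" "B_facet \<T> k F = on_open_simplices \<T> w"
      by (auto simp: S0_space_def)
    have "glue (\<lambda>K. nodal K (facet_coeff (\<lambda>G. if G = F then 1 else 0) K)) = on_open_simplices \<T> w + glue (\<lambda>K x. 0)"
      using w(2) by (simp add: B_facet_glue[OF F'] glue_0)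
    from glue_eq_conf_plus[OF _ _ _ this] w(1)
    show False
      by (intro B_facet_nonconforming[OF \<rho> F w(1), of "\<lambda>_. 0"]) (auto simp: nodal_poly_space poly_space_const)
  qed
  moreover have "B_facet \<T> k F \<in> CR0 \<Omega> \<T> k"
    using set_plus_intro[OF subspace_0[OF subspace_S0] B] False by (simp add: CR0_def)
  ultimately show ?thesis using S0_subset_CR0 by blast
qed

text \<open>If a simplex function were in the canonical space, its vertex values would determine
  each facet coefficient of \<open>K\<close>. Computed from inside \<open>K\<close>, the coefficient
  contains an extra term proportional to d \<eta>; computed from the neighbour or from the boundary
  condition, it does not.\<close>

lemma CR0_max_strict_odd:
  assumes "odd k" and \<eta>: "\<eta> \<noteq> 0"
  shows "CR0 \<Omega> \<T> k \<subset> CR0_max \<Omega> \<T> k"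
proof -
  note \<rho> = \<rho>_odd'[OF assms(1)]
  obtain K where K: "K \<in> \<T>" using nonempty_\<T> by blast
  interpret K: full_simplex K by (rule simplex_\<T>[OF K])
  define N where "N K' x = (if K' = K then 1 else 0) * BP K' x" for K' x
  have N: "N K' \<in> poly_space k" if "K' \<in> \<T>" for K'
    unfolding N_def[abs_def] by (intro poly_space_scale BP_poly_space that)
  have "on_open_simplices \<T> (\<lambda>x. 0) + glue N \<in> CR0_max \<Omega> \<T> k"
  proof (rule conf_plus_glue_CR_max(2)[OF conf_zero N])
    fix L F assume "L \<in> \<T>" "F facet_of L"
    from BP_trace_orth[OF this, of "if L = K then 1 else 0"] show "orth_polys F (k - 1) (\<lambda>x. N L x - 0)"
      by (simp add: N_def)
  qed (auto intro: H10_zero)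
  hence in_max: "glue N \<in> CR0_max \<Omega> \<T> k" by (simp add: on_open_simplices_0)
  have "glue N \<notin> CR0 \<Omega> \<T> k"
  proof
    assume "glue N \<in> CR0 \<Omega> \<T> k"
    then obtain w a where w: "w \<in> conf0" and a: "\<And>F. F \<notin> interior_facets \<Omega> \<T> \<Longrightarrow> a F = 0"
      and eq: "glue N = on_open_simplices \<T> w + glue (\<lambda>K. nodal K (facet_coeff a K))"
      using assms(1) by (auto simp: CR0_def S0_space_def V_facets_eq[OF interior_facets_subset] elim!: set_plus_elim)
    have eqs: "N L x = w x + nodal L (facet_coeff a L) x" if "L \<in> \<T>" "x \<in> L" for L x
      using glue_eq_conf_plus[OF _ N _ eq that] w nodal_poly_space by blast
    have co: "facet_coeff a L y = ((if L = K then \<eta> else 0) - w y) / (\<rho> - 1)"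
      if "L \<in> \<T>" "y \<in> \<V> L" for L y
    proof -
      have "y \<in> L" using that full_simplex.V_subset[OF simplex_\<T>[OF that(1)]] by blast
      thus ?thesis
        using eqs[OF that(1), of y] \<rho> by (simp add: N_def BP_vertex[OF that] nodal_vertex[OF that] field_simps split: if_splits)
    qed
    obtain z where "z \<in> K.V" using K.V_nonempty by blast
    define F where "F = convex hull (K.V - {z})"
    have F: "F facet_of K" unfolding F_def by (rule K.facet_of_vertex(1)[OF \<open>z \<in> K.V\<close>])
    have aL: "a F = (\<Sum>y\<in>\<V> F. w y - (if L = K then \<eta> else 0)) / (\<rho> - 1)"
      if L: "L \<in> \<T>" "F facet_of L" for L
    proof -
      have "\<V> F \<subseteq> \<V> L" using full_simplex.facet_vertices(1)[OF simplex_\<T>[OF L(1)] L(2)] by blast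
      hence "(\<Sum>y\<in>\<V> F. facet_coeff a L y) =
          (\<Sum>y\<in>\<V> F. - ((w y - (if L = K then \<eta> else 0)) / (\<rho> - 1)))"
      proof (intro sum.cong refl)
        fix y assume "y \<in> \<V> F"
        with \<open>\<V> F \<subseteq> \<V> L\<close> have "y \<in> \<V> L" by blast
        from co[OF L(1) this] show "facet_coeff a L y = - ((w y - (if L = K then \<eta> else 0)) / (\<rho> - 1))"
          by (simp add: minus_divide_left)
      qed
      thus ?thesis unfolding facet_coeff_sum[OF L, of a] by (simp add: sum_negf sum_divide_distrib)
    qed
    define s where "s = (\<Sum>y\<in>\<V> F. w y)"
    have "card (\<V> F) = DIM('a)"
      using K.facet_vertices(1)[OF F] K.opposite_vertex_in[OF F] K.card_V K.finite_V by simp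
    hence aK: "a F = (s - real DIM('a) * \<eta>) / (\<rho> - 1)"
      unfolding aL[OF K F] by (simp add: s_def sum_subtractf)
    have "a F = s / (\<rho> - 1)"
    proof (cases "F \<in> boundary_facets \<Omega> \<T>")
      case True
      have "\<V> F \<subseteq> F" using K.facet_vertices[OF F] by blast
      hence "s = 0" unfolding s_def using conforming_H10_trace[of w k F] True w by (intro sum.neutral) auto
      thus ?thesis using a[of F] True by (simp add: interior_facets_def)
    next
      case False
      hence "F \<in> interior_facets \<Omega> \<T>" using facet_in_mesh[OF K F] mesh_facets_cases by blast
      then obtain L where L: "L \<in> \<T>" "L \<noteq> K" "F \<subseteq> L"
        by (rule interior_facet_neighbour[OF _ K F])
      show ?thesis unfolding aL[OF L(1) shared_facet[OF K L(1) F L(3)]] using L(2) by (simp add: s_def)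
    qed
    hence "real DIM('a) * \<eta> = 0" using aK \<rho> by (simp add: field_simps)
    thus False using \<eta> by simp
  qed
  thus ?thesis using in_max CR0_subset_max by blast
qed

lemma CR0_max_strict_even:
  assumes "even k" and \<rho>: "\<rho> \<noteq> 1" and card: "card \<T> > 1"
  shows "CR0 \<Omega> \<T> k \<subset> CR0_max \<Omega> \<T> k"
proof -
  obtain F where F: "F \<in> interior_facets \<Omega> \<T>" using interior_facetE card by blast
  hence F': "F \<in> mesh_facets \<T>" using interior_facets_subset by blast
  define a where "a G = (if G = F then 1 else 0 :: real)" for G
  have a: "a G = 0" if "G \<in> boundary_facets \<Omega> \<T>" for G
    using F that by (auto simp: a_def interior_facets_def)
  let ?N = "\<lambda>K. nodal K (facet_coeff a K)"
  have "on_open_simplices \<T> (\<lambda>x. 0) + glue ?N \<in> CR0_max \<Omega> \<T> k"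
    by (rule conf_plus_glue_CR_max(2)[OF conf_zero nodal_poly_space nodal_trace_orth]) (use a H10_zero in blast)+
  hence in_max: "glue ?N \<in> CR0_max \<Omega> \<T> k" by (simp add: on_open_simplices_0)
  have "glue ?N \<notin> CR0 \<Omega> \<T> k"
  proof
    assume "glue ?N \<in> CR0 \<Omega> \<T> k"
    then obtain w c where w: "w \<in> conf0" and eq: "glue ?N = on_open_simplices \<T> w + glue (\<lambda>K x. c K * BP K x)"
      using assms(1) by (auto simp: CR0_def S0_space_def V_simplices_eq elim!: set_plus_elim)
    have "?N L x = w x + c L * BP L x" if "L \<in> \<T>" "x \<in> L" for L x
      using glue_eq_conf_plus[OF _ nodal_poly_space _ eq that] w poly_space_scale[OF BP_poly_space] by blast
    thus False using B_facet_nonconforming[OF \<rho> F w, of c] by (simp add: a_def[abs_def])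
  qed
  thus ?thesis using in_max CR0_subset_max by blast
qed

end

section \<open>A single tetrahedron\<close>

text \<open>Gram-Schmidt, one generator at a time, for a form that is only semidefinite. The form
  used later is degenerate, since functions of three variables are seen only on the plane x + y + z
  = 1.\<close>

lemma psd_projection:
  fixes B :: "'v::real_vector \<Rightarrow> 'v \<Rightarrow> real"
  assumes W: "subspace W" and S: "finite S" "S \<subseteq> W"
    and add: "\<And>f g h. f \<in> W \<Longrightarrow> g \<in> W \<Longrightarrow> h \<in> W \<Longrightarrow> B (f + g) h = B f h + B g h"
    and scale: "\<And>c f h. f \<in> W \<Longrightarrow> h \<in> W \<Longrightarrow> B (c *\<^sub>R f) h = c * B f h"
    and sym: "\<And>f g. f \<in> W \<Longrightarrow> g \<in> W \<Longrightarrow> B f g = B g f" and pos: "\<And>f. f \<in> W \<Longrightarrow> B f f \<ge> 0"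
    and e: "e \<in> W"
  shows "\<exists>q\<in>span S. \<forall>r\<in>span S. B (e - q) r = 0" using S e
proof (induction S arbitrary: e rule: finite_induct)
  case empty
  have "B (c *\<^sub>R e) 0 = 0" if "e \<in> W" for c e
    using scale[OF subspace_0[OF W], of e 0] sym[OF subspace_0[OF W], of "c *\<^sub>R e"] scale[OF subspace_0[OF W], of "c *\<^sub>R e" 0]
      subspace_scale[OF W that] by simp
  from this[OF empty.prems(2), of 1] show ?case by simp
next
  case (insert a S)
  note WI = subspace_add[OF W] subspace_diff[OF W] subspace_scale[OF W]
  have SW: "span S \<subseteq> W" using insert.prems(1) by (intro span_minimal W) blast
  have aW: "a \<in> W" using insert.prems by blast
  have diff: "B (f - g) h = B f h - B g h" if "f \<in> W" "g \<in> W" "h \<in> W" for f g h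
    using add[of f "- g" h] scale[of g h "-1"] that subspace_neg[OF W] by simp
  have addr: "B h (f + g) = B h f + B h g" if "f \<in> W" "g \<in> W" "h \<in> W" for f g h
    using add[OF that] sym that WI by metis
  have scaler: "B h (c *\<^sub>R f) = c * B h f" if "f \<in> W" "h \<in> W" for c f h
    using scale[OF that] sym that WI by metis
  obtain qa where qa: "qa \<in> span S" "\<And>r. r \<in> span S \<Longrightarrow> B (a - qa) r = 0"
    using insert.IH[of a] insert.prems by blast
  obtain qe where qe: "qe \<in> span S" "\<And>r. r \<in> span S \<Longrightarrow> B (e - qe) r = 0"
    using insert.IH[of e] insert.prems by blast
  define a' where "a' = a - qa"
  define e' where "e' = e - qe"
  have W': "a' \<in> W" "e' \<in> W" unfolding a'_def e'_def using aW insert.prems(2) qa(1) qe(1) SW WI(2) by blast+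
  \<comment> \<open>If \<open>a'\<close> has length zero, the quotient is 0 by convention; the case
    below shows that \<open>e'\<close> is then already orthogonal to \<open>a'\<close>.\<close>
  define c where "c = B e' a' / B a' a'"
  have c: "B e' a' - c * B a' a' = 0"
  proof (cases "B a' a' = 0")
    case True
    have "0 \<le> B e' e' + 2 * t * B e' a'" for t
    proof -
      have tW: "t *\<^sub>R a' \<in> W" using W' WI by blast
      have "0 \<le> B (e' + t *\<^sub>R a') (e' + t *\<^sub>R a')" using pos W' tW WI(1) by blast
      also have "\<dots> = B e' e' + t * B e' a' + (t * B a' e' + t * (t * B a' a'))"
        using W' tW WI(1) by (simp add: add addr scale scaler algebra_simps)
      finally show ?thesis using True sym[OF W'] by simp
    qed
    \<comment> \<open>This value of \<open>t\<close> would make the nonnegative expression equal to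
      -1.\<close>
    from this[of "- (B e' e' + 1) / (2 * B e' a')"] have "B e' a' = 0"
      by (cases "B e' a' = 0") (simp_all add: field_simps)
    thus ?thesis using True by simp
  qed (simp add: c_def)
  let ?q = "qe + c *\<^sub>R a'"
  have q_eq: "e - ?q = e' - c *\<^sub>R a'" by (simp add: e'_def)
  have caW: "c *\<^sub>R a' \<in> W" using W' WI by blast
  have "B (e - ?q) r = 0" if r: "r \<in> span (insert a S)" for r
  proof -
    obtain l where l: "r - l *\<^sub>R a \<in> span S" using r by (auto simp: span_breakdown_eq)
    define s where "s = (r - l *\<^sub>R a) + l *\<^sub>R qa"
    have s: "s \<in> span S" unfolding s_def by (intro span_add span_scale l qa)
    have r_eq: "r = l *\<^sub>R a' + s" by (simp add: s_def a'_def scaleR_diff_right)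
    have "B (e' - c *\<^sub>R a') s = 0"
      using diff[OF W'(2) caW, of s] scale[OF W'(1), of s c] s SW qa(2)[OF s] qe(2)[OF s]
      by (auto simp: a'_def e'_def)
    moreover have "B (e' - c *\<^sub>R a') (l *\<^sub>R a') = 0"
      using scaler[OF W'(1), of "e' - c *\<^sub>R a'" l] diff[OF W'(2) caW W'(1)] scale[OF W'(1) W'(1), of c] c
        WI(2)[OF W'(2) caW] by simp
    ultimately show ?thesis
      unfolding q_eq r_eq using addr[of "l *\<^sub>R a'" s "e' - c *\<^sub>R a'"] W' caW s SW WI by auto
  qed
  moreover have "?q \<in> span (insert a S)"
  proof -
    have "span S \<subseteq> span (insert a S)" "a \<in> span (insert a S)"
      using span_mono[OF subset_insertI[of S a]] by (auto intro: span_base)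
    thus ?thesis unfolding a'_def using qa(1) qe(1) by (intro span_add span_scale span_diff) blast+
  qed
  ultimately show ?case by blast
qed

section \<open>Symmetric polynomials in the barycentric coordinates of triangular facets\<close>

definition mono3 :: "nat \<Rightarrow> nat \<Rightarrow> nat \<Rightarrow> real \<times> real \<times> real \<Rightarrow> real" where
  "mono3 a b c = (\<lambda>(x, y, z). x ^ a * y ^ b * z ^ c)"

definition monos3 :: "nat \<Rightarrow> (real \<times> real \<times> real \<Rightarrow> real) set" where
  "monos3 n = {mono3 a b c | a b c. a + b + c \<le> n}"

lemma monos3I: "a + b + c \<le> n \<Longrightarrow> mono3 a b c \<in> monos3 n" by (auto simp: monos3_def)

definition symmetric3 :: "(real \<times> real \<times> real \<Rightarrow> real) \<Rightarrow> bool" where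
  "symmetric3 g \<longleftrightarrow> (\<forall>x y z. g (x, y, z) = g (y, x, z) \<and> g (x, y, z) = g (x, z, y))"

lemma symmetric3_perm:
  assumes "symmetric3 g"
  shows "g (x, z, y) = g (x, y, z)" "g (y, x, z) = g (x, y, z)" "g (y, z, x) = g (x, y, z)"
    "g (z, x, y) = g (x, y, z)" "g (z, y, x) = g (x, y, z)" using assms unfolding symmetric3_def by metis+

lemma span_monos3_mult:
  assumes "f \<in> span (monos3 m)" "g \<in> span (monos3 n)"
  shows "(\<lambda>p. f p * g p) \<in> span (monos3 (m + n))"
proof (rule span_mult_graded[OF _ assms])
  fix f g assume "f \<in> monos3 m" "g \<in> monos3 n"
  then obtain a b c a' b' c' where *: "f = mono3 a b c" "a + b + c \<le> m" "g = mono3 a' b' c'" "a' + b' + c' \<le> n"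
    by (auto simp: monos3_def)
  hence "(\<lambda>p. f p * g p) = mono3 (a + a') (b + b') (c + c')" by (auto simp: mono3_def power_add)
  thus "(\<lambda>p. f p * g p) \<in> monos3 (m + n)" using * by (force simp: monos3_def)
qed

lemma span_monos3_power: "f \<in> span (monos3 m) \<Longrightarrow> (\<lambda>p. f p ^ n) \<in> span (monos3 (n * m))"
proof (induction n)
  case 0
  have "(\<lambda>p. 1) = mono3 0 0 0" by (auto simp: mono3_def)
  thus ?case by (auto simp: monos3_def intro: span_base)
next
  case (Suc n)
  thus ?case using span_monos3_mult[of f m "\<lambda>p. f p ^ n" "n * m"] by simp
qed

lemma continuous_monos3: "g \<in> span (monos3 n) \<Longrightarrow> continuous_on UNIV g"
proof (induction rule: span_induct)
  case base
  show ?case by (rule subspaceI) (auto simp: zero_fun_def plus_fun_def scaleR_fun_def intro!: continuous_intros)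
next
  case (step g)
  thus ?case by (auto simp: monos3_def mono3_def case_prod_beta intro!: continuous_intros)
qed

lemma monos3_affine:
  fixes l1 l2 l3 :: "'a::euclidean_space \<Rightarrow> real"
  assumes g: "g \<in> span (monos3 n)" and l: "affine_fn l1" "affine_fn l2" "affine_fn l3"
  shows "(\<lambda>x. g (l1 x, l2 x, l3 x)) \<in> poly_space n" using g
proof (induction rule: span_induct)
  case base
  show ?case by (rule subspaceI)
      (auto simp: zero_fun_def plus_fun_def scaleR_fun_def intro!: poly_space_const poly_space_add poly_space_scale)
next
  case (step g)
  then obtain a b c where g: "g = mono3 a b c" "a + b + c \<le> n" by (auto simp: monos3_def)
  have "(\<lambda>x. l1 x ^ a * l2 x ^ b * l3 x ^ c) \<in> poly_space (a * 1 + b * 1 + c * 1)"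
    by (intro poly_space_mult poly_space_power poly_space_affine l)
  thus ?case using g(2) by (auto simp: g(1) mono3_def intro: poly_space_mono)
qed

lemma monos3_line:
  assumes g: "g \<in> span (monos3 n)" and deg: "degree X \<le> 1" "degree Y \<le> 1" "degree Z \<le> 1"
  shows "\<exists>P. degree P \<le> n \<and> (\<forall>t. g (poly X t, poly Y t, poly Z t) = poly P t)" using g
proof (induction rule: span_induct)
  case base
  show ?case
  proof (rule subspaceI; unfold mem_Collect_eq)
    show "\<exists>P. degree P \<le> n \<and> (\<forall>t. 0 (poly X t, poly Y t, poly Z t) = poly P t)"
      by (intro exI[of _ 0]) simp
  next
    fix f g
    assume "\<exists>P. degree P \<le> n \<and> (\<forall>t. f (poly X t, poly Y t, poly Z t) = poly P t)"
      "\<exists>P. degree P \<le> n \<and> (\<forall>t. g (poly X t, poly Y t, poly Z t) = poly P t)"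
    then obtain P Q where "degree P \<le> n" "degree Q \<le> n" "\<forall>t. f (poly X t, poly Y t, poly Z t) = poly P t"
      "\<forall>t. g (poly X t, poly Y t, poly Z t) = poly Q t" by blast
    thus "\<exists>P. degree P \<le> n \<and> (\<forall>t. (f + g) (poly X t, poly Y t, poly Z t) = poly P t)"
      by (intro exI[of _ "P + Q"]) (simp add: degree_add_le)
  next
    fix c f
    assume "\<exists>P. degree P \<le> n \<and> (\<forall>t. f (poly X t, poly Y t, poly Z t) = poly P t)"
    then obtain P where "degree P \<le> n" "\<forall>t. f (poly X t, poly Y t, poly Z t) = poly P t" by blast
    thus "\<exists>P. degree P \<le> n \<and> (\<forall>t. (c *\<^sub>R f) (poly X t, poly Y t, poly Z t) = poly P t)"
      by (intro exI[of _ "smult c P"]) (auto intro: order_trans[OF degree_smult_le])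
  qed
next
  case (step g)
  then obtain a b c where g: "g = mono3 a b c" "a + b + c \<le> n" by (auto simp: monos3_def)
  have pow: "degree (p ^ i) \<le> i" if "degree p \<le> 1" for p :: "real poly" and i
    using order_trans[OF degree_power_le mult_le_mono1[OF that]] by simp
  have "degree (X ^ a * Y ^ b * Z ^ c) \<le> a + b + c"
    using degree_mult_le[of "X ^ a * Y ^ b" "Z ^ c"] degree_mult_le[of "X ^ a" "Y ^ b"]
      pow[OF deg(1), of a] pow[OF deg(2), of b] pow[OF deg(3), of c] by linarith
  thus ?case using g(2) by (intro exI[of _ "X ^ a * Y ^ b * Z ^ c"]) (simp add: g(1) mono3_def)
qed

abbreviation bary3 :: "'a::euclidean_space set \<Rightarrow> 'a \<Rightarrow> 'a \<Rightarrow> 'a \<Rightarrow> 'a \<Rightarrow> real \<times> real \<times> real" where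
  "bary3 K u v w x \<equiv> (barycentric K u x, barycentric K v x, barycentric K w x)"

definition facet_triple :: "'a::euclidean_space set \<Rightarrow> 'a set \<Rightarrow> 'a \<Rightarrow> 'a \<Rightarrow> 'a \<Rightarrow> bool" where
  "facet_triple K F u v w \<longleftrightarrow> simplex_facet K F \<and> \<V> F = {u, v, w} \<and> u \<noteq> v \<and> u \<noteq> w \<and> v \<noteq> w"

lemma facet_triple_perm:
  assumes "facet_triple K F u v w"
  shows "facet_triple K F u w v" "facet_triple K F v u w" "facet_triple K F v w u"
    "facet_triple K F w u v" "facet_triple K F w v u" using assms by (auto simp: facet_triple_def)

context simplex_facet
begin

text \<open>Dirichlet's formula on a triangle: about each vertex in turn the other coordinates are
  homogeneous, so three beta integrals peel off the powers one after the other.\<close>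

lemma facet_integral_mono3:
  assumes d: "DIM('a) = 3" and T: "\<V> F = {u, v, w}" "u \<noteq> v" "u \<noteq> w" "v \<noteq> w"
  shows "(\<integral>x. mono3 a b c (bary3 K u v w x) \<partial>facet_measure F) =
    2 * fact a * fact b * fact c / fact (a + b + c + 2) * (\<integral>x. 1 \<partial>facet_measure F)"
proof -
  have V: "u \<in> V" "v \<in> V" "w \<in> V" and opp: "u \<noteq> opp" "v \<noteq> opp" "w \<noteq> opp"
    using facet_vertices(1)[OF facet] T(1) by auto
  have hom: "homogeneous_about z n (\<lambda>x. bc y x ^ n)" if "y \<in> V" "z \<in> V" "y \<noteq> z" for y z n
    using homogeneous_about_power[OF homogeneous_about_affine[OF affine_bc, of y z], of n] bc_vertex[OF that(2), of y] that(3)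
    by simp
  have dim: "DIM('a) + m - 1 = m + 2" for m using d by simp
  have "homogeneous_about u (b + c) (\<lambda>x. bc v x ^ b * bc w x ^ c)"
    using V T(2-4) by (intro homogeneous_about_mult hom) auto
  from facet_integral_beta[OF V(1) opp(1) this, of a]
  have "(\<integral>x. bc u x ^ a * (bc v x ^ b * bc w x ^ c) \<partial>facet_measure F) =
      fact a * fact (b + c + 2) / fact (a + (b + c + 2)) * (\<integral>x. bc v x ^ b * bc w x ^ c \<partial>facet_measure F)"
    unfolding dim .
  also have "(\<integral>x. bc v x ^ b * bc w x ^ c \<partial>facet_measure F) =
      fact b * fact (c + 2) / fact (b + (c + 2)) * (\<integral>x. bc w x ^ c \<partial>facet_measure F)"
    using facet_integral_beta[OF V(2) opp(2) hom[OF V(3,2) T(4)[symmetric]], of b c] unfolding dim .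
  also have "(\<integral>x. bc w x ^ c \<partial>facet_measure F) = fact c * 2 / fact (c + 2) * (\<integral>x. 1 \<partial>facet_measure F)"
    using facet_integral_beta[OF V(3) opp(3) homogeneous_about_one, of c] unfolding dim by (simp add: fact_numeral)
  finally show ?thesis by (simp add: mono3_def add.assoc mult.assoc)
qed

lemma continuous_bc3: "continuous_on UNIV g \<Longrightarrow> continuous_on UNIV (\<lambda>x. g (bary3 K u v w x))"
  by (rule continuous_on_compose2[where t = UNIV]) (auto intro!: continuous_intros)

end

text \<open>For a monomial the ratio to the area depends on the exponents alone, neither on the
  facet nor on which vertex carries which exponent within the area factor; linearity extends the
  common ratio to the span.\<close>

lemma facet_integral_proportional:
  assumes d: "DIM('a::euclidean_space) = 3" and g: "g \<in> span (monos3 n)"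
  obtains l where "\<And>(K :: 'a set) F u v w. facet_triple K F u v w \<Longrightarrow>
    (\<integral>x. g (bary3 K u v w x) \<partial>facet_measure F) = l * (\<integral>x. 1 \<partial>facet_measure F)"
proof -
  let ?I = "\<lambda>(g :: real \<times> real \<times> real \<Rightarrow> real) (K :: 'a set) F u v w. \<integral>x. g (bary3 K u v w x) \<partial>facet_measure F"
  let ?P = "\<lambda>g l. \<forall>K F u v w. facet_triple K F u v w \<longrightarrow> ?I g K F u v w = l * (\<integral>x. 1 \<partial>facet_measure F)"
  have "continuous_on UNIV g \<and> (\<exists>l. ?P g l)" using g
  proof (rule span_induct)
    show "subspace {g. continuous_on UNIV g \<and> (\<exists>l. ?P g l)}"
    proof (rule subspaceI; unfold mem_Collect_eq)
      have "?P 0 0" by simp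
      thus "continuous_on UNIV 0 \<and> (\<exists>l. ?P 0 l)" by (auto simp: zero_fun_def)
    next
      fix f g :: "real \<times> real \<times> real \<Rightarrow> real"
      assume "continuous_on UNIV f \<and> (\<exists>l. ?P f l)" "continuous_on UNIV g \<and> (\<exists>l. ?P g l)"
      then obtain l m where fg: "continuous_on UNIV f" "continuous_on UNIV g" "?P f l" "?P g m" by blast
      have "?P (f + g) (l + m)"
      proof (intro allI impI)
        fix K :: "'a set" and F u v w assume T: "facet_triple K F u v w"
        interpret simplex_facet K F using T by (simp add: facet_triple_def)
        have "?I (f + g) K F u v w = ?I f K F u v w + ?I g K F u v w"
          using facet_integral_linear(1)[OF continuous_bc3[OF fg(1)] continuous_bc3[OF fg(2)]] by simp
        thus "?I (f + g) K F u v w = (l + m) * (\<integral>x. 1 \<partial>facet_measure F)"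
          using fg(3,4) T by (simp only: distrib_right)
      qed
      thus "continuous_on UNIV (f + g) \<and> (\<exists>l. ?P (f + g) l)"
        using continuous_on_add[OF fg(1,2)] by (auto simp: plus_fun_def)
    next
      fix c and f :: "real \<times> real \<times> real \<Rightarrow> real"
      assume "continuous_on UNIV f \<and> (\<exists>l. ?P f l)"
      then obtain l where f: "continuous_on UNIV f" "?P f l" by blast
      have "?P (c *\<^sub>R f) (c * l)" using f(2) by (auto simp: mult.assoc)
      moreover have "continuous_on UNIV (c *\<^sub>R f)"
        using continuous_on_mult_left[OF f(1), of c] by (simp add: scaleR_fun_def)
      ultimately show "continuous_on UNIV (c *\<^sub>R f) \<and> (\<exists>l. ?P (c *\<^sub>R f) l)" by blast
    qed
  next
    fix g assume "g \<in> monos3 n"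
    then obtain a b c where g: "g = mono3 a b c" by (auto simp: monos3_def)
    have "continuous_on UNIV g" by (auto simp: g mono3_def case_prod_beta intro!: continuous_intros)
    moreover have "?P g (2 * fact a * fact b * fact c / fact (a + b + c + 2))"
      unfolding g facet_triple_def using simplex_facet.facet_integral_mono3[OF _ d] by blast
    ultimately show "continuous_on UNIV g \<and> (\<exists>l. ?P g l)" by blast
  qed
  thus ?thesis using that by blast
qed

definition sym3 :: "(real \<times> real \<times> real \<Rightarrow> real) \<Rightarrow> real \<times> real \<times> real \<Rightarrow> real" where
  "sym3 g = (\<lambda>(x, y, z). g (x, y, z) + g (x, z, y) + g (y, x, z) + g (y, z, x) + g (z, x, y) + g (z, y, x))"

lemma finite_monos3: "finite (monos3 n)"
proof -
  have "monos3 n \<subseteq> (\<lambda>(a, b, c). mono3 a b c) ` ({..n} \<times> {..n} \<times> {..n})"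
  proof
    fix g assume "g \<in> monos3 n"
    then obtain a b c where "g = mono3 a b c" "a + b + c \<le> n" by (auto simp: monos3_def)
    thus "g \<in> (\<lambda>(a, b, c). mono3 a b c) ` ({..n} \<times> {..n} \<times> {..n})"
      by (intro image_eqI[of _ _ "(a, b, c)"]) auto
  qed
  thus ?thesis by (rule finite_subset) auto
qed

lemma sym3_mono3: "g \<in> monos3 n \<Longrightarrow> sym3 g \<in> span (monos3 n)"
proof -
  assume "g \<in> monos3 n"
  then obtain a b c where g: "g = mono3 a b c" "a + b + c \<le> n" by (auto simp: monos3_def)
  have eq: "sym3 g = mono3 a b c + mono3 a c b + mono3 b a c + mono3 c a b + mono3 b c a + mono3 c b a"
    by (auto simp: sym3_def g(1) mono3_def fun_eq_iff mult_ac)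
  show ?thesis unfolding eq using g(2) by (intro span_add span_base monos3I) simp_all
qed

lemma symmetric3_span_sym3: "q \<in> span (sym3 ` monos3 n) \<Longrightarrow> symmetric3 q"
proof (induction rule: span_induct)
  case base
  show ?case by (rule subspaceI) (auto simp: symmetric3_def)
next
  case (step x)
  thus ?case by (auto simp: symmetric3_def sym3_def)
qed

text \<open>Integrals of barycentric monomials over different facets, and for different orders of the
  vertices, are proportional; so orthogonality on one facet to the symmetrised monomials gives
  orthogonality on all facets to all monomials.\<close>

lemma symmetric_orthogonal_part:
  fixes K :: "'a::euclidean_space set"
  assumes d: "DIM('a) = 3" and K: "full_simplex K" and e: "e \<in> span (monos3 m)" "symmetric3 e"
  obtains q where "q \<in> span (monos3 n)" "symmetric3 q"
    "\<And>F u v w r. facet_triple K F u v w \<Longrightarrow> r \<in> monos3 n \<Longrightarrow>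
      (\<integral>x. (e - q) (bary3 K u v w x) *
         r (bary3 K u v w x) \<partial>facet_measure F) = 0"
proof (cases "\<exists>F u v w. facet_triple K F u v w \<and> (\<integral>x. 1 \<partial>facet_measure F) \<noteq> (0::real)")
  case True
  then obtain F u v w where T: "facet_triple K F u v w" and ne: "(\<integral>x. 1 \<partial>facet_measure F) \<noteq> (0::real)"
    by blast
  interpret simplex_facet K F using T by (simp add: facet_triple_def)
  define B where "B f g = (\<integral>x. f (bary3 K u v w x) * g (bary3 K u v w x) \<partial>facet_measure F)"
    for f g :: "real \<times> real \<times> real \<Rightarrow> real"
  let ?W = "{f :: real \<times> real \<times> real \<Rightarrow> real. continuous_on UNIV f}"
  have span_sub: "span (sym3 ` monos3 n) \<subseteq> span (monos3 n)"
    by (rule span_minimal) (use sym3_mono3 in auto)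
  have "\<exists>q\<in>span (sym3 ` monos3 n). \<forall>r\<in>span (sym3 ` monos3 n). B (e - q) r = 0"
  proof (rule psd_projection)
    show "subspace ?W"
      by (rule subspaceI) (auto simp: zero_fun_def plus_fun_def scaleR_fun_def intro!: continuous_intros)
    show "finite (sym3 ` monos3 n)" by (intro finite_imageI finite_monos3)
    show "sym3 ` monos3 n \<subseteq> ?W" using continuous_monos3 sym3_mono3 by blast
    show "e \<in> ?W" using continuous_monos3 e(1) by blast
  next
    fix f g h assume "f \<in> ?W" "g \<in> ?W" "h \<in> ?W"
    hence "continuous_on UNIV (\<lambda>x. f x * h x)" "continuous_on UNIV (\<lambda>x. g x * h x)"
      by (auto intro: continuous_on_mult)
    from facet_integral_linear(1)[OF this[THEN continuous_bc3], of u v w u v w] show "B (f + g) h = B f h + B g h"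
      by (simp add: B_def distrib_right)
  next
    fix c f h assume "f \<in> ?W" "h \<in> ?W"
    show "B (c *\<^sub>R f) h = c * B f h" by (simp add: B_def mult.assoc)
  next
    fix f g show "B f g = B g f" by (simp add: B_def mult.commute)
  next
    fix f show "B f f \<ge> 0" by (simp add: B_def)
  qed
  then obtain q where q: "q \<in> span (sym3 ` monos3 n)" and "\<forall>r\<in>span (sym3 ` monos3 n). B (e - q) r = 0"
    by blast
  hence orth: "B (e - q) (sym3 r) = 0" if "r \<in> monos3 n" for r using span_base[OF imageI[OF that]] by blast
  have qn: "q \<in> span (monos3 n)" using q span_sub by blast
  have qs: "symmetric3 q" by (rule symmetric3_span_sym3[OF q])
  show thesis
  proof (rule that[OF qn qs])
    fix F' u' v' w' r assume T': "facet_triple K F' u' v' w'" and r: "r \<in> monos3 n"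
    define g where "g p = (e - q) p * r p" for p
    have rn: "r \<in> span (monos3 n)" using r by (rule span_base)
    have mono: "monos3 i \<subseteq> monos3 (m + n)" if "i \<le> m + n" for i using that by (force simp: monos3_def)
    have "e \<in> span (monos3 (m + n))" "q \<in> span (monos3 (m + n))"
      using e(1) qn span_mono[OF mono] by (meson le_add1 le_add2 subsetD)+
    hence "g \<in> span (monos3 (m + n + n))" unfolding g_def using rn by (intro span_monos3_mult span_diff)
    then obtain l where l: "\<And>(K :: 'a set) F u v w. facet_triple K F u v w \<Longrightarrow>
        (\<integral>x. g (bary3 K u v w x) \<partial>facet_measure F) = l * (\<integral>x. 1 \<partial>facet_measure F)"
      by (rule facet_integral_proportional[OF d]) blast
    have gc: "continuous_on UNIV g" using continuous_monos3[OF \<open>g \<in> span (monos3 (m + n + n))\<close>] .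
    have perm: "(e - q) (y, x, z) = (e - q) (x, y, z)" "(e - q) (x, z, y) = (e - q) (x, y, z)" for x y z
      using symmetric3_perm[OF e(2)] symmetric3_perm[OF qs] by simp_all
    let ?G = "\<lambda>u v w x. g (bary3 K u v w x)"
    \<comment> \<open>\<open>e - q\<close> is symmetric, so its product with the symmetrised
      \<open>r\<close> is the sum of \<open>g\<close> over the six orders of the vertices. All six
      integrals equal \<open>l\<close> times the area, and their sum is zero.\<close>
    have eq: "(e - q) (bary3 K u v w x) * sym3 r (bary3 K u v w x) =
        (\<Sum>i\<in>{..<6::nat}. ([?G u v w x, ?G u w v x, ?G v u w x, ?G v w u x, ?G w u v x, ?G w v u x] ! i))" for x
      using symmetric3_perm[OF e(2), of "bc u x" "bc w x" "bc v x"] symmetric3_perm[OF qs, of "bc u x" "bc w x" "bc v x"]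
      by (simp add: sym3_def g_def algebra_simps numeral_eq_Suc lessThan_Suc)
    define c1 where "c1 = (\<integral>x. (1::real) \<partial>facet_measure F)"
    have cc: "continuous_on UNIV (?G u v w)" for u v w by (rule continuous_bc3[OF gc])
    have "0 = B (e - q) (sym3 r)" using orth[OF r] by simp
    also have "\<dots> = (\<integral>x. ?G u v w x + (?G u w v x + (?G v u w x + (?G v w u x + (?G w u v x + ?G w v u x)))) \<partial>facet_measure F)"
      unfolding B_def eq by (simp add: numeral_eq_Suc lessThan_Suc algebra_simps)
    also have "\<dots> = (\<integral>x. ?G u v w x \<partial>facet_measure F) + ((\<integral>x. ?G u w v x \<partial>facet_measure F) + ((\<integral>x. ?G v u w x \<partial>facet_measure F)
        + ((\<integral>x. ?G v w u x \<partial>facet_measure F) + ((\<integral>x. ?G w u v x \<partial>facet_measure F) + (\<integral>x. ?G w v u x \<partial>facet_measure F)))))"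
      by (simp only: facet_integral_linear(1) cc continuous_on_add)
    also have "\<dots> = 6 * (l * c1)"
      by (simp only: l[OF T] l[OF facet_triple_perm(1)[OF T]] l[OF facet_triple_perm(2)[OF T]] l[OF facet_triple_perm(3)[OF T]]
          l[OF facet_triple_perm(4)[OF T]] l[OF facet_triple_perm(5)[OF T]] c1_def)
    finally have "l = 0" using ne unfolding c1_def[symmetric] by simp
    thus "(\<integral>x. (e - q) (bary3 K u' v' w' x) * r (bary3 K u' v' w' x) \<partial>facet_measure F') = 0"
      using l[OF T'] by (simp add: g_def)
  qed
next
  \<comment> \<open>If every such facet integral of 1 is zero, proportionality makes all integrals
    vanish and \<open>q = 0\<close> serves. This branch replaces a proof that facets have positive
    area.\<close>
  case False
  show thesis
  proof (rule that[of 0])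
    show "0 \<in> span (monos3 n)" by (rule span_zero)
    show "symmetric3 0" by (simp add: symmetric3_def)
    fix F u v w r assume T: "facet_triple K F u v w" and r: "r \<in> monos3 n"
    have "(\<lambda>p. e p * r p) \<in> span (monos3 (m + n))" by (intro span_monos3_mult e(1) span_base r)
    then obtain l where "\<And>(K :: 'a set) F u v w. facet_triple K F u v w \<Longrightarrow>
        (\<integral>x. e (bary3 K u v w x) * r (bary3 K u v w x)
          \<partial>facet_measure F) = l * (\<integral>x. 1 \<partial>facet_measure F)"
      by (rule facet_integral_proportional[OF d]) blast
    from this[OF T] have "(\<integral>x. e (bary3 K u v w x) *
        r (bary3 K u v w x) \<partial>facet_measure F) = 0"
      using False T by (metis mult_zero_right)
    thus "(\<integral>x. (e - 0) (bary3 K u v w x) *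
        r (bary3 K u v w x) \<partial>facet_measure F) = 0"
      by simp
  qed
qed


context full_simplex
begin

text \<open>Polynomials of degree n are spanned by monomials in all four barycentric coordinates,
  and those with a factor of the opposite coordinate vanish on the facet.\<close>

lemma orth_polys_monos3I:
  assumes T: "facet_triple K F u v w" and p: "continuous_on UNIV p"
    and orth: "\<And>r. r \<in> monos3 n \<Longrightarrow> (\<integral>x. p x * r (bary3 K u v w x) \<partial>facet_measure F) = 0"
  shows "orth_polys F n p" unfolding orth_polys_def
proof
  interpret simplex_facet K F using T by (simp add: facet_triple_def)
  have V: "V = {opp, u, v, w}" and distinct: "opp \<notin> {u, v, w}" "u \<noteq> v" "u \<noteq> w" "v \<noteq> w"
    using T facet_vertices(1)[OF facet] opposite_vertex_in[OF facet] by (auto simp: facet_triple_def)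
  let ?h = "\<lambda>i a b c x. bc opp x ^ i * mono3 a b c (bary3 K u v w x)"
  define A where "A n = {?h i a b c | i a b c. i + a + b + c \<le> n}" for n
  have A: "?h i a b c \<in> A m" if "i + a + b + c \<le> m" for i a b c m unfolding A_def using that by blast
  have "poly_space n \<subseteq> span (A n)"
  proof (rule poly_space_graded)
    fix m m' :: nat assume "m \<le> m'"
    thus "A m \<subseteq> A m'" by (auto simp: A_def[of m] intro!: A)
  next
    have "(\<lambda>x. 1) = ?h 0 0 0 0" by (simp add: mono3_def)
    thus "(\<lambda>x. 1) \<in> span (A 0)" using A[of 0 0 0 0 0] by (auto intro: span_base)
  next
    fix b :: 'a
    have eq: "(\<lambda>x. x \<bullet> b) = (opp \<bullet> b) *\<^sub>R ?h 1 0 0 0 + (u \<bullet> b) *\<^sub>R ?h 0 1 0 0 + (v \<bullet> b) *\<^sub>R ?h 0 0 1 0 + (w \<bullet> b) *\<^sub>R ?h 0 0 0 1"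
    proof
      fix x
      have "x \<bullet> b = (\<Sum>y\<in>V. bc y x *\<^sub>R y) \<bullet> b" by (simp add: bc_repr)
      also have "\<dots> = (\<Sum>y\<in>{opp, u, v, w}. (y \<bullet> b) * bc y x)"
        unfolding inner_sum_left using V by (simp add: mult.commute)
      finally show "x \<bullet> b = ((opp \<bullet> b) *\<^sub>R ?h 1 0 0 0 + (u \<bullet> b) *\<^sub>R ?h 0 1 0 0 + (v \<bullet> b) *\<^sub>R ?h 0 0 1 0 + (w \<bullet> b) *\<^sub>R ?h 0 0 0 1) x"
        using distinct by (simp add: mono3_def)
    qed
    show "(\<lambda>x. x \<bullet> b) \<in> span (A 1)"
      unfolding eq by (intro span_add span_scale span_base A) simp_all
  next
    fix m m' f g assume "f \<in> A m" "g \<in> A m'"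
    then obtain i a b c i' a' b' c' where *: "f = ?h i a b c" "i + a + b + c \<le> m" "g = ?h i' a' b' c'" "i' + a' + b' + c' \<le> m'"
      unfolding A_def by blast
    have "(\<lambda>x. f x * g x) = ?h (i + i') (a + a') (b + b') (c + c')"
      by (simp add: * mono3_def power_add mult_ac)
    thus "(\<lambda>x. f x * g x) \<in> A (m + m')"
      using *(2,4) A[of "i + i'" "a + a'" "b + b'" "c + c'" "m + m'"] by simp
  qed
  fix q :: "'a \<Rightarrow> real" assume "q \<in> poly_space n"
  hence "q \<in> span (A n)" using \<open>poly_space n \<subseteq> span (A n)\<close> by blast
  hence "continuous_on UNIV q \<and> (\<integral>x. p x * q x \<partial>facet_measure F) = 0"
  proof (rule span_induct)
    show "subspace {q. continuous_on UNIV q \<and> (\<integral>x. p x * q x \<partial>facet_measure F) = 0}"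
    proof (rule subspaceI; unfold mem_Collect_eq)
      show "continuous_on UNIV 0 \<and> (\<integral>x. p x * 0 x \<partial>facet_measure F) = 0"
        by (auto simp: zero_fun_def)
    next
      fix f g assume *: "continuous_on UNIV f \<and> (\<integral>x. p x * f x \<partial>facet_measure F) = 0"
        "continuous_on UNIV g \<and> (\<integral>x. p x * g x \<partial>facet_measure F) = 0"
      hence "(\<integral>x. p x * f x + p x * g x \<partial>facet_measure F) = 0"
        using facet_integral_linear(1)[OF continuous_on_mult[OF p, of f] continuous_on_mult[OF p, of g]] by simp
      thus "continuous_on UNIV (f + g) \<and> (\<integral>x. p x * (f + g) x \<partial>facet_measure F) = 0"
        using * continuous_on_add[of UNIV f g] by (simp add: distrib_left plus_fun_def)
    next
      fix c f assume "continuous_on UNIV f \<and> (\<integral>x. p x * f x \<partial>facet_measure F) = 0"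
      thus "continuous_on UNIV (c *\<^sub>R f) \<and> (\<integral>x. p x * (c *\<^sub>R f) x \<partial>facet_measure F) = 0"
        using continuous_on_mult_left[of UNIV f c] by (simp add: mult.left_commute scaleR_fun_def)
    qed
  next
    fix q assume "q \<in> A n"
    then obtain i a b c where q: "q = ?h i a b c" "i + a + b + c \<le> n" unfolding A_def by blast
    have mc: "continuous_on UNIV (\<lambda>x. mono3 a b c (bary3 K u v w x))"
      unfolding mono3_def by (auto intro!: continuous_intros)
    have qc: "continuous_on UNIV q" unfolding q(1) by (intro continuous_on_mult mc continuous_intros)
    have "(\<integral>x. p x * q x \<partial>facet_measure F) = 0"
    proof (cases "i = 0")
      case True
      thus ?thesis using orth[OF monos3I[of a b c n]] q by simp
    next
      case False
      have "(\<integral>x. p x * q x \<partial>facet_measure F) = (\<integral>x. 0 \<partial>facet_measure F)"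
      proof (rule facet_integral_cong)
        fix x assume "x \<in> F"
        thus "p x * q x = 0" using False mem_facet_iff[OF facet, of x] by (simp add: q(1))
      qed (intro continuous_on_mult p qc continuous_on_const)+
      thus ?thesis by simp
    qed
    with qc show "continuous_on UNIV q \<and> (\<integral>x. p x * q x \<partial>facet_measure F) = 0" by blast
  qed
  thus "(\<integral>x. p x * q x \<partial>facet_measure F) = 0" by blast
qed

end

text \<open>Extends a symmetric function of the barycentric coordinates from the facets of a tetrahedron, by
  inclusion and exclusion over the faces.\<close>

definition extend3 :: "(real \<times> real \<times> real \<Rightarrow> real) \<Rightarrow> real \<Rightarrow> real \<Rightarrow> real \<Rightarrow> real \<Rightarrow> real" where
  "extend3 g a b c d =
     g (a, b, c) + g (a, b, d) + g (a, c, d) + g (b, c, d)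
     - (g (a, b, 0) + g (a, c, 0) + g (a, d, 0) + g (b, c, 0) + g (b, d, 0) + g (c, d, 0))
     + (g (a, 0, 0) + g (b, 0, 0) + g (c, 0, 0) + g (d, 0, 0)) - g (0, 0, 0)"

lemma extend3_facet:
  assumes "symmetric3 g"
  shows "extend3 g 0 b c d = g (b, c, d)" "extend3 g a 0 c d = g (a, c, d)"
    "extend3 g a b 0 d = g (a, b, d)" "extend3 g a b c 0 = g (a, b, c)"
proof -
  have 1: "g (0, x, y) = g (x, y, 0)" "g (x, 0, y) = g (x, y, 0)" for x y using symmetric3_perm[OF assms] by metis+
  show "extend3 g 0 b c d = g (b, c, d)"
    using 1(1)[of b c] 1(1)[of b d] 1(1)[of c d] 1(1)[of b 0] 1(1)[of c 0] 1(1)[of d 0]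
      1(2)[of b 0] 1(2)[of c 0] 1(2)[of d 0] by (simp add: extend3_def)
  show "extend3 g a 0 c d = g (a, c, d)"
    using 1(1)[of c d] 1(2)[of a c] 1(2)[of a d] 1(1)[of c 0] 1(1)[of d 0] 1(2)[of a 0]
      1(2)[of c 0] 1(2)[of d 0] by (simp add: extend3_def)
  show "extend3 g a b 0 d = g (a, b, d)"
    using 1(2)[of a d] 1(2)[of b d] 1(2)[of a 0] 1(2)[of b 0] 1(1)[of d 0] 1(2)[of d 0] by (simp add: extend3_def)
  show "extend3 g a b c 0 = g (a, b, c)" by (simp add: extend3_def)
qed

lemma extend3_poly_space:
  assumes g: "g \<in> span (monos3 n)" and l: "affine_fn l1" "affine_fn l2" "affine_fn l3" "affine_fn l4"
  shows "(\<lambda>x. extend3 g (l1 x) (l2 x) (l3 x) (l4 x)) \<in> poly_space n"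
proof -
  note p = monos3_affine[OF g]
  show ?thesis unfolding extend3_def by (intro poly_space_add poly_space_diff p l affine_fn_const)
qed

lemma coeff_mult_degree_sum_le:
  fixes p q :: "real poly"
  assumes "degree p \<le> m" "degree q \<le> n"
  shows "coeff (p * q) (m + n) = coeff p m * coeff q n"
proof (cases "degree p = m \<and> degree q = n")
  case True
  thus ?thesis using coeff_mult_degree_sum[of p q] by simp
next
  case False
  hence "degree (p * q) < m + n" using degree_mult_le[of p q] assms by linarith
  thus ?thesis using False assms by (auto simp: coeff_eq_0)
qed

text \<open>The two highest-order parts \<open>e\<^sub>2\<^bsup>k/2\<^esup>\<close> and \<open>e\<^sub>2\<^bsup>k/2-3\<^esup> e\<^sub>3\<^sup>2\<close> (elementary symmetric polynomials) are
  independent modulo lower order on the plane \<open>x + y + z = 1\<close>: on the line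
  \<open>(1/3 + t, 1/3, 1/3 - t)\<close> the degree of the second drops by 2, and on
  \<open>(1/3 + t, 1/3 + t, 1/3 - 2 t)\<close> it does not drop.\<close>

lemma symmetric_parts_independent:
  assumes k: "k = 2 * h" "h \<ge> 3" and q: "q \<in> span (monos3 (k - 1))"
    and zero: "\<And>x y z. 0 \<le> x \<Longrightarrow> 0 \<le> y \<Longrightarrow> 0 \<le> z \<Longrightarrow> x + y + z = 1 \<Longrightarrow>
      \<alpha> * (x * y + y * z + z * x) ^ h + \<beta> * ((x * y + y * z + z * x) ^ (h - 3) * (x * y * z) ^ 2) = q (x, y, z)"
  shows "\<alpha> = 0 \<and> \<beta> = 0"
proof -
  \<comment> \<open>Up to t = 1/6 all three coordinates on both lines are nonnegative, which is
    where \<open>zero\<close> is available; infinitely many such t determine a polynomial.\<close>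
  have ext: "P = Q" if "\<And>t. 0 \<le> t \<Longrightarrow> t \<le> 1 / 6 \<Longrightarrow> poly P t = poly Q t" for P Q :: "real poly"
  proof -
    have "{0..1/6} \<subseteq> {t. poly (P - Q) t = 0}" using that by auto
    moreover have "infinite {0..1/6::real}" by (simp add: infinite_Icc)
    ultimately have "P - Q = 0" using poly_roots_finite[of "P - Q"] finite_subset by blast
    thus ?thesis by simp
  qed
  obtain P where P: "degree P \<le> k - 1" "\<And>t. q (poly [:1/3, 1:] t, poly [:1/3:] t, poly [:1/3, -1:] t) = poly P t"
    using monos3_line[OF q, of "[:1/3, 1:]" "[:1/3:]" "[:1/3, -1:]"] by auto
  obtain R where R: "degree R \<le> k - 1" "\<And>t. q (poly [:1/3, 1:] t, poly [:1/3, 1:] t, poly [:1/3, -2:] t) = poly R t"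
    using monos3_line[OF q, of "[:1/3, 1:]" "[:1/3, 1:]" "[:1/3, -2:]"] by auto
  have k1: "k - 1 < k" using k by simp
  have lead: "coeff (p ^ i) (n * i) = coeff p n ^ i" if "degree p \<le> n" for p :: "real poly" and n i using that
  proof (induction i)
    case (Suc i)
    have "degree (p ^ i) \<le> n * i" using order_trans[OF degree_power_le mult_le_mono1[OF Suc.prems]] .
    with Suc.prems have "coeff (p * p ^ i) (n + n * i) = coeff p n * coeff (p ^ i) (n * i)"
      by (rule coeff_mult_degree_sum_le)
    thus ?case using Suc by simp
  qed simp
  have A: "smult \<alpha> ([:1/3, 0, -1:] ^ h) + smult \<beta> ([:1/3, 0, -1:] ^ (h - 3) * [:1/27, 0, -1/3:] ^ 2) = P"
  proof (rule ext)
    fix t :: real assume t: "0 \<le> t" "t \<le> 1 / 6"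
    define X Y Z :: real where "X = 1/3 + t" and "Y = 1/3" and "Z = 1/3 - t"
    have e2: "X * Y + Y * Z + Z * X = poly [:1/3, 0, -1:] t" and e3: "X * Y * Z = poly [:1/27, 0, -1/3:] t"
      by (simp_all add: X_def Y_def Z_def field_simps)
    have "q (X, Y, Z) = poly P t" using P(2)[of t] by (simp add: X_def Y_def Z_def)
    moreover have "0 \<le> X" "0 \<le> Y" "0 \<le> Z" "X + Y + Z = 1" using t by (simp_all add: X_def Y_def Z_def)
    ultimately show "poly (smult \<alpha> ([:1/3, 0, -1:] ^ h) + smult \<beta> ([:1/3, 0, -1:] ^ (h - 3) * [:1/27, 0, -1/3:] ^ 2)) t = poly P t"
      using zero[of X Y Z] by (simp only: e2 e3 poly_add poly_smult poly_mult poly_power)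
  qed
  have "degree ([:1/3, 0, -1::real:] ^ (h - 3) * [:1/27, 0, -1/3:] ^ 2) \<le> 2 * (h - 3) + 2 * 2"
    using degree_mult_le[of "[:1/3, 0, -1::real:] ^ (h - 3)" "[:1/27, 0, -1/3:] ^ 2"]
      degree_power_le[of "[:1/3, 0, -1::real:]" "h - 3"] degree_power_le[of "[:1/27, 0, -1/3::real:]" 2] by simp
  hence "coeff ([:1/3, 0, -1::real:] ^ (h - 3) * [:1/27, 0, -1/3:] ^ 2) k = 0" using k by (intro coeff_eq_0) simp
  moreover have "coeff ([:1/3, 0, -1::real:] ^ h) k = (-1) ^ h"
    using lead[of "[:1/3, 0, -1:]" 2 h] k by (simp add: numeral_2_eq_2)
  moreover have "coeff P k = 0" using P(1) k1 by (intro coeff_eq_0) simp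
  ultimately have \<alpha>: "\<alpha> = 0" using arg_cong[OF A, of "\<lambda>p. coeff p k"] by simp
  have B: "smult \<beta> ([:1/3, 0, -3:] ^ (h - 3) * [:1/27, 0, -1, -2:] ^ 2) = R"
  proof (rule ext)
    fix t :: real assume t: "0 \<le> t" "t \<le> 1 / 6"
    define X Y Z :: real where "X = 1/3 + t" and "Y = 1/3 + t" and "Z = 1/3 - 2 * t"
    have e2: "X * Y + Y * Z + Z * X = poly [:1/3, 0, -3:] t" and e3: "X * Y * Z = poly [:1/27, 0, -1, -2:] t"
      by (simp_all add: X_def Y_def Z_def field_simps)
    have "q (X, Y, Z) = poly R t" using R(2)[of t] by (simp add: X_def Y_def Z_def mult.commute)
    moreover have "0 \<le> X" "0 \<le> Y" "0 \<le> Z" "X + Y + Z = 1" using t by (simp_all add: X_def Y_def Z_def)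
    ultimately show "poly (smult \<beta> ([:1/3, 0, -3:] ^ (h - 3) * [:1/27, 0, -1, -2:] ^ 2)) t = poly R t"
      using zero[of X Y Z] \<alpha> by (simp only: e2 e3 poly_add poly_smult poly_mult poly_power mult_zero_left add_0_left)
  qed
  have "coeff ([:1/3, 0, -3::real:] ^ (h - 3) * [:1/27, 0, -1, -2:] ^ 2) (2 * (h - 3) + 3 * 2) =
      coeff ([:1/3, 0, -3::real:] ^ (h - 3)) (2 * (h - 3)) * coeff ([:1/27, 0, -1, -2::real:] ^ 2) (3 * 2)"
    using degree_power_le[of "[:1/3, 0, -3::real:]" "h - 3"] degree_power_le[of "[:1/27, 0, -1, -2::real:]" 2]
    by (intro coeff_mult_degree_sum_le) simp_all
  also have "\<dots> = (-3) ^ (h - 3) * (-2) ^ 2"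
    using lead[of "[:1/3, 0, -3:]" 2 "h - 3"] lead[of "[:1/27, 0, -1, -2:]" 3 2]
    by (simp add: numeral_2_eq_2 numeral_3_eq_3)
  also have "2 * (h - 3) + 3 * 2 = k" using k by simp
  finally have "coeff ([:1/3, 0, -3::real:] ^ (h - 3) * [:1/27, 0, -1, -2:] ^ 2) k \<noteq> 0" by simp
  moreover have "coeff R k = 0" using R(1) k1 by (intro coeff_eq_0) simp
  ultimately have "\<beta> = 0" using arg_cong[OF B, of "\<lambda>p. coeff p k"] by simp
  with \<alpha> show ?thesis by simp
qed

section \<open>A polynomial orthogonal on all facets of a tetrahedron\<close>

context full_simplex
begin

text \<open>Symmetry is what makes the construction possible: one function \<open>g\<close> of three
  coordinates serves all four facets in any order of their vertices, its traces on common edges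
  agree so that \<open>extend3\<close> applies, and vanishing at one vertex means vanishing at
  all.\<close>

lemma exotic_polynomial:
  assumes d: "DIM('a) = 3" and k: "even k" "k \<ge> 6"
  obtains p where "p \<in> poly_space k" "\<And>F. F facet_of K \<Longrightarrow> orth_polys F (k - 1) p" "\<And>y. y \<in> V \<Longrightarrow> p y = 0"
    "\<exists>F x. F facet_of K \<and> x \<in> F \<and> p x \<noteq> 0"
proof -
  obtain h where h: "k = 2 * h" "h \<ge> 3" using k by (auto elim: evenE)
  define E2 :: "real \<times> real \<times> real \<Rightarrow> real" where "E2 = mono3 1 1 0 + mono3 0 1 1 + mono3 1 0 1"
  define E3 :: "real \<times> real \<times> real \<Rightarrow> real" where "E3 = mono3 1 1 1"
  have E2: "E2 \<in> span (monos3 2)" and E3: "E3 \<in> span (monos3 3)"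
    unfolding E2_def E3_def by (intro span_add span_base monos3I; simp)+
  have E2': "E2 (x, y, z) = x * y + y * z + z * x" and E3': "E3 (x, y, z) = x * y * z" for x y z
    by (simp_all add: E2_def E3_def mono3_def mult.commute)
  define e e' where "e = (\<lambda>p. E2 p ^ h)" and "e' = (\<lambda>p. E2 p ^ (h - 3) * E3 p ^ 2)"
  have "e \<in> span (monos3 (h * 2))" unfolding e_def by (rule span_monos3_power[OF E2])
  hence e: "e \<in> span (monos3 k)" using h by (simp add: mult.commute)
  have "e' \<in> span (monos3 ((h - 3) * 2 + 2 * 3))"
    unfolding e'_def by (intro span_monos3_mult span_monos3_power E2 E3)
  hence e': "e' \<in> span (monos3 k)" using h by (simp add: algebra_simps)
  have es: "symmetric3 e" "symmetric3 e'" by (simp_all add: symmetric3_def e_def e'_def E2' E3' algebra_simps)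
  obtain q where q: "q \<in> span (monos3 (k - 1))" "symmetric3 q"
    "\<And>F u v w r. facet_triple K F u v w \<Longrightarrow> r \<in> monos3 (k - 1) \<Longrightarrow>
      (\<integral>x. (e - q) (bary3 K u v w x) * r (bary3 K u v w x) \<partial>facet_measure F) = 0"
    by (rule symmetric_orthogonal_part[OF d full_simplex_axioms e es(1), of "k - 1"]) blast
  obtain q' where q': "q' \<in> span (monos3 (k - 1))" "symmetric3 q'"
    "\<And>F u v w r. facet_triple K F u v w \<Longrightarrow> r \<in> monos3 (k - 1) \<Longrightarrow>
      (\<integral>x. (e' - q') (bary3 K u v w x) * r (bary3 K u v w x) \<partial>facet_measure F) = 0"
    by (rule symmetric_orthogonal_part[OF d full_simplex_axioms e' es(2), of "k - 1"]) blast
  \<comment> \<open>One linear condition, vanishing at a vertex, on two unknowns.\<close>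
  have "\<exists>\<alpha> \<beta>. (\<alpha>, \<beta>) \<noteq> (0, 0) \<and> \<alpha> * (e - q) (1, 0, 0) + \<beta> * (e' - q') (1, 0, 0) = 0"
  proof (cases "(e - q) (1, 0, 0) = 0")
    case True
    hence "((1, 0) :: real \<times> real) \<noteq> (0, 0) \<and> 1 * (e - q) (1, 0, 0) + 0 * (e' - q') (1, 0, 0) = 0"
      by simp
    thus ?thesis by blast
  next
    case False
    hence "(- (e' - q') (1, 0, 0), (e - q) (1, 0, 0)) \<noteq> (0, 0) \<and>
        - (e' - q') (1, 0, 0) * (e - q) (1, 0, 0) + (e - q) (1, 0, 0) * (e' - q') (1, 0, 0) = 0"
      by (simp add: algebra_simps)
    thus ?thesis by blast
  qed
  then obtain \<alpha> \<beta> where \<alpha>\<beta>: "(\<alpha>, \<beta>) \<noteq> (0, 0)" "\<alpha> * (e - q) (1, 0, 0) + \<beta> * (e' - q') (1, 0, 0) = 0"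
    by blast
  define g where "g = \<alpha> *\<^sub>R (e - q) + \<beta> *\<^sub>R (e' - q')"
  have mono: "monos3 (k - 1) \<subseteq> monos3 k" by (force simp: monos3_def)
  have g: "g \<in> span (monos3 k)"
    unfolding g_def using e e' q(1) q'(1) span_mono[OF mono] by (intro span_add span_scale span_diff) blast+
  have gs: "symmetric3 g" using es q(2) q'(2) unfolding symmetric3_def g_def by auto
  have gc: "continuous_on UNIV f" if "f \<in> span (monos3 m)" for f m using that by (rule continuous_monos3)
  have g_orth: "(\<integral>x. g (bary3 K u v w x) * r (bary3 K u v w x) \<partial>facet_measure F) = 0"
    if T: "facet_triple K F u v w" and r: "r \<in> monos3 (k - 1)" for F u v w r
  proof -
    interpret F: simplex_facet K F using T by (simp add: facet_triple_def)
    have rc: "continuous_on UNIV r" by (rule gc[OF span_base[OF r]])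
    have "continuous_on UNIV (e - q)" "continuous_on UNIV (e' - q')"
      using gc[OF span_diff[OF e subsetD[OF span_mono[OF mono] q(1)]]]
        gc[OF span_diff[OF e' subsetD[OF span_mono[OF mono] q'(1)]]] .
    hence c: "continuous_on UNIV (\<lambda>x. \<alpha> * ((e - q) x * r x))" "continuous_on UNIV (\<lambda>x. \<beta> * ((e' - q') x * r x))"
      by (auto intro!: continuous_on_mult_left continuous_on_mult rc)
    have "(\<integral>x. g (bary3 K u v w x) * r (bary3 K u v w x) \<partial>facet_measure F) =
        (\<integral>x. \<alpha> * ((e - q) (bary3 K u v w x) * r (bary3 K u v w x)) +
          \<beta> * ((e' - q') (bary3 K u v w x) * r (bary3 K u v w x)) \<partial>facet_measure F)"
      by (simp add: g_def algebra_simps)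
    also have "\<dots> = 0"
      using F.facet_integral_linear(1)[OF F.continuous_bc3[OF c(1)] F.continuous_bc3[OF c(2)], of u v w u v w]
        q(3)[OF T r] q'(3)[OF T r] by simp
    finally show ?thesis .
  qed
  have "card V = Suc (Suc (Suc (Suc 0)))" using card_V d by simp
  then obtain v1 v2 v3 v4 where v: "V = {v1, v2, v3, v4}" "distinct [v1, v2, v3, v4]" by (auto simp: card_Suc_eq)
  define p where "p x = extend3 g (bc v1 x) (bc v2 x) (bc v3 x) (bc v4 x)" for x
  have p: "p \<in> poly_space k" unfolding p_def by (intro extend3_poly_space[OF g] affine_bc)
  have trace: "\<exists>u v w. facet_triple K F u v w \<and> (\<forall>x\<in>F. p x = g (bary3 K u v w x))" if F: "F facet_of K" for F
  proof -
    interpret F: simplex_facet K F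
      using F full_simplex_axioms by (simp add: simplex_facet_def simplex_facet_axioms_def)
    have zero: "bc (opposite_vertex K F) x = 0" if "x \<in> F" for x using mem_facet_iff[OF F] that by blast
    have tr: ?thesis if "{v1, v2, v3, v4} = {opposite_vertex K F, u, v, w}" "distinct [opposite_vertex K F, u, v, w]"
      "\<And>x. bc (opposite_vertex K F) x = 0 \<Longrightarrow> p x = g (bary3 K u v w x)" for u v w
    proof (intro exI conjI ballI)
      show "facet_triple K F u v w"
        using that(1,2) facet_vertices(1)[OF F] v(1) F.simplex_facet_axioms by (auto simp: facet_triple_def)
    qed (use that(3) zero in blast)
    consider "opposite_vertex K F = v1" | "opposite_vertex K F = v2" | "opposite_vertex K F = v3" | "opposite_vertex K F = v4"
      using opposite_vertex_in[OF F] v(1) by blast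
    thus ?thesis
    proof cases
      case 1
      thus ?thesis using v(2) by (intro tr[of v2 v3 v4]) (auto simp: p_def extend3_facet[OF gs])
    next
      case 2
      thus ?thesis using v(2) by (intro tr[of v1 v3 v4]) (auto simp: p_def extend3_facet[OF gs])
    next
      case 3
      thus ?thesis using v(2) by (intro tr[of v1 v2 v4]) (auto simp: p_def extend3_facet[OF gs])
    next
      case 4
      thus ?thesis using v(2) by (intro tr[of v1 v2 v3]) (auto simp: p_def extend3_facet[OF gs])
    qed
  qed
  have vanish: "p y = 0" if y: "y \<in> V" for y
  proof -
    have "\<not> V \<subseteq> {y}" using v by auto
    then obtain z where z: "z \<in> V" "z \<noteq> y" by blast
    define F where "F = convex hull (V - {z})"
    have F: "F facet_of K" "opposite_vertex K F = z" unfolding F_def using facet_of_vertex[OF z(1)] by auto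
    obtain u v w where T: "facet_triple K F u v w" "\<forall>x\<in>F. p x = g (bary3 K u v w x)"
      using trace[OF F(1)] by blast
    have yF: "y \<in> \<V> F" "y \<in> F" using facet_vertices[OF F(1)] F(2) z y by auto
    have "g (1, 0, 0) = 0" using \<alpha>\<beta>(2) by (simp add: g_def)
    hence "g (0, 1, 0) = 0" "g (0, 0, 1) = 0" using symmetric3_perm[OF gs] by metis+
    moreover have "y = u \<or> y = v \<or> y = w" using yF(1) T(1) by (auto simp: facet_triple_def)
    ultimately show ?thesis
      using T \<open>g (1, 0, 0) = 0\<close> yF(2) bc_vertex[OF y] by (auto simp: facet_triple_def)
  qed
  have nonzero: "\<exists>F x. F facet_of K \<and> x \<in> F \<and> p x \<noteq> 0"
  proof (rule ccontr)
    assume "\<not> (\<exists>F x. F facet_of K \<and> x \<in> F \<and> p x \<noteq> 0)"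
    hence pF: "p x = 0" if "F facet_of K" "x \<in> F" for F x using that by blast
    obtain z where z: "z \<in> V" using V_nonempty by blast
    define F where "F = convex hull (V - {z})"
    have F: "F facet_of K" "opposite_vertex K F = z" unfolding F_def using facet_of_vertex[OF z] by auto
    obtain u v w where T: "facet_triple K F u v w" "\<forall>x\<in>F. p x = g (bary3 K u v w x)"
      using trace[OF F(1)] by blast
    have VT: "V = {z, u, v, w}" "z \<notin> {u, v, w}" "u \<noteq> v" "u \<noteq> w" "v \<noteq> w"
      using T(1) facet_vertices(1)[OF F(1)] F(2) z by (auto simp: facet_triple_def)
    have g0: "g (a, b, c) = 0" if abc: "0 \<le> a" "0 \<le> b" "0 \<le> c" "a + b + c = 1" for a b c
    proof -
      define l where "l y = (if y = u then a else if y = v then b else if y = w then c else 0)" for y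
      have l1: "sum l V = 1" unfolding VT(1) using VT(2-) abc(4) by (auto simp: l_def)
      define x where "x = (\<Sum>y\<in>V. l y *\<^sub>R y)"
      have bc: "bc y x = l y" if "y \<in> V" for y unfolding x_def by (rule bc_comb[OF l1 that])
      have "x \<in> F" unfolding mem_facet_iff[OF F(1)] F(2) mem_K_iff using bc z VT(2) abc by (auto simp: l_def)
      moreover have "bc u x = a" "bc v x = b" "bc w x = c" using bc[of u] bc[of v] bc[of w] VT by (auto simp: l_def)
      ultimately show ?thesis using T(2) pF[OF F(1)] by metis
    qed
    have "\<alpha> = 0 \<and> \<beta> = 0"
    proof (rule symmetric_parts_independent[OF h, of "\<alpha> *\<^sub>R q + \<beta> *\<^sub>R q'"])
      show "\<alpha> *\<^sub>R q + \<beta> *\<^sub>R q' \<in> span (monos3 (k - 1))"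
        by (intro span_add span_scale q q')
      fix x y z :: real assume "0 \<le> x" "0 \<le> y" "0 \<le> z" "x + y + z = 1"
      from g0[OF this] show "\<alpha> * (x * y + y * z + z * x) ^ h + \<beta> * ((x * y + y * z + z * x) ^ (h - 3) * (x * y * z) ^ 2) =
          (\<alpha> *\<^sub>R q + \<beta> *\<^sub>R q') (x, y, z)"
        by (simp add: g_def e_def e'_def E2' E3' right_diff_distrib)
    qed
    with \<alpha>\<beta>(1) show False by simp
  qed
  have "orth_polys F (k - 1) p" if F: "F facet_of K" for F
  proof -
    obtain u v w where T: "facet_triple K F u v w" "\<forall>x\<in>F. p x = g (bary3 K u v w x)"
      using trace[OF F] by blast
    interpret F: simplex_facet K F using T by (simp add: facet_triple_def)
    note pc = poly_space_continuous[OF p, of UNIV]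
    show ?thesis
    proof (rule orth_polys_monos3I[OF T(1) pc])
      fix r assume r: "r \<in> monos3 (k - 1)"
      have rc: "continuous_on UNIV r" by (rule gc[OF span_base[OF r]])
      have "(\<integral>x. p x * r (bary3 K u v w x) \<partial>facet_measure F) =
          (\<integral>x. g (bary3 K u v w x) * r (bary3 K u v w x) \<partial>facet_measure F)"
        by (rule F.facet_integral_cong)
          (use T(2) in \<open>auto intro!: continuous_on_mult pc F.continuous_bc3 gc[OF g] rc\<close>)
      thus "(\<integral>x. p x * r (bary3 K u v w x) \<partial>facet_measure F) = 0" using g_orth[OF T(1) r] by simp
    qed
  qed
  from that[OF p this vanish nonzero] show ?thesis .
qed

end

section \<open>Strictness of the inclusion in the maximal space in dimension three\<close>

context mesh_degree
begin

text \<open>All facets are boundary facets, so a conforming part with zero boundary values is zero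
  on them. Since \<open>p\<close> vanishes at the vertices and \<eta> \<noteq> 0, the coefficient of
  the simplex function is zero, and then \<open>p\<close> would vanish on every facet.\<close>

lemma CR0_max_strict_single:
  assumes d: "DIM('a) = 3" and k: "even k" "k \<ge> 6" and \<T>: "card \<T> = 1"
  shows "CR0 \<Omega> \<T> k \<subset> CR0_max \<Omega> \<T> k"
proof -
  obtain K where K: "\<T> = {K}" using \<T> by (rule card_1_singletonE)
  hence KT: "K \<in> \<T>" by simp
  interpret K: full_simplex K by (rule simplex_\<T>[OF KT])
  obtain p where p: "p \<in> poly_space k" "\<And>F. F facet_of K \<Longrightarrow> orth_polys F (k - 1) p" "\<And>y. y \<in> K.V \<Longrightarrow> p y = 0"
    "\<exists>F x. F facet_of K \<and> x \<in> F \<and> p x \<noteq> 0" by (rule K.exotic_polynomial[OF d k]) blast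
  have boundary: "F \<in> boundary_facets \<Omega> \<T>" if F: "F facet_of K" for F
  proof (rule ccontr)
    assume "F \<notin> boundary_facets \<Omega> \<T>"
    hence "F \<in> interior_facets \<Omega> \<T>" using facet_in_mesh[OF KT F] mesh_facets_cases by blast
    then obtain L where "L \<in> \<T>" "L \<noteq> K" by (rule interior_facet_neighbour[OF _ KT F])
    thus False using K by simp
  qed
  have "on_open_simplices \<T> (\<lambda>x. 0) + glue (\<lambda>_. p) \<in> CR0_max \<Omega> \<T> k"
    by (rule conf_plus_glue_CR_max(2)[where a = "\<lambda>F. 0", OF conf_zero]) (use p(1,2) K H10_zero in auto)
  hence in_max: "glue (\<lambda>_. p) \<in> CR0_max \<Omega> \<T> k" by (simp add: on_open_simplices_0)
  have "glue (\<lambda>_. p) \<notin> CR0 \<Omega> \<T> k"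
  proof
    assume "glue (\<lambda>_. p) \<in> CR0 \<Omega> \<T> k"
    then obtain w c where w: "w \<in> conf0" and eq: "glue (\<lambda>_. p) = on_open_simplices \<T> w + glue (\<lambda>K x. c K * BP K x)"
      using k(1) by (auto simp: CR0_def S0_space_def V_simplices_eq elim!: set_plus_elim)
    have eqs: "p x = w x + c K * BP K x" if "x \<in> K" for x
      using glue_eq_conf_plus[OF _ _ _ eq KT that] w p(1) poly_space_scale[OF BP_poly_space] by blast
    have w0: "w x = 0" if "F facet_of K" "x \<in> F" for F x
      using conforming_H10_trace[of w k F x] w boundary[OF that(1)] that(2) by blast
    obtain y z where yz: "y \<in> K.V" "z \<in> K.V" "y \<noteq> z"
    proof -
      have "\<not> card K.V \<le> Suc 0" using K.card_V d by simp
      thus thesis using that card_le_Suc0_iff_eq[OF K.finite_V] by blast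
    qed
    have "y \<in> convex hull (K.V - {z})" using yz by (intro hull_inc) simp
    hence "w y = 0" by (rule w0[OF K.facet_of_vertex(1)[OF yz(2)]])
    hence "c K * \<eta> = 0" using eqs[of y] p(3)[OF yz(1)] yz(1) K.V_subset BP_vertex[OF KT yz(1)] by auto
    hence "c K = 0" using \<eta>_even[OF k(1)] by simp
    moreover obtain F x where "F facet_of K" "x \<in> F" "p x \<noteq> 0" using p(4) by blast
    ultimately show False using eqs[of x] w0[of F x] facet_of_imp_subset by auto
  qed
  thus ?thesis using in_max CR0_subset_max by blast
qed

end

context mesh_degree
begin

text \<open>The excluded cases reflect the construction for one tetrahedron: it combines two
  monomials e2^i e3^j with 2i + 3j = k, and for k = 2 and k = 4 there is only one.\<close>

lemma CR0_max_strict: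
  assumes d: "DIM('a) = 3" and k: "k \<ge> 2" "\<not> (card \<T> = 1 \<and> k \<in> {2, 4})"
  shows "CR0 \<Omega> \<T> k \<subset> CR0_max \<Omega> \<T> k"
proof -
  have \<rho>: "\<rho> = (-1) ^ k * (real k + 1)"
    unfolding \<rho>_eq using d choose_one[of "k + 1"] binomial_symmetric[of k "k + 1"] by simp
  show ?thesis
  proof (cases "odd k")
    case True
    \<comment> \<open>For odd k and d = 3, \<rho> = -(k+1), so \<eta> = (1 - k)/3, which is zero
      only for k = 1.\<close>
    hence "\<eta> \<noteq> 0" using k(1) d by (simp add: \<eta>_def \<rho>)
    thus ?thesis by (rule CR0_max_strict_odd[OF True])
  next
    case False
    hence even: "even k" by simp
    have "card \<T> \<noteq> 0" using finite_\<T> nonempty_\<T> by simp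
    then consider "card \<T> > 1" | "card \<T> = 1" by linarith
    thus ?thesis
    proof cases
      case 1
      thus ?thesis using CR0_max_strict_even[OF even] even k(1) \<rho> by simp
    next
      case 2
      obtain h where "k = 2 * h" using even by (rule evenE)
      hence "k \<ge> 6" using k 2 by auto
      thus ?thesis by (rule CR0_max_strict_single[OF d even _ 2])
    qed
  qed
qed

end

theorem theorem13:
  fixes \<Omega> :: "'a::euclidean_space set" and \<T> :: "'a set set" and k :: nat
  assumes "DIM('a) \<ge> 2"
    and "lipschitz_polytope \<Omega>"
    and "conforming_mesh \<Omega> \<T>"
    and "k \<ge> 1"
  shows
    "((odd k \<longrightarrow>
         is_direct_sum (CR \<Omega> \<T> k) (S_bullet \<Omega> \<T> k) (V_facets \<T> k (mesh_facets \<T>))) \<and>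
      (even k \<longrightarrow>
         (\<forall>\<T>'. \<T>' \<subseteq> \<T> \<and> card \<T>' = card \<T> - 1 \<longrightarrow>
            is_direct_sum (CR \<Omega> \<T> k) (S_space \<Omega> \<T> k) (V_simplices k \<T>'))))
     \<and>
     ((odd k \<longrightarrow>
         is_direct_sum (CR0 \<Omega> \<T> k) (S0_bullet \<Omega> \<T> k) (V_facets \<T> k (interior_facets \<Omega> \<T>))) \<and>
      (even k \<longrightarrow>
         is_direct_sum (CR0 \<Omega> \<T> k) (S0_space \<Omega> \<T> k) (V_simplices k \<T>)))
     \<and>
     ((odd k \<longrightarrow>
         family_basis (B_facet \<T> k) (mesh_facets \<T>) (V_facets \<T> k (mesh_facets \<T>)) \<and>
         family_basis (B_facet \<T> k) (interior_facets \<Omega> \<T>)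
           (V_facets \<T> k (interior_facets \<Omega> \<T>))) \<and>
      (k \<ge> 2 \<longrightarrow> family_basis (B_simplex k) \<T> (V_simplices k \<T>)) \<and>
      (k = 1 \<longrightarrow> V_simplices k \<T> = {0}))
     \<and>
     (S_space \<Omega> \<T> k \<subseteq> CR \<Omega> \<T> k \<and> CR \<Omega> \<T> k \<subseteq> CR_max \<Omega> \<T> k \<and>
      S0_space \<Omega> \<T> k \<subseteq> CR0 \<Omega> \<T> k \<and> CR0 \<Omega> \<T> k \<subseteq> CR0_max \<Omega> \<T> k)
     \<and>
     ((even k \<or> (odd k \<and> card \<T> > 1) \<longrightarrow> S0_space \<Omega> \<T> k \<subset> CR0 \<Omega> \<T> k) \<and>
      (DIM('a) = 3 \<and> k \<ge> 2 \<and> \<not> (card \<T> = 1 \<and> k \<in> {2, 4}) \<longrightarrow>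
         CR0 \<Omega> \<T> k \<subset> CR0_max \<Omega> \<T> k))"
proof -
  interpret mesh_degree \<Omega> \<T> k by unfold_locales (rule assms)+
  show ?thesis using direct_sum_odd direct_sum_even direct_sum_even0
      B_facet_basis[OF \<rho>_odd' order_refl] B_facet_basis[OF \<rho>_odd' interior_facets_subset]
      B_simplex_basis V_simplices_1 S_subset_CR CR_subset_max S0_subset_CR0 CR0_subset_max
      S0_strict CR0_max_strict by (intro conjI impI allI) simp_all
qed

end
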